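(* Let $Y=Y_\Sigma$ be a smooth projective toric variety with $-K_Y$ base-point free, $G=\mathrm{Aut}^0(Y)$ and $\beta=(0;\mathrm{id})$. Then the tautological system $\tau_Y(G,-K_Y,\beta)$ is equivalent to the extended GKZ system on $Y$ (i.e. they define the same left ideal of differential operators in the coordinates $b_\mu$ on $H^0(Y,-K_Y)$).
   Context: Let $N\cong\mathbb Z^n$, $M=\mathrm{Hom}(N,\mathbb Z)$, $\Sigma$ the fan of $Y$, $\Sigma(1)$ its rays (identified with primitive generators $\rho$), $e_1,\dots,e_n$ the standard basis of $N$. $\mathrm{Aut}^0(Y)$ is the identity component of the automorphism group of $Y$. Let $\Delta=\{m\in M_{\mathbb R}:\langle m,\rho\rangle\ge-1\ \forall\rho\in\Sigma(1)\}$; $H^0(Y,-K_Y)$ has the basis $t^\mu$, $\mu\in\Delta\cap M$ (in torus coordinates, $t^\mu$ standing for the section $t^\mu\bigwedge_i t_i\partial/\partial t_i$ of $\wedge^nT_Y$), with linear coordinates $b_\mu$. Tautological system. The anti-canonical bundle $-K_Y=\wedge^nT_Y$ is naturally $G$-equivariant, so $V=H^0(Y,-K_Y)^*$ is a $G$-module, and there is a $G$-equivariant map $Y\to\mathbb P(V)$. $\mathbb C^\times$ acts on $V$ by scaling; $\hat G=G\times\mathbb C^\times$, $\hat{\mathfrak g}=\mathrm{Lie}(\hat G)=\mathfrak g\times\mathbb C$, and $Z:\hat{\mathfrak g}\to\mathrm{End}(V)$ is the associated Lie algebra map; elements of $\mathrm{End}(V)$ are viewed as linear derivations on $V^*=H^0(Y,-K_Y)$,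 $V$ being the space of linear functions on $V^*$ (so that $1\in\mathbb C$ gives $\sum b_\mu\partial/\partial b_\mu$). $\beta=(0;\mathrm{id}):\mathfrak g\times\mathbb C\to\mathbb C$. Let $\hat Y\subset V$ be the cone over the image of $Y$, $I=I(\hat Y,V)\subset\mathbb C[V]=\mathrm{Sym}(V^* )$ its homogeneous ideal, and for $\zeta\in V^*$ let $\partial_\zeta$ be the derivation on $V^*$ with $\partial_\zeta(a)=\langle a,\zeta\rangle$, $a\in V$. Then $$\tau_Y(G,-K_Y,\beta)=D_{V^*}\big/\big(D_{V^*}\langle p(\partial_\zeta):p(\zeta)\in I\rangle+D_{V^*}\langle Z(x)+\beta(x):x\in\hat{\mathfrak g}\rangle\big).$$ Extended GKZ system. It is generated by: - $\prod_{\mu}(\partial/\partial b_\mu)^{l_\mu^+}-\prod_\mu(\partial/\partial b_\mu)^{l_\mu^-}$ for $l\in\mathbb Z^{\Delta\cap M}$ with $\sum l_\mu=0$, $\sum l_\mu\mu=0$, where $l=l^+-l^-$ with $l^\pm\geq 0$ the positive and negative parts; - $\sum_\mu\langle\mu,e_j\rangle b_\mu\partial/\partial b_\mu$, $j=1,\dots,n$; - $\sum_\mu b_\mu\partial/\partial b_\mu+1$; - $Z_\alpha=\sum_{\mu\in\Delta\cap M}\langle\mu-\alpha,\rho_\alpha\rangle\,b_\mu\,\partial/\partial b_{\mu+\alpha}$ for every root $\alpha\in R(\Sigma,N)$, where $R(\Sigma,N)$ is the set of $\alpha\in M$ for which there is a unique ray $\rho_\alpha$ with $\langle\alpha,\rho_\alpha\rangle=-1$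 and $\langle\alpha,\rho\rangle\ge0$ for all $\rho\ne\rho_\alpha$ (if $\mu+\alpha\notin\Delta$ the coefficient is zero). *)

theory Defs
  imports "HOL-Analysis.Analysis" "HOL-Library.Poly_Mapping"
begin

text \<open>
  Conventions: \<open>N = \<int>\<^sup>n\<close> is the type \<^typ>\<open>int ^ 'n\<close> with \<open>n = CARD('n)\<close>, and \<open>M = Hom(N, \<int>)\<close> is
  identified with \<^typ>\<open>int ^ 'n\<close> through the dual of the standard basis \<open>e\<^sub>1, \<dots>, e\<^sub>n\<close> of \<open>N\<close>, so
  that \<open>\<langle>m, e\<^sub>j\<rangle> = m $ j\<close>.  All varieties are over \<open>\<complex>\<close> and are given by their closed points.
\<close>

type_synonym 'n lattice = "int ^ 'n"
type_synonym 'n toric_point = "((real ^ 'n) set \<times> ('n lattice \<Rightarrow> complex)) set"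
type_synonym 'n chart = "(real ^ 'n) set \<times> ('n \<Rightarrow> 'n lattice)"
type_synonym 'n mat_M = "'n lattice \<Rightarrow> 'n lattice \<Rightarrow> complex"

definition pair :: "'n::finite lattice \<Rightarrow> 'n lattice \<Rightarrow> int" where
  "pair m v = (\<Sum>i\<in>UNIV. m $ i * v $ i)"

definition rvec :: "'n::finite lattice \<Rightarrow> real ^ 'n" where
  "rvec v = (\<chi> i. real_of_int (v $ i))"


section \<open>Fans and toric varieties\<close>

definition rational_polyhedral_cone :: "(real ^ 'n::finite) set \<Rightarrow> bool" where
  "rational_polyhedral_cone \<sigma> \<longleftrightarrow> (\<exists>S. finite S \<and> \<sigma> = convex_cone hull (rvec ` S))"

definition fan :: "(real ^ 'n::finite) set set \<Rightarrow> bool" where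
  "fan \<Sigma> \<longleftrightarrow> finite \<Sigma> \<and> \<Sigma> \<noteq> {} \<and>
     (\<forall>\<sigma>\<in>\<Sigma>. rational_polyhedral_cone \<sigma> \<and> \<sigma> \<inter> uminus ` \<sigma> = {0}) \<and>
     (\<forall>\<sigma>\<in>\<Sigma>. \<forall>\<tau>. \<tau> face_of \<sigma> \<and> \<tau> \<noteq> {} \<longrightarrow> \<tau> \<in> \<Sigma>) \<and>
     (\<forall>\<sigma>\<in>\<Sigma>. \<forall>\<tau>\<in>\<Sigma>. (\<sigma> \<inter> \<tau>) face_of \<sigma> \<and> (\<sigma> \<inter> \<tau>) face_of \<tau>)"

definition primitive :: "'n::finite lattice \<Rightarrow> bool" where
  "primitive v \<longleftrightarrow> (\<forall>k w. v = k *s w \<longrightarrow> \<bar>k\<bar> = 1)"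

text \<open>\<open>\<Sigma>(1)\<close>, each ray being identified with its primitive generator.\<close>
definition rays :: "(real ^ 'n::finite) set set \<Rightarrow> 'n lattice set" where
  "rays \<Sigma> = {\<rho>. primitive \<rho> \<and> convex_cone hull {rvec \<rho>} \<in> \<Sigma>}"

text \<open>The semigroup \<open>S\<^sub>\<sigma> = \<sigma>\<^sup>\<or> \<inter> M\<close>.\<close>
definition dual_semigroup :: "(real ^ 'n::finite) set \<Rightarrow> 'n lattice set" where
  "dual_semigroup \<sigma> = {m. \<forall>u\<in>\<sigma>. 0 \<le> rvec m \<bullet> u}"

text \<open>
  The closed points of \<open>Spec \<complex>[S\<^sub>\<sigma>]\<close>, as semigroup homomorphisms \<open>(S\<^sub>\<sigma>, +) \<rightarrow> (\<complex>, \<cdot>)\<close>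
  (extended by \<open>0\<close> to all of \<open>M\<close>).
\<close>
definition aff :: "(real ^ 'n::finite) set \<Rightarrow> ('n lattice \<Rightarrow> complex) set" where
  "aff \<sigma> = {x. x 0 = 1 \<and>
     (\<forall>m\<in>dual_semigroup \<sigma>. \<forall>m'\<in>dual_semigroup \<sigma>. x (m + m') = x m * x m') \<and>
     (\<forall>m. m \<notin> dual_semigroup \<sigma> \<longrightarrow> x m = 0)}"

definition restr :: "(real ^ 'n::finite) set \<Rightarrow> ('n lattice \<Rightarrow> complex) \<Rightarrow> ('n lattice \<Rightarrow> complex)" where
  "restr \<sigma> x = (\<lambda>m. if m \<in> dual_semigroup \<sigma> then x m else 0)"

text \<open>\<open>U\<^sub>\<sigma>\<close> and \<open>U\<^sub>\<tau>\<close> are glued along \<open>U\<^bsub>\<sigma>\<inter>\<tau>\<^esub>\<close>; a point of \<open>Y\<^sub>\<Sigma>\<close> is an equivalence class.\<close>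
definition glue :: "(real ^ 'n::finite) set set \<Rightarrow>
    (((real ^ 'n) set \<times> ('n lattice \<Rightarrow> complex)) \<times> ((real ^ 'n) set \<times> ('n lattice \<Rightarrow> complex))) set" where
  "glue \<Sigma> = {((\<sigma>, x), (\<tau>, y)) | \<sigma> x \<tau> y. \<sigma> \<in> \<Sigma> \<and> \<tau> \<in> \<Sigma> \<and>
     (\<exists>z\<in>aff (\<sigma> \<inter> \<tau>). restr \<sigma> z = x \<and> restr \<tau> z = y)}"

definition toric_variety :: "(real ^ 'n::finite) set set \<Rightarrow> 'n toric_point set" where
  "toric_variety \<Sigma> = (SIGMA \<sigma>:\<Sigma>. aff \<sigma>) // glue \<Sigma>"

text \<open>The image of \<open>U\<^sub>\<sigma>\<close> in \<open>Y\<^sub>\<Sigma>\<close>, and the regular function \<open>\<chi>\<^sup>m\<close> (\<open>m \<in> S\<^sub>\<sigma>\<close>) on it.\<close>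
definition U :: "(real ^ 'n::finite) set set \<Rightarrow> (real ^ 'n) set \<Rightarrow> 'n toric_point set" where
  "U \<Sigma> \<sigma> = {P \<in> toric_variety \<Sigma>. \<exists>x. (\<sigma>, x) \<in> P}"

definition chi :: "(real ^ 'n::finite) set \<Rightarrow> 'n lattice \<Rightarrow> 'n toric_point \<Rightarrow> complex" where
  "chi \<sigma> m P = (THE x. (\<sigma>, x) \<in> P) m"

text \<open>The coordinate ring \<open>\<complex>[S\<^sub>\<sigma>]\<close> of \<open>U\<^sub>\<sigma>\<close>; only the values on \<open>U\<^sub>\<sigma>\<close> are meaningful.\<close>
definition coord_ring :: "(real ^ 'n::finite) set \<Rightarrow> ('n toric_point \<Rightarrow> complex) set" where
  "coord_ring \<sigma> = {(\<lambda>P. \<Sum>m\<in>F. c m * chi \<sigma> m P) | F c. finite F \<and> F \<subseteq> dual_semigroup \<sigma>}"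

text \<open>\<open>f\<close> is a regular function on \<open>W\<close>; in particular \<open>W\<close> is Zariski open.\<close>
definition regular_on ::
    "(real ^ 'n::finite) set set \<Rightarrow> 'n toric_point set \<Rightarrow> ('n toric_point \<Rightarrow> complex) \<Rightarrow> bool" where
  "regular_on \<Sigma> W f \<longleftrightarrow> (\<forall>P\<in>W. \<exists>\<sigma>\<in>\<Sigma>. P \<in> U \<Sigma> \<sigma> \<and>
     (\<exists>a\<in>coord_ring \<sigma>. \<exists>b\<in>coord_ring \<sigma>. b P \<noteq> 0 \<and>
        (\<forall>Q\<in>U \<Sigma> \<sigma>. b Q \<noteq> 0 \<longrightarrow> Q \<in> W \<and> f Q = a Q / b Q)))"


section \<open>Smoothness and projectivity\<close>

text \<open>The Zariski tangent space at \<open>x\<close>: the derivations \<open>\<complex>[S\<^sub>\<sigma>] \<rightarrow> \<complex>\<close> at \<open>x\<close>, given on characters.\<close>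
definition tangent_space ::
    "(real ^ 'n::finite) set \<Rightarrow> ('n lattice \<Rightarrow> complex) \<Rightarrow> ('n lattice \<Rightarrow> complex) set" where
  "tangent_space \<sigma> x = {d.
     (\<forall>m\<in>dual_semigroup \<sigma>. \<forall>m'\<in>dual_semigroup \<sigma>. d (m + m') = x m * d m' + x m' * d m) \<and>
     (\<forall>m. m \<notin> dual_semigroup \<sigma> \<longrightarrow> d m = 0)}"

text \<open>All tangent spaces have dimension \<open>n = dim Y\<close>, i.e. a basis indexed by \<open>'n\<close>.\<close>
definition smooth_variety :: "(real ^ 'n::finite) set set \<Rightarrow> bool" where
  "smooth_variety \<Sigma> \<longleftrightarrow> (\<forall>\<sigma>\<in>\<Sigma>. \<forall>x\<in>aff \<sigma>. \<exists>B :: 'n \<Rightarrow> 'n lattice \<Rightarrow> complex.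
     (\<forall>i. B i \<in> tangent_space \<sigma> x) \<and>
     (\<forall>d\<in>tangent_space \<sigma> x. \<exists>!c :: 'n \<Rightarrow> complex. d = (\<lambda>m. \<Sum>i\<in>UNIV. c i * B i m)))"

definition peval :: "(('v \<Rightarrow>\<^sub>0 nat) \<Rightarrow>\<^sub>0 complex) \<Rightarrow> ('v \<Rightarrow> complex) \<Rightarrow> complex" where
  "peval p z = (\<Sum>e\<in>Poly_Mapping.keys p. Poly_Mapping.lookup p e *
     (\<Prod>v\<in>Poly_Mapping.keys e. z v ^ Poly_Mapping.lookup e v))"

definition homogeneous :: "nat \<Rightarrow> nat \<Rightarrow> ((nat \<Rightarrow>\<^sub>0 nat) \<Rightarrow>\<^sub>0 complex) \<Rightarrow> bool" where
  "homogeneous k d p \<longleftrightarrow> (\<forall>e\<in>Poly_Mapping.keys p. Poly_Mapping.keys e \<subseteq> {..<k} \<and>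
     (\<Sum>i\<in>Poly_Mapping.keys e. Poly_Mapping.lookup e i) = d)"

text \<open>
  \<open>Y\<close> is isomorphic to a Zariski-closed subvariety of \<open>\<P>\<^bsup>k-1\<^esup>\<close>: \<open>\<phi>\<close> gives homogeneous
  coordinates of a morphism that is injective, has closed image, and has a regular inverse.
\<close>
definition projective_variety :: "(real ^ 'n::finite) set set \<Rightarrow> bool" where
  "projective_variety \<Sigma> \<longleftrightarrow> (\<exists>(k::nat) (\<phi> :: 'n toric_point \<Rightarrow> nat \<Rightarrow> complex).
     (\<forall>P\<in>toric_variety \<Sigma>. \<exists>i<k. \<phi> P i \<noteq> 0) \<and>
     (\<forall>i<k. \<forall>j<k. regular_on \<Sigma> {P \<in> toric_variety \<Sigma>. \<phi> P i \<noteq> 0} (\<lambda>P. \<phi> P j / \<phi> P i)) \<and>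
     (\<forall>P\<in>toric_variety \<Sigma>. \<forall>Q\<in>toric_variety \<Sigma>. \<forall>c. c \<noteq> 0 \<and> (\<forall>i<k. \<phi> P i = c * \<phi> Q i) \<longrightarrow> P = Q) \<and>
     (\<exists>F. (\<forall>p\<in>F. \<exists>d. homogeneous k d p) \<and>
        (\<forall>z. (\<exists>i<k. z i \<noteq> 0) \<longrightarrow>
           ((\<exists>P\<in>toric_variety \<Sigma>. \<exists>c. c \<noteq> 0 \<and> (\<forall>i<k. z i = c * \<phi> P i)) \<longleftrightarrow>
            (\<forall>p\<in>F. peval p z = 0)))) \<and>
     (\<forall>\<sigma>\<in>\<Sigma>. \<forall>P\<in>U \<Sigma> \<sigma>. \<forall>m\<in>dual_semigroup \<sigma>. \<exists>d p q.
        homogeneous k d p \<and> homogeneous k d q \<and> peval q (\<phi> P) \<noteq> 0 \<and>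
        (\<forall>Q\<in>toric_variety \<Sigma>. peval q (\<phi> Q) \<noteq> 0 \<longrightarrow>
           Q \<in> U \<Sigma> \<sigma> \<and> chi \<sigma> m Q = peval p (\<phi> Q) / peval q (\<phi> Q))))"


section \<open>The group \<open>Aut\<^sup>0(Y)\<close> and its Lie algebra\<close>

definition morphism :: "(real ^ 'n::finite) set set \<Rightarrow> ('n toric_point \<Rightarrow> 'n toric_point) \<Rightarrow> bool" where
  "morphism \<Sigma> f \<longleftrightarrow> f ` toric_variety \<Sigma> \<subseteq> toric_variety \<Sigma> \<and>
     (\<forall>\<tau>\<in>\<Sigma>. \<forall>m\<in>dual_semigroup \<tau>.
        regular_on \<Sigma> {P \<in> toric_variety \<Sigma>. f P \<in> U \<Sigma> \<tau>} (\<lambda>P. chi \<tau> m (f P)))"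

text \<open>Automorphisms are extended by the identity outside \<open>Y\<close>; the group law is \<open>\<circ>\<close>.\<close>
definition Aut :: "(real ^ 'n::finite) set set \<Rightarrow> ('n toric_point \<Rightarrow> 'n toric_point) set" where
  "Aut \<Sigma> = {f. f permutes toric_variety \<Sigma> \<and> morphism \<Sigma> f \<and> morphism \<Sigma> (inv f)}"

text \<open>
  The classical topology of \<open>Y\<close>, glued from the affine pieces; \<open>U\<^sub>\<sigma>\<close> carries the topology of
  pointwise convergence on \<open>S\<^sub>\<sigma>\<close>.
\<close>
definition open_in_Y :: "(real ^ 'n::finite) set set \<Rightarrow> 'n toric_point set \<Rightarrow> bool" where
  "open_in_Y \<Sigma> W \<longleftrightarrow> W \<subseteq> toric_variety \<Sigma> \<and>
     (\<forall>\<sigma>\<in>\<Sigma>. openin (top_of_set (aff \<sigma>)) {x \<in> aff \<sigma>. glue \<Sigma> `` {(\<sigma>, x)} \<in> W})"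

lemma istopology_open_in_Y: "istopology (open_in_Y \<Sigma>)"
proof -
  have 1: "open_in_Y \<Sigma> (S \<inter> T)" if "open_in_Y \<Sigma> S" "open_in_Y \<Sigma> T" for S T
  proof -
    have "{x \<in> aff \<sigma>. glue \<Sigma> `` {(\<sigma>, x)} \<in> S \<inter> T} =
        {x \<in> aff \<sigma>. glue \<Sigma> `` {(\<sigma>, x)} \<in> S} \<inter> {x \<in> aff \<sigma>. glue \<Sigma> `` {(\<sigma>, x)} \<in> T}" for \<sigma>
      by blast
    then show ?thesis using that unfolding open_in_Y_def by (auto intro: openin_Int)
  qed
  have 2: "open_in_Y \<Sigma> (\<Union>\<K>)" if "\<forall>K\<in>\<K>. open_in_Y \<Sigma> K" for \<K>
  proof -
    have "{x \<in> aff \<sigma>. glue \<Sigma> `` {(\<sigma>, x)} \<in> \<Union>\<K>} =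
        (\<Union>K\<in>\<K>. {x \<in> aff \<sigma>. glue \<Sigma> `` {(\<sigma>, x)} \<in> K})" for \<sigma>
      by blast
    then show ?thesis using that unfolding open_in_Y_def by (auto intro!: openin_Union)
  qed
  show ?thesis unfolding istopology_def using 1 2 by blast
qed

definition top_Y :: "(real ^ 'n::finite) set set \<Rightarrow> 'n toric_point topology" where
  "top_Y \<Sigma> = topology (open_in_Y \<Sigma>)"

text \<open>The compact-open topology, which is the Lie group topology of \<open>Aut(Y)\<close> for complete \<open>Y\<close>.\<close>
definition top_Aut :: "(real ^ 'n::finite) set set \<Rightarrow> ('n toric_point \<Rightarrow> 'n toric_point) topology" where
  "top_Aut \<Sigma> = topology_generated_by
     {{g \<in> Aut \<Sigma>. g ` K \<subseteq> W} | K W. compactin (top_Y \<Sigma>) K \<and> openin (top_Y \<Sigma>) W}"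

definition Aut0 :: "(real ^ 'n::finite) set set \<Rightarrow> ('n toric_point \<Rightarrow> 'n toric_point) set" where
  "Aut0 \<Sigma> = connected_component_of_set (top_Aut \<Sigma>) id"

text \<open>
  The Lie algebra of a Lie group \<open>G\<close>, as the set of its (continuous) one-parameter subgroups
  \<open>\<gamma> : \<real> \<rightarrow> G\<close>; a tangent vector \<open>x\<close> at the identity corresponds to \<open>t \<mapsto> exp (t x)\<close>.
\<close>
definition lie_algebra ::
    "(real ^ 'n::finite) set set \<Rightarrow> ('n toric_point \<Rightarrow> 'n toric_point) set \<Rightarrow>
     (real \<Rightarrow> 'n toric_point \<Rightarrow> 'n toric_point) set" where
  "lie_algebra \<Sigma> G = {\<gamma>. continuous_map euclideanreal (subtopology (top_Aut \<Sigma>) G) \<gamma> \<and>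
     (\<forall>s t. \<gamma> (s + t) = \<gamma> s \<circ> \<gamma> t)}"


section \<open>The anticanonical bundle\<close>

definition lattice_basis :: "('n \<Rightarrow> 'n::finite lattice) \<Rightarrow> bool" where
  "lattice_basis m \<longleftrightarrow> (\<forall>v. \<exists>!c :: 'n \<Rightarrow> int. v = (\<Sum>j\<in>UNIV. c j *s m j))"

text \<open>
  A chart \<open>(\<sigma>, m)\<close> is a cone \<open>\<sigma>\<close> for which \<open>S\<^sub>\<sigma>\<close> is freely generated by the basis \<open>m\<close> of \<open>M\<close>, so
  that the functions \<open>x\<^sub>j = \<chi>\<^bsup>m j\<^esup>\<close> identify \<open>U\<^sub>\<sigma>\<close> with \<open>\<complex>\<^sup>n\<close>.  For smooth complete \<open>Y\<close> these charts
  cover \<open>Y\<close>.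
\<close>
definition charts :: "(real ^ 'n::finite) set set \<Rightarrow> 'n chart set" where
  "charts \<Sigma> = {(\<sigma>, m). \<sigma> \<in> \<Sigma> \<and> lattice_basis m \<and>
     dual_semigroup \<sigma> = {(\<Sum>j\<in>UNIV. int (k j) *s m j) | k. True}}"

definition dom_chart :: "(real ^ 'n::finite) set set \<Rightarrow> 'n chart \<Rightarrow> 'n toric_point set" where
  "dom_chart \<Sigma> c = U \<Sigma> (fst c)"

definition coords :: "'n chart \<Rightarrow> 'n toric_point \<Rightarrow> complex ^ 'n::finite" where
  "coords c P = (\<chi> j. chi (fst c) (snd c j) P)"

definition point_of :: "(real ^ 'n::finite) set set \<Rightarrow> 'n chart \<Rightarrow> complex ^ 'n \<Rightarrow> 'n toric_point" where
  "point_of \<Sigma> c z = (THE P. P \<in> dom_chart \<Sigma> c \<and> coords c P = z)"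

text \<open>The Jacobian determinant at \<open>P\<close> of \<open>g\<close>, in the charts \<open>c\<close> around \<open>P\<close> and \<open>d\<close> around \<open>g P\<close>.\<close>
definition jac ::
    "(real ^ 'n::finite) set set \<Rightarrow> ('n toric_point \<Rightarrow> 'n toric_point) \<Rightarrow> 'n chart \<Rightarrow> 'n chart \<Rightarrow>
     'n toric_point \<Rightarrow> complex" where
  "jac \<Sigma> g c d P =
     det (\<chi> i j. deriv (\<lambda>s. coords d (g (point_of \<Sigma> c (coords c P + axis j s))) $ i) 0)"

text \<open>
  A section of \<open>\<wedge>\<^sup>nTY\<close> is represented by its coefficients \<open>s c\<close> with respect to the frames
  \<open>\<partial>/\<partial>x\<^sub>1 \<and> \<dots> \<and> \<partial>/\<partial>x\<^sub>n\<close> of the charts \<open>c\<close>.  The push-forward \<open>g\<^sub>* s = s'\<close> multiplies coefficients by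
  the Jacobian determinant of \<open>g\<close>; for \<open>g = id\<close> it is the compatibility between charts.
\<close>
definition pushforward ::
    "(real ^ 'n::finite) set set \<Rightarrow> ('n toric_point \<Rightarrow> 'n toric_point) \<Rightarrow>
     ('n chart \<Rightarrow> 'n toric_point \<Rightarrow> complex) \<Rightarrow> ('n chart \<Rightarrow> 'n toric_point \<Rightarrow> complex) \<Rightarrow> bool" where
  "pushforward \<Sigma> g s s' \<longleftrightarrow> (\<forall>c\<in>charts \<Sigma>. \<forall>d\<in>charts \<Sigma>. \<forall>P\<in>dom_chart \<Sigma> c.
     g P \<in> dom_chart \<Sigma> d \<longrightarrow> s' d (g P) = jac \<Sigma> g c d P * s c P)"

definition anticanonical_section ::
    "(real ^ 'n::finite) set set \<Rightarrow> ('n chart \<Rightarrow> 'n toric_point \<Rightarrow> complex) \<Rightarrow> bool" where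
  "anticanonical_section \<Sigma> s \<longleftrightarrow>
     (\<forall>c\<in>charts \<Sigma>. \<exists>f\<in>coord_ring (fst c). \<forall>P\<in>dom_chart \<Sigma> c. s c P = f P) \<and>
     pushforward \<Sigma> id s s"

definition anticanonical_bpf :: "(real ^ 'n::finite) set set \<Rightarrow> bool" where
  "anticanonical_bpf \<Sigma> \<longleftrightarrow> (\<forall>P\<in>toric_variety \<Sigma>. \<exists>s. anticanonical_section \<Sigma> s \<and>
     (\<exists>c\<in>charts \<Sigma>. P \<in> dom_chart \<Sigma> c \<and> s c P \<noteq> 0))"

definition Delta :: "(real ^ 'n::finite) set set \<Rightarrow> (real ^ 'n) set" where
  "Delta \<Sigma> = {m. \<forall>\<rho>\<in>rays \<Sigma>. -1 \<le> m \<bullet> rvec \<rho>}"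

definition DeltaM :: "(real ^ 'n::finite) set set \<Rightarrow> 'n lattice set" where
  "DeltaM \<Sigma> = {\<mu>. rvec \<mu> \<in> Delta \<Sigma>}"

text \<open>
  The section \<open>t\<^sup>\<mu> \<and>\<^sub>i t\<^sub>i\<partial>/\<partial>t\<^sub>i\<close>.  In the chart \<open>(\<sigma>, m)\<close> one has
  \<open>t\<^sub>i\<partial>/\<partial>t\<^sub>i = \<Sum>\<^sub>j \<langle>m j, e\<^sub>i\<rangle> x\<^sub>j\<partial>/\<partial>x\<^sub>j\<close>, hence \<open>\<and>\<^sub>i t\<^sub>i\<partial>/\<partial>t\<^sub>i = det(\<langle>m j, e\<^sub>i\<rangle>) \<Prod>\<^sub>j x\<^sub>j \<and>\<^sub>j \<partial>/\<partial>x\<^sub>j\<close>.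
\<close>
definition tsec :: "'n lattice \<Rightarrow> 'n::finite chart \<Rightarrow> 'n toric_point \<Rightarrow> complex" where
  "tsec \<mu> c P = of_int (det (\<chi> j. snd c j)) * chi (fst c) (\<mu> + (\<Sum>j\<in>UNIV. snd c j)) P"

text \<open>The matrix of \<open>g\<^sub>*\<close> on \<open>V\<^sup>* = H\<^sup>0(Y, -K\<^sub>Y)\<close> in the basis \<open>t\<^sup>\<mu>\<close>: \<open>g\<^sub>* t\<^sup>\<mu> = \<Sum>\<^sub>\<nu> A \<nu> \<mu> t\<^sup>\<nu>\<close>.\<close>
definition act :: "(real ^ 'n::finite) set set \<Rightarrow> ('n toric_point \<Rightarrow> 'n toric_point) \<Rightarrow> 'n mat_M" where
  "act \<Sigma> g = (THE A.
     (\<forall>\<nu> \<mu>. A \<nu> \<mu> \<noteq> 0 \<longrightarrow> \<nu> \<in> DeltaM \<Sigma> \<and> \<mu> \<in> DeltaM \<Sigma>) \<and>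
     (\<forall>\<mu>\<in>DeltaM \<Sigma>. pushforward \<Sigma> g (tsec \<mu>) (\<lambda>c P. \<Sum>\<nu>\<in>DeltaM \<Sigma>. A \<nu> \<mu> * tsec \<nu> c P)))"

text \<open>
  The dual representation on \<open>V\<close>, in the basis \<open>b\<^sub>\<nu>\<close> of \<open>V\<close> dual to \<open>t\<^sup>\<nu>\<close>:
  \<open>(g b\<^sub>\<nu>)(t\<^sup>\<mu>) = b\<^sub>\<nu>(g\<inverse> t\<^sup>\<mu>)\<close>, i.e. \<open>g b\<^sub>\<nu> = \<Sum>\<^sub>\<mu> act (g\<inverse>) \<nu> \<mu> b\<^sub>\<mu>\<close>.  Its differential:
\<close>
definition lie_act ::
    "(real ^ 'n::finite) set set \<Rightarrow> (real \<Rightarrow> 'n toric_point \<Rightarrow> 'n toric_point) \<Rightarrow> 'n mat_M" where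
  "lie_act \<Sigma> \<gamma> \<nu> \<mu> = vector_derivative (\<lambda>t. act \<Sigma> (inv (\<gamma> t)) \<nu> \<mu>) (at 0)"

text \<open>
  The cone \<open>\<hat>Y \<subseteq> V\<close>: multiples of the evaluation functionals at points of \<open>Y\<close>, in the coordinates
  \<open>a \<mapsto> \<langle>a, t\<^sup>\<mu>\<rangle>\<close> on \<open>V\<close>.
\<close>
definition cone_Y :: "(real ^ 'n::finite) set set \<Rightarrow> ('n lattice \<Rightarrow> complex) set" where
  "cone_Y \<Sigma> = {(\<lambda>\<mu>. if \<mu> \<in> DeltaM \<Sigma> then k * tsec \<mu> c P else 0) | k c P.
     c \<in> charts \<Sigma> \<and> P \<in> dom_chart \<Sigma> c}"


section \<open>Differential operators\<close>

text \<open>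
  Operators act on the polynomial ring \<open>\<complex>[b\<^sub>m : m \<in> M]\<close>.  Since the variables \<open>b\<^sub>m\<close> with \<open>m \<notin> A\<close> are
  just scalars for the operators below, the algebra \<open>weyl A\<close> is the Weyl algebra in \<open>b\<^sub>m, \<partial>/\<partial>b\<^sub>m\<close>,
  \<open>m \<in> A\<close>; for \<open>A = \<Delta> \<inter> M\<close> it is \<open>D\<^bsub>V\<^sup>*\<^esub>\<close>.
\<close>
type_synonym 'v mpoly = "('v \<Rightarrow>\<^sub>0 nat) \<Rightarrow>\<^sub>0 complex"

definition Const :: "complex \<Rightarrow> 'v mpoly" where
  "Const c = Poly_Mapping.single 0 c"

definition var :: "'v \<Rightarrow> 'v mpoly" where
  "var v = Poly_Mapping.single (Poly_Mapping.single v 1) 1"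

definition pd :: "'v \<Rightarrow> 'v mpoly \<Rightarrow> 'v mpoly" where
  "pd v q = (\<Sum>e\<in>Poly_Mapping.keys q. Poly_Mapping.single (e - Poly_Mapping.single v 1)
     (of_nat (Poly_Mapping.lookup e v) * Poly_Mapping.lookup q e))"

inductive_set weyl :: "'v set \<Rightarrow> ('v mpoly \<Rightarrow> 'v mpoly) set" for A where
  weyl_const: "(\<lambda>q. Const c * q) \<in> weyl A"
| weyl_var: "v \<in> A \<Longrightarrow> (\<lambda>q. var v * q) \<in> weyl A"
| weyl_pd: "v \<in> A \<Longrightarrow> pd v \<in> weyl A"
| weyl_add: "S \<in> weyl A \<Longrightarrow> T \<in> weyl A \<Longrightarrow> (\<lambda>q. S q + T q) \<in> weyl A"
| weyl_mult: "S \<in> weyl A \<Longrightarrow> T \<in> weyl A \<Longrightarrow> S \<circ> T \<in> weyl A"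

inductive_set left_ideal :: "'v set \<Rightarrow> ('v mpoly \<Rightarrow> 'v mpoly) set \<Rightarrow> ('v mpoly \<Rightarrow> 'v mpoly) set"
  for A X where
  li_zero: "(\<lambda>q. 0) \<in> left_ideal A X"
| li_gen: "T \<in> X \<Longrightarrow> T \<in> left_ideal A X"
| li_add: "S \<in> left_ideal A X \<Longrightarrow> T \<in> left_ideal A X \<Longrightarrow> (\<lambda>q. S q + T q) \<in> left_ideal A X"
| li_mult: "S \<in> weyl A \<Longrightarrow> T \<in> left_ideal A X \<Longrightarrow> S \<circ> T \<in> left_ideal A X"

text \<open>The product of the commuting operators \<open>(\<partial>/\<partial>b\<^sub>v)\<^bsup>e v\<^esup>\<close>.\<close>
definition pd_monom :: "('v \<Rightarrow>\<^sub>0 nat) \<Rightarrow> 'v mpoly \<Rightarrow> 'v mpoly" where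
  "pd_monom e = Finite_Set.fold (\<lambda>v T. (pd v ^^ Poly_Mapping.lookup e v) \<circ> T) id (Poly_Mapping.keys e)"

text \<open>\<open>p(\<partial>)\<close>; a monomial in the \<open>\<zeta> = t\<^sup>\<mu> \<in> V\<^sup>*\<close> becomes a monomial in the \<open>\<partial>\<^sub>\<zeta> = \<partial>/\<partial>b\<^sub>\<mu>\<close>.\<close>
definition pd_poly :: "'v mpoly \<Rightarrow> 'v mpoly \<Rightarrow> 'v mpoly" where
  "pd_poly p q = (\<Sum>e\<in>Poly_Mapping.keys p. Const (Poly_Mapping.lookup p e) * pd_monom e q)"


section \<open>The tautological system\<close>

text \<open>
  \<open>\<complex>[V] = Sym(V\<^sup>*)\<close> has the basis elements \<open>t\<^sup>\<mu>\<close>, \<open>\<mu> \<in> \<Delta> \<inter> M\<close>, of \<open>V\<^sup>*\<close> as variables.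
\<close>
definition ideal_cone_Y :: "(real ^ 'n::finite) set set \<Rightarrow> ('n lattice) mpoly set" where
  "ideal_cone_Y \<Sigma> = {p. (\<forall>e\<in>Poly_Mapping.keys p. Poly_Mapping.keys e \<subseteq> DeltaM \<Sigma>) \<and>
     (\<forall>a\<in>cone_Y \<Sigma>. peval p a = 0)}"

text \<open>
  \<open>Z(\<gamma>, c)\<close> for \<open>(\<gamma>, c) \<in> \<gg> \<times> \<complex>\<close>: an endomorphism \<open>b\<^sub>\<nu> \<mapsto> \<Sum>\<^sub>\<mu> z \<nu> \<mu> b\<^sub>\<mu>\<close> of \<open>V\<close> is viewed as the
  derivation \<open>\<Sum>\<^bsub>\<nu>,\<mu>\<^esub> z \<nu> \<mu> b\<^sub>\<mu> \<partial>/\<partial>b\<^sub>\<nu>\<close>.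
\<close>
definition Zhat ::
    "(real ^ 'n::finite) set set \<Rightarrow> (real \<Rightarrow> 'n toric_point \<Rightarrow> 'n toric_point) \<times> complex \<Rightarrow>
     ('n lattice) mpoly \<Rightarrow> ('n lattice) mpoly" where
  "Zhat \<Sigma> x q =
     (\<Sum>\<nu>\<in>DeltaM \<Sigma>. \<Sum>\<mu>\<in>DeltaM \<Sigma>. Const (lie_act \<Sigma> (fst x) \<nu> \<mu>) * (var \<mu> * pd \<nu> q)) +
     (\<Sum>\<mu>\<in>DeltaM \<Sigma>. Const (snd x) * (var \<mu> * pd \<mu> q))"

text \<open>The left ideal defining \<open>\<tau>\<^sub>Y(G, -K\<^sub>Y, \<beta>)\<close>.\<close>
definition tautological_ideal ::
    "(real ^ 'n::finite) set set \<Rightarrow> ('n toric_point \<Rightarrow> 'n toric_point) set \<Rightarrow>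
     ((real \<Rightarrow> 'n toric_point \<Rightarrow> 'n toric_point) \<times> complex \<Rightarrow> complex) \<Rightarrow>
     (('n lattice) mpoly \<Rightarrow> ('n lattice) mpoly) set" where
  "tautological_ideal \<Sigma> G \<beta> = left_ideal (DeltaM \<Sigma>)
     (pd_poly ` ideal_cone_Y \<Sigma> \<union>
      {(\<lambda>q. Zhat \<Sigma> x q + Const (\<beta> x) * q) | x. x \<in> lie_algebra \<Sigma> G \<times> UNIV})"


section \<open>The extended GKZ system\<close>

definition is_root_ray :: "(real ^ 'n::finite) set set \<Rightarrow> 'n lattice \<Rightarrow> 'n lattice \<Rightarrow> bool" where
  "is_root_ray \<Sigma> \<alpha> \<rho>0 \<longleftrightarrow> \<rho>0 \<in> rays \<Sigma> \<and> pair \<alpha> \<rho>0 = -1 \<and>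
     (\<forall>\<rho>\<in>rays \<Sigma>. \<rho> \<noteq> \<rho>0 \<longrightarrow> 0 \<le> pair \<alpha> \<rho>)"

definition roots :: "(real ^ 'n::finite) set set \<Rightarrow> 'n lattice set" where
  "roots \<Sigma> = {\<alpha>. \<exists>!\<rho>. is_root_ray \<Sigma> \<alpha> \<rho>}"

definition root_ray :: "(real ^ 'n::finite) set set \<Rightarrow> 'n lattice \<Rightarrow> 'n lattice" where
  "root_ray \<Sigma> \<alpha> = (THE \<rho>. is_root_ray \<Sigma> \<alpha> \<rho>)"

definition gkz_box :: "('v \<Rightarrow>\<^sub>0 int) \<Rightarrow> 'v mpoly \<Rightarrow> 'v mpoly" where
  "gkz_box l q = pd_monom (Poly_Mapping.map nat l) q - pd_monom (Poly_Mapping.map nat (- l)) q"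

text \<open>Terms with \<open>\<mu> + \<alpha> \<notin> \<Delta>\<close>, whose coefficient vanishes, are omitted from the sum.\<close>
definition gkz_root ::
    "(real ^ 'n::finite) set set \<Rightarrow> 'n lattice \<Rightarrow> ('n lattice) mpoly \<Rightarrow> ('n lattice) mpoly" where
  "gkz_root \<Sigma> \<alpha> q = (\<Sum>\<mu> | \<mu> \<in> DeltaM \<Sigma> \<and> \<mu> + \<alpha> \<in> DeltaM \<Sigma>.
     Const (of_int (pair (\<mu> - \<alpha>) (root_ray \<Sigma> \<alpha>))) * (var \<mu> * pd (\<mu> + \<alpha>) q))"

definition extended_gkz_ideal ::
    "(real ^ 'n::finite) set set \<Rightarrow> (('n lattice) mpoly \<Rightarrow> ('n lattice) mpoly) set" where
  "extended_gkz_ideal \<Sigma> = left_ideal (DeltaM \<Sigma>)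
     ({gkz_box l | l. Poly_Mapping.keys l \<subseteq> DeltaM \<Sigma> \<and>
         (\<Sum>\<mu>\<in>Poly_Mapping.keys l. Poly_Mapping.lookup l \<mu>) = 0 \<and>
         (\<Sum>\<mu>\<in>Poly_Mapping.keys l. Poly_Mapping.lookup l \<mu> *s \<mu>) = 0} \<union>
      {(\<lambda>q. \<Sum>\<mu>\<in>DeltaM \<Sigma>. Const (of_int (pair \<mu> (axis j 1))) * (var \<mu> * pd \<mu> q)) | j. True} \<union>
      {(\<lambda>q. (\<Sum>\<mu>\<in>DeltaM \<Sigma>. var \<mu> * pd \<mu> q) + q)} \<union>
      gkz_root \<Sigma> ` roots \<Sigma>)"

end

theory Submission
  imports Defs "HOL-Complex_Analysis.Cauchy_Integral_Formula"
begin

text \<open>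
  A one-parameter subgroup \<open>\<gamma>\<close> of \<open>Aut(Y)\<close> acts on \<open>H\<^sup>0(Y, -K\<^sub>Y)\<close>, so on the torus the functions
  \<open>t\<^sup>\<mu>(\<gamma>\<^sub>t Q)\<close> are quotients of sections.  Hence \<open>\<gamma>\<close> is generated by a vector field
  \<open>\<Sum>\<^sub>\<alpha> t\<^sup>\<alpha> \<delta>\<^sub>\<alpha>\<close> with Laurent polynomial coefficients, \<open>\<delta>\<^sub>\<alpha>\<close> being an invariant vector field.
  The Jacobian of \<open>\<gamma>\<close> then gives the action on sections:
  \<open>lie_act \<nu> \<mu> = \<delta>\<^sub>\<alpha>(\<mu>) - \<delta>\<^sub>\<alpha>(\<alpha>)\<close> with \<open>\<alpha> = \<nu> - \<mu>\<close>.  So \<open>\<delta>\<^sub>\<alpha>(\<mu>) = \<delta>\<^sub>\<alpha>(\<alpha>)\<close> for all \<open>\<mu> \<in> \<Delta>\<close> with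
  \<open>\<mu> + \<alpha> \<notin> \<Delta>\<close>.  Applied to the vertices of \<open>\<Delta>\<close>, this forces \<open>\<alpha>\<close> to be a root and \<open>\<delta>\<^sub>\<alpha>\<close> to be a multiple of
  \<open>\<rho>\<^sub>\<alpha>\<close> whenever \<open>\<alpha> \<noteq> 0\<close> and \<open>\<delta>\<^sub>\<alpha> \<noteq> 0\<close>.  Conversely,
  these fields are realised by the torus and by the root subgroups, which in Cox coordinates map
  \<open>z\<^sub>\<rho>\<close> to \<open>z\<^sub>\<rho> + t M\<close> for \<open>\<rho> = \<rho>\<^sub>\<alpha>\<close>, with \<open>M\<close> the product of the \<open>z\<^sub>\<tau> powi pair \<alpha> \<tau>\<close> over the other rays
  \<open>\<tau>\<close>.  So the operators \<open>Z(x)\<close> are spanned by the torus operators, the \<open>Z\<^sub>\<alpha>\<close> and, through the scaling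
  of \<open>V\<close>, the Euler operator.  The ideal of the cone over \<open>Y\<close>, in turn, is spanned by the differences of
  monomials of equal degree and weight.
\<close>

section \<open>Cones, fans and charts\<close>

text \<open>An element of the Lie algebra is a continuous one-parameter subgroup for the
  compact-open topology: it cannot be added to another one directly, and the derivative in
  \<open>lie_act\<close> has to be shown to exist. Closeness of \<open>\<gamma> t\<close> to the
  identity, uniform on compact sets, controls Jacobians by Cauchy estimates. So the matrices
  \<open>act\<close> are continuous at t = 0, and a continuous group of matrices is differentiable.
  Left ideals are closed under complex combinations, so only the linear span of the operators Z(x)
  has to be determined. The quotients \<open>t\<^sup>\<mu>(\<gamma>\<^sub>t Q)\<close> leave the
  action on sections open up to a common factor. Its derivative is, up to sign, the divergence of
  the vector field; this is the origin of the term \<open>\<delta>\<^sub>\<alpha>(\<alpha>)\<close>.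
  Base-point freeness puts the point \<open>- (\<Sum>j. m j)\<close> of every maximal cone into
  \<Delta>. At this point all rays of the cone have height -1, so a shift by \<alpha> leaves
  \<Delta> as soon as \<alpha> is negative on one of them.\<close>

lemma pair_add_left: "pair (a + b) v = pair a v + pair b v"
  by (simp add: pair_def distrib_right sum.distrib)
lemma pair_add_right: "pair a (v + w) = pair a v + pair a w"
  by (simp add: pair_def distrib_left sum.distrib)
lemma pair_scale_left: "pair (k *s a) v = k * pair a v"
  by (simp add: pair_def sum_distrib_left mult.assoc)
lemma pair_scale_right: "pair a (k *s v) = k * pair a v"
  by (simp add: pair_def sum_distrib_left mult_ac)
lemma pair_minus_left: "pair (- a) v = - pair a v"
  by (simp add: pair_def sum_negf)
lemma pair_minus_right: "pair a (- v) = - pair a v"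
  by (simp add: pair_def sum_negf)
lemma pair_diff_left: "pair (a - b) v = pair a v - pair b v"
  by (simp add: pair_def left_diff_distrib sum_subtractf)
lemma pair_zero [simp]: "pair 0 v = 0" "pair a 0 = 0"
  by (simp_all add: pair_def)
lemma pair_sum_left: "pair (\<Sum>i\<in>I. f i) v = (\<Sum>i\<in>I. pair (f i) v)"
  by (induction I rule: infinite_finite_induct) (simp_all add: pair_add_left)
lemma pair_sum_right: "pair a (\<Sum>i\<in>I. f i) = (\<Sum>i\<in>I. pair a (f i))"
  by (induction I rule: infinite_finite_induct) (simp_all add: pair_add_right)
lemma pair_axis: "pair a (axis j 1) = a $ j"
  by (simp add: pair_def axis_def if_distrib[of "\<lambda>x. _ * x"] cong: if_cong)
text \<open>M and N have the same type, so \<open>pair\<close> is also a positive definite form;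
  nondegeneracy follows from this.\<close>

lemma pair_self_le_0: "pair a a \<le> 0 \<Longrightarrow> a = 0"
proof -
  assume "pair a a \<le> 0"
  then have "(\<Sum>i\<in>UNIV. a $ i * a $ i) = 0"
    unfolding pair_def by (simp add: antisym sum_nonneg)
  then show "a = 0" by (simp add: sum_nonneg_eq_0_iff vec_eq_iff)
qed

lemmas pair_simps = pair_add_left pair_add_right pair_scale_left pair_scale_right
  pair_minus_left pair_minus_right pair_diff_left pair_sum_left pair_sum_right

lemma inner_rvec: "rvec m \<bullet> rvec v = of_int (pair m v)"
  by (simp add: rvec_def pair_def inner_vec_def)
lemma rvec_add: "rvec (a + b) = rvec a + rvec b"
  by (simp add: rvec_def vec_eq_iff)
lemma rvec_minus: "rvec (- a) = - rvec a"
  by (simp add: rvec_def vec_eq_iff)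
lemma rvec_scale: "rvec (k *s a) = of_int k *\<^sub>R rvec a"
  by (simp add: rvec_def vec_eq_iff)
lemma rvec_zero [simp]: "rvec 0 = 0"
  by (simp add: rvec_def vec_eq_iff)
lemma rvec_sum: "rvec (\<Sum>i\<in>I. f i) = (\<Sum>i\<in>I. rvec (f i))"
  by (induction I rule: infinite_finite_induct) (simp_all add: rvec_add)
lemma rvec_eq_iff [simp]: "rvec a = rvec b \<longleftrightarrow> a = b"
  by (simp add: rvec_def vec_eq_iff)
lemma rvec_eq_0_iff [simp]: "rvec a = 0 \<longleftrightarrow> a = 0"
  by (simp add: rvec_def vec_eq_iff)
lemma inj_rvec: "inj rvec"
  by (simp add: inj_on_def)

section \<open>Lattice approximation and duality of strongly convex rational cones\<close>

lemma tendsto_lattice_approx: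
  fixes a :: "real ^ 'n::finite"
  shows "(\<lambda>n. (1 / real n) *\<^sub>R rvec (\<chi> i. \<lfloor>real n * a $ i\<rfloor>)) \<longlonglongrightarrow> a"
proof (rule vec_tendstoI)
  fix i :: 'n
  have "(\<lambda>n. of_int \<lfloor>real n * a $ i\<rfloor> / real n) \<longlonglongrightarrow> a $ i"
  proof (rule tendsto_sandwich)
    show "\<forall>\<^sub>F n in sequentially. a $ i - 1 / real n \<le> of_int \<lfloor>real n * a $ i\<rfloor> / real n"
      using eventually_gt_at_top[of 0]
    proof eventually_elim
      case (elim n)
      have "real n * a $ i - 1 \<le> of_int \<lfloor>real n * a $ i\<rfloor>" by linarith
      then have "(real n * a $ i - 1) / real n \<le> of_int \<lfloor>real n * a $ i\<rfloor> / real n"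
        by (intro divide_right_mono) auto
      then show ?case using elim by (simp add: diff_divide_distrib)
    qed
    show "\<forall>\<^sub>F n in sequentially. of_int \<lfloor>real n * a $ i\<rfloor> / real n \<le> a $ i"
      using eventually_gt_at_top[of 0]
      by eventually_elim (simp add: field_simps)
    show "(\<lambda>n. a $ i - 1 / real n) \<longlonglongrightarrow> a $ i" by real_asymp
  qed auto
  then show "(\<lambda>n. ((1 / real n) *\<^sub>R rvec (\<chi> i. \<lfloor>real n * a $ i\<rfloor>)) $ i) \<longlonglongrightarrow> a $ i"
    by (simp add: rvec_def)
qed

text \<open>Turns real functionals from separation theorems into lattice points: scaled integer
  parts of \<open>a\<close> enter the open set, and \<open>cone\<close> removes the scaling.\<close>

lemma lattice_point_in_open_cone:
  fixes a :: "real ^ 'n::finite"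
  assumes "open O'" "a \<in> O'" and cone: "\<And>x t. t > 0 \<Longrightarrow> t *\<^sub>R rvec x \<in> O' \<Longrightarrow> rvec x \<in> O'"
  shows "\<exists>m. rvec m \<in> O'"
proof -
  have "\<forall>\<^sub>F n in sequentially. (1 / real n) *\<^sub>R rvec (\<chi> i. \<lfloor>real n * a $ i\<rfloor>) \<in> O'"
    using tendsto_lattice_approx[of a] assms(1,2) by (rule topological_tendstoD)
  then have "\<forall>\<^sub>F n in sequentially. (1 / real n) *\<^sub>R rvec (\<chi> i. \<lfloor>real n * a $ i\<rfloor>) \<in> O' \<and> n > 0"
    using eventually_gt_at_top[of 0] by eventually_elim simp
  then obtain n where "(1 / real n) *\<^sub>R rvec (\<chi> i. \<lfloor>real n * a $ i\<rfloor>) \<in> O'" "n > 0"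
    by (metis (mono_tags, lifting) eventually_happens' sequentially_bot)
  then show ?thesis using cone[of "1 / real n"] by fastforce
qed

definition pointed_cone :: "(real ^ 'n::finite) set \<Rightarrow> bool" where
  "pointed_cone \<sigma> \<longleftrightarrow> rational_polyhedral_cone \<sigma> \<and> \<sigma> \<inter> uminus ` \<sigma> = {0}"

lemma pointed_cone_obtain:
  assumes "pointed_cone \<sigma>"
  obtains S where "finite S" "\<sigma> = convex_cone hull (rvec ` S)"
  using assms unfolding pointed_cone_def rational_polyhedral_cone_def by (elim conjE exE) (rule that)

lemma pointed_cone_facts:
  assumes "pointed_cone \<sigma>"
  shows "closed \<sigma>" "convex \<sigma>" "0 \<in> \<sigma>" "\<And>x y. x \<in> \<sigma> \<Longrightarrow> y \<in> \<sigma> \<Longrightarrow> x + y \<in> \<sigma>"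
    "\<And>x c. x \<in> \<sigma> \<Longrightarrow> 0 \<le> c \<Longrightarrow> c *\<^sub>R x \<in> \<sigma>" "\<And>x. x \<in> \<sigma> \<Longrightarrow> - x \<in> \<sigma> \<Longrightarrow> x = 0"
proof -
  obtain S where S: "finite S" "\<sigma> = convex_cone hull (rvec ` S)"
    by (rule pointed_cone_obtain[OF assms])
  show "closed \<sigma>" unfolding S(2) by (rule closed_convex_cone_hull) (rule finite_imageI[OF S(1)])
  show "convex \<sigma>" unfolding S(2) by (rule convex_convex_cone_hull)
  show "0 \<in> \<sigma>" unfolding S(2) by (rule convex_cone_hull_contains_0)
  show "\<And>x y. x \<in> \<sigma> \<Longrightarrow> y \<in> \<sigma> \<Longrightarrow> x + y \<in> \<sigma>" unfolding S(2) by (rule convex_cone_hull_add)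
  show "\<And>x c. x \<in> \<sigma> \<Longrightarrow> 0 \<le> c \<Longrightarrow> c *\<^sub>R x \<in> \<sigma>" unfolding S(2) by (rule convex_cone_hull_mul)
  show "x = 0" if "x \<in> \<sigma>" "- x \<in> \<sigma>" for x
  proof -
    have "x \<in> uminus ` \<sigma>" using that(2) by (metis imageI minus_minus)
    then show ?thesis using assms that(1) unfolding pointed_cone_def by blast
  qed
qed

lemma convex_cone_hull_inner_nonneg:
  assumes "\<And>x. x \<in> S \<Longrightarrow> 0 \<le> a \<bullet> x" "x \<in> convex_cone hull S"
  shows "0 \<le> a \<bullet> x"
proof -
  have "convex_cone hull S \<subseteq> {x. 0 \<le> a \<bullet> x}"
    by (rule hull_minimal)
      (use assms(1) in \<open>auto simp: convex_cone_def convex_halfspace_ge conic_def inner_add_right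
         intro: exI[of _ 0]\<close>)
  then show ?thesis using assms(2) by blast
qed

text \<open>A vanishing convex combination of nonzero generators would put some nonzero vector and
  its negative into the cone. So 0 lies outside the hull of the nonzero generators and can be
  separated from it.\<close>

lemma strictly_positive_functional:
  assumes S: "finite S" and "pointed_cone (convex_cone hull (rvec ` S))"
  shows "\<exists>a. \<forall>s\<in>S. s \<noteq> 0 \<longrightarrow> 0 < a \<bullet> rvec s"
proof -
  note P = pointed_cone_facts[OF assms(2)]
  let ?T = "rvec ` (S - {0})"
  have fin: "finite ?T" using S by simp
  have "0 \<notin> convex hull ?T"
  proof
    assume "0 \<in> convex hull ?T"
    then obtain u where u: "\<forall>x\<in>?T. 0 \<le> u x" "sum u ?T = 1" "(\<Sum>x\<in>?T. u x *\<^sub>R x) = 0"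
      unfolding convex_hull_finite[OF fin] by auto
    obtain x where x: "x \<in> ?T" "u x \<noteq> 0" using u(2) by (metis sum.neutral zero_neq_one)
    have in_cone: "y \<in> convex_cone hull (rvec ` S)" if "y \<in> ?T" for y
      using that by (intro hull_inc) auto
    have "(\<Sum>y\<in>?T - {x}. u y *\<^sub>R y) \<in> convex_cone hull (rvec ` S)"
    proof -
      have "(\<Sum>y\<in>A. u y *\<^sub>R y) \<in> convex_cone hull (rvec ` S)" if "finite A" "A \<subseteq> ?T" for A
        using that
      proof (induction A rule: finite_induct)
        case (insert y A)
        then have "u y *\<^sub>R y \<in> convex_cone hull (rvec ` S)" using P(5) in_cone u(1) by auto
        then show ?case using insert P(4) by auto
      qed (use P(3) in auto)
      from this[of "?T - {x}"] fin show ?thesis by auto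
    qed
    moreover have "(\<Sum>y\<in>?T - {x}. u y *\<^sub>R y) = - (u x *\<^sub>R x)"
      using u(3) sum.remove[OF fin x(1), of "\<lambda>y. u y *\<^sub>R y"] by (simp add: eq_neg_iff_add_eq_0 add.commute)
    moreover have "u x *\<^sub>R x \<in> convex_cone hull (rvec ` S)"
      using P(5) in_cone[OF x(1)] u(1) x(1) by auto
    ultimately have "u x *\<^sub>R x = 0" using P(6)[of "u x *\<^sub>R x"] by metis
    then show False using x by auto
  qed
  moreover have "closed (convex hull ?T)"
    using fin finite_imp_compact_convex_hull compact_imp_closed by blast
  ultimately obtain a b where ab: "0 < b" "\<forall>x\<in>convex hull ?T. b < a \<bullet> x"
    using separating_hyperplane_closed_0[of "convex hull ?T"] convex_convex_hull by blast
  have "0 < a \<bullet> rvec s" if "s \<in> S" "s \<noteq> 0" for s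
    using that ab hull_inc[of "rvec s" ?T convex] by fastforce
  then show ?thesis by blast
qed

lemma interior_dual_lattice_point:
  assumes S: "finite S" and "pointed_cone (convex_cone hull (rvec ` S))"
  shows "\<exists>m. \<forall>s\<in>S. s \<noteq> 0 \<longrightarrow> 0 < pair m s"
proof -
  obtain a where a: "\<forall>s\<in>S. s \<noteq> 0 \<longrightarrow> 0 < a \<bullet> rvec s"
    using strictly_positive_functional[OF assms] by blast
  let ?O = "\<Inter>s\<in>S-{0}. {x. 0 < x \<bullet> rvec s}"
  have "open ?O"
    by (intro open_INT ballI) (use S in \<open>auto intro!: open_Collect_less continuous_intros\<close>)
  moreover have "a \<in> ?O" using a by auto
  ultimately have "\<exists>m. rvec m \<in> ?O"
    by (rule lattice_point_in_open_cone) (auto simp: zero_less_mult_iff)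
  then show ?thesis by (auto simp: inner_rvec)
qed

text \<open>A real functional separating \<open>u\<close> from \<open>\<sigma>\<close> is perturbed
  by a strictly positive one, so that it is negative at \<open>u\<close> and strictly positive on
  the generators. These conditions are open, so some lattice point satisfies them.\<close>

lemma pointed_cone_bidual:
  fixes u :: "real ^ 'n::finite"
  assumes "pointed_cone \<sigma>" "\<And>m. m \<in> dual_semigroup \<sigma> \<Longrightarrow> 0 \<le> rvec m \<bullet> u"
  shows "u \<in> \<sigma>"
proof (rule ccontr)
  assume u: "u \<notin> \<sigma>"
  obtain S where S: "finite S" "\<sigma> = convex_cone hull (rvec ` S)"
    by (rule pointed_cone_obtain[OF assms(1)])
  note P = pointed_cone_facts[OF assms(1)]
  obtain a0 where a0: "\<forall>s\<in>S. s \<noteq> 0 \<longrightarrow> 0 < a0 \<bullet> rvec s"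
    using strictly_positive_functional S assms(1) by blast
  obtain a b where ab: "a \<bullet> u < b" "\<forall>x\<in>\<sigma>. b < a \<bullet> x"
    using separating_hyperplane_closed_point[OF P(2,1) u] by blast
  have b: "b < 0" using ab P(3) by fastforce
  have anon: "0 \<le> a \<bullet> x" if x: "x \<in> \<sigma>" for x
  proof (rule ccontr)
    assume n: "\<not> 0 \<le> a \<bullet> x"
    have "(b / (a \<bullet> x)) *\<^sub>R x \<in> \<sigma>"
      using P(5)[OF x, of "b / (a \<bullet> x)"] n b by (simp add: divide_nonpos_neg)
    then have "b < a \<bullet> ((b / (a \<bullet> x)) *\<^sub>R x)" using ab(2) by blast
    then show False using n by simp
  qed
  \<comment> \<open>If \<open>a0\<close> is positive at \<open>u\<close>, this choice halves the
    negative value of \<open>a\<close> there; otherwise any positive multiple keeps it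
    negative.\<close>
  define e where "e = (if a0 \<bullet> u > 0 then - (a \<bullet> u) / (2 * (a0 \<bullet> u)) else 1)"
  have e: "e > 0" "(a + e *\<^sub>R a0) \<bullet> u < 0"
    using ab b by (auto simp: e_def inner_add_left intro!: divide_neg_pos)
  let ?O = "{x. x \<bullet> u < 0} \<inter> (\<Inter>s\<in>S-{0}. {x. 0 < x \<bullet> rvec s})"
  have "open ?O"
    by (intro open_Int open_INT ballI) (use S in \<open>auto intro!: open_Collect_less continuous_intros\<close>)
  moreover have "a + e *\<^sub>R a0 \<in> ?O"
  proof -
    have "0 < (a + e *\<^sub>R a0) \<bullet> rvec s" if "s \<in> S - {0}" for s
    proof -
      have "rvec s \<in> \<sigma>" using that S by (auto intro!: hull_inc)
      then have "0 \<le> a \<bullet> rvec s" using anon by blast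
      then show ?thesis using that a0 e by (simp add: inner_add_left add_nonneg_pos)
    qed
    then show ?thesis using e by auto
  qed
  ultimately have "\<exists>m. rvec m \<in> ?O"
    by (rule lattice_point_in_open_cone) (auto simp: zero_less_mult_iff mult_less_0_iff)
  then obtain m where m: "rvec m \<bullet> u < 0" "\<forall>s\<in>S-{0}. 0 < rvec m \<bullet> rvec s" by auto
  have "m \<in> dual_semigroup \<sigma>"
    unfolding dual_semigroup_def S(2)
  proof (intro CollectI ballI)
    fix x assume "x \<in> convex_cone hull (rvec ` S)"
    then show "0 \<le> rvec m \<bullet> x"
      by (rule convex_cone_hull_inner_nonneg[rotated]) (use m(2) in \<open>auto intro: less_imp_le\<close>)
  qed
  then show False using assms(2) m(1) by fastforce
qed

section \<open>Limits in projective space and completeness of the fan\<close>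

lemma coordinatewise_convergent_subsequence:
  fixes z :: "nat \<Rightarrow> nat \<Rightarrow> 'a::heine_borel"
  assumes "\<And>i. i < k \<Longrightarrow> bounded (range (\<lambda>s. z s i))"
  shows "\<exists>r l. strict_mono (r :: nat \<Rightarrow> nat) \<and> (\<forall>i<k. (\<lambda>s. z (r s) i) \<longlonglongrightarrow> l i)"
  using assms
proof (induction k)
  case 0
  then show ?case by (auto intro: exI[of _ id] simp: strict_mono_def)
next
  case (Suc k)
  then obtain r l where rl: "strict_mono r" "\<forall>i<k. (\<lambda>s. z (r s) i) \<longlonglongrightarrow> l i"
    by (metis less_SucI)
  have "bounded (range (\<lambda>s. z (r s) k))"
    using Suc.prems[of k] by (rule bounded_subset) auto
  then obtain a q where aq: "strict_mono q" "((\<lambda>s. z (r s) k) \<circ> q) \<longlonglongrightarrow> a"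
    using bounded_imp_convergent_subsequence by blast
  have "(\<lambda>s. z ((r \<circ> q) s) i) \<longlonglongrightarrow> (l(k := a)) i" if "i < Suc k" for i
  proof (cases "i = k")
    case True
    then show ?thesis using aq by (simp add: o_def)
  next
    case False
    then have "(\<lambda>s. z (r s) i) \<longlonglongrightarrow> l i" using that rl by auto
    then show ?thesis using LIMSEQ_subseq_LIMSEQ[OF _ aq(1)] False by (fastforce simp: o_def)
  qed
  moreover have "strict_mono (r \<circ> q)" using rl(1) aq(1) by (rule strict_mono_o)
  ultimately show ?case by blast
qed

lemma peval_homogeneous_cong:
  assumes "homogeneous k d p" "\<And>i. i < k \<Longrightarrow> z i = w i"
  shows "peval p z = peval p w"
  unfolding peval_def
  by (intro sum.cong prod.cong refl arg_cong2[where f = "(*)"])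
    (use assms in \<open>auto simp: homogeneous_def subset_iff\<close>)

lemma peval_homogeneous_scale:
  assumes "homogeneous k d p"
  shows "peval p (\<lambda>i. c * z i) = c ^ d * peval p z"
proof -
  have "(\<Prod>v\<in>Poly_Mapping.keys e. (c * z v) ^ Poly_Mapping.lookup e v) =
      c ^ d * (\<Prod>v\<in>Poly_Mapping.keys e. z v ^ Poly_Mapping.lookup e v)"
    if "e \<in> Poly_Mapping.keys p" for e
  proof -
    have "(\<Prod>v\<in>Poly_Mapping.keys e. c ^ Poly_Mapping.lookup e v) = c ^ d"
      using assms that by (simp add: homogeneous_def flip: power_sum)
    then show ?thesis by (simp add: power_mult_distrib prod.distrib)
  qed
  then show ?thesis unfolding peval_def
    by (simp add: sum_distrib_left mult.left_commute cong: sum.cong)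
qed

lemma tendsto_peval_homogeneous:
  assumes "homogeneous k d p" "\<And>i. i < k \<Longrightarrow> ((\<lambda>s. z s i) \<longlongrightarrow> l i) F"
  shows "((\<lambda>s. peval p (z s)) \<longlongrightarrow> peval p l) F"
  unfolding peval_def
  by (intro tendsto_intros) (use assms in \<open>auto simp: homogeneous_def subset_iff\<close>)

lemma fan_pointed_cone: "fan \<Sigma> \<Longrightarrow> \<sigma> \<in> \<Sigma> \<Longrightarrow> pointed_cone \<sigma>"
  by (simp add: fan_def pointed_cone_def)

lemma restr_aff: "x \<in> aff \<sigma> \<Longrightarrow> restr \<sigma> x = x"
  by (auto simp: restr_def aff_def)

text \<open>If 0 is interior to a segment in a strongly convex cone, positive multiples of the
  endpoints are opposite, so both endpoints are 0. Hence the apex is a face.\<close>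

lemma zero_cone_in_fan:
  assumes "fan \<Sigma>"
  shows "{0} \<in> \<Sigma>"
proof -
  obtain \<sigma> where \<sigma>: "\<sigma> \<in> \<Sigma>" using assms unfolding fan_def by blast
  note P = pointed_cone_facts[OF fan_pointed_cone[OF assms \<sigma>]]
  have "{0} face_of \<sigma>"
    unfolding face_of_def
  proof (intro conjI ballI impI)
    fix a b x assume ab: "a \<in> \<sigma>" "b \<in> \<sigma>" "x \<in> {0}" "x \<in> open_segment a b"
    then obtain u where u: "0 = (1 - u) *\<^sub>R a + u *\<^sub>R b" "0 < u" "u < 1"
      by (auto simp: in_segment)
    have "u *\<^sub>R b = - ((1 - u) *\<^sub>R a)" using u(1) by (simp add: eq_neg_iff_add_eq_0 add.commute)
    then have "(1 - u) *\<^sub>R a = 0"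
      using P(6)[of "(1 - u) *\<^sub>R a"] P(5)[OF ab(1), of "1 - u"] P(5)[OF ab(2), of u] u(2,3)
      by (metis diff_ge_0_iff_ge less_eq_real_def)
    then have "a = 0" using u by simp
    then show "a \<in> {0}" "b \<in> {0}" using u by auto
  qed (use P(3) in auto)
  then show ?thesis using assms \<sigma> unfolding fan_def by blast
qed

text \<open>The one-parameter subgroup of \<open>v\<close> has a limit point in \<open>Y\<close>, and \<open>v\<close> lies in the cone of any chart
  around it.\<close>

lemma projective_imp_complete:
  fixes \<Sigma> :: "(real ^ 'n::finite) set set"
  assumes fan: "fan \<Sigma>" and "projective_variety \<Sigma>"
  shows "\<exists>\<sigma>\<in>\<Sigma>. rvec v \<in> \<sigma>"
proof -
  obtain k :: nat and \<phi> :: "'n toric_point \<Rightarrow> nat \<Rightarrow> complex" and F where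
    nz: "\<forall>P\<in>toric_variety \<Sigma>. \<exists>i<k. \<phi> P i \<noteq> 0" and
    F: "\<forall>p\<in>F. \<exists>d. homogeneous k d p" and
    cl: "\<forall>z. (\<exists>i<k. z i \<noteq> 0) \<longrightarrow>
           ((\<exists>P\<in>toric_variety \<Sigma>. \<exists>c. c \<noteq> 0 \<and> (\<forall>i<k. z i = c * \<phi> P i)) \<longleftrightarrow>
            (\<forall>p\<in>F. peval p z = 0))" and
    loc: "\<forall>\<sigma>\<in>\<Sigma>. \<forall>P\<in>U \<Sigma> \<sigma>. \<forall>m\<in>dual_semigroup \<sigma>. \<exists>d p q.
        homogeneous k d p \<and> homogeneous k d q \<and> peval q (\<phi> P) \<noteq> 0 \<and>
        (\<forall>Q\<in>toric_variety \<Sigma>. peval q (\<phi> Q) \<noteq> 0 \<longrightarrow>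
           Q \<in> U \<Sigma> \<sigma> \<and> chi \<sigma> m Q = peval p (\<phi> Q) / peval q (\<phi> Q))"
    using assms(2) unfolding projective_variety_def by (elim exE conjE) (rule that)
  note closed = cl[rule_format]
  \<comment> \<open>The one-parameter subgroup of \<open>v\<close> at 1/(s+1): a sequence tending to
    0 inside the torus.\<close>
  define x where "x s = (\<lambda>m. (1 / (of_nat s + 1) :: complex) powi pair m v)" for s :: nat
  define P where "P s = glue \<Sigma> `` {({0}, x s)}" for s
  have dual0: "dual_semigroup {0} = (UNIV :: 'n lattice set)"
    by (auto simp: dual_semigroup_def)
  have ne: "1 / (of_nat s + 1 :: complex) \<noteq> 0" for s
    using of_nat_neq_0[of s, where 'a = complex] by (simp add: add.commute)
  have xadd: "x s (m + m') = x s m * x s m'" for s m m'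
    unfolding x_def pair_add_left using ne by (intro power_int_add) blast
  have xaff: "x s \<in> aff {0}" for s
    by (simp add: aff_def dual0 xadd) (simp add: x_def)
  have z\<Sigma>: "{0} \<in> \<Sigma>" by (rule zero_cone_in_fan[OF fan])
  have PY: "P s \<in> toric_variety \<Sigma>" for s
    unfolding toric_variety_def P_def by (rule quotientI) (use z\<Sigma> xaff in auto)
  have chiP: "chi \<sigma> m (P s) = x s m" if s1: "\<sigma> \<in> \<Sigma>" and s2: "m \<in> dual_semigroup \<sigma>" and s3: "P s \<in> U \<Sigma> \<sigma>" for \<sigma> m s
  proof -
    have "0 \<in> \<sigma>" using pointed_cone_facts fan_pointed_cone[OF fan s1] by blast
    then have eq: "{0} \<inter> \<sigma> = {0}" by blast
    have "(\<sigma>, y) \<in> P s \<Longrightarrow> y = restr \<sigma> (x s)" for y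
      unfolding P_def glue_def using eq by (auto simp: restr_def dual0)
    moreover obtain y where "(\<sigma>, y) \<in> P s" using s3 unfolding U_def by blast
    ultimately have "(THE y. (\<sigma>, y) \<in> P s) = restr \<sigma> (x s)" by (metis (mono_tags, lifting) the_equality)
    then show ?thesis unfolding chi_def using s2 by (simp add: restr_def)
  qed
  define N where "N s = (\<Sum>i<k. norm (\<phi> (P s) i))" for s
  have N: "N s > 0" for s
  proof -
    obtain i where "i < k" "\<phi> (P s) i \<noteq> 0" using nz PY by blast
    then show ?thesis unfolding N_def by (intro sum_pos2[of _ i]) auto
  qed
  \<comment> \<open>Normalised coordinates stay bounded, and the limit again has norm sum 1, so it
    is a point of projective space.\<close>
  define z where "z s i = complex_of_real (1 / N s) * \<phi> (P s) i" for s i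
  have zsum: "(\<Sum>i<k. norm (z s i)) = 1" for s
  proof -
    have "norm (z s i) = (1 / N s) * norm (\<phi> (P s) i)" for i
      using N[of s] by (simp add: z_def norm_mult norm_divide del: of_real_divide)
    then have "(\<Sum>i<k. norm (z s i)) = (1 / N s) * N s"
      by (simp only: N_def[of s] sum_distrib_left)
    then show ?thesis using N[of s] by simp
  qed
  have "bounded (range (\<lambda>s. z s i))" if "i < k" for i
  proof -
    have "norm (z s i) \<le> 1" for s
      using zsum[of s] member_le_sum[of i "{..<k}" "\<lambda>i. norm (z s i)"] that by auto
    then show ?thesis unfolding bounded_iff by blast
  qed
  then obtain r l where r: "strict_mono r" and l: "\<And>i. i < k \<Longrightarrow> (\<lambda>s. z (r s) i) \<longlonglongrightarrow> l i"
    using coordinatewise_convergent_subsequence[of k z] by blast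
  have "(\<lambda>s. \<Sum>i<k. norm (z (r s) i)) \<longlonglongrightarrow> (\<Sum>i<k. norm (l i))"
    by (intro tendsto_intros l) auto
  then have l1: "(\<Sum>i<k. norm (l i)) = 1" unfolding zsum by (simp only: LIMSEQ_const_iff)
  have nonzero: "\<exists>i<k. f i \<noteq> 0" if "(\<Sum>i<k. norm (f i)) = 1" for f :: "nat \<Rightarrow> complex"
  proof (rule ccontr)
    assume "\<not> ?thesis"
    then have "(\<Sum>i<k. norm (f i)) = 0" by (intro sum.neutral) auto
    then show False using that by simp
  qed
  have lnz: "\<exists>i<k. l i \<noteq> 0" by (rule nonzero[OF l1])
  have "peval p l = 0" if pF: "p \<in> F" for p
  proof -
    obtain d where d: "homogeneous k d p" using F pF by blast
    have "peval p (z (r s)) = 0" for s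
    proof -
      have "\<exists>i<k. z (r s) i \<noteq> 0" by (rule nonzero[OF zsum])
      note A = closed[OF this, THEN iffD1]
      have "complex_of_real (1 / N (r s)) \<noteq> 0" using N[of "r s"] by simp
      then have "\<exists>P\<in>toric_variety \<Sigma>. \<exists>c. c \<noteq> 0 \<and> (\<forall>i<k. z (r s) i = c * \<phi> P i)"
        using z_def by (intro bexI[OF _ PY[of "r s"]] exI[of _ "complex_of_real (1 / N (r s))"] conjI) auto
      from A[OF this] show ?thesis using pF by blast
    qed
    moreover have "(\<lambda>s. peval p (z (r s))) \<longlonglongrightarrow> peval p l"
      by (rule tendsto_peval_homogeneous[OF d l])
    ultimately show ?thesis by (simp add: LIMSEQ_const_iff)
  qed
  then obtain Q c where Q: "Q \<in> toric_variety \<Sigma>" "c \<noteq> 0" "\<And>i. i < k \<Longrightarrow> l i = c * \<phi> Q i"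
    using closed[OF lnz, THEN iffD2] by blast
  then obtain \<sigma> y where \<sigma>: "\<sigma> \<in> \<Sigma>" "y \<in> aff \<sigma>" "Q = glue \<Sigma> `` {(\<sigma>, y)}"
    unfolding toric_variety_def by (auto elim!: quotientE)
  have "((\<sigma>, y), (\<sigma>, y)) \<in> glue \<Sigma>"
    unfolding glue_def using \<sigma> restr_aff[OF \<sigma>(2)] by auto
  then have QU: "Q \<in> U \<Sigma> \<sigma>" using Q(1) \<sigma> unfolding U_def by blast
  \<comment> \<open>Near the limit point the character of \<open>m\<close> is a quotient of
    homogeneous polynomials with nonzero denominator, so \<open>x (r s) m\<close> converges. With a
    negative pairing it would be unbounded.\<close>
  have "0 \<le> rvec m \<bullet> rvec v" if m: "m \<in> dual_semigroup \<sigma>" for m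
  proof (rule ccontr)
    assume neg: "\<not> 0 \<le> rvec m \<bullet> rvec v"
    then have pneg: "pair m v < 0" by (simp add: inner_rvec)
    obtain d p q where pq: "homogeneous k d p" "homogeneous k d q" "peval q (\<phi> Q) \<noteq> 0"
      "\<forall>Q'\<in>toric_variety \<Sigma>. peval q (\<phi> Q') \<noteq> 0 \<longrightarrow>
           Q' \<in> U \<Sigma> \<sigma> \<and> chi \<sigma> m Q' = peval p (\<phi> Q') / peval q (\<phi> Q')"
      using loc[rule_format, OF \<sigma>(1) QU m] by (elim exE conjE) (rule that)
    have "peval q l = c ^ d * peval q (\<phi> Q)"
      using peval_homogeneous_cong[OF pq(2), of l "\<lambda>i. c * \<phi> Q i"] Q(3)
        peval_homogeneous_scale[OF pq(2)] by simp
    then have ql: "peval q l \<noteq> 0" using Q(2) pq(3) by simp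
    have tq: "(\<lambda>s. peval q (z (r s))) \<longlonglongrightarrow> peval q l"
      and tp: "(\<lambda>s. peval p (z (r s))) \<longlonglongrightarrow> peval p l"
      by (rule tendsto_peval_homogeneous[OF pq(2) l] tendsto_peval_homogeneous[OF pq(1) l]; assumption)+
    have sc: "peval q (z s) = complex_of_real (1 / N s) ^ d * peval q (\<phi> (P s))"
      "peval p (z s) = complex_of_real (1 / N s) ^ d * peval p (\<phi> (P s))" for s
      unfolding z_def by (rule peval_homogeneous_scale[OF pq(2)] peval_homogeneous_scale[OF pq(1)])+
    have "\<forall>\<^sub>F s in sequentially. peval p (z (r s)) / peval q (z (r s)) = x (r s) m"
      using tendsto_imp_eventually_ne[OF tq ql]
    proof eventually_elim
      case (elim s)
      then have "peval q (\<phi> (P (r s))) \<noteq> 0" using sc by auto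
      then have "x (r s) m = peval p (\<phi> (P (r s))) / peval q (\<phi> (P (r s)))"
        using pq(4)[rule_format, OF PY, of "r s"] chiP[OF \<sigma>(1) m, of "r s"] by simp
      then show ?case using N[of "r s"] by (simp add: sc)
    qed
    then have "(\<lambda>s. x (r s) m) \<longlonglongrightarrow> peval p l / peval q l"
      using tendsto_divide[OF tp tq ql] by (rule Lim_transform_eventually[rotated])
    then have "Bseq (\<lambda>s. x (r s) m)" using convergent_imp_Bseq convergentI by blast
    then obtain K where K: "\<And>s. norm (x (r s) m) \<le> K" unfolding Bseq_def by blast
    have xn: "real s + 1 \<le> norm (x s m)" for s
    proof -
      define j where "j = nat (- pair m v)"
      have j: "pair m v = - int j" "j > 0" using pneg by (auto simp: j_def)
      have "norm (of_nat s + 1 :: complex) = real s + 1"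
        by (metis norm_of_nat of_nat_1 of_nat_add)
      then have "norm (x s m) = (real s + 1) ^ j"
        unfolding x_def j(1) by (simp add: power_int_minus norm_inverse norm_power norm_divide power_divide)
      also have "\<dots> \<ge> real s + 1" using j(2) by (intro self_le_power) auto
      finally show ?thesis .
    qed
    obtain s :: nat where "K < real s" using reals_Archimedean2 by blast
    moreover have "s \<le> r s" by (rule seq_suble[OF r])
    ultimately show False using xn[of "r s"] K[of s] by linarith
  qed
  then have "rvec v \<in> \<sigma>" using pointed_cone_bidual fan_pointed_cone[OF fan \<sigma>(1)] by blast
  then show ?thesis using \<sigma>(1) by blast
qed

section \<open>Lattice bases and their duals\<close>

definition dual_basis :: "('n \<Rightarrow> 'n::finite lattice) \<Rightarrow> 'n \<Rightarrow> 'n lattice" where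
  "dual_basis m = (SOME r. \<forall>i j. pair (m i) (r j) = (if i = j then 1 else 0))"

lemma lattice_basis_unique:
  assumes "lattice_basis m" "(\<Sum>j\<in>UNIV. c j *s m j) = (\<Sum>j\<in>UNIV. d j *s m j)"
  shows "c = d"
  using assms unfolding lattice_basis_def by metis

lemma sum_axis: "v = (\<Sum>i\<in>UNIV. v $ i *s axis i (1 :: int))"
  by (simp add: vec_eq_iff axis_def if_distrib[of "\<lambda>x. _ * x"] cong: if_cong)

lemma dual_basis_pair:
  assumes "lattice_basis m"
  shows "pair (m i) (dual_basis m j) = (if i = j then 1 else 0)"
proof -
  obtain C where C: "\<And>v. v = (\<Sum>j\<in>UNIV. C v j *s m j)"
    using assms unfolding lattice_basis_def by metis
  define r where "r j = (\<chi> i. C (axis i 1) j)" for j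
  have ex: "v = (\<Sum>j\<in>UNIV. pair v (r j) *s m j)" for v
  proof -
    have "(\<Sum>j\<in>UNIV. C (axis i 1) j *s m j) = axis i 1" for i by (rule C[symmetric])
    then have "v = (\<Sum>i\<in>UNIV. v $ i *s (\<Sum>j\<in>UNIV. C (axis i 1) j *s m j))"
      using sum_axis[of v] by simp
    also have "\<dots> = (\<Sum>j\<in>UNIV. (\<Sum>i\<in>UNIV. v $ i * C (axis i 1) j) *s m j)"
      by (subst vec_eq_iff, simp add: sum_distrib_left sum_distrib_right mult.assoc, subst sum.swap, simp)
    finally show ?thesis by (simp add: pair_def r_def)
  qed
  have "pair (m i) (r j) = (if i = j then 1 else 0)" for i j
  proof -
    have "(\<Sum>j\<in>UNIV. (if i = j then 1 else 0) *s m j) = m i"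
      by (simp add: if_distrib[of "\<lambda>x. x *s _"] cong: if_cong)
    then have "(\<Sum>j\<in>UNIV. pair (m i) (r j) *s m j) = (\<Sum>j\<in>UNIV. (if i = j then 1 else 0) *s m j)"
      using ex[of "m i"] by simp
    from lattice_basis_unique[OF assms this] show ?thesis by (rule fun_cong)
  qed
  then have "\<forall>i j. pair (m i) (r j) = (if i = j then 1 else 0)" by blast
  from someI[of "\<lambda>r. \<forall>i j. pair (m i) (r j) = (if i = j then 1 else 0)", OF this]
  show ?thesis unfolding dual_basis_def by blast
qed

lemma lattice_basis_expand:
  assumes "lattice_basis m"
  shows "v = (\<Sum>j\<in>UNIV. pair v (dual_basis m j) *s m j)"
proof -
  obtain c where c: "v = (\<Sum>j\<in>UNIV. c j *s m j)"
    using assms unfolding lattice_basis_def by metis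
  have "pair v (dual_basis m j) = c j" for j
    by (subst c) (simp add: pair_simps dual_basis_pair[OF assms] if_distrib[of "\<lambda>x. _ * x"] cong: if_cong)
  then show ?thesis using c by simp
qed

lemma dual_basis_expand:
  assumes "lattice_basis m"
  shows "w = (\<Sum>j\<in>UNIV. pair (m j) w *s dual_basis m j)"
proof -
  let ?d = "w - (\<Sum>j\<in>UNIV. pair (m j) w *s dual_basis m j)"
  have "pair (m i) (\<Sum>j\<in>UNIV. pair (m j) w *s dual_basis m j) = pair (m i) w" for i
    by (simp add: pair_simps dual_basis_pair[OF assms] if_distrib[of "\<lambda>x. _ * x"] cong: if_cong)
  then have 0: "pair (m i) ?d = 0" for i
    by (simp add: diff_conv_add_uminus pair_simps del: add_uminus_conv_diff)
  have "pair v ?d = 0" for v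
    by (subst lattice_basis_expand[OF assms, of v]) (simp add: pair_simps 0)
  then have "?d = 0" using pair_self_le_0[of ?d] by simp
  then show ?thesis by simp
qed

lemma pair_dual_basis:
  assumes "lattice_basis m"
  shows "pair a w = (\<Sum>j\<in>UNIV. pair a (dual_basis m j) * pair (m j) w)"
  by (subst lattice_basis_expand[OF assms, of a]) (simp add: pair_simps)

lemma primitive_dual_basis:
  assumes "lattice_basis m"
  shows "primitive (dual_basis m j)"
  unfolding primitive_def
proof (intro allI impI)
  fix k w assume "dual_basis m j = k *s w"
  then have "pair (m j) (k *s w) = 1" using dual_basis_pair[OF assms, of j j] by simp
  then have "k * pair (m j) w = 1" by (simp add: pair_simps)
  then show "\<bar>k\<bar> = 1" by (metis abs_zmult_eq_1 abs_one)
qed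

lemma inj_dual_basis:
  assumes "lattice_basis m"
  shows "inj (dual_basis m)"
  by (rule injI) (metis dual_basis_pair[OF assms] zero_neq_one)

lemma lattice_basis_rvec_span:
  assumes "lattice_basis m"
  shows "rvec v = (\<Sum>j\<in>UNIV. of_int (pair v (dual_basis m j)) *\<^sub>R rvec (m j))"
  by (subst lattice_basis_expand[OF assms, of v]) (simp add: rvec_sum rvec_scale)

lemma real_dual_basis_expand:
  fixes u :: "real ^ 'n::finite"
  assumes "lattice_basis m"
  shows "u = (\<Sum>j\<in>UNIV. (rvec (m j) \<bullet> u) *\<^sub>R rvec (dual_basis m j))"
proof -
  let ?d = "u - (\<Sum>j\<in>UNIV. (rvec (m j) \<bullet> u) *\<^sub>R rvec (dual_basis m j))"
  have 0: "rvec (m i) \<bullet> ?d = 0" for i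
    by (simp add: inner_diff_right inner_sum_right inner_rvec dual_basis_pair[OF assms]
        if_distrib[of "\<lambda>x. _ * real_of_int x"] cong: if_cong)
  have "rvec v \<bullet> ?d = 0" for v
    by (subst lattice_basis_rvec_span[OF assms, of v]) (simp only: inner_sum_left inner_scaleR_left 0 sum.neutral_const mult_zero_right)
  moreover have "rvec (axis i 1) = axis i 1" for i :: 'n
    by (simp add: rvec_def axis_def vec_eq_iff)
  ultimately have "axis i 1 \<bullet> ?d = 0" for i by metis
  then have "?d $ i = 0" for i by (simp add: inner_axis')
  then have "?d = 0" by (simp add: vec_eq_iff)
  then show ?thesis by simp
qed

lemma interior_finite_Union_closed_empty:
  assumes "finite B" "\<And>b. b \<in> B \<Longrightarrow> closed b" "\<And>b. b \<in> B \<Longrightarrow> interior b = {}"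
  shows "interior (\<Union>B) = {}"
  using assms
proof (induction B rule: finite_induct)
  case (insert b B)
  then show ?case using interior_closed_Un_empty_interior[of b "\<Union>B"] by simp
qed simp

section \<open>Dual semigroups and their irreducible elements\<close>

lemma dual_semigroup_hull:
  "m \<in> dual_semigroup (convex_cone hull (rvec ` S)) \<longleftrightarrow> (\<forall>s\<in>S. 0 \<le> pair m s)"
proof
  assume "m \<in> dual_semigroup (convex_cone hull (rvec ` S))"
  then have "0 \<le> rvec m \<bullet> rvec s" if "s \<in> S" for s
    using that by (auto simp: dual_semigroup_def hull_inc)
  then show "\<forall>s\<in>S. 0 \<le> pair m s" by (simp add: inner_rvec)
next
  assume "\<forall>s\<in>S. 0 \<le> pair m s"
  then show "m \<in> dual_semigroup (convex_cone hull (rvec ` S))"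
    unfolding dual_semigroup_def
    by (auto simp: inner_rvec intro: convex_cone_hull_inner_nonneg[of "rvec ` S" "rvec m"])
qed

lemma dual_semigroup_add:
  "a \<in> dual_semigroup \<sigma> \<Longrightarrow> b \<in> dual_semigroup \<sigma> \<Longrightarrow> a + b \<in> dual_semigroup \<sigma>"
  by (auto simp: dual_semigroup_def rvec_add inner_add_left)

lemma dual_semigroup_zero: "0 \<in> dual_semigroup \<sigma>"
  by (simp add: dual_semigroup_def)

lemma dual_semigroup_scale: "a \<in> dual_semigroup \<sigma> \<Longrightarrow> int k *s a \<in> dual_semigroup \<sigma>"
  by (auto simp: dual_semigroup_def rvec_scale)

lemma dual_semigroup_sum: "(\<And>i. i \<in> I \<Longrightarrow> f i \<in> dual_semigroup \<sigma>) \<Longrightarrow> (\<Sum>i\<in>I. f i) \<in> dual_semigroup \<sigma>"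
  by (induction I rule: infinite_finite_induct) (auto intro: dual_semigroup_add dual_semigroup_zero)

text \<open>Otherwise the cone would lie in the hyperplane orthogonal to \<open>m\<close>, which has
  empty interior.\<close>

lemma fulldim_dual_trivial:
  assumes "interior \<sigma> \<noteq> {}" "m \<in> dual_semigroup \<sigma>" "- m \<in> dual_semigroup \<sigma>"
  shows "m = 0"
proof (rule ccontr)
  assume "m \<noteq> 0"
  then have "interior {x. rvec m \<bullet> x = 0} = {}" by (simp add: interior_hyperplane)
  moreover have "\<sigma> \<subseteq> {x. rvec m \<bullet> x = 0}"
  proof
    fix x assume "x \<in> \<sigma>"
    then have "0 \<le> rvec m \<bullet> x" "0 \<le> rvec (- m) \<bullet> x" using assms(2,3) unfolding dual_semigroup_def by blast+
    then show "x \<in> {x. rvec m \<bullet> x = 0}" by (simp add: rvec_minus)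
  qed
  ultimately show False using assms(1) interior_mono by blast
qed

text \<open>The tangent space at the torus fixed point of a full-dimensional cone has the dual basis of the
  irreducible elements of the dual semigroup.\<close>

lemma few_irreducibles:
  fixes \<sigma> :: "(real ^ 'n::finite) set"
  assumes smooth: "\<forall>x\<in>aff \<sigma>. \<exists>B :: 'n \<Rightarrow> 'n lattice \<Rightarrow> complex.
     (\<forall>i. B i \<in> tangent_space \<sigma> x) \<and>
     (\<forall>d\<in>tangent_space \<sigma> x. \<exists>!c :: 'n \<Rightarrow> complex. d = (\<lambda>m. \<Sum>i\<in>UNIV. c i * B i m))"
    and int: "interior \<sigma> \<noteq> {}"
  defines "H \<equiv> {h \<in> dual_semigroup \<sigma>. h \<noteq> 0 \<and>
    \<not> (\<exists>a\<in>dual_semigroup \<sigma>. \<exists>b\<in>dual_semigroup \<sigma>. a \<noteq> 0 \<and> b \<noteq> 0 \<and> h = a + b)}"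
  shows "finite H \<and> card H \<le> CARD('n)"
proof -
  \<comment> \<open>The torus fixed point. It is multiplicative because two elements of the dual
    semigroup cancel only if both are 0.\<close>
  define x0 :: "'n lattice \<Rightarrow> complex" where "x0 m = (if m = 0 then 1 else 0)" for m
  have no_cancel: "a = 0 \<and> b = 0" if "a \<in> dual_semigroup \<sigma>" "b \<in> dual_semigroup \<sigma>" "a + b = 0" for a b
  proof -
    have "b = - a" using that(3) by (simp add: eq_neg_iff_add_eq_0 add.commute)
    then show ?thesis using fulldim_dual_trivial[OF int] that by auto
  qed
  have x0: "x0 \<in> aff \<sigma>" unfolding aff_def
  proof (intro CollectI conjI ballI allI impI)
    fix a b assume ab: "a \<in> dual_semigroup \<sigma>" "b \<in> dual_semigroup \<sigma>"
    show "x0 (a + b) = x0 a * x0 b"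
      unfolding x0_def using no_cancel[OF ab] by (cases "a = 0") auto
  next
    fix m assume "m \<notin> dual_semigroup \<sigma>"
    then show "x0 m = 0" unfolding x0_def using dual_semigroup_zero by metis
  qed (simp add: x0_def)
  obtain B :: "'n \<Rightarrow> 'n lattice \<Rightarrow> complex" where
    B: "\<forall>d\<in>tangent_space \<sigma> x0. \<exists>!c :: 'n \<Rightarrow> complex. d = (\<lambda>m. \<Sum>i\<in>UNIV. c i * B i m)"
    using bspec[OF smooth x0] by (elim exE conjE) (rule that)
  \<comment> \<open>At \<open>x0\<close> both sides of the Leibniz rule vanish on two nonzero
    elements, since \<open>h\<close> is not such a sum; only the cases with a zero summand
    remain.\<close>
  have "(\<lambda>m. if m = h then 1 else 0) \<in> tangent_space \<sigma> x0" if h: "h \<in> H" for h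
  proof -
    have hD: "h \<in> dual_semigroup \<sigma>" "h \<noteq> 0" using h by (simp_all add: H_def)
    have ne: "a + b \<noteq> h" if "a \<in> dual_semigroup \<sigma>" "b \<in> dual_semigroup \<sigma>" "a \<noteq> 0" "b \<noteq> 0" for a b
      using h that unfolding H_def by blast
    show ?thesis
      unfolding tangent_space_def
    proof (intro CollectI conjI ballI allI impI)
      fix a b assume ab: "a \<in> dual_semigroup \<sigma>" "b \<in> dual_semigroup \<sigma>"
      show "(if a + b = h then 1 else 0) = x0 a * (if b = h then 1 else 0) + x0 b * (if a = h then 1 else 0)"
        unfolding x0_def using ne[OF ab] hD(2) by auto
    qed (use hD in auto)
  qed
  then have "\<forall>h\<in>H. \<exists>c. (\<lambda>m. if m = h then 1 else 0) = (\<lambda>m. \<Sum>i\<in>UNIV. c i * B i m)"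
    using B by blast
  then obtain c where c: "\<And>h. h \<in> H \<Longrightarrow> (\<lambda>m. if m = h then 1 else 0) = (\<lambda>m. \<Sum>i\<in>UNIV. c h i * B i m)"
    by metis
  define w :: "_ \<Rightarrow> complex ^ 'n" where "w h = (\<chi> i. c h i)" for h
  have inj: "inj_on w H"
  proof (rule inj_onI)
    fix h h' assume h: "h \<in> H" "h' \<in> H" "w h = w h'"
    then have "c h = c h'" by (simp add: w_def vec_eq_iff fun_eq_iff)
    then have "(\<lambda>m. if m = h then 1 else 0) = (\<lambda>m. if m = h' then 1 else (0::complex))"
      using c h(1,2) by metis
    from fun_cong[OF this, of h] show "h = h'" by (simp split: if_splits)
  qed
  \<comment> \<open>These derivations are indicator functions of distinct points, hence independent;
    so are their coordinate vectors with respect to \<open>B\<close>, which live in dimension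
    n.\<close>
  have le: "card H' \<le> CARD('n)" if H': "finite H'" "H' \<subseteq> H" for H'
  proof -
    have inj': "inj_on w H'" using inj H' inj_on_subset by blast
    have "vec.independent (w ` H')"
    proof (rule vec.independent_if_scalars_zero)
      show "finite (w ` H')" using H' by simp
      fix f x assume f: "(\<Sum>x\<in>w ` H'. f x *s x) = 0" and "x \<in> w ` H'"
      then obtain h0 where h0: "x = w h0" "h0 \<in> H'" by blast
      have f': "(\<Sum>h\<in>H'. f (w h) *s w h) = 0" using f by (simp add: sum.reindex[OF inj'])
      have comp: "(\<Sum>h\<in>H'. f (w h) * c h i) = 0" for i
        using arg_cong[OF f', of "\<lambda>v. v $ i"] by (simp add: w_def)
      have cc: "(\<Sum>i\<in>UNIV. c h i * B i h0) = (if h0 = h then 1 else 0)" if "h \<in> H'" for h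
        using fun_cong[OF c[of h], of h0] H'(2) that by (simp add: subset_iff)
      have "f (w h0) = (\<Sum>h\<in>H'. f (w h) * (if h0 = h then 1 else 0))"
        using H'(1) h0(2) by (simp add: if_distrib[of "\<lambda>x. _ * x"] cong: if_cong)
      also have "\<dots> = (\<Sum>h\<in>H'. f (w h) * (\<Sum>i\<in>UNIV. c h i * B i h0))"
        by (intro sum.cong refl) (simp add: cc)
      also have "\<dots> = (\<Sum>i\<in>UNIV. (\<Sum>h\<in>H'. f (w h) * c h i) * B i h0)"
        unfolding sum_distrib_left sum_distrib_right
        by (subst sum.swap) (simp add: mult.assoc)
      finally show "f x = 0" using comp h0 by simp
    qed
    then have "card (w ` H') \<le> CARD('n)"
      using vec.independent_bound_general[of "w ` H'"] dim_subset_UNIV_cart_gen[of "w ` H'"]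
      by simp
    then show ?thesis by (simp add: card_image[OF inj'])
  qed
  have "finite H"
  proof (rule ccontr)
    assume "infinite H"
    then obtain H' where "finite H'" "card H' = Suc (CARD('n))" "H' \<subseteq> H"
      using infinite_arbitrarily_large by blast
    then show False using le[of H'] by simp
  qed
  then show ?thesis using le by blast
qed

lemma rvec_diff: "rvec (a - b) = rvec a - rvec b"
  by (simp add: rvec_def vec_eq_iff)

text \<open>\<open>x + y\<close> is the midpoint of \<open>2 x\<close> and \<open>2 y\<close>, and
  \<open>2 x\<close> is the midpoint of \<open>x\<close> and \<open>3 x\<close>. The face property
  is used for both segments, apart from the degenerate cases.\<close>

lemma face_of_cone_summand:
  fixes x :: "'a::real_vector"
  assumes F: "F face_of \<sigma>" and cone: "\<And>x c. x \<in> \<sigma> \<Longrightarrow> 0 \<le> c \<Longrightarrow> c *\<^sub>R x \<in> \<sigma>"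
    and xy: "x \<in> \<sigma>" "y \<in> \<sigma>" "x + y \<in> F"
  shows "x \<in> F"
proof -
  have face: "a \<in> F" if "a \<in> \<sigma>" "b \<in> \<sigma>" "z \<in> F" "z \<in> open_segment a b" for a b z
    using F that unfolding face_of_def by blast
  have "2 *\<^sub>R x \<in> F"
  proof (cases "x = y")
    case True
    then show ?thesis using xy(3) by (simp add: scaleR_2)
  next
    case False
    have "x + y = (1 - 1/2) *\<^sub>R (2 *\<^sub>R x) + (1/2) *\<^sub>R (2 *\<^sub>R y)" by simp
    then have "x + y \<in> open_segment (2 *\<^sub>R x) (2 *\<^sub>R y)"
      unfolding in_segment using False by (intro conjI exI[of _ "1/2"]) auto
    then show ?thesis using face[of "2 *\<^sub>R x" "2 *\<^sub>R y"] xy cone by simp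
  qed
  show ?thesis
  proof (cases "x = 0")
    case True
    then show ?thesis using \<open>2 *\<^sub>R x \<in> F\<close> by simp
  next
    case False
    have "2 *\<^sub>R x = (1 - 1/2) *\<^sub>R x + (1/2) *\<^sub>R (3 *\<^sub>R x)" by (simp flip: scaleR_left_distrib)
    moreover have "x \<noteq> 3 *\<^sub>R x" using scaleR_cancel_right[of 1 x 3] False by simp
    ultimately have "2 *\<^sub>R x \<in> open_segment x (3 *\<^sub>R x)"
      unfolding in_segment by (intro conjI exI[of _ "1/2"]) auto
    then show ?thesis using face[of x "3 *\<^sub>R x"] xy(1) cone \<open>2 *\<^sub>R x \<in> F\<close> by simp
  qed
qed

lemma convex_cone_hull_singleton: "convex_cone hull {a} = {c *\<^sub>R a | c. 0 \<le> c}"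
  by (subst convex_cone_hull_convex_hull_nonempty) auto

section \<open>Smooth complete fans and their charts\<close>

locale smooth_complete_fan =
  fixes \<Sigma> :: "(real ^ 'n::finite) set set"
  assumes fan: "fan \<Sigma>" and smooth: "smooth_variety \<Sigma>" and complete: "\<And>v. \<exists>\<sigma>\<in>\<Sigma>. rvec v \<in> \<sigma>"
begin

abbreviation "LieAut \<equiv> lie_algebra \<Sigma> (Aut0 \<Sigma>)"
abbreviation "Torus \<equiv> U \<Sigma> {0}"
abbreviation "DM \<equiv> DeltaM \<Sigma>"
abbreviation "Ch \<equiv> charts \<Sigma>"
abbreviation "Dom \<equiv> dom_chart \<Sigma>"
abbreviation "TV \<equiv> toric_variety \<Sigma>"
abbreviation "Aff \<equiv> U \<Sigma>"
abbreviation "Jac \<equiv> jac \<Sigma>"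
abbreviation "Act \<equiv> act \<Sigma>"
abbreviation "LieAct \<equiv> lie_act \<Sigma>"
abbreviation "TopY \<equiv> top_Y \<Sigma>"
abbreviation "AutY \<equiv> Aut \<Sigma>"
abbreviation "Rays \<equiv> rays \<Sigma>"
abbreviation "Glue \<equiv> glue \<Sigma>"
abbreviation "Roots \<equiv> roots \<Sigma>"
abbreviation "isRoot \<equiv> is_root_ray \<Sigma>"

lemma finite_fan: "finite \<Sigma>"
  using fan unfolding fan_def by blast

lemma pointed: "\<sigma> \<in> \<Sigma> \<Longrightarrow> pointed_cone \<sigma>"
  by (rule fan_pointed_cone[OF fan])

lemma fan_Int_face: "\<sigma> \<in> \<Sigma> \<Longrightarrow> \<tau> \<in> \<Sigma> \<Longrightarrow> (\<sigma> \<inter> \<tau>) face_of \<sigma>"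
  using fan unfolding fan_def by blast

lemma face_in_fan: "\<sigma> \<in> \<Sigma> \<Longrightarrow> \<tau> face_of \<sigma> \<Longrightarrow> \<tau> \<noteq> {} \<Longrightarrow> \<tau> \<in> \<Sigma>"
  using fan unfolding fan_def by blast

lemma fan_Int:
  assumes "\<sigma> \<in> \<Sigma>" "\<tau> \<in> \<Sigma>"
  shows "\<sigma> \<inter> \<tau> \<in> \<Sigma>"
proof (rule face_in_fan[OF assms(1) fan_Int_face[OF assms]])
  show "\<sigma> \<inter> \<tau> \<noteq> {}" using pointed_cone_facts(3) pointed assms by blast
qed

lemma closed_cone: "\<sigma> \<in> \<Sigma> \<Longrightarrow> closed \<sigma>"
  by (rule pointed_cone_facts(1)[OF pointed])

text \<open>Completeness is assumed at lattice points only. The union of the cones is closed and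
  contains the scaled integer approximations of \<open>u\<close>.\<close>

lemma covers: "\<exists>\<sigma>\<in>\<Sigma>. u \<in> \<sigma>"
proof -
  have cl: "closed (\<Union>\<Sigma>)"
    by (rule closed_Union[OF finite_fan]) (blast intro: closed_cone)
  have mem: "(1 / real n) *\<^sub>R rvec (\<chi> i. \<lfloor>real n * u $ i\<rfloor>) \<in> \<Union>\<Sigma>" for n
  proof -
    obtain \<sigma> where \<sigma>: "\<sigma> \<in> \<Sigma>" "rvec (\<chi> i. \<lfloor>real n * u $ i\<rfloor>) \<in> \<sigma>" using complete by blast
    have "(1 / real n) *\<^sub>R rvec (\<chi> i. \<lfloor>real n * u $ i\<rfloor>) \<in> \<sigma>"
      by (rule pointed_cone_facts(5)[OF pointed[OF \<sigma>(1)] \<sigma>(2)]) simp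
    then show ?thesis using \<sigma>(1) by blast
  qed
  have "u \<in> \<Union>\<Sigma>" by (rule closed_sequentially[OF cl mem tendsto_lattice_approx])
  then show ?thesis by (simp add: Union_iff)
qed

text \<open>The complement of the full-dimensional cones is open and covered by finitely many closed
  cones with empty interior, so it is empty.\<close>

lemma fulldim_covers: "\<exists>\<sigma>\<in>\<Sigma>. interior \<sigma> \<noteq> {} \<and> u \<in> \<sigma>"
proof (rule ccontr)
  define A where "A = {\<sigma> \<in> \<Sigma>. interior \<sigma> \<noteq> {}}"
  define B where "B = {\<sigma> \<in> \<Sigma>. interior \<sigma> = {}}"
  assume "\<not> ?thesis"
  then have u: "u \<in> - \<Union>A" unfolding A_def by blast
  have "open (- \<Union>A)"
    using finite_fan closed_cone unfolding A_def by (intro open_Compl closed_Union) auto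
  moreover have "- \<Union>A \<subseteq> \<Union>B" using covers unfolding A_def B_def by blast
  moreover have "interior (\<Union>B) = {}"
    using finite_fan closed_cone unfolding B_def by (intro interior_finite_Union_closed_empty) auto
  ultimately show False using u interior_maximal by blast
qed

text \<open>A relative interior point of \<open>\<tau>\<close> lies in some full-dimensional
  \<open>\<sigma>\<close>. The intersection is a face of \<open>\<tau>\<close> through that point,
  hence all of \<open>\<tau>\<close>.\<close>

lemma fulldim_above:
  assumes "\<tau> \<in> \<Sigma>"
  shows "\<exists>\<sigma>\<in>\<Sigma>. interior \<sigma> \<noteq> {} \<and> \<tau> \<subseteq> \<sigma>"
proof -
  note P = pointed_cone_facts[OF pointed[OF assms]]
  obtain u where u: "u \<in> rel_interior \<tau>" using P(2,3) rel_interior_eq_empty by blast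
  obtain \<sigma> where \<sigma>: "\<sigma> \<in> \<Sigma>" "interior \<sigma> \<noteq> {}" "u \<in> \<sigma>" using fulldim_covers by blast
  have "\<tau> \<inter> (\<tau> \<inter> \<sigma>) \<subseteq> \<tau> \<inter> \<sigma>" by blast
  have "\<tau> \<subseteq> \<tau> \<inter> \<sigma>"
    by (rule subset_of_face_of[OF fan_Int_face[OF assms \<sigma>(1)]])
      (use u \<sigma> rel_interior_subset in auto)
  then show ?thesis using \<sigma> by blast
qed

text \<open>The irreducible elements \<open>H\<close> generate the dual semigroup, by induction on
  the height \<open>pair m u\<close>; their differences generate M. As there are at most n of them
  and they span, they form a basis of M.\<close>

lemma fulldim_chart:
  assumes \<sigma>: "\<sigma> \<in> \<Sigma>" and int: "interior \<sigma> \<noteq> {}"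
  shows "\<exists>m. (\<sigma>, m) \<in> Ch"
proof -
  let ?D = "dual_semigroup \<sigma>"
  define H where "H = {h \<in> ?D. h \<noteq> 0 \<and> \<not> (\<exists>a\<in>?D. \<exists>b\<in>?D. a \<noteq> 0 \<and> b \<noteq> 0 \<and> h = a + b)}"
  have H: "finite H" "card H \<le> CARD('n)"
    using few_irreducibles[OF _ int] smooth \<sigma> unfolding smooth_variety_def H_def by blast+
  obtain S where S: "finite S" "\<sigma> = convex_cone hull (rvec ` S)"
    by (rule pointed_cone_obtain[OF pointed[OF \<sigma>]])
  have D: "m \<in> ?D \<longleftrightarrow> (\<forall>s\<in>S. 0 \<le> pair m s)" for m
    unfolding S(2) by (rule dual_semigroup_hull)
  define u where "u = \<Sum>S"
  have pos: "0 < pair m u" if "m \<in> ?D" "m \<noteq> 0" for m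
  proof (rule ccontr)
    assume "\<not> 0 < pair m u"
    then have "(\<Sum>s\<in>S. pair m s) \<le> 0" by (simp add: u_def pair_simps)
    then have "(\<Sum>s\<in>S. pair m s) = 0" using that(1) D by (intro antisym) (auto intro: sum_nonneg)
    then have "\<forall>s\<in>S. pair m s = 0" using that(1) D S(1) by (subst (asm) sum_nonneg_eq_0_iff) auto
    then have "- m \<in> ?D" unfolding D by (simp add: pair_simps)
    then show False using fulldim_dual_trivial[OF int] that by blast
  qed
  have gen: "\<exists>k. m = (\<Sum>h\<in>H. int (k h) *s h)" if "m \<in> ?D" for m
    using that
  proof (induction "nat (pair m u)" arbitrary: m rule: less_induct)
    case less
    consider "m = 0" | "m \<in> H" | a b where "a \<in> ?D" "b \<in> ?D" "a \<noteq> 0" "b \<noteq> 0" "m = a + b"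
      unfolding H_def using less.prems by blast
    then show ?case
    proof cases
      case 1
      then show ?thesis by (auto intro!: exI[of _ "\<lambda>_. 0"])
    next
      case 2
      then have "m = (\<Sum>h\<in>H. int (if h = m then 1 else 0) *s h)"
        using H(1) by (simp add: if_distrib[of int] if_distrib[of "\<lambda>x. x *s _"] cong: if_cong)
      then show ?thesis by (rule exI[of _ "\<lambda>h. if h = m then 1 else 0"])
    next
      case 3
      have "pair m u = pair a u + pair b u" using 3 by (simp add: pair_simps)
      then have lt: "nat (pair a u) < nat (pair m u)" "nat (pair b u) < nat (pair m u)"
        using pos[OF 3(1,3)] pos[OF 3(2,4)] by auto
      obtain k where k: "a = (\<Sum>h\<in>H. int (k h) *s h)" using less.hyps[OF lt(1) 3(1)] by (elim exE)
      obtain l where l: "b = (\<Sum>h\<in>H. int (l h) *s h)" using less.hyps[OF lt(2) 3(2)] by (elim exE)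
      from k l have "m = (\<Sum>h\<in>H. int (k h + l h) *s h)"
        using 3(5) by (simp add: vector_sadd_rdistrib sum.distrib)
      then show ?thesis by (rule exI[of _ "\<lambda>h. k h + l h"])
    qed
  qed
  \<comment> \<open>A large multiple of an interior point of the dual cone moves any
    \<open>v\<close> into the dual semigroup, so \<open>v\<close> is a difference of two of its
    elements.\<close>
  have genM: "\<exists>k :: 'n lattice \<Rightarrow> int. v = (\<Sum>h\<in>H. k h *s h)" for v
  proof -
    obtain m0 where m0: "\<forall>s\<in>S. s \<noteq> 0 \<longrightarrow> 0 < pair m0 s"
      using interior_dual_lattice_point S pointed[OF \<sigma>] by blast
    define N where "N = (\<Sum>s\<in>S. \<bar>pair v s\<bar>)"
    have "0 \<le> pair (int (nat N) *s m0) s \<and> 0 \<le> pair (v + int (nat N) *s m0) s" if s: "s \<in> S" for s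
    proof (cases "s = 0")
      case False
      have 1: "\<bar>pair v s\<bar> \<le> N" unfolding N_def by (rule member_le_sum) (use s S(1) in auto)
      then have "N * 1 \<le> N * pair m0 s"
        using m0 s False by (intro mult_left_mono) (auto simp: N_def sum_nonneg)
      then show ?thesis using 1 by (auto simp: pair_simps abs_le_iff)
    qed simp
    then have mem: "v + int (nat N) *s m0 \<in> ?D" "int (nat N) *s m0 \<in> ?D" unfolding D by blast+
    obtain k where k: "v + int (nat N) *s m0 = (\<Sum>h\<in>H. int (k h) *s h)" using gen[OF mem(1)] by (elim exE)
    obtain l where l: "int (nat N) *s m0 = (\<Sum>h\<in>H. int (l h) *s h)" using gen[OF mem(2)] by (elim exE)
    have "v = (v + int (nat N) *s m0) - int (nat N) *s m0" by simp
    also have "\<dots> = (\<Sum>h\<in>H. int (k h) *s h) - (\<Sum>h\<in>H. int (l h) *s h)"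
      by (rule arg_cong2[where f = "(-)", OF k l])
    also have "\<dots> = (\<Sum>h\<in>H. (int (k h) - int (l h)) *s h)"
      by (simp add: vec_eq_iff left_diff_distrib sum_subtractf)
    finally show ?thesis by (rule exI[of _ "\<lambda>h. int (k h) - int (l h)"])
  qed
  have inS: "rvec v \<in> span (rvec ` H)" for v
  proof -
    obtain k :: "'n lattice \<Rightarrow> int" where "v = (\<Sum>h\<in>H. k h *s h)" using genM by blast
    then have "rvec v = (\<Sum>h\<in>H. of_int (k h) *\<^sub>R rvec h)" by (simp add: rvec_sum rvec_scale)
    then show ?thesis by (simp add: span_sum span_scale span_base)
  qed
  have "axis i (1::real) = rvec (axis i 1)" for i :: 'n by (simp add: rvec_def axis_def vec_eq_iff)
  then have "(Basis :: (real ^ 'n) set) \<subseteq> span (rvec ` H)"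
    using inS by (auto simp: Basis_vec_def)
  then have sp: "(UNIV :: (real ^ 'n) set) \<subseteq> span (rvec ` H)"
    by (metis span_Basis span_mono span_span)
  have "CARD('n) \<le> card (rvec ` H)"
    using span_card_ge_dim[OF subset_UNIV sp] H(1) by simp
  then have cH: "card (rvec ` H) = CARD('n)" "card H = CARD('n)"
    using H card_image_le[OF H(1), of rvec] by linarith+
  have indep: "independent (rvec ` H)"
    by (rule card_le_dim_spanning[OF subset_UNIV sp]) (use H cH in auto)
  obtain f :: "'n \<Rightarrow> 'n lattice" where f: "bij_betw f UNIV H"
    using finite_same_card_bij[OF _ H(1)] cH by (metis finite_class.finite_UNIV)
  have f_reindex: "(\<Sum>h\<in>H. g h) = (\<Sum>j\<in>UNIV. g (f j))" for g :: "_ \<Rightarrow> 'n lattice"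
    using sum.reindex_bij_betw[OF f, of g] by simp
  have uniq: "c = d" if eq: "(\<Sum>j\<in>UNIV. c j *s f j) = (\<Sum>j\<in>UNIV. d j *s f j)" for c d :: "'n \<Rightarrow> int"
  proof (rule ext, rule ccontr)
    fix j assume ne: "c j \<noteq> d j"
    define g where "g x = real_of_int (c (inv f (inv rvec x)) - d (inv f (inv rvec x)))" for x
    have injf: "inj f" using f by (simp add: bij_betw_def)
    have gr: "g (rvec (f i)) = of_int (c i - d i)" for i
      by (simp add: g_def inv_f_f[OF inj_rvec] inv_f_f[OF injf])
    have "(\<Sum>x\<in>rvec ` H. g x *\<^sub>R x) = (\<Sum>h\<in>H. g (rvec h) *\<^sub>R rvec h)"
      by (subst sum.reindex) (auto simp: inj_on_def)
    also have "\<dots> = (\<Sum>i\<in>UNIV. of_int (c i - d i) *\<^sub>R rvec (f i))"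
      using sum.reindex_bij_betw[OF f, of "\<lambda>h. g (rvec h) *\<^sub>R rvec h"] by (simp only: gr)
    also have "\<dots> = rvec ((\<Sum>i\<in>UNIV. c i *s f i) - (\<Sum>i\<in>UNIV. d i *s f i))"
      by (simp add: rvec_sum rvec_scale rvec_diff scaleR_left_diff_distrib sum_subtractf)
    also have "\<dots> = 0" using eq by simp
    finally have "(\<Sum>x\<in>rvec ` H. g x *\<^sub>R x) = 0" .
    moreover have "rvec (f j) \<in> rvec ` H" using f by (auto simp: bij_betw_def)
    ultimately have "g (rvec (f j)) = 0"
      using independentD[OF indep, of "rvec ` H" g] H(1) by auto
    then show False using ne gr by simp
  qed
  have "lattice_basis f"
    unfolding lattice_basis_def
  proof
    fix v
    obtain k :: "'n lattice \<Rightarrow> int" where "v = (\<Sum>h\<in>H. k h *s h)" using genM by blast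
    then have "v = (\<Sum>j\<in>UNIV. k (f j) *s f j)" by (simp add: f_reindex)
    then show "\<exists>!c. v = (\<Sum>j\<in>UNIV. c j *s f j)" using uniq by metis
  qed
  moreover have "?D = {(\<Sum>j\<in>UNIV. int (k j) *s f j) | k. True}"
  proof
    show "?D \<subseteq> {(\<Sum>j\<in>UNIV. int (k j) *s f j) | k. True}"
    proof
      fix m assume "m \<in> ?D"
      then obtain k where "m = (\<Sum>h\<in>H. int (k h) *s h)" using gen by blast
      then have "m = (\<Sum>j\<in>UNIV. int (k (f j)) *s f j)" by (simp add: f_reindex)
      then show "m \<in> {(\<Sum>j\<in>UNIV. int (k j) *s f j) | k. True}"
        by (intro CollectI exI[of _ "\<lambda>j. k (f j)"]) simp
    qed
    have "f j \<in> ?D" for j using f unfolding bij_betw_def H_def by blast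
    then show "{(\<Sum>j\<in>UNIV. int (k j) *s f j) | k. True} \<subseteq> ?D"
      by (auto intro!: dual_semigroup_sum dual_semigroup_scale)
  qed
  ultimately have "(\<sigma>, f) \<in> Ch" unfolding charts_def by (simp only: mem_Collect_eq case_prod_conv \<sigma> simp_thms)
  then show ?thesis by blast
qed

lemma chart_above: "\<tau> \<in> \<Sigma> \<Longrightarrow> \<exists>\<sigma> m. (\<sigma>, m) \<in> Ch \<and> \<tau> \<subseteq> \<sigma>"
  using fulldim_above fulldim_chart by blast

lemma chart_covers: "\<exists>\<sigma> m. (\<sigma>, m) \<in> Ch \<and> u \<in> \<sigma>"
proof -
  obtain \<sigma> where \<sigma>: "\<sigma> \<in> \<Sigma>" "interior \<sigma> \<noteq> {}" "u \<in> \<sigma>" using fulldim_covers by blast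
  then obtain m where "(\<sigma>, m) \<in> Ch" using fulldim_chart by blast
  then show ?thesis using \<sigma>(3) by blast
qed

end

section \<open>Rays of cones and lattice points of the polytope\<close>

definition (in smooth_complete_fan) gens :: "(real ^ 'n) set \<Rightarrow> 'n lattice set" where
  "gens \<sigma> = {\<rho> \<in> Rays. rvec \<rho> \<in> \<sigma>}"

lemma (in smooth_complete_fan) gens_Int: "gens (\<sigma> \<inter> \<tau>) = gens \<sigma> \<inter> gens \<tau>"
  by (auto simp: gens_def)

lemma DeltaM_iff: "\<mu> \<in> DeltaM \<Sigma> \<longleftrightarrow> (\<forall>\<rho>\<in>rays \<Sigma>. -1 \<le> pair \<mu> \<rho>)"
proof -
  have "- 1 \<le> rvec \<mu> \<bullet> rvec \<rho> \<longleftrightarrow> -1 \<le> pair \<mu> \<rho>" for \<rho>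
    unfolding inner_rvec by linarith
  then show ?thesis by (simp add: DeltaM_def Delta_def)
qed

lemma zero_in_DeltaM: "0 \<in> DeltaM \<Sigma>"
  by (simp add: DeltaM_iff)

context smooth_complete_fan
begin

lemma chart_basis:
  assumes "(\<sigma>, m) \<in> Ch"
  shows "lattice_basis m" "\<sigma> \<in> \<Sigma>"
  using assms by (auto simp: charts_def)

lemma chart_dual_iff:
  assumes c: "(\<sigma>, m) \<in> Ch"
  shows "k \<in> dual_semigroup \<sigma> \<longleftrightarrow> (\<forall>j. 0 \<le> pair k (dual_basis m j))"
proof -
  have b: "lattice_basis m" and D: "dual_semigroup \<sigma> = {(\<Sum>j\<in>UNIV. int (k j) *s m j) | k. True}"
    using c by (auto simp: charts_def)
  show ?thesis
  proof
    assume "k \<in> dual_semigroup \<sigma>"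
    then obtain l where "k = (\<Sum>j\<in>UNIV. int (l j) *s m j)" unfolding D by blast
    then have "pair k (dual_basis m j) = int (l j)" for j
      by (simp add: pair_simps dual_basis_pair[OF b] if_distrib[of "\<lambda>x. _ * x"] cong: if_cong)
    then show "\<forall>j. 0 \<le> pair k (dual_basis m j)" by simp
  next
    assume "\<forall>j. 0 \<le> pair k (dual_basis m j)"
    then have "k = (\<Sum>j\<in>UNIV. int (nat (pair k (dual_basis m j))) *s m j)"
      using lattice_basis_expand[OF b, of k] by simp
    then show "k \<in> dual_semigroup \<sigma>" unfolding D
      by (intro CollectI exI[of _ "\<lambda>j. nat (pair k (dual_basis m j))"]) simp
  qed
qed

lemma chart_basis_in_dual: "(\<sigma>, m) \<in> Ch \<Longrightarrow> m j \<in> dual_semigroup \<sigma>"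
  by (simp add: chart_dual_iff dual_basis_pair chart_basis)

lemma chart_cone_iff:
  assumes c: "(\<sigma>, m) \<in> Ch"
  shows "u \<in> \<sigma> \<longleftrightarrow> (\<forall>j. 0 \<le> rvec (m j) \<bullet> u)"
proof
  assume "u \<in> \<sigma>"
  then show "\<forall>j. 0 \<le> rvec (m j) \<bullet> u"
    using chart_basis_in_dual[OF c] unfolding dual_semigroup_def by blast
next
  assume u: "\<forall>j. 0 \<le> rvec (m j) \<bullet> u"
  show "u \<in> \<sigma>"
  proof (rule pointed_cone_bidual[OF pointed[OF chart_basis(2)[OF c]]])
    fix k assume "k \<in> dual_semigroup \<sigma>"
    then have "0 \<le> pair k (dual_basis m j)" for j using chart_dual_iff[OF c] by blast
    then show "0 \<le> rvec k \<bullet> u"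
      unfolding lattice_basis_rvec_span[OF chart_basis(1)[OF c], of k] inner_sum_left
      using u by (auto intro!: sum_nonneg)
  qed
qed

lemma chart_face:
  assumes c: "(\<sigma>, m) \<in> Ch"
  shows "{u \<in> \<sigma>. \<forall>j\<in>J. rvec (m j) \<bullet> u = 0} \<in> \<Sigma>"
proof (rule face_in_fan[OF chart_basis(2)[OF c]])
  let ?a = "\<Sum>j\<in>J. rvec (m j)"
  have nn: "0 \<le> rvec (m j) \<bullet> u" if "u \<in> \<sigma>" for u j using that chart_cone_iff[OF c] by blast
  have eq: "{u \<in> \<sigma>. \<forall>j\<in>J. rvec (m j) \<bullet> u = 0} = \<sigma> \<inter> {u. ?a \<bullet> u = 0}"
    using nn by (auto simp: inner_sum_left sum_nonneg_eq_0_iff)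
  show "{u \<in> \<sigma>. \<forall>j\<in>J. rvec (m j) \<bullet> u = 0} face_of \<sigma>"
    unfolding eq
  proof (rule face_of_Int_supporting_hyperplane_ge)
    show "convex \<sigma>" by (rule pointed_cone_facts(2)[OF pointed[OF chart_basis(2)[OF c]]])
    show "?a \<bullet> x \<ge> 0" if "x \<in> \<sigma>" for x
      unfolding inner_sum_left using nn[OF that] by (intro sum_nonneg) auto
  qed
  show "{u \<in> \<sigma>. \<forall>j\<in>J. rvec (m j) \<bullet> u = 0} \<noteq> {}"
    using pointed_cone_facts(3)[OF pointed[OF chart_basis(2)[OF c]]] by auto
qed

text \<open>The face on which all coordinates but the j-th vanish is the half-line of the j-th dual
  vector.\<close>

lemma chart_ray:
  assumes c: "(\<sigma>, m) \<in> Ch"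
  shows "dual_basis m j \<in> gens \<sigma>"
proof -
  note b = chart_basis(1)[OF c]
  have in_\<sigma>: "rvec (dual_basis m j) \<in> \<sigma>"
    by (simp add: chart_cone_iff[OF c] inner_rvec dual_basis_pair[OF b])
  have "{u \<in> \<sigma>. \<forall>i\<in>-{j}. rvec (m i) \<bullet> u = 0} = convex_cone hull {rvec (dual_basis m j)}"
    unfolding convex_cone_hull_singleton
  proof (intro equalityI subsetI)
    fix u assume u: "u \<in> {u \<in> \<sigma>. \<forall>i\<in>-{j}. rvec (m i) \<bullet> u = 0}"
    have "u = (\<Sum>i\<in>UNIV. (rvec (m i) \<bullet> u) *\<^sub>R rvec (dual_basis m i))"
      by (rule real_dual_basis_expand[OF b])
    also have "\<dots> = (\<Sum>i\<in>{j}. (rvec (m i) \<bullet> u) *\<^sub>R rvec (dual_basis m i))"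
      by (rule sum.mono_neutral_right) (use u in auto)
    finally have "u = (rvec (m j) \<bullet> u) *\<^sub>R rvec (dual_basis m j)" by simp
    moreover have "0 \<le> rvec (m j) \<bullet> u" using u chart_cone_iff[OF c] by blast
    ultimately show "u \<in> {t *\<^sub>R rvec (dual_basis m j) | t. 0 \<le> t}" by blast
  next
    fix u assume "u \<in> {t *\<^sub>R rvec (dual_basis m j) | t. 0 \<le> t}"
    then show "u \<in> {u \<in> \<sigma>. \<forall>i\<in>-{j}. rvec (m i) \<bullet> u = 0}"
      using in_\<sigma> pointed_cone_facts(5)[OF pointed[OF chart_basis(2)[OF c]]]
      by (auto simp: inner_rvec dual_basis_pair[OF b] split: if_splits)
  qed
  then have "convex_cone hull {rvec (dual_basis m j)} \<in> \<Sigma>" using chart_face[OF c, of "-{j}"] by simp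
  then show ?thesis using primitive_dual_basis[OF b] in_\<sigma> by (simp add: gens_def rays_def)
qed

text \<open>\<open>u\<close> is the sum of its components along the dual vectors, all of which lie
  in \<open>\<sigma>\<close>; a face of a cone contains the summands of its elements.\<close>

lemma chart_component_in_face:
  assumes c: "(\<sigma>, m) \<in> Ch" and \<tau>: "\<tau> \<in> \<Sigma>" "\<tau> \<subseteq> \<sigma>" and u: "u \<in> \<tau>"
  shows "(rvec (m j) \<bullet> u) *\<^sub>R rvec (dual_basis m j) \<in> \<tau>"
proof -
  note b = chart_basis(1)[OF c] and P = pointed_cone_facts[OF pointed[OF chart_basis(2)[OF c]]]
  have face: "\<tau> face_of \<sigma>" using fan_Int_face[OF chart_basis(2)[OF c] \<tau>(1)] \<tau>(2) by (simp add: inf.absorb2)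
  have mem: "(rvec (m i) \<bullet> u) *\<^sub>R rvec (dual_basis m i) \<in> \<sigma>" for i
    using chart_cone_iff[OF c] chart_ray[OF c, of i] u \<tau>(2) P(5) by (auto simp: gens_def)
  have sum_mem: "(\<Sum>i\<in>A. (rvec (m i) \<bullet> u) *\<^sub>R rvec (dual_basis m i)) \<in> \<sigma>" for A
  proof (induction A rule: infinite_finite_induct)
    case (insert x A)
    then show ?case using P(4)[OF mem[of x] insert.IH] by simp
  qed (use P(3) in simp_all)
  have "u = (\<Sum>i\<in>UNIV. (rvec (m i) \<bullet> u) *\<^sub>R rvec (dual_basis m i))"
    by (rule real_dual_basis_expand[OF b])
  also have "\<dots> = (rvec (m j) \<bullet> u) *\<^sub>R rvec (dual_basis m j) +
      (\<Sum>i\<in>UNIV - {j}. (rvec (m i) \<bullet> u) *\<^sub>R rvec (dual_basis m i))"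
    by (rule sum.remove) auto
  finally have "(rvec (m j) \<bullet> u) *\<^sub>R rvec (dual_basis m j) +
      (\<Sum>i\<in>UNIV - {j}. (rvec (m i) \<bullet> u) *\<^sub>R rvec (dual_basis m i)) \<in> \<tau>" using u by simp
  from face_of_cone_summand[OF face P(5) mem sum_mem this] show ?thesis .
qed

text \<open>The half-line of a ray \<open>\<rho>\<close> of \<open>\<sigma>\<close> is itself a cone
  of the fan, so it contains the components of \<open>\<rho>\<close> along the dual vectors. A
  nonzero component must then equal \<open>\<rho>\<close>, and primitivity makes its coefficient
  1.\<close>

lemma chart_gens:
  assumes c: "(\<sigma>, m) \<in> Ch"
  shows "gens \<sigma> = range (dual_basis m)"
proof (intro equalityI subsetI)
  note b = chart_basis(1)[OF c]
  fix \<rho> assume \<rho>: "\<rho> \<in> gens \<sigma>"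
  let ?C = "convex_cone hull {rvec \<rho>}"
  have C: "?C \<in> \<Sigma>" "primitive \<rho>" and \<rho>\<sigma>: "rvec \<rho> \<in> \<sigma>" using \<rho> by (auto simp: gens_def rays_def)
  have C\<sigma>: "?C \<subseteq> \<sigma>"
    using pointed_cone_facts(5)[OF pointed[OF chart_basis(2)[OF c]]] \<rho>\<sigma>
    by (auto simp: convex_cone_hull_singleton)
  have "\<rho> \<noteq> 0"
  proof
    assume "\<rho> = 0"
    then have "\<rho> = 0 *s \<rho>" by simp
    then show False using C(2) unfolding primitive_def by (metis abs_zero zero_neq_one)
  qed
  then obtain j where j: "pair (m j) \<rho> \<noteq> 0"
    using dual_basis_expand[OF b, of \<rho>] by (metis (no_types, lifting) sum.neutral vector_smult_lzero)
  have "(rvec (m j) \<bullet> rvec \<rho>) *\<^sub>R rvec (dual_basis m j) \<in> ?C"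
    by (rule chart_component_in_face[OF c C(1) C\<sigma>]) (simp add: hull_inc)
  then obtain t where t: "of_int (pair (m j) \<rho>) *\<^sub>R rvec (dual_basis m j) = t *\<^sub>R rvec \<rho>"
    by (auto simp: convex_cone_hull_singleton inner_rvec)
  have "of_int (pair (m j) \<rho>) = t * of_int (pair (m j) \<rho>)"
    using arg_cong[OF t, of "\<lambda>x. rvec (m j) \<bullet> x"] by (simp add: inner_rvec dual_basis_pair[OF b])
  then have "t = 1" using j by simp
  then have "rvec \<rho> = rvec (pair (m j) \<rho> *s dual_basis m j)" using t by (simp add: rvec_scale)
  then have eq: "\<rho> = pair (m j) \<rho> *s dual_basis m j" by simp
  then have "\<bar>pair (m j) \<rho>\<bar> = 1" using C(2) unfolding primitive_def by blast
  moreover have "0 \<le> pair (m j) \<rho>" using \<rho>\<sigma> chart_cone_iff[OF c] by (simp add: inner_rvec)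
  ultimately have "pair (m j) \<rho> = 1" by simp
  then show "\<rho> \<in> range (dual_basis m)" using eq by simp
next
  fix \<rho> assume "\<rho> \<in> range (dual_basis m)"
  then show "\<rho> \<in> gens \<sigma>" using chart_ray[OF c] by blast
qed

text \<open>Every vector of \<open>\<tau>\<close> is a nonnegative combination of rays of
  \<open>\<tau>\<close>: take its components in a chart above \<open>\<tau>\<close>, which stay in
  the face \<open>\<tau>\<close>.\<close>

lemma gens_dual:
  assumes \<tau>: "\<tau> \<in> \<Sigma>"
  shows "k \<in> dual_semigroup \<tau> \<longleftrightarrow> (\<forall>\<rho>\<in>gens \<tau>. 0 \<le> pair k \<rho>)"
proof
  assume "k \<in> dual_semigroup \<tau>"
  then have "0 \<le> rvec k \<bullet> rvec \<rho>" if "\<rho> \<in> gens \<tau>" for \<rho>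
    using that by (auto simp: dual_semigroup_def gens_def)
  then show "\<forall>\<rho>\<in>gens \<tau>. 0 \<le> pair k \<rho>" by (simp add: inner_rvec)
next
  assume k: "\<forall>\<rho>\<in>gens \<tau>. 0 \<le> pair k \<rho>"
  obtain \<sigma> m where c: "(\<sigma>, m) \<in> Ch" and sub: "\<tau> \<subseteq> \<sigma>" using chart_above[OF \<tau>] by blast
  note b = chart_basis(1)[OF c]
  show "k \<in> dual_semigroup \<tau>"
    unfolding dual_semigroup_def
  proof (intro CollectI ballI)
    fix u assume u: "u \<in> \<tau>"
    have "0 \<le> (rvec (m j) \<bullet> u) * (rvec k \<bullet> rvec (dual_basis m j))" for j
    proof (cases "rvec (m j) \<bullet> u = 0")
      case False
      then have pos: "0 < rvec (m j) \<bullet> u" using chart_cone_iff[OF c, of u] subsetD[OF sub u] by (simp add: less_le)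
      have "(1 / (rvec (m j) \<bullet> u)) *\<^sub>R ((rvec (m j) \<bullet> u) *\<^sub>R rvec (dual_basis m j)) \<in> \<tau>"
        by (rule pointed_cone_facts(5)[OF pointed[OF \<tau>] chart_component_in_face[OF c \<tau> sub u]]) (use pos in simp)
      then have "rvec (dual_basis m j) \<in> \<tau>" using pos by simp
      then have "dual_basis m j \<in> gens \<tau>" using chart_ray[OF c, of j] by (simp add: gens_def)
      then show ?thesis using k pos by (simp add: inner_rvec)
    qed simp
    then have "0 \<le> (\<Sum>j\<in>UNIV. (rvec (m j) \<bullet> u) * (rvec k \<bullet> rvec (dual_basis m j)))"
      by (intro sum_nonneg) auto
    then show "0 \<le> rvec k \<bullet> u"
      by (subst real_dual_basis_expand[OF b, of u]) (simp add: inner_sum_right)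
  qed
qed

lemma ray_in_chart:
  assumes "\<rho> \<in> Rays"
  shows "\<exists>\<sigma> m. (\<sigma>, m) \<in> Ch \<and> \<rho> \<in> gens \<sigma>"
proof -
  have "convex_cone hull {rvec \<rho>} \<in> \<Sigma>" using assms by (simp add: rays_def)
  then obtain \<sigma> m where c: "(\<sigma>, m) \<in> Ch" "convex_cone hull {rvec \<rho>} \<subseteq> \<sigma>"
    using chart_above by blast
  then have "rvec \<rho> \<in> \<sigma>" using hull_inc[of "rvec \<rho>" "{rvec \<rho>}"] by blast
  then show ?thesis using c assms by (auto simp: gens_def)
qed

lemma finite_rays: "finite Rays"
proof -
  have "Rays \<subseteq> (\<Union>\<sigma>\<in>fst ` Ch. gens \<sigma>)" using ray_in_chart by force
  moreover have "fst ` Ch \<subseteq> \<Sigma>" by (auto simp: charts_def)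
  then have "finite (fst ` Ch)" using finite_fan finite_subset by blast
  moreover have "finite (gens \<sigma>)" if "\<sigma> \<in> fst ` Ch" for \<sigma>
    using that chart_gens by fastforce
  ultimately show ?thesis by (meson finite_UN_I finite_subset)
qed

lemma finite_gens: "finite (gens \<sigma>)"
  using finite_rays by (simp add: gens_def)

lemma gens_subset_rays: "gens \<sigma> \<subseteq> Rays"
  by (auto simp: gens_def)

lemma lattice_nonneg_expand:
  shows "\<exists>\<sigma> m. (\<sigma>, m) \<in> Ch \<and> (\<forall>j. 0 \<le> pair (m j) v)"
proof -
  obtain \<sigma> m where c: "(\<sigma>, m) \<in> Ch" "rvec v \<in> \<sigma>" using chart_covers by blast
  then show ?thesis using chart_cone_iff[OF c(1)] by (auto simp: inner_rvec)
qed

text \<open>\<open>v\<close> is a nonnegative combination of the rays of a cone containing it, and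
  each ray has height at least -1 on \<Delta>.\<close>

lemma DeltaM_lower_bound: "\<exists>B. \<forall>\<mu>\<in>DM. B \<le> pair \<mu> v"
proof -
  obtain \<sigma> m where c: "(\<sigma>, m) \<in> Ch" "\<forall>j. 0 \<le> pair (m j) v"
    using lattice_nonneg_expand by blast
  note b = chart_basis(1)[OF c(1)]
  have "(\<Sum>j\<in>UNIV. - pair (m j) v) \<le> pair \<mu> v" if \<mu>: "\<mu> \<in> DM" for \<mu>
    unfolding pair_dual_basis[OF b, of \<mu> v]
  proof (rule sum_mono)
    fix j
    have "-1 \<le> pair \<mu> (dual_basis m j)"
      using \<mu> chart_ray[OF c(1), of j] by (simp add: DeltaM_iff gens_def)
    then have "- 1 * pair (m j) v \<le> pair \<mu> (dual_basis m j) * pair (m j) v"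
      using c(2) by (intro mult_right_mono) auto
    then show "- pair (m j) v \<le> pair \<mu> (dual_basis m j) * pair (m j) v" by simp
  qed
  then show ?thesis by blast
qed

lemma finite_DeltaM: "finite DM"
proof -
  have "\<exists>B. \<forall>\<mu>\<in>DM. \<bar>\<mu> $ i\<bar> \<le> B" for i
  proof -
    obtain A B where "\<forall>\<mu>\<in>DM. A \<le> pair \<mu> (axis i 1)" "\<forall>\<mu>\<in>DM. B \<le> pair \<mu> (- axis i 1)"
      using DeltaM_lower_bound by metis
    then have "\<forall>\<mu>\<in>DM. \<bar>\<mu> $ i\<bar> \<le> \<bar>A\<bar> + \<bar>B\<bar>" by (force simp: pair_minus_right pair_axis)
    then show ?thesis by blast
  qed
  then obtain B where B: "\<And>i \<mu>. \<mu> \<in> DM \<Longrightarrow> \<bar>\<mu> $ i\<bar> \<le> B i" by metis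
  have "DM \<subseteq> vec_lambda ` (PiE UNIV (\<lambda>i. {- B i..B i}))"
  proof
    fix \<mu> assume "\<mu> \<in> DM"
    then have "vec_nth \<mu> \<in> PiE UNIV (\<lambda>i. {- B i..B i})" unfolding PiE_UNIV_domain using B by (auto simp: abs_le_iff minus_le_iff)
    then show "\<mu> \<in> vec_lambda ` (PiE UNIV (\<lambda>i. {- B i..B i}))" by (intro image_eqI[of _ _ "vec_nth \<mu>"]) simp_all
  qed
  then show ?thesis by (rule finite_subset) (auto intro!: finite_imageI finite_PiE)
qed

text \<open>Expand \<open>- \<alpha>\<close>, regarded as a vector of N, in the rays of a cone
  containing it: this gives \<open>pair \<alpha> (- \<alpha>)\<close> nonnegative.\<close>

lemma pair_rays_nonneg_imp_zero:
  assumes "\<forall>\<rho>\<in>Rays. 0 \<le> pair \<alpha> \<rho>"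
  shows "\<alpha> = 0"
proof -
  obtain \<sigma> m where c: "(\<sigma>, m) \<in> Ch" "\<forall>j. 0 \<le> pair (m j) (- \<alpha>)"
    using lattice_nonneg_expand by blast
  have "0 \<le> pair \<alpha> (- \<alpha>)"
    unfolding pair_dual_basis[OF chart_basis(1)[OF c(1)], of \<alpha> "- \<alpha>"]
    using c(2) assms chart_ray[OF c(1)] by (intro sum_nonneg mult_nonneg_nonneg) (auto simp: gens_def)
  then show ?thesis using pair_self_le_0[of \<alpha>] by (simp add: pair_minus_right)
qed

text \<open>The cones containing \<open>k \<Sum>I + \<rho>0\<close> for infinitely many \<open>k\<close> contain \<open>\<Sum>I\<close>, hence \<open>I\<close>; as \<open>\<alpha>\<close> is
  negative on \<open>k \<Sum>I + \<rho>0\<close>, they also contain a ray on which \<open>\<alpha>\<close> is negative.\<close>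

lemma root_cone:
  assumes root: "isRoot \<alpha> \<rho>0" and \<tau>: "\<tau> \<in> \<Sigma>" and I: "I \<subseteq> gens \<tau>" "\<forall>\<rho>\<in>I. pair \<alpha> \<rho> = 0"
  shows "\<exists>\<sigma>\<in>\<Sigma>. I \<subseteq> gens \<sigma> \<and> \<rho>0 \<in> gens \<sigma>"
proof -
  define v where "v k = int k *s (\<Sum>I) + \<rho>0" for k :: nat
  have finI: "finite I" using I(1) finite_gens finite_subset by blast
  have "\<forall>k. \<exists>\<sigma>. \<sigma> \<in> fst ` Ch \<and> rvec (v k) \<in> \<sigma>" using chart_covers by (metis fst_conv imageI)
  then obtain s where s: "\<And>k. s k \<in> fst ` Ch" "\<And>k. rvec (v k) \<in> s k" by metis
  have "finite (range s)"
  proof (rule finite_subset[OF _ finite_fan])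
    have "fst ` Ch \<subseteq> \<Sigma>" by (auto simp: charts_def)
    then show "range s \<subseteq> \<Sigma>" using s(1) by blast
  qed
  then obtain \<sigma> where \<sigma>: "infinite {k. s k = \<sigma>}"
    using pigeonhole_infinite[of UNIV s] by auto
  then obtain k0 where "s k0 = \<sigma>" using not_finite_existsD by blast
  then obtain m where c: "(\<sigma>, m) \<in> Ch" using s(1)[of k0] by auto
  note b = chart_basis[OF c]
  have nn: "0 \<le> pair (m j) (v k)" if "s k = \<sigma>" for j k
    using s(2)[of k] that chart_cone_iff[OF c] by (simp add: inner_rvec)
  have "0 \<le> pair (m j) (\<Sum>I)" for j
  proof (rule ccontr)
    assume neg: "\<not> 0 \<le> pair (m j) (\<Sum>I)"
    obtain k where k: "s k = \<sigma>" "nat \<bar>pair (m j) \<rho>0\<bar> < k"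
      using \<sigma> by (metis (mono_tags) infinite_nat_iff_unbounded mem_Collect_eq)
    have "int k * pair (m j) (\<Sum>I) \<le> int k * (-1)" using neg by (intro mult_left_mono) auto
    then show False using nn[OF k(1), of j] k(2) by (simp add: v_def pair_add_right pair_scale_right)
  qed
  then have "rvec (\<Sum>I) \<in> \<sigma>" by (simp add: chart_cone_iff[OF c] inner_rvec)
  note P = pointed_cone_facts[OF pointed[OF \<tau>]]
  have I\<tau>: "rvec (\<Sum>J) \<in> \<tau>" if "J \<subseteq> I" for J
  proof -
    have "finite J" using that finI finite_subset by blast
    then show ?thesis using that
    proof (induction J rule: finite_induct)
      case empty
      then show ?case using P(3) by simp
    next
      case (insert x J)
      then have "rvec x \<in> \<tau>" using I(1) by (auto simp: gens_def)
      then show ?case using insert P(4)[of "rvec x" "rvec (\<Sum>J)"] by (simp add: rvec_add)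
    qed
  qed
  have "\<rho> \<in> gens \<sigma>" if \<rho>: "\<rho> \<in> I" for \<rho>
  proof -
    have "rvec \<rho> + rvec (\<Sum>(I - {\<rho>})) \<in> \<tau> \<inter> \<sigma>"
      using I\<tau>[of I] \<open>rvec (\<Sum>I) \<in> \<sigma>\<close> sum.remove[OF finI \<rho>, of "\<lambda>x. x"] by (simp flip: rvec_add)
    moreover have "rvec \<rho> \<in> \<tau>" using \<rho> I(1) by (auto simp: gens_def)
    ultimately have "rvec \<rho> \<in> \<tau> \<inter> \<sigma>"
      using face_of_cone_summand[OF fan_Int_face[OF \<tau> b(2)] P(5)] I\<tau>[of "I - {\<rho>}"] by blast
    then show ?thesis using \<rho> I(1) by (auto simp: gens_def)
  qed
  moreover have "\<rho>0 \<in> gens \<sigma>"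
  proof -
    have "pair \<alpha> (v k0) < 0"
      using root I(2) by (simp add: v_def pair_simps is_root_ray_def)
    have "\<exists>j. pair \<alpha> (dual_basis m j) * pair (m j) (v k0) < 0"
    proof (rule ccontr)
      assume "\<nexists>j. pair \<alpha> (dual_basis m j) * pair (m j) (v k0) < 0"
      then have "0 \<le> (\<Sum>j\<in>UNIV. pair \<alpha> (dual_basis m j) * pair (m j) (v k0))"
        by (intro sum_nonneg) (simp add: not_less)
      then show False using \<open>pair \<alpha> (v k0) < 0\<close> pair_dual_basis[OF b(1), of \<alpha> "v k0"] by simp
    qed
    then obtain j where j: "pair \<alpha> (dual_basis m j) * pair (m j) (v k0) < 0" ..
    then have neg: "pair \<alpha> (dual_basis m j) < 0"
      using nn[OF \<open>s k0 = \<sigma>\<close>, of j] by (simp add: mult_less_0_iff)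
    have ray: "dual_basis m j \<in> gens \<sigma>" by (rule chart_ray[OF c])
    then have "dual_basis m j = \<rho>0"
      using root neg gens_subset_rays unfolding is_root_ray_def by (meson not_less subsetD)
    then show ?thesis using ray by simp
  qed
  ultimately show ?thesis using b(2) by blast
qed

end

section \<open>Cox coordinates\<close>

text \<open>
  \<open>cdom\<close> is the complement of the irrelevant locus in the space of Cox coordinates \<open>z\<close>, \<open>cox\<close> is the
  quotient map onto \<open>Y\<close>, and \<open>zc m\<close> is its section over the chart \<open>m\<close>.  As \<open>0 powi n = 0\<close> for
  \<open>n < 0\<close>, the monomial \<open>ev z k\<close> is meaningful only if \<open>k\<close> is nonnegative on \<open>Zs z\<close>.
\<close>

definition (in smooth_complete_fan) ev :: "('n lattice \<Rightarrow> complex) \<Rightarrow> 'n lattice \<Rightarrow> complex" where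
  "ev z k = (\<Prod>\<rho>\<in>Rays. z \<rho> powi pair k \<rho>)"

definition (in smooth_complete_fan) Zs :: "('n lattice \<Rightarrow> complex) \<Rightarrow> 'n lattice set" where
  "Zs z = {\<rho> \<in> Rays. z \<rho> = 0}"

definition (in smooth_complete_fan) cdom :: "('n lattice \<Rightarrow> complex) set" where
  "cdom = {z. \<exists>\<sigma>\<in>\<Sigma>. Zs z \<subseteq> gens \<sigma>}"

definition (in smooth_complete_fan) Xp :: "(real ^ 'n) set \<Rightarrow> ('n lattice \<Rightarrow> complex) \<Rightarrow> 'n lattice \<Rightarrow> complex" where
  "Xp \<sigma> z = restr \<sigma> (ev z)"

definition (in smooth_complete_fan) cox :: "('n lattice \<Rightarrow> complex) \<Rightarrow> 'n toric_point" where
  "cox z = {(\<sigma>, Xp \<sigma> z) | \<sigma>. \<sigma> \<in> \<Sigma> \<and> Zs z \<subseteq> gens \<sigma>}"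

definition zc :: "('n \<Rightarrow> 'n::finite lattice) \<Rightarrow> complex ^ 'n \<Rightarrow> 'n lattice \<Rightarrow> complex" where
  "zc m x \<rho> = (if \<rho> \<in> range (dual_basis m) then x $ inv (dual_basis m) \<rho> else 1)"

definition mon :: "('n \<Rightarrow> 'n::finite lattice) \<Rightarrow> complex ^ 'n \<Rightarrow> 'n lattice \<Rightarrow> complex" where
  "mon m x k = (\<Prod>j\<in>UNIV. x $ j powi pair k (dual_basis m j))"

definition (in smooth_complete_fan) pt :: "('n \<Rightarrow> 'n lattice) \<Rightarrow> complex ^ 'n \<Rightarrow> 'n toric_point" where
  "pt m x = cox (zc m x)"

section \<open>Cox monomials and the points of Y\<close>

lemma power_int_add_nonneg:
  fixes x :: "'a::field"
  assumes "x = 0 \<Longrightarrow> 0 \<le> a \<and> 0 \<le> b"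
  shows "x powi (a + b) = x powi a * x powi b"
proof (cases "x = 0")
  case True
  then show ?thesis using assms by (auto simp: power_int_0_left_if)
next
  case False
  then show ?thesis by (simp add: power_int_add)
qed

lemma prod_power_int_distrib: "(\<Prod>i\<in>I. f i) powi n = (\<Prod>i\<in>I. (f i :: 'a::field) powi n)"
  by (induction I rule: infinite_finite_induct) (simp_all add: power_int_mult_distrib)

lemma mon_basis:
  assumes "lattice_basis m"
  shows "mon m x (m j) = x $ j"
  by (simp add: mon_def dual_basis_pair[OF assms] if_distrib[of "\<lambda>e. _ powi e"] cong: if_cong)

context smooth_complete_fan
begin

lemma ev_add:
  assumes "\<forall>\<rho>\<in>Zs z. 0 \<le> pair k \<rho> \<and> 0 \<le> pair l \<rho>"
  shows "ev z (k + l) = ev z k * ev z l"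
  unfolding ev_def prod.distrib[symmetric] pair_add_left
  by (intro prod.cong refl power_int_add_nonneg) (use assms in \<open>auto simp: Zs_def\<close>)

lemma ev_zero [simp]: "ev z 0 = 1"
  by (simp add: ev_def)

lemma ev_nonzero_iff: "ev z k \<noteq> 0 \<longleftrightarrow> (\<forall>\<rho>\<in>Zs z. pair k \<rho> = 0)"
  by (auto simp: ev_def Zs_def prod_zero_iff[OF finite_rays])

text \<open>By smoothness the rays of a cone belong to a lattice basis, so 0-1 values on them can be
  prescribed. Multiples of such elements serve to clear negative exponents.\<close>

lemma separator:
  assumes \<sigma>: "\<sigma> \<in> \<Sigma>"
  shows "\<exists>b\<in>dual_semigroup \<sigma>. \<forall>\<rho>\<in>gens \<sigma>. pair b \<rho> = (if \<rho> \<in> J then 1 else 0)"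
proof -
  obtain \<sigma>' m where c: "(\<sigma>', m) \<in> Ch" "\<sigma> \<subseteq> \<sigma>'" using chart_above[OF \<sigma>] by blast
  let ?b = "\<Sum>j\<in>{j. dual_basis m j \<in> J}. m j"
  have pb: "pair ?b (dual_basis m i) = (if dual_basis m i \<in> J then 1 else 0)" for i
    by (simp add: pair_simps dual_basis_pair[OF chart_basis(1)[OF c(1)]])
  have "\<forall>\<rho>\<in>gens \<sigma>'. pair ?b \<rho> = (if \<rho> \<in> J then 1 else 0)"
    unfolding chart_gens[OF c(1)] using pb by blast
  moreover have "gens \<sigma> \<subseteq> gens \<sigma>'" using c(2) by (auto simp: gens_def)
  ultimately have 1: "\<forall>\<rho>\<in>gens \<sigma>. pair ?b \<rho> = (if \<rho> \<in> J then 1 else 0)" by blast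
  then have "?b \<in> dual_semigroup \<sigma>" unfolding gens_dual[OF \<sigma>] by simp
  then show ?thesis using 1 by blast
qed

lemma Xp_aff:
  assumes "\<sigma> \<in> \<Sigma>" "Zs z \<subseteq> gens \<sigma>"
  shows "Xp \<sigma> z \<in> aff \<sigma>"
  unfolding aff_def
proof (intro CollectI conjI ballI allI impI)
  fix k l assume kl: "k \<in> dual_semigroup \<sigma>" "l \<in> dual_semigroup \<sigma>"
  then have "ev z (k + l) = ev z k * ev z l"
    using assms gens_dual by (intro ev_add) blast
  then show "Xp \<sigma> z (k + l) = Xp \<sigma> z k * Xp \<sigma> z l"
    using kl dual_semigroup_add[OF kl] by (simp add: Xp_def restr_def)
qed (simp_all add: Xp_def restr_def dual_semigroup_zero)

lemma aff_scale:
  assumes "x \<in> aff \<sigma>" "k \<in> dual_semigroup \<sigma>"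
  shows "x (int n *s k) = x k ^ n"
proof (induction n)
  case 0
  then show ?case using assms(1) by (simp add: aff_def)
next
  case (Suc n)
  have "int (Suc n) *s k = k + int n *s k" by (simp add: vector_sadd_rdistrib)
  then show ?case using assms Suc dual_semigroup_scale[OF assms(2), of n] by (simp add: aff_def)
qed

lemma aff_sum:
  assumes "x \<in> aff \<sigma>" "\<And>i. i \<in> I \<Longrightarrow> f i \<in> dual_semigroup \<sigma>"
  shows "x (\<Sum>i\<in>I. f i) = (\<Prod>i\<in>I. x (f i))"
  using assms(2)
proof (induction I rule: infinite_finite_induct)
  case (insert i I)
  then show ?case using assms(1) dual_semigroup_sum[of I f \<sigma>] by (simp add: aff_def)
qed (use assms(1) in \<open>simp_all add: aff_def\<close>)

lemma zc_dual: "lattice_basis m \<Longrightarrow> zc m x (dual_basis m j) = x $ j"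
  by (simp add: zc_def inv_f_f inj_dual_basis)

lemma ev_zc:
  assumes c: "(\<sigma>, m) \<in> Ch"
  shows "ev (zc m x) k = mon m x k"
proof -
  note b = chart_basis(1)[OF c]
  have sub: "range (dual_basis m) \<subseteq> Rays" using chart_gens[OF c] gens_subset_rays by metis
  have "ev (zc m x) k = (\<Prod>\<rho>\<in>range (dual_basis m). zc m x \<rho> powi pair k \<rho>)"
    unfolding ev_def
    by (rule prod.mono_neutral_right) (use sub finite_rays in \<open>auto simp: zc_def\<close>)
  also have "\<dots> = mon m x k"
    unfolding mon_def by (subst prod.reindex[OF inj_dual_basis[OF b]]) (simp add: zc_dual[OF b])
  finally show ?thesis .
qed

lemma Zs_zc:
  assumes c: "(\<sigma>, m) \<in> Ch"
  shows "Zs (zc m x) = dual_basis m ` {j. x $ j = 0}"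
proof -
  note b = chart_basis(1)[OF c]
  have "range (dual_basis m) \<subseteq> Rays" using chart_gens[OF c] gens_subset_rays by metis
  then show ?thesis
    by (auto simp: Zs_def zc_def inv_f_f[OF inj_dual_basis[OF b]] dest: injD[OF inj_dual_basis[OF b]])
qed

lemma Zs_zc_subset: "(\<sigma>, m) \<in> Ch \<Longrightarrow> Zs (zc m x) \<subseteq> gens \<sigma>"
  using Zs_zc chart_gens by blast

lemma zc_cdom: "(\<sigma>, m) \<in> Ch \<Longrightarrow> zc m x \<in> cdom"
  using Zs_zc_subset chart_basis(2) unfolding cdom_def by blast

text \<open>The Cox coordinates are the values \<open>x (m j)\<close> in a larger chart. For a dual
  vector outside \<open>\<sigma>\<close> both \<open>m j\<close> and \<open>- m j\<close> lie in the
  dual semigroup, so this value is invertible and the zeros stay among the rays of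
  \<open>\<sigma>\<close>.\<close>

lemma aff_surj:
  assumes \<sigma>: "\<sigma> \<in> \<Sigma>" and x: "x \<in> aff \<sigma>"
  shows "\<exists>z. Zs z \<subseteq> gens \<sigma> \<and> x = Xp \<sigma> z"
proof -
  obtain \<sigma>' m where c: "(\<sigma>', m) \<in> Ch" "\<sigma> \<subseteq> \<sigma>'" using chart_above[OF \<sigma>] by blast
  note b = chart_basis(1)[OF c(1)]
  have mem: "m j \<in> dual_semigroup \<sigma>" for j
    using chart_basis_in_dual[OF c(1), of j] c(2) by (auto simp: dual_semigroup_def)
  have mem': "- m j \<in> dual_semigroup \<sigma>" if "dual_basis m j \<notin> gens \<sigma>" for j
    unfolding gens_dual[OF \<sigma>]
  proof
    fix \<rho> assume \<rho>: "\<rho> \<in> gens \<sigma>"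
    then have "\<rho> \<in> gens \<sigma>'" using c(2) by (auto simp: gens_def)
    then obtain i where i: "\<rho> = dual_basis m i" using chart_gens[OF c(1)] by blast
    then have "i \<noteq> j" using \<rho> that by blast
    then show "0 \<le> pair (- m j) \<rho>" using i by (simp add: pair_simps dual_basis_pair[OF b])
  qed
  have x0: "x 0 = 1" using x by (simp add: aff_def)
  have inv: "x (m j) * x (- m j) = 1" if "dual_basis m j \<notin> gens \<sigma>" for j
    using x mem mem'[OF that] x0 by (auto simp: aff_def) (metis add.right_inverse)
  let ?v = "(\<chi> j. x (m j)) :: complex ^ 'n"
  have "Zs (zc m ?v) \<subseteq> gens \<sigma>"
    unfolding Zs_zc[OF c(1)] using inv by force
  moreover have "x = Xp \<sigma> (zc m ?v)"
  proof
    fix k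
    show "x k = Xp \<sigma> (zc m ?v) k"
    proof (cases "k \<in> dual_semigroup \<sigma>")
      case True
      have trm: "pair k (dual_basis m j) *s m j \<in> dual_semigroup \<sigma> \<and>
          x (pair k (dual_basis m j) *s m j) = x (m j) powi pair k (dual_basis m j)" for j
      proof (cases "0 \<le> pair k (dual_basis m j)")
        case True
        then obtain n where "pair k (dual_basis m j) = int n" using nonneg_int_cases by blast
        then show ?thesis using aff_scale[OF x mem] dual_semigroup_scale[OF mem] by simp
      next
        case False
        define n where "n = nat (- pair k (dual_basis m j))"
        have n: "pair k (dual_basis m j) = - int n" using False by (simp add: n_def)
        have ng: "dual_basis m j \<notin> gens \<sigma>" using False True gens_dual[OF \<sigma>] by blast
        have "pair k (dual_basis m j) *s m j = int n *s (- m j)" by (simp add: n vec_eq_iff)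
        then show ?thesis
          using aff_scale[OF x mem'[OF ng], of n] dual_semigroup_scale[OF mem'[OF ng], of n]
            inverse_unique[OF inv[OF ng]]
          by (simp add: n power_int_minus flip: power_inverse)
      qed
      have "x k = x (\<Sum>j\<in>UNIV. pair k (dual_basis m j) *s m j)"
        using lattice_basis_expand[OF b, of k] by simp
      also have "\<dots> = (\<Prod>j\<in>UNIV. x (m j) powi pair k (dual_basis m j))"
        by (subst aff_sum[OF x]) (use trm in auto)
      finally show ?thesis using True by (simp add: Xp_def restr_def ev_zc[OF c(1)] mon_def)
    next
      case False
      then show ?thesis using x by (simp add: Xp_def restr_def aff_def)
    qed
  qed
  ultimately show ?thesis by blast
qed

text \<open>The separator of a single ray detects whether its coordinate vanishes. An exponent that
  is nonnegative on the zero set enters the dual semigroup after adding a multiple of the separator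
  of the remaining rays, whose monomial is nonzero.\<close>

lemma Xp_determines:
  assumes \<tau>: "\<tau> \<in> \<Sigma>" and sub: "Zs z \<subseteq> gens \<tau>" "Zs w \<subseteq> gens \<tau>" and eq: "Xp \<tau> z = Xp \<tau> w"
  shows "Zs z = Zs w" "\<And>k. \<forall>\<rho>\<in>Zs z. 0 \<le> pair k \<rho> \<Longrightarrow> ev z k = ev w k"
proof -
  have eveq: "ev z k = ev w k" if "k \<in> dual_semigroup \<tau>" for k
    using fun_cong[OF eq, of k] that by (simp add: Xp_def restr_def)
  have "\<rho> \<in> Zs z \<longleftrightarrow> \<rho> \<in> Zs w" if "\<rho> \<in> gens \<tau>" for \<rho>
  proof -
    obtain b where b: "b \<in> dual_semigroup \<tau>" "\<forall>\<rho>'\<in>gens \<tau>. pair b \<rho>' = (if \<rho>' \<in> {\<rho>} then 1 else 0)"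
      using separator[OF \<tau>, of "{\<rho>}"] by blast
    have "\<rho> \<in> Zs v \<longleftrightarrow> ev v b = 0" if "Zs v \<subseteq> gens \<tau>" for v
    proof -
      have "ev v b \<noteq> 0 \<longleftrightarrow> (\<forall>\<rho>'\<in>Zs v. \<rho>' \<noteq> \<rho>)"
        unfolding ev_nonzero_iff using b(2) that by (auto simp: subset_iff)
      then show ?thesis by blast
    qed
    then show ?thesis using sub eveq[OF b(1)] by simp
  qed
  then show Z: "Zs z = Zs w" using sub by blast
  fix k assume k: "\<forall>\<rho>\<in>Zs z. 0 \<le> pair k \<rho>"
  obtain b where b: "b \<in> dual_semigroup \<tau>" "\<forall>\<rho>\<in>gens \<tau>. pair b \<rho> = (if \<rho> \<in> gens \<tau> - Zs z then 1 else 0)"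
    using separator[OF \<tau>, of "gens \<tau> - Zs z"] by blast
  define N where "N = nat (\<Sum>\<rho>\<in>gens \<tau>. \<bar>pair k \<rho>\<bar>)"
  let ?b = "int N *s b"
  have N: "\<bar>pair k \<rho>\<bar> \<le> int N" if "\<rho> \<in> gens \<tau>" for \<rho>
    unfolding N_def using member_le_sum[OF that, of "\<lambda>\<rho>. \<bar>pair k \<rho>\<bar>"] finite_gens by simp
  have "k + ?b \<in> dual_semigroup \<tau>"
    unfolding gens_dual[OF \<tau>]
  proof
    fix \<rho> assume \<rho>: "\<rho> \<in> gens \<tau>"
    show "0 \<le> pair (k + ?b) \<rho>"
      using N[OF \<rho>] b(2) \<rho> k by (cases "\<rho> \<in> Zs z") (auto simp: pair_simps)
  qed
  moreover have bz: "\<forall>\<rho>\<in>Zs z. pair ?b \<rho> = 0" using b(2) sub by (auto simp: pair_simps)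
  moreover have "ev z (k + ?b) = ev z k * ev z ?b" "ev w (k + ?b) = ev w k * ev w ?b"
    using k bz Z by (auto intro!: ev_add)
  moreover have "ev z ?b = ev w ?b" by (rule eveq[OF dual_semigroup_scale[OF b(1)]])
  moreover have "ev z ?b \<noteq> 0" using bz ev_nonzero_iff by blast
  ultimately show "ev z k = ev w k" using eveq[of "k + ?b"] by simp
qed

lemma glue_iff:
  "((\<sigma>, x), (\<tau>, y)) \<in> Glue \<longleftrightarrow> \<sigma> \<in> \<Sigma> \<and> \<tau> \<in> \<Sigma> \<and>
     (\<exists>z. Zs z \<subseteq> gens \<sigma> \<inter> gens \<tau> \<and> x = Xp \<sigma> z \<and> y = Xp \<tau> z)"
proof -
  have restr: "restr \<sigma> (Xp (\<sigma> \<inter> \<tau>) z) = Xp \<sigma> z" "restr \<tau> (Xp (\<sigma> \<inter> \<tau>) z) = Xp \<tau> z" for z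
    by (auto simp: Xp_def restr_def dual_semigroup_def fun_eq_iff)
  show ?thesis
  proof
    assume "((\<sigma>, x), (\<tau>, y)) \<in> Glue"
    then obtain v where v: "\<sigma> \<in> \<Sigma>" "\<tau> \<in> \<Sigma>" "v \<in> aff (\<sigma> \<inter> \<tau>)" "restr \<sigma> v = x" "restr \<tau> v = y"
      by (auto simp: glue_def)
    obtain z where "Zs z \<subseteq> gens (\<sigma> \<inter> \<tau>)" "v = Xp (\<sigma> \<inter> \<tau>) z"
      using aff_surj[OF fan_Int[OF v(1,2)] v(3)] by blast
    then show "\<sigma> \<in> \<Sigma> \<and> \<tau> \<in> \<Sigma> \<and> (\<exists>z. Zs z \<subseteq> gens \<sigma> \<inter> gens \<tau> \<and> x = Xp \<sigma> z \<and> y = Xp \<tau> z)"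
      using v restr by (auto simp: gens_Int)
  next
    assume "\<sigma> \<in> \<Sigma> \<and> \<tau> \<in> \<Sigma> \<and> (\<exists>z. Zs z \<subseteq> gens \<sigma> \<inter> gens \<tau> \<and> x = Xp \<sigma> z \<and> y = Xp \<tau> z)"
    then obtain z where z: "\<sigma> \<in> \<Sigma>" "\<tau> \<in> \<Sigma>" "Zs z \<subseteq> gens (\<sigma> \<inter> \<tau>)" "x = Xp \<sigma> z" "y = Xp \<tau> z"
      by (auto simp: gens_Int)
    have "Xp (\<sigma> \<inter> \<tau>) z \<in> aff (\<sigma> \<inter> \<tau>)" by (rule Xp_aff[OF fan_Int[OF z(1,2)] z(3)])
    then show "((\<sigma>, x), (\<tau>, y)) \<in> Glue" unfolding glue_def using z(1,2,4,5) restr[of z] by auto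
  qed
qed

lemma Xp_cong:
  assumes "\<sigma> \<in> \<Sigma>" "Zs z \<subseteq> gens \<sigma>" "\<And>k. \<forall>\<rho>\<in>Zs z. 0 \<le> pair k \<rho> \<Longrightarrow> ev z k = ev w k"
  shows "Xp \<sigma> z = Xp \<sigma> w"
proof
  fix k
  have "ev z k = ev w k" if "k \<in> dual_semigroup \<sigma>"
    using that assms(2) gens_dual[OF assms(1), of k] by (intro assms(3)) blast
  then show "Xp \<sigma> z k = Xp \<sigma> w k" by (simp add: Xp_def restr_def)
qed

lemma glue_class:
  assumes \<sigma>: "\<sigma> \<in> \<Sigma>" and z: "Zs z \<subseteq> gens \<sigma>"
  shows "Glue `` {(\<sigma>, Xp \<sigma> z)} = cox z"
proof (intro equalityI subsetI)
  fix p assume "p \<in> Glue `` {(\<sigma>, Xp \<sigma> z)}"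
  then obtain \<tau> y where p: "p = (\<tau>, y)" and "((\<sigma>, Xp \<sigma> z), (\<tau>, y)) \<in> Glue" by (cases p) auto
  then obtain w where w: "\<tau> \<in> \<Sigma>" "Zs w \<subseteq> gens \<sigma> \<inter> gens \<tau>" "Xp \<sigma> z = Xp \<sigma> w" "y = Xp \<tau> w"
    unfolding glue_iff by blast
  note D = Xp_determines[OF \<sigma> z _ w(3)]
  have Z: "Zs z = Zs w" using D(1) w(2) by blast
  have "Xp \<tau> z = Xp \<tau> w"
    by (rule Xp_cong[OF w(1)]) (use D(2) w(2) Z in auto)
  then show "p \<in> cox z" using p w Z by (auto simp: cox_def)
next
  fix p assume "p \<in> cox z"
  then obtain \<tau> where \<tau>: "p = (\<tau>, Xp \<tau> z)" "\<tau> \<in> \<Sigma>" "Zs z \<subseteq> gens \<tau>" by (auto simp: cox_def)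
  have "((\<sigma>, Xp \<sigma> z), (\<tau>, Xp \<tau> z)) \<in> Glue"
    unfolding glue_iff using \<sigma> z \<tau>(2,3) by (intro conjI exI[of _ z]) auto
  then show "p \<in> Glue `` {(\<sigma>, Xp \<sigma> z)}" using \<tau>(1) by simp
qed

lemma toric_variety_eq: "TV = cox ` cdom"
proof (intro equalityI subsetI)
  fix P assume "P \<in> TV"
  then obtain \<sigma> x where P: "\<sigma> \<in> \<Sigma>" "x \<in> aff \<sigma>" "P = Glue `` {(\<sigma>, x)}"
    unfolding toric_variety_def by (auto elim!: quotientE)
  then obtain z where z: "Zs z \<subseteq> gens \<sigma>" "x = Xp \<sigma> z" using aff_surj by blast
  then have "P = cox z" using P glue_class by simp
  then show "P \<in> cox ` cdom" using z P(1) by (auto simp: cdom_def)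
next
  fix P assume "P \<in> cox ` cdom"
  then obtain z \<sigma> where z: "P = cox z" "\<sigma> \<in> \<Sigma>" "Zs z \<subseteq> gens \<sigma>" by (auto simp: cdom_def)
  have "Glue `` {(\<sigma>, Xp \<sigma> z)} \<in> TV"
    unfolding toric_variety_def by (rule quotientI) (use z Xp_aff in auto)
  then show "P \<in> TV" using glue_class[OF z(2,3)] z(1) by simp
qed

lemma cox_in: "z \<in> cdom \<Longrightarrow> cox z \<in> TV"
  by (simp add: toric_variety_eq)

lemma U_cox_iff: "z \<in> cdom \<Longrightarrow> cox z \<in> Aff \<sigma> \<longleftrightarrow> \<sigma> \<in> \<Sigma> \<and> Zs z \<subseteq> gens \<sigma>"
  using cox_in by (auto simp: U_def cox_def)

lemma chi_cox:
  assumes "\<sigma> \<in> \<Sigma>" "Zs z \<subseteq> gens \<sigma>"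
  shows "chi \<sigma> k (cox z) = Xp \<sigma> z k"
proof -
  have "(THE x. (\<sigma>, x) \<in> cox z) = Xp \<sigma> z"
    by (rule the_equality) (use assms in \<open>auto simp: cox_def\<close>)
  then show ?thesis by (simp add: chi_def)
qed

lemma chi_cox_ev:
  assumes "\<sigma> \<in> \<Sigma>" "Zs z \<subseteq> gens \<sigma>" "k \<in> dual_semigroup \<sigma>"
  shows "chi \<sigma> k (cox z) = ev z k"
  using chi_cox assms by (simp add: Xp_def restr_def)

text \<open>Equality of points is tested by the zero set and the monomials regular along it; this
  replaces orbits of the group by which the Cox quotient is taken.\<close>

lemma cox_eq_iff:
  assumes "z \<in> cdom"
  shows "cox z = cox w \<longleftrightarrow> Zs z = Zs w \<and> (\<forall>k. (\<forall>\<rho>\<in>Zs z. 0 \<le> pair k \<rho>) \<longrightarrow> ev z k = ev w k)"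
proof
  assume eq: "cox z = cox w"
  obtain \<sigma> where \<sigma>: "\<sigma> \<in> \<Sigma>" "Zs z \<subseteq> gens \<sigma>" using assms by (auto simp: cdom_def)
  then have "(\<sigma>, Xp \<sigma> z) \<in> cox w" unfolding eq[symmetric] by (auto simp: cox_def)
  then have w: "Zs w \<subseteq> gens \<sigma>" "Xp \<sigma> z = Xp \<sigma> w" by (auto simp: cox_def)
  show "Zs z = Zs w \<and> (\<forall>k. (\<forall>\<rho>\<in>Zs z. 0 \<le> pair k \<rho>) \<longrightarrow> ev z k = ev w k)"
    using Xp_determines[OF \<sigma> w] by blast
next
  assume a: "Zs z = Zs w \<and> (\<forall>k. (\<forall>\<rho>\<in>Zs z. 0 \<le> pair k \<rho>) \<longrightarrow> ev z k = ev w k)"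
  have "Xp \<sigma> z = Xp \<sigma> w" if "\<sigma> \<in> \<Sigma>" "Zs z \<subseteq> gens \<sigma>" for \<sigma>
    by (rule Xp_cong[OF that]) (use a in blast)
  then show "cox z = cox w" using a by (auto simp: cox_def)
qed

section \<open>Charts in Cox coordinates\<close>

lemma pt_in_chart:
  assumes c: "(\<sigma>, m) \<in> Ch"
  shows "pt m x \<in> Dom (\<sigma>, m)"
  unfolding dom_chart_def pt_def using U_cox_iff[OF zc_cdom[OF c]] Zs_zc_subset[OF c] chart_basis(2)[OF c]
  by simp

lemma pt_in: "(\<sigma>, m) \<in> Ch \<Longrightarrow> pt m x \<in> TV"
  unfolding pt_def by (rule cox_in[OF zc_cdom])

lemma coords_cox:
  assumes c: "(\<sigma>, m) \<in> Ch" and "Zs z \<subseteq> gens \<sigma>"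
  shows "coords (\<sigma>, m) (cox z) = (\<chi> j. ev z (m j))"
  unfolding coords_def using chi_cox_ev[OF chart_basis(2)[OF c] assms(2) chart_basis_in_dual[OF c]] by simp

lemma coords_pt:
  assumes c: "(\<sigma>, m) \<in> Ch"
  shows "coords (\<sigma>, m) (pt m x) = x"
  unfolding pt_def coords_cox[OF c Zs_zc_subset[OF c]] ev_zc[OF c]
  by (simp add: mon_basis[OF chart_basis(1)[OF c]] vec_eq_iff)

lemma ev_prod:
  assumes "lattice_basis m" "\<And>j. \<forall>\<rho>\<in>Zs z. 0 \<le> pair k (dual_basis m j) * pair (m j) \<rho>"
    "\<And>j. pair k (dual_basis m j) < 0 \<Longrightarrow> \<forall>\<rho>\<in>Zs z. pair (m j) \<rho> = 0"
  shows "ev z k = (\<Prod>j\<in>UNIV. ev z (m j) powi pair k (dual_basis m j))"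
proof -
  have sum: "ev z (\<Sum>j\<in>J. pair k (dual_basis m j) *s m j) = (\<Prod>j\<in>J. ev z (pair k (dual_basis m j) *s m j))"
    if "finite J" for J
    using that
  proof (induction J rule: finite_induct)
    case (insert j J)
    have "ev z (pair k (dual_basis m j) *s m j + (\<Sum>j\<in>J. pair k (dual_basis m j) *s m j)) =
        ev z (pair k (dual_basis m j) *s m j) * ev z (\<Sum>j\<in>J. pair k (dual_basis m j) *s m j)"
      by (rule ev_add) (use assms(2) in \<open>auto simp: pair_simps intro!: sum_nonneg\<close>)
    then show ?case using insert by simp
  qed simp
  have "ev z (pair k (dual_basis m j) *s m j) = ev z (m j) powi pair k (dual_basis m j)" for j
    unfolding ev_def prod_power_int_distrib pair_scale_left
    by (intro prod.cong refl) (simp add: mult.commute[of "pair k _"] power_int_mult)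
  then show ?thesis using sum[of UNIV] lattice_basis_expand[OF assms(1), of k] by simp
qed

lemma pt_coords:
  assumes c: "(\<sigma>, m) \<in> Ch" and P: "P \<in> Dom (\<sigma>, m)"
  shows "pt m (coords (\<sigma>, m) P) = P"
proof -
  note b = chart_basis(1)[OF c]
  have "P \<in> TV" using P by (simp add: dom_chart_def U_def)
  then obtain z where z: "z \<in> cdom" "P = cox z" using toric_variety_eq by blast
  then have Z: "Zs z \<subseteq> gens \<sigma>" using P U_cox_iff[OF z(1)] by (simp add: dom_chart_def)
  let ?x = "\<chi> j. ev z (m j)"
  have Xeq: "Xp \<sigma> z = Xp \<sigma> (zc m ?x)"
  proof
    fix k
    show "Xp \<sigma> z k = Xp \<sigma> (zc m ?x) k"
    proof (cases "k \<in> dual_semigroup \<sigma>")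
      case True
      then have nn: "0 \<le> pair k (dual_basis m j)" for j using chart_dual_iff[OF c] by blast
      have mn: "0 \<le> pair (m j) \<rho>" if "\<rho> \<in> Zs z" for j \<rho>
        using that Z chart_basis_in_dual[OF c, of j] gens_dual[OF chart_basis(2)[OF c]] by blast
      have "ev z k = (\<Prod>j\<in>UNIV. ev z (m j) powi pair k (dual_basis m j))"
      proof (rule ev_prod[OF b])
        fix j assume "pair k (dual_basis m j) < 0"
        then show "\<forall>\<rho>\<in>Zs z. pair (m j) \<rho> = 0" using nn[of j] by simp
      qed (use nn mn in simp)
      then show ?thesis using True by (simp add: Xp_def restr_def ev_zc[OF c] mon_def)
    qed (simp add: Xp_def restr_def)
  qed
  have "cox z = cox (zc m ?x)"
    unfolding cox_eq_iff[OF z(1)]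
    using Xp_determines[OF chart_basis(2)[OF c] Z Zs_zc_subset[OF c] Xeq] by blast
  then show ?thesis using z(2) coords_cox[OF c Z] by (simp add: pt_def)
qed

lemma point_of_eq:
  assumes c: "(\<sigma>, m) \<in> Ch"
  shows "point_of \<Sigma> (\<sigma>, m) x = pt m x"
  unfolding point_of_def
  by (rule the_equality) (use pt_in_chart[OF c] coords_pt[OF c] pt_coords[OF c] in auto)

lemma dom_chart_eq: "(\<sigma>, m) \<in> Ch \<Longrightarrow> Dom (\<sigma>, m) = range (pt m)"
  using pt_in_chart pt_coords by (auto intro: rev_image_eqI) (metis rangeI)

lemma pt_in_U_iff:
  assumes c: "(\<sigma>, m) \<in> Ch"
  shows "pt m x \<in> Aff \<tau> \<longleftrightarrow> \<tau> \<in> \<Sigma> \<and> (\<forall>j. x $ j = 0 \<longrightarrow> dual_basis m j \<in> gens \<tau>)"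
  unfolding pt_def U_cox_iff[OF zc_cdom[OF c]] Zs_zc[OF c] by blast

lemma chi_pt:
  assumes c: "(\<sigma>, m) \<in> Ch" and "pt m x \<in> Aff \<tau>" "k \<in> dual_semigroup \<tau>"
  shows "chi \<tau> k (pt m x) = mon m x k"
  using assms(2) chi_cox_ev[of \<tau> "zc m x" k] assms(3) U_cox_iff[OF zc_cdom[OF c]] ev_zc[OF c]
  unfolding pt_def by simp

lemma in_some_chart:
  assumes "P \<in> TV"
  shows "\<exists>\<sigma> m. (\<sigma>, m) \<in> Ch \<and> P \<in> Dom (\<sigma>, m)"
proof -
  obtain z where z: "z \<in> cdom" "P = cox z" using assms toric_variety_eq by blast
  then obtain \<tau> where \<tau>: "\<tau> \<in> \<Sigma>" "Zs z \<subseteq> gens \<tau>" by (auto simp: cdom_def)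
  obtain \<sigma> m where c: "(\<sigma>, m) \<in> Ch" "\<tau> \<subseteq> \<sigma>" using chart_above[OF \<tau>(1)] by blast
  then have "Zs z \<subseteq> gens \<sigma>" using \<tau>(2) by (auto simp: gens_def)
  then have "P \<in> Dom (\<sigma>, m)" using U_cox_iff[OF z(1)] z(2) chart_basis(2)[OF c(1)] by (simp add: dom_chart_def)
  then show ?thesis using c(1) by blast
qed

lemma dom_chart_subset: "Dom c \<subseteq> TV"
  by (auto simp: dom_chart_def U_def)

end

section \<open>Topology and one-parameter subgroups\<close>

lemma continuous_on_mon:
  assumes "\<And>j. 0 \<le> pair k (dual_basis m j)"
  shows "continuous_on S (\<lambda>x. mon m x k)"
  unfolding mon_def power_int_def using assms by (auto intro!: continuous_intros)

lemma openin_top_Y: "openin (top_Y \<Sigma>) = open_in_Y \<Sigma>"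
  unfolding top_Y_def by (rule topology_inverse'[OF istopology_open_in_Y])

lemma AutD:
  assumes "g \<in> Aut \<Sigma>"
  shows "g permutes toric_variety \<Sigma>" "morphism \<Sigma> g" "morphism \<Sigma> (inv g)" "bij g"
    "\<And>P. g P \<in> toric_variety \<Sigma> \<longleftrightarrow> P \<in> toric_variety \<Sigma>" "inv g \<in> Aut \<Sigma>"
  using assms permutes_inv[of g] permutes_bij[of g] inv_inv_eq[of g] permutes_in_image[of g "toric_variety \<Sigma>"]
  by (auto simp: Aut_def)

lemma openin_top_Aut:
  assumes "compactin (top_Y \<Sigma>) K" "openin (top_Y \<Sigma>) W"
  shows "openin (top_Aut \<Sigma>) {g \<in> Aut \<Sigma>. g ` K \<subseteq> W}"
  unfolding top_Aut_def by (rule topology_generated_by_Basis) (use assms in blast)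

lemma topspace_top_Aut: "topspace (top_Aut \<Sigma>) = Aut \<Sigma>"
proof
  show "topspace (top_Aut \<Sigma>) \<subseteq> Aut \<Sigma>"
    unfolding top_Aut_def topology_generated_by_topspace by blast
  show "Aut \<Sigma> \<subseteq> topspace (top_Aut \<Sigma>)"
    using openin_subset[OF openin_top_Aut[of \<Sigma> "{}" "{}"]] by simp
qed

lemma idempotent_bij_eq_id:
  assumes "bij f" "f \<circ> f = f"
  shows "f = id"
proof
  fix x
  have "f (f x) = f x" using fun_cong[OF assms(2), of x] by simp
  then show "f x = id x" using injD[OF bij_is_inj[OF assms(1)]] by simp
qed

lemma lie_algebraD:
  assumes "\<gamma> \<in> lie_algebra \<Sigma> (Aut0 \<Sigma>)"
  shows "\<gamma> t \<in> Aut \<Sigma>" "\<gamma> 0 = id" "inv (\<gamma> t) = \<gamma> (- t)" "\<gamma> (s + t) = \<gamma> s \<circ> \<gamma> t"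
    "continuous_map euclideanreal (top_Aut \<Sigma>) \<gamma>"
proof -
  have c: "continuous_map euclideanreal (subtopology (top_Aut \<Sigma>) (Aut0 \<Sigma>)) \<gamma>"
    and add: "\<And>s t. \<gamma> (s + t) = \<gamma> s \<circ> \<gamma> t"
    using assms by (auto simp: lie_algebra_def)
  show cont: "continuous_map euclideanreal (top_Aut \<Sigma>) \<gamma>"
    using c by (simp add: continuous_map_in_subtopology)
  then have aut: "\<gamma> t \<in> Aut \<Sigma>" for t
    using continuous_map_image_subset_topspace[OF cont] topspace_top_Aut by fastforce
  show "\<gamma> t \<in> Aut \<Sigma>" by (rule aut)
  show "\<gamma> (s + t) = \<gamma> s \<circ> \<gamma> t" by (rule add)
  have "\<gamma> 0 \<circ> \<gamma> 0 = \<gamma> 0" using add[of 0 0] by simp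
  then show z: "\<gamma> 0 = id"
    by (rule idempotent_bij_eq_id[OF AutD(4)[OF aut[of 0]]])
  have "\<gamma> t \<circ> \<gamma> (- t) = \<gamma> (t + - t)" by (rule add[symmetric])
  then have inverse: "\<gamma> t \<circ> \<gamma> (- t) = id" by (simp only: add.right_inverse z)
  show "inv (\<gamma> t) = \<gamma> (- t)"
  proof
    fix P
    have "\<gamma> t (\<gamma> (- t) P) = P" using fun_cong[OF inverse, of P] by (simp only: comp_apply id_apply)
    then show "inv (\<gamma> t) P = \<gamma> (- t) P" by (rule inv_f_eq[OF bij_is_inj[OF AutD(4)[OF aut[of t]]]])
  qed
qed

lemma lie_algebra_eventually:
  assumes \<gamma>: "\<gamma> \<in> lie_algebra \<Sigma> (Aut0 \<Sigma>)"
    and K: "compactin (top_Y \<Sigma>) K" and W: "openin (top_Y \<Sigma>) W" and "K \<subseteq> W"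
  shows "\<forall>\<^sub>F t in nhds 0. \<gamma> t ` K \<subseteq> W"
proof -
  have *: "openin euclideanreal {t \<in> topspace euclideanreal. \<gamma> t \<in> {g \<in> Aut \<Sigma>. g ` K \<subseteq> W}}"
    by (rule openin_continuous_map_preimage[OF lie_algebraD(5)[OF \<gamma>] openin_top_Aut[OF K W]])
  have "{t \<in> topspace euclideanreal. \<gamma> t \<in> {g \<in> Aut \<Sigma>. g ` K \<subseteq> W}} = {t. \<gamma> t ` K \<subseteq> W}"
    using lie_algebraD(1)[OF \<gamma>] by auto
  from *[unfolded this] have "open {t. \<gamma> t ` K \<subseteq> W}" by (simp only: open_openin)
  moreover have "0 \<in> {t. \<gamma> t ` K \<subseteq> W}" using lie_algebraD(2)[OF \<gamma>] assms(4) by simp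
  ultimately have "\<forall>\<^sub>F t in nhds 0. t \<in> {t. \<gamma> t ` K \<subseteq> W}" by (rule eventually_nhds_in_open)
  then show ?thesis by simp
qed

section \<open>The classical topology in charts\<close>

context smooth_complete_fan
begin

lemma topspace_top_Y: "topspace TopY = TV"
proof
  show "topspace TopY \<subseteq> TV"
    using openin_topspace[of "TopY"] unfolding openin_top_Y open_in_Y_def by blast
  have "{x \<in> aff \<sigma>. Glue `` {(\<sigma>, x)} \<in> TV} = aff \<sigma>" if "\<sigma> \<in> \<Sigma>" for \<sigma>
    using that unfolding toric_variety_def by (auto intro!: quotientI)
  then have "openin TopY TV" unfolding openin_top_Y open_in_Y_def by simp
  then show "TV \<subseteq> topspace TopY" by (rule openin_subset)
qed

lemma continuous_on_Xp_zc:
  assumes c: "(\<sigma>, m) \<in> Ch"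
  shows "continuous_on S (\<lambda>x. Xp \<sigma> (zc m x))"
proof (rule continuous_on_coordinatewise_then_product)
  fix k
  show "continuous_on S (\<lambda>x. Xp \<sigma> (zc m x) k)"
  proof (cases "k \<in> dual_semigroup \<sigma>")
    case True
    then show ?thesis
      using continuous_on_mon[of k m S] chart_dual_iff[OF c] by (simp add: Xp_def restr_def ev_zc[OF c])
  qed (simp add: Xp_def restr_def)
qed

lemma open_pt_vimage:
  assumes c: "(\<sigma>, m) \<in> Ch" and W: "openin TopY W"
  shows "open {x. pt m x \<in> W}"
proof -
  note \<sigma> = chart_basis(2)[OF c]
  have "openin (top_of_set (aff \<sigma>)) {y \<in> aff \<sigma>. Glue `` {(\<sigma>, y)} \<in> W}"
    using W \<sigma> unfolding openin_top_Y open_in_Y_def by blast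
  then obtain V where V: "open V" "{y \<in> aff \<sigma>. Glue `` {(\<sigma>, y)} \<in> W} = aff \<sigma> \<inter> V"
    unfolding openin_open by blast
  have "{x. pt m x \<in> W} = (\<lambda>x. Xp \<sigma> (zc m x)) -` V"
  proof (intro set_eqI)
    fix x
    have "Xp \<sigma> (zc m x) \<in> aff \<sigma>" by (rule Xp_aff[OF \<sigma> Zs_zc_subset[OF c]])
    moreover have "Glue `` {(\<sigma>, Xp \<sigma> (zc m x))} = pt m x"
      unfolding pt_def by (rule glue_class[OF \<sigma> Zs_zc_subset[OF c]])
    moreover have "Xp \<sigma> (zc m x) \<in> {y \<in> aff \<sigma>. Glue `` {(\<sigma>, y)} \<in> W} \<longleftrightarrow>
        Xp \<sigma> (zc m x) \<in> aff \<sigma> \<inter> V" unfolding V(2) ..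
    ultimately show "x \<in> {x. pt m x \<in> W} \<longleftrightarrow> x \<in> (\<lambda>x. Xp \<sigma> (zc m x)) -` V"
      by simp
  qed
  then show ?thesis using open_vimage[OF V(1) continuous_on_Xp_zc[OF c]] by simp
qed

text \<open>On the affine piece of \<open>\<tau>\<close>, the points of the chart are those where
  one monomial \<open>b'\<close> is nonzero, and the coordinates of the chart are quotients with
  denominator \<open>b'\<close>.\<close>

lemma openin_pt_image:
  assumes c: "(\<sigma>, m) \<in> Ch" and O': "open B"
  shows "openin TopY (pt m ` B)"
  unfolding openin_top_Y open_in_Y_def
proof (intro conjI ballI)
  show "pt m ` B \<subseteq> TV" using pt_in[OF c] by blast
  fix \<tau> assume \<tau>: "\<tau> \<in> \<Sigma>"
  note \<sigma> = chart_basis(2)[OF c]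
  obtain b where b: "b \<in> dual_semigroup \<tau>" "\<forall>\<rho>\<in>gens \<tau>. pair b \<rho> = (if \<rho> \<in> gens \<tau> - gens \<sigma> then 1 else 0)"
    using separator[OF \<tau>, of "gens \<tau> - gens \<sigma>"] by blast
  \<comment> \<open>Large enough that \<open>m j + b'\<close> is nonnegative on the rays of
    \<open>\<tau>\<close>; the summand 1 makes \<open>b'\<close> positive on every ray of
    \<open>\<tau>\<close> outside \<open>\<sigma>\<close>.\<close>
  define N where "N = nat (1 + (\<Sum>\<rho>\<in>gens \<tau>. \<Sum>j\<in>UNIV. \<bar>pair (m j) \<rho>\<bar>))"
  have Npos: "int N > 0" unfolding N_def by (simp add: sum_nonneg add_pos_nonneg)
  define b' where "b' = int N *s b"
  have b'1: "b' \<in> dual_semigroup \<tau>" unfolding b'_def by (rule dual_semigroup_scale[OF b(1)])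
  have N: "\<bar>pair (m j) \<rho>\<bar> \<le> int N" if "\<rho> \<in> gens \<tau>" for \<rho> j
  proof -
    have "\<bar>pair (m j) \<rho>\<bar> \<le> (\<Sum>j\<in>UNIV. \<bar>pair (m j) \<rho>\<bar>)"
      by (rule member_le_sum) auto
    also have "\<dots> \<le> (\<Sum>\<rho>\<in>gens \<tau>. \<Sum>j\<in>UNIV. \<bar>pair (m j) \<rho>\<bar>)"
      using that finite_gens by (intro member_le_sum[of \<rho>]) (auto intro: sum_nonneg)
    finally show ?thesis unfolding N_def by simp
  qed
  have b'2: "m j + b' \<in> dual_semigroup \<tau>" for j
    unfolding gens_dual[OF \<tau>]
  proof
    fix \<rho> assume \<rho>: "\<rho> \<in> gens \<tau>"
    show "0 \<le> pair (m j + b') \<rho>"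
    proof (cases "\<rho> \<in> gens \<sigma>")
      case True
      then have "0 \<le> pair (m j) \<rho>" using chart_basis_in_dual[OF c, of j] gens_dual[OF \<sigma>] by blast
      then show ?thesis using b(2) \<rho> True by (simp add: b'_def pair_simps)
    next
      case False
      then show ?thesis using b(2) \<rho> N[OF \<rho>, of j] by (simp add: b'_def pair_simps abs_le_iff)
    qed
  qed
  let ?g = "\<lambda>y. (\<chi> j. y (m j + b') / y b') :: complex ^ 'n"
  have key: "Glue `` {(\<tau>, y)} \<in> pt m ` B \<longleftrightarrow> y b' \<noteq> 0 \<and> ?g y \<in> B" if y: "y \<in> aff \<tau>" for y
  proof -
    obtain z where z: "Zs z \<subseteq> gens \<tau>" "y = Xp \<tau> z" using aff_surj[OF \<tau> y] by blast
    have zd: "z \<in> cdom" using z(1) \<tau> by (auto simp: cdom_def)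
    have cl: "Glue `` {(\<tau>, y)} = cox z" unfolding z(2) by (rule glue_class[OF \<tau> z(1)])
    have nz: "y b' \<noteq> 0 \<longleftrightarrow> Zs z \<subseteq> gens \<sigma>"
    proof -
      have "y b' = ev z b'" using b'1 by (simp add: z(2) Xp_def restr_def)
      then have "y b' \<noteq> 0 \<longleftrightarrow> (\<forall>\<rho>\<in>Zs z. pair b' \<rho> = 0)" using ev_nonzero_iff by simp
      also have "\<dots> \<longleftrightarrow> Zs z \<subseteq> gens \<sigma>"
        using z(1) b(2) Npos by (auto simp: b'_def pair_simps subset_iff)
      finally show ?thesis .
    qed
    have g: "?g y = (\<chi> j. ev z (m j))" if Z: "Zs z \<subseteq> gens \<sigma>"
    proof -
      have "ev z (m j + b') = ev z (m j) * ev z b'" for j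
      proof (rule ev_add, intro ballI conjI)
        fix \<rho> assume "\<rho> \<in> Zs z"
        then show "0 \<le> pair (m j) \<rho>" "0 \<le> pair b' \<rho>"
          using Z z(1) chart_basis_in_dual[OF c, of j] gens_dual[OF \<sigma>] b'1 gens_dual[OF \<tau>] by blast+
      qed
      moreover have "y (m j + b') = ev z (m j + b')" "y b' = ev z b'" for j
        using b'1 b'2 by (simp_all add: z(2) Xp_def restr_def)
      ultimately show ?thesis using nz Z by (simp add: vec_eq_iff)
    qed
    have "cox z \<in> pt m ` B \<longleftrightarrow> Zs z \<subseteq> gens \<sigma> \<and> (\<chi> j. ev z (m j)) \<in> B"
    proof
      assume "cox z \<in> pt m ` B"
      then obtain x where x: "x \<in> B" "cox z = pt m x" by blast
      then have Z: "Zs z \<subseteq> gens \<sigma>"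
        using pt_in_chart[OF c, of x] U_cox_iff[OF zd] by (simp add: dom_chart_def)
      then show "Zs z \<subseteq> gens \<sigma> \<and> (\<chi> j. ev z (m j)) \<in> B"
        using coords_cox[OF c Z] coords_pt[OF c, of x] x by simp
    next
      assume a: "Zs z \<subseteq> gens \<sigma> \<and> (\<chi> j. ev z (m j)) \<in> B"
      then have "cox z \<in> Dom (\<sigma>, m)" using U_cox_iff[OF zd] \<sigma> by (simp add: dom_chart_def)
      from pt_coords[OF c this] show "cox z \<in> pt m ` B"
        using a coords_cox[OF c] by (metis image_eqI)
    qed
    then show ?thesis using cl nz g by auto
  qed
  have cont: "continuous_on {y. y b' \<noteq> 0} ?g"
    by (intro continuous_on_vec_lambda continuous_on_divide continuous_on_product_coordinates
        continuous_on_subset[OF continuous_on_product_coordinates]) auto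
  have "open {y :: 'n lattice \<Rightarrow> complex. y b' \<noteq> 0}"
  proof -
    have "{y :: 'n lattice \<Rightarrow> complex. y b' \<noteq> 0} = (\<lambda>y. y b') -` (- {0})" by auto
    then show ?thesis by (simp add: open_vimage open_Compl continuous_on_product_coordinates)
  qed
  then have "open ({y. y b' \<noteq> 0} \<inter> ?g -` B)" by (rule continuous_open_preimage[OF cont _ O'])
  moreover have "{y \<in> aff \<tau>. Glue `` {(\<tau>, y)} \<in> pt m ` B} = aff \<tau> \<inter> ({y. y b' \<noteq> 0} \<inter> ?g -` B)"
    using key by auto
  ultimately show "openin (top_of_set (aff \<tau>)) {y \<in> aff \<tau>. Glue `` {(\<tau>, y)} \<in> pt m ` B}"
    unfolding openin_open by blast
qed

lemma compactin_pt_image: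
  assumes c: "(\<sigma>, m) \<in> Ch" and K: "compact K"
  shows "compactin TopY (pt m ` K)"
proof (rule image_compactin)
  show "compactin euclidean K" using K by simp
  show "continuous_map euclidean TopY (pt m)"
    unfolding continuous_map_def
  proof (intro conjI allI impI)
    show "pt m \<in> topspace euclidean \<rightarrow> topspace TopY" using pt_in[OF c] topspace_top_Y by simp
    fix W assume "openin TopY W"
    then show "openin euclidean {x \<in> topspace euclidean. pt m x \<in> W}"
      using open_pt_vimage[OF c] by simp
  qed
qed

text \<open>For small t each closed ball of radius e/3 is mapped into the ball of radius e/2 with
  the same centre. Finitely many balls cover \<open>K\<close>, and 1/2 + 1/3 < 1.\<close>

lemma lie_algebra_uniform:
  assumes \<gamma>: "\<gamma> \<in> LieAut" and c: "(\<sigma>, m) \<in> Ch" and K: "compact K" and e: "e > 0"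
  shows "\<forall>\<^sub>F t in nhds 0. \<forall>x\<in>K. \<gamma> t (pt m x) \<in> Dom (\<sigma>, m) \<and>
    dist (coords (\<sigma>, m) (\<gamma> t (pt m x))) x < e"
proof -
  obtain A where A: "finite A" "A \<subseteq> K" "K \<subseteq> (\<Union>a\<in>A. ball a (e/3))"
  proof (rule compactE_image[OF K, of K "\<lambda>a. ball a (e/3)"])
    show "K \<subseteq> (\<Union>a\<in>K. ball a (e/3))" using e by force
  qed auto
  have "\<forall>\<^sub>F t in nhds 0. \<gamma> t ` (pt m ` cball a (e/3)) \<subseteq> pt m ` ball a (e/2)" for a
  proof (rule lie_algebra_eventually[OF \<gamma> compactin_pt_image[OF c] openin_pt_image[OF c]])
    have "cball a (e/3) \<subseteq> ball a (e/2)" using e by auto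
    then show "pt m ` cball a (e/3) \<subseteq> pt m ` ball a (e/2)" by blast
  qed auto
  then have "\<forall>\<^sub>F t in nhds 0. \<forall>a\<in>A. \<gamma> t ` (pt m ` cball a (e/3)) \<subseteq> pt m ` ball a (e/2)"
    using A(1) by (simp add: eventually_ball_finite)
  then show ?thesis
  proof eventually_elim
    case (elim t)
    show ?case
    proof
      fix x assume "x \<in> K"
      then obtain a where a: "a \<in> A" "x \<in> ball a (e/3)" using A(3) by blast
      then have "\<gamma> t (pt m x) \<in> \<gamma> t ` (pt m ` cball a (e/3))" by auto
      then obtain y where y: "\<gamma> t (pt m x) = pt m y" "y \<in> ball a (e/2)" using elim a(1) by blast
      have "dist y x \<le> dist y a + dist a x" by (rule dist_triangle)
      also have "\<dots> < e" using y(2) a(2) e by (simp add: dist_commute)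
      finally show "\<gamma> t (pt m x) \<in> Dom (\<sigma>, m) \<and> dist (coords (\<sigma>, m) (\<gamma> t (pt m x))) x < e"
        using y(1) pt_in_chart[OF c] coords_pt[OF c] by simp
    qed
  qed
qed

text \<open>Joint continuity in time and point gives, by compactness of \<open>K\<close>, continuity
  into the compact-open topology. The range is then connected and contains \<open>id\<close>, so it
  lies in the identity component.\<close>

lemma lie_algebraI:
  assumes aut: "\<And>t. \<gamma> t \<in> AutY" and add: "\<And>s t. \<gamma> (s + t) = \<gamma> s \<circ> \<gamma> t"
    and op: "\<And>\<sigma> m W. (\<sigma>, m) \<in> Ch \<Longrightarrow> openin TopY W \<Longrightarrow>
      open {(t :: real, x). \<gamma> t (pt m x) \<in> W}"
  shows "\<gamma> \<in> LieAut"
proof -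
  have "open {t. \<gamma> t ` K \<subseteq> W}" if K: "compactin TopY K" and W: "openin TopY W" for K W
  proof (subst open_subopen, intro ballI)
    fix t0 assume t0: "t0 \<in> {t. \<gamma> t ` K \<subseteq> W}"
    have "\<exists>T N. open T \<and> t0 \<in> T \<and> openin TopY N \<and> P \<in> N \<and> (\<forall>t\<in>T. \<gamma> t ` N \<subseteq> W)" if P: "P \<in> K" for P
    proof -
      have "P \<in> TV" using P K topspace_top_Y by (auto simp: compactin_def)
      then obtain \<sigma> m where c: "(\<sigma>, m) \<in> Ch" "P \<in> Dom (\<sigma>, m)" using in_some_chart by blast
      then obtain x where x: "P = pt m x" using pt_coords[OF c] by metis
      have "(t0, x) \<in> {(t, x). \<gamma> t (pt m x) \<in> W}" using t0 P x by auto
      with op[OF c(1) W] obtain T B where TB: "open T" "open B" "(t0, x) \<in> T \<times> B"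
        "T \<times> B \<subseteq> {(t, x). \<gamma> t (pt m x) \<in> W}" by (rule open_prod_elim)
      have "P \<in> pt m ` B" using TB(3) x by blast
      moreover have "\<forall>t\<in>T. \<gamma> t ` (pt m ` B) \<subseteq> W" using TB(4) by auto
      ultimately show ?thesis using TB(1,3) openin_pt_image[OF c(1) TB(2)] by blast
    qed
    then obtain T N where TN: "\<And>P. P \<in> K \<Longrightarrow> open (T P) \<and> t0 \<in> T P \<and> openin TopY (N P) \<and> P \<in> N P \<and>
        (\<forall>t\<in>T P. \<gamma> t ` N P \<subseteq> W)" by metis
    have "\<exists>F. finite F \<and> F \<subseteq> N ` K \<and> K \<subseteq> \<Union>F"
      using K TN unfolding compactin_def by (elim conjE allE[of _ "N ` K"]) blast
    then obtain A where A: "finite A" "A \<subseteq> K" "K \<subseteq> \<Union>(N ` A)"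
      by (metis finite_subset_image)
    have "open (\<Inter>(T ` A))" using A TN by (intro open_INT) auto
    moreover have "t0 \<in> \<Inter>(T ` A)" using A TN by blast
    moreover have "\<Inter>(T ` A) \<subseteq> {t. \<gamma> t ` K \<subseteq> W}"
    proof
      fix t assume t: "t \<in> \<Inter>(T ` A)"
      have "\<gamma> t P \<in> W" if PK: "P \<in> K" for P
      proof -
        obtain Q where "Q \<in> A" "P \<in> N Q" using A(3) PK by blast
        then show ?thesis using TN[of Q] A(2) t by blast
      qed
      then show "t \<in> {t. \<gamma> t ` K \<subseteq> W}" by blast
    qed
    ultimately show "\<exists>T. open T \<and> t0 \<in> T \<and> T \<subseteq> {t. \<gamma> t ` K \<subseteq> W}" by blast
  qed
  then have cont: "continuous_map euclideanreal (top_Aut \<Sigma>) \<gamma>"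
    unfolding top_Aut_def
  proof (intro continuous_on_generated_topo)
    fix V assume o: "\<And>K W. compactin TopY K \<Longrightarrow> openin TopY W \<Longrightarrow> open {t. \<gamma> t ` K \<subseteq> W}"
      and "V \<in> {{g \<in> AutY. g ` K \<subseteq> W} |K W. compactin TopY K \<and> openin TopY W}"
    then obtain K W where KW: "compactin TopY K" "openin TopY W" "V = {g \<in> AutY. g ` K \<subseteq> W}" by blast
    have "\<gamma> -` V \<inter> topspace euclideanreal = {t. \<gamma> t ` K \<subseteq> W}" using aut KW(3) by auto
    then show "openin euclideanreal (\<gamma> -` V \<inter> topspace euclideanreal)" using o[OF KW(1,2)] by simp
  next
    show "\<gamma> ` topspace euclideanreal \<subseteq> \<Union>{{g \<in> AutY. g ` K \<subseteq> W} |K W. compactin TopY K \<and> openin TopY W}"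
      using aut topspace_top_Aut[of \<Sigma>] unfolding top_Aut_def topology_generated_by_topspace by blast
  qed
  have bij: "bij (\<gamma> 0)" using AutD(4)[OF aut] .
  have "\<gamma> 0 \<circ> \<gamma> 0 = \<gamma> 0" using add[of 0 0] by simp
  then have id: "\<gamma> 0 = id" by (rule idempotent_bij_eq_id[OF bij])
  have "connectedin (top_Aut \<Sigma>) (range \<gamma>)"
    using connectedin_continuous_map_image[OF cont, of UNIV] by simp
  moreover have "id \<in> range \<gamma>" using id rangeI[of \<gamma> 0] by simp
  ultimately have "connected_component_of (top_Aut \<Sigma>) id (\<gamma> t)" for t
    unfolding connected_component_of_def by (intro exI[of _ "range \<gamma>"] conjI) simp_all
  then have "\<gamma> t \<in> Aut0 \<Sigma>" for t unfolding Aut0_def by simp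
  then have "continuous_map euclideanreal (subtopology (top_Aut \<Sigma>) (Aut0 \<Sigma>)) \<gamma>"
    using cont by (auto simp: continuous_map_in_subtopology)
  then show ?thesis using add by (auto simp: lie_algebra_def)
qed

end

section \<open>Rational maps and Jacobians in charts\<close>

text \<open>\<open>ratl x0 f\<close>: near \<open>x0\<close> the function \<open>f\<close> agrees with a rational function regular at \<open>x0\<close>.\<close>

inductive ratl :: "complex ^ 'n::finite \<Rightarrow> (complex ^ 'n \<Rightarrow> complex) \<Rightarrow> bool" for x0 where
  ratl_const: "ratl x0 (\<lambda>x. a)"
| ratl_coord: "ratl x0 (\<lambda>x. x $ j)"
| ratl_add: "ratl x0 f \<Longrightarrow> ratl x0 g \<Longrightarrow> ratl x0 (\<lambda>x. f x + g x)"
| ratl_mult: "ratl x0 f \<Longrightarrow> ratl x0 g \<Longrightarrow> ratl x0 (\<lambda>x. f x * g x)"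
| ratl_inverse: "ratl x0 f \<Longrightarrow> f x0 \<noteq> 0 \<Longrightarrow> ratl x0 (\<lambda>x. inverse (f x))"
| ratl_cong: "ratl x0 f \<Longrightarrow> \<forall>\<^sub>F x in nhds x0. f x = g x \<Longrightarrow> ratl x0 g"

lemma ratl_uminus: "ratl x0 f \<Longrightarrow> ratl x0 (\<lambda>x. - f x)"
  using ratl_mult[OF ratl_const[of x0 "-1"], of f] by simp

lemma ratl_diff: "ratl x0 f \<Longrightarrow> ratl x0 g \<Longrightarrow> ratl x0 (\<lambda>x. f x - g x)"
  using ratl_add[OF _ ratl_uminus, of x0 f g] by simp

lemma ratl_divide: "ratl x0 f \<Longrightarrow> ratl x0 g \<Longrightarrow> g x0 \<noteq> 0 \<Longrightarrow> ratl x0 (\<lambda>x. f x / g x)"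
  unfolding divide_inverse by (intro ratl_mult ratl_inverse)

lemma ratl_sum: "(\<And>i. i \<in> I \<Longrightarrow> ratl x0 (f i)) \<Longrightarrow> ratl x0 (\<lambda>x. \<Sum>i\<in>I. f i x)"
  by (induction I rule: infinite_finite_induct) (auto intro: ratl_const ratl_add)

lemma ratl_prod: "(\<And>i. i \<in> I \<Longrightarrow> ratl x0 (f i)) \<Longrightarrow> ratl x0 (\<lambda>x. \<Prod>i\<in>I. f i x)"
  by (induction I rule: infinite_finite_induct) (auto intro: ratl_const ratl_mult)

lemma ratl_power: "ratl x0 f \<Longrightarrow> ratl x0 (\<lambda>x. f x ^ n)"
  by (induction n) (auto intro: ratl_const ratl_mult)

lemma ratl_power_int:
  assumes "ratl x0 f" "f x0 \<noteq> 0 \<or> 0 \<le> n"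
  shows "ratl x0 (\<lambda>x. f x powi n)"
proof (cases "0 \<le> n")
  case True
  then show ?thesis using assms(1) by (simp add: power_int_def ratl_power)
next
  case False
  then have "ratl x0 (\<lambda>x. inverse (f x) ^ nat (- n))"
    using assms by (intro ratl_power ratl_inverse) auto
  then show ?thesis using False by (simp add: power_int_def)
qed

lemma ratl_det:
  assumes "\<And>i j. ratl x0 (\<lambda>x. f x $ i $ j)"
  shows "ratl x0 (\<lambda>x. det (f x))"
  unfolding det_def by (intro ratl_sum ratl_mult ratl_const ratl_prod assms)

lemma eventually_nhds_continuous_nonzero:
  fixes f :: "'a::t2_space \<Rightarrow> complex"
  assumes "isCont f x0" "f x0 \<noteq> 0"
  shows "\<forall>\<^sub>F x in nhds x0. f x \<noteq> 0"
proof -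
  have "(f \<longlongrightarrow> f x0) (nhds x0)"
    using assms(1) by (simp add: isCont_def tendsto_at_iff_tendsto_nhds)
  then show ?thesis by (rule tendsto_imp_eventually_ne[OF _ assms(2)])
qed

section \<open>Partial derivatives of rational functions\<close>

definition pdv :: "(complex ^ 'n::finite \<Rightarrow> complex) \<Rightarrow> 'n \<Rightarrow> complex ^ 'n \<Rightarrow> complex" where
  "pdv f j x = deriv (\<lambda>s. f (x + axis j s)) 0"

lemma axis_zero [simp]: "axis j (0 :: 'a::zero) = 0"
  by (simp add: axis_def vec_eq_iff)

lemma has_derivative_line:
  fixes x :: "complex ^ 'n::finite"
  shows "((\<lambda>s. x + axis j s) has_derivative (\<lambda>s. axis j s)) (at s0)"
proof -
  have "linear (\<lambda>s :: complex. axis j s :: complex ^ 'n)"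
    by (rule linearI) (simp_all add: axis_def vec_eq_iff)
  then have "bounded_linear (\<lambda>s :: complex. axis j s :: complex ^ 'n)" by (rule linear_conv_bounded_linear[THEN iffD1])
  then have "((\<lambda>s. axis j s :: complex ^ 'n) has_derivative (\<lambda>s. axis j s)) (at s0)"
    by (rule bounded_linear_imp_has_derivative)
  from has_derivative_add[OF has_derivative_const this] show ?thesis by simp
qed

lemma has_derivative_imp_line:
  fixes x :: "complex ^ 'n::finite"
  assumes "(f has_derivative (\<lambda>h. \<Sum>i\<in>UNIV. f' i * h $ i)) (at x)"
  shows "((\<lambda>s. f (x + axis j s)) has_field_derivative f' j) (at 0)"
proof -
  have "(f has_derivative (\<lambda>h. \<Sum>i\<in>UNIV. f' i * h $ i)) (at (x + axis j 0))"
    using assms by simp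
  from has_derivative_compose[OF has_derivative_line[of x j 0] this]
  have "((\<lambda>s. f (x + axis j s)) has_derivative (\<lambda>s. \<Sum>i\<in>UNIV. f' i * (axis j s :: complex ^ 'n) $ i)) (at 0)" .
  moreover have "(\<Sum>i\<in>UNIV. f' i * (axis j s :: complex ^ 'n) $ i) = f' j * s" for s
    by (simp add: axis_def if_distrib[of "\<lambda>x. _ * x"] cong: if_cong)
  ultimately show ?thesis unfolding has_field_derivative_def by simp
qed

lemma has_derivative_imp_pdv:
  "(f has_derivative (\<lambda>h. \<Sum>i\<in>UNIV. f' i * h $ i)) (at x) \<Longrightarrow> pdv f j x = f' j"
  unfolding pdv_def by (intro DERIV_imp_deriv has_derivative_imp_line)

text \<open>The derivative is complex linear with partial derivatives that are again
  \<open>ratl\<close>. This is what the induction for inverses needs, and it makes Jacobian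
  determinants \<open>ratl\<close>.\<close>

lemma ratl_derivatives:
  fixes x0 :: "complex ^ 'n::finite"
  assumes "ratl x0 f"
  shows "\<exists>f'. (\<forall>j. ratl x0 (f' j)) \<and>
    (\<forall>\<^sub>F x in nhds x0. (f has_derivative (\<lambda>h. \<Sum>i\<in>UNIV. f' i x * h $ i)) (at x))"
  using assms
proof induction
  case (ratl_const a)
  show ?case by (rule exI[of _ "\<lambda>_ _. 0"]) (auto intro: ratl.ratl_const)
next
  case (ratl_coord j)
  have "((\<lambda>x. x $ j) has_derivative (\<lambda>h. \<Sum>i\<in>UNIV. (if i = j then 1 else 0) * h $ i)) (at x)" for x :: "complex ^ 'n"
    by (simp add: if_distrib[of "\<lambda>x. x * _"] bounded_linear_vec_nth bounded_linear_imp_has_derivative cong: if_cong)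
  then show ?case by (intro exI[of _ "\<lambda>i _. if i = j then 1 else 0"]) (auto intro: ratl.ratl_const)
next
  case (ratl_add f g)
  then obtain f' g' where f': "\<And>j. ratl x0 (f' j)" "\<forall>\<^sub>F x in nhds x0. (f has_derivative (\<lambda>h. \<Sum>i\<in>UNIV. f' i x * h $ i)) (at x)"
    and g': "\<And>j. ratl x0 (g' j)" "\<forall>\<^sub>F x in nhds x0. (g has_derivative (\<lambda>h. \<Sum>i\<in>UNIV. g' i x * h $ i)) (at x)"
    by blast
  have "\<forall>\<^sub>F x in nhds x0. ((\<lambda>x. f x + g x) has_derivative (\<lambda>h. \<Sum>i\<in>UNIV. (f' i x + g' i x) * h $ i)) (at x)"
    using f'(2) g'(2)
  proof eventually_elim
    case (elim x)
    then show ?case using has_derivative_add[OF elim] by (simp add: distrib_right sum.distrib)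
  qed
  then show ?case using f'(1) g'(1) by (intro exI[of _ "\<lambda>i x. f' i x + g' i x"]) (auto intro: ratl.ratl_add)
next
  case (ratl_mult f g)
  then obtain f' g' where f': "\<And>j. ratl x0 (f' j)" "\<forall>\<^sub>F x in nhds x0. (f has_derivative (\<lambda>h. \<Sum>i\<in>UNIV. f' i x * h $ i)) (at x)"
    and g': "\<And>j. ratl x0 (g' j)" "\<forall>\<^sub>F x in nhds x0. (g has_derivative (\<lambda>h. \<Sum>i\<in>UNIV. g' i x * h $ i)) (at x)"
    by blast
  have "\<forall>\<^sub>F x in nhds x0. ((\<lambda>x. f x * g x) has_derivative (\<lambda>h. \<Sum>i\<in>UNIV. (f x * g' i x + f' i x * g x) * h $ i)) (at x)"
    using f'(2) g'(2)
  proof eventually_elim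
    case (elim x)
    have eq: "f x * (\<Sum>i\<in>UNIV. g' i x * h $ i) + (\<Sum>i\<in>UNIV. f' i x * h $ i) * g x =
        (\<Sum>i\<in>UNIV. (f x * g' i x + f' i x * g x) * h $ i)" for h :: "complex ^ 'n"
      unfolding sum_distrib_left sum_distrib_right sum.distrib[symmetric]
      by (intro sum.cong refl) (simp add: algebra_simps)
    show ?case using has_derivative_mult[OF elim] unfolding eq .
  qed
  then show ?case using f'(1) g'(1) ratl_mult.hyps
    by (intro exI[of _ "\<lambda>i x. f x * g' i x + f' i x * g x"]) (auto intro!: ratl.ratl_add ratl.ratl_mult)
next
  case (ratl_inverse f)
  then obtain f' where f': "\<And>j. ratl x0 (f' j)" "\<forall>\<^sub>F x in nhds x0. (f has_derivative (\<lambda>h. \<Sum>i\<in>UNIV. f' i x * h $ i)) (at x)"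
    by blast
  have "isCont f x0"
    using eventually_nhds_x_imp_x[OF f'(2)] by (rule has_derivative_continuous)
  then have "\<forall>\<^sub>F x in nhds x0. f x \<noteq> 0" using ratl_inverse.hyps(2) by (rule eventually_nhds_continuous_nonzero)
  with f'(2) have "\<forall>\<^sub>F x in nhds x0. ((\<lambda>x. inverse (f x)) has_derivative
      (\<lambda>h. \<Sum>i\<in>UNIV. (- (inverse (f x) * inverse (f x) * f' i x)) * h $ i)) (at x)"
  proof eventually_elim
    case (elim x)
    then show ?case using Deriv.has_derivative_inverse[OF elim(2,1)]
      by (simp add: sum_distrib_left sum_distrib_right mult_ac flip: sum_negf)
  qed
  then show ?case using f'(1) ratl_inverse.hyps
    by (intro exI[of _ "\<lambda>i x. - (inverse (f x) * inverse (f x) * f' i x)"])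
      (auto intro!: ratl_uminus ratl.ratl_mult ratl.ratl_inverse)
next
  case (ratl_cong f g)
  then obtain f' where f': "\<And>j. ratl x0 (f' j)" "\<forall>\<^sub>F x in nhds x0. (f has_derivative (\<lambda>h. \<Sum>i\<in>UNIV. f' i x * h $ i)) (at x)"
    by blast
  have "\<forall>\<^sub>F x in nhds x0. \<forall>\<^sub>F y in nhds x. f y = g y" using ratl_cong.hyps(2) by (simp add: eventually_eventually)
  with f'(2) have "\<forall>\<^sub>F x in nhds x0. (g has_derivative (\<lambda>h. \<Sum>i\<in>UNIV. f' i x * h $ i)) (at x)"
  proof eventually_elim
    case (elim x)
    have "\<forall>\<^sub>F y in at x. f y = g y"
      using elim(2) by (auto simp: eventually_at_filter elim: eventually_mono)
    then show ?case
      using eventually_nhds_x_imp_x[OF elim(2)]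
      by (rule has_derivative_transform_eventually[OF elim(1)]) simp
  qed
  then show ?case using f'(1) by blast
qed

lemma ratl_has_derivative:
  assumes "ratl x0 f"
  shows "\<forall>\<^sub>F x in nhds x0. (f has_derivative (\<lambda>h. \<Sum>i\<in>UNIV. pdv f i x * h $ i)) (at x)"
    and "ratl x0 (pdv f j)"
proof -
  obtain f' where f': "\<And>j. ratl x0 (f' j)" "\<forall>\<^sub>F x in nhds x0. (f has_derivative (\<lambda>h. \<Sum>i\<in>UNIV. f' i x * h $ i)) (at x)"
    using ratl_derivatives[OF assms] by blast
  show "\<forall>\<^sub>F x in nhds x0. (f has_derivative (\<lambda>h. \<Sum>i\<in>UNIV. pdv f i x * h $ i)) (at x)"
    using f'(2) by eventually_elim (simp add: has_derivative_imp_pdv)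
  have "\<forall>\<^sub>F x in nhds x0. f' j x = pdv f j x"
    using f'(2) by eventually_elim (simp add: has_derivative_imp_pdv)
  then show "ratl x0 (pdv f j)" by (rule ratl_cong[OF f'(1)])
qed

lemma ratl_isCont: "ratl x0 f \<Longrightarrow> isCont f x0"
  using eventually_nhds_x_imp_x[OF ratl_has_derivative(1)] by (rule has_derivative_continuous)

lemma ratl_eventually_nonzero: "ratl x0 f \<Longrightarrow> f x0 \<noteq> 0 \<Longrightarrow> \<forall>\<^sub>F x in nhds x0. f x \<noteq> 0"
  by (rule eventually_nhds_continuous_nonzero[OF ratl_isCont])

lemma pdv_cong:
  assumes "\<forall>\<^sub>F x in nhds x0. f x = g x"
  shows "pdv f j x0 = pdv g j x0"
proof -
  have "isCont (\<lambda>s. x0 + axis j s) 0"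
    by (rule has_derivative_continuous[OF has_derivative_line])
  then have "((\<lambda>s. x0 + axis j s) \<longlongrightarrow> x0 + axis j 0) (nhds (0::complex))"
    unfolding isCont_def by (rule iffD1[OF tendsto_at_iff_tendsto_nhds[of "\<lambda>s. x0 + axis j s" 0]])
  then have "((\<lambda>s. x0 + axis j s) \<longlongrightarrow> x0) (nhds (0::complex))" by simp
  from eventually_compose_filterlim[OF assms this]
  show ?thesis unfolding pdv_def by (rule deriv_cong_ev) simp
qed

lemma has_derivative_vecI:
  fixes F :: "'a::real_normed_vector \<Rightarrow> complex ^ 'k::finite"
  assumes "\<And>k. ((\<lambda>x. F x $ k) has_derivative (\<lambda>h. F' h k)) (at x0)"
  shows "(F has_derivative (\<lambda>h. \<chi> k. F' h k)) (at x0)"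
proof -
  have "((\<lambda>s. 0 + axis k s) has_derivative axis k) (at a)" for k :: 'k and a :: complex
    by (rule has_derivative_line)
  then have "((\<lambda>x. 0 + axis k (F x $ k)) has_derivative (\<lambda>h. axis k (F' h k))) (at x0)" for k
    by (rule has_derivative_compose[OF assms])
  then have "((\<lambda>x. \<Sum>k\<in>UNIV. 0 + axis k (F x $ k)) has_derivative (\<lambda>h. \<Sum>k\<in>UNIV. axis k (F' h k))) (at x0)"
    by (rule has_derivative_sum)
  moreover have "(\<Sum>k\<in>UNIV. axis k (v k)) = (\<chi> k. v k)" for v :: "'k \<Rightarrow> complex"
    by (simp add: vec_eq_iff axis_def)
  ultimately show ?thesis by (simp add: vec_nth_inverse)
qed

lemma ratl_chain:
  fixes F :: "complex ^ 'n::finite \<Rightarrow> complex ^ 'k::finite"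
  assumes F: "\<And>i. ratl x0 (\<lambda>x. F x $ i)" and G: "ratl (F x0) G"
  shows "pdv (\<lambda>x. G (F x)) j x0 = (\<Sum>k\<in>UNIV. pdv G k (F x0) * pdv (\<lambda>x. F x $ k) j x0)"
proof -
  have "((\<lambda>x. F x $ k) has_derivative (\<lambda>h. \<Sum>i\<in>UNIV. pdv (\<lambda>x. F x $ k) i x0 * h $ i)) (at x0)" for k
    by (rule eventually_nhds_x_imp_x[OF ratl_has_derivative(1)[OF F]])
  then have F': "(F has_derivative (\<lambda>h. \<chi> k. \<Sum>i\<in>UNIV. pdv (\<lambda>x. F x $ k) i x0 * h $ i)) (at x0)"
    by (rule has_derivative_vecI)
  have "(G has_derivative (\<lambda>h. \<Sum>i\<in>UNIV. pdv G i (F x0) * h $ i)) (at (F x0))"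
    by (rule eventually_nhds_x_imp_x[OF ratl_has_derivative(1)[OF G]])
  from has_derivative_compose[OF F' this]
  have "((\<lambda>x. G (F x)) has_derivative
      (\<lambda>h. \<Sum>k\<in>UNIV. pdv G k (F x0) * (\<Sum>i\<in>UNIV. pdv (\<lambda>x. F x $ k) i x0 * h $ i))) (at x0)" by simp
  moreover have "(\<Sum>k\<in>UNIV. pdv G k (F x0) * (\<Sum>i\<in>UNIV. pdv (\<lambda>x. F x $ k) i x0 * h $ i)) =
      (\<Sum>i\<in>UNIV. (\<Sum>k\<in>UNIV. pdv G k (F x0) * pdv (\<lambda>x. F x $ k) i x0) * h $ i)" for h :: "complex ^ 'n"
    unfolding sum_distrib_left sum_distrib_right by (subst sum.swap) (simp add: mult.assoc)
  ultimately have "((\<lambda>x. G (F x)) has_derivative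
      (\<lambda>h. \<Sum>i\<in>UNIV. (\<Sum>k\<in>UNIV. pdv G k (F x0) * pdv (\<lambda>x. F x $ k) i x0) * h $ i)) (at x0)" by simp
  then show ?thesis by (rule has_derivative_imp_pdv)
qed

text \<open>Extends identities from the torus to the whole chart: along
  \<open>x0 + (s, ..., s)\<close> no coordinate vanishes for small nonzero s, and \<open>f\<close>
  is continuous at \<open>x0\<close>.\<close>

lemma ratl_zero_by_density:
  fixes f :: "complex ^ 'n::finite \<Rightarrow> complex"
  assumes f: "ratl x0 f" and 0: "\<forall>\<^sub>F x in nhds x0. (\<forall>j. x $ j \<noteq> 0) \<longrightarrow> f x = 0"
  shows "f x0 = 0"
proof -
  let ?p = "\<lambda>s :: complex. x0 + (\<chi> j. s)"
  have p: "(?p \<longlongrightarrow> x0) (at 0)"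
  proof (rule vec_tendstoI)
    fix i
    have "((\<lambda>s :: complex. x0 $ i + s) \<longlongrightarrow> x0 $ i + 0) (at 0)" by (intro tendsto_intros)
    then show "((\<lambda>s. ?p s $ i) \<longlongrightarrow> x0 $ i) (at 0)" by simp
  qed
  have "\<forall>\<^sub>F s in at 0. ?p s $ j \<noteq> 0" for j
  proof (cases "x0 $ j = 0")
    case True
    then show ?thesis by (simp add: eventually_at_filter)
  next
    case False
    then show ?thesis using tendsto_imp_eventually_ne[OF tendsto_vec_nth[OF p]] by simp
  qed
  then have "\<forall>\<^sub>F s in at 0. \<forall>j. ?p s $ j \<noteq> 0" by (simp add: eventually_all_finite)
  moreover have "\<forall>\<^sub>F s in at 0. (\<forall>j. ?p s $ j \<noteq> 0) \<longrightarrow> f (?p s) = 0"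
    using eventually_compose_filterlim[OF 0 p] .
  ultimately have "\<forall>\<^sub>F s in at 0. f (?p s) = 0" by eventually_elim simp
  moreover have "((\<lambda>s. f (?p s)) \<longlongrightarrow> f x0) (at 0)"
    by (rule isCont_tendsto_compose[OF ratl_isCont[OF f] p])
  ultimately have "((\<lambda>s :: complex. 0 :: complex) \<longlongrightarrow> f x0) (at 0)" by (rule Lim_transform_eventually[rotated])
  then show ?thesis by (simp add: tendsto_const_iff)
qed

section \<open>Characters on the torus, coordinate forms of maps, and the sections
  \<open>tsec\<close>\<close>

definition Xt :: "'n::finite lattice \<Rightarrow> 'n toric_point \<Rightarrow> complex" where
  "Xt k P = chi {0} k P"

definition (in smooth_complete_fan) lrep :: "('n toric_point \<Rightarrow> 'n toric_point) \<Rightarrow> ('n \<Rightarrow> 'n lattice) \<Rightarrow>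
    'n chart \<Rightarrow> complex ^ 'n \<Rightarrow> complex ^ 'n" where
  "lrep g m d x = coords d (g (pt m x))"

lemma mon_zero [simp]: "mon m x 0 = 1"
  by (simp add: mon_def)

lemma mon_add: "\<forall>j. x $ j \<noteq> 0 \<Longrightarrow> mon m x (k + l) = mon m x k * mon m x l"
  by (simp add: mon_def pair_simps power_int_add prod.distrib)

lemma mon_nonzero: "\<forall>j. x $ j \<noteq> 0 \<Longrightarrow> mon m x k \<noteq> 0"
  by (simp add: mon_def)

lemma mon_scale: "mon m x (n *s k) = mon m x k powi n"
  by (simp add: mon_def pair_simps prod_power_int_distrib power_int_mult mult.commute[of n])

lemma mon_sum: "\<forall>j. x $ j \<noteq> 0 \<Longrightarrow> mon m x (\<Sum>i\<in>I. f i) = (\<Prod>i\<in>I. mon m x (f i))"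
  by (induction I rule: infinite_finite_induct) (simp_all add: mon_add)

lemma ratl_mon:
  assumes "\<And>j. x0 $ j \<noteq> 0 \<or> 0 \<le> pair k (dual_basis m j)"
  shows "ratl x0 (\<lambda>x. mon m x k)"
  unfolding mon_def by (intro ratl_prod ratl_power_int ratl_coord assms)

lemma det_scale_rows_columns:
  fixes A :: "'a::comm_ring_1 ^ 'n::finite ^ 'n"
  shows "det (\<chi> i j. A $ i $ j * u i * v j) = det A * (\<Prod>i\<in>UNIV. u i) * (\<Prod>j\<in>UNIV. v j)"
proof -
  have "(\<Prod>i\<in>UNIV. A $ i $ p i * u i * v (p i)) = (\<Prod>i\<in>UNIV. A $ i $ p i) * (\<Prod>i\<in>UNIV. u i) * (\<Prod>j\<in>UNIV. v j)"
    if "p permutes UNIV" for p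
    using prod.permute[OF that, of v] by (simp add: prod.distrib o_def)
  then show ?thesis by (simp add: det_def sum_distrib_right mult.assoc)
qed

lemma det_of_int: "det (\<chi> i j. (of_int (A $ i $ j) :: 'a::comm_ring_1)) = of_int (det (A :: int ^ 'n::finite ^ 'n))"
  by (simp add: det_def)

text \<open>The transposed matrix of the dual basis is inverse to that of \<open>m\<close>, so the
  first factor is the determinant of the change of basis. It accounts for the change of the constant
  in \<open>tsec\<close> between charts.\<close>

lemma det_lattice_basis:
  fixes m n :: "'n::finite \<Rightarrow> 'n lattice"
  assumes "lattice_basis m"
  shows "det (\<chi> i j. pair (n i) (dual_basis m j)) * det (\<chi> j. m j) = det (\<chi> j. n j)"
proof -
  have m: "(\<chi> i j. pair (n i) (dual_basis m j)) = (\<chi> j. n j) ** transpose (\<chi> j. dual_basis m j)" for n :: "'n \<Rightarrow> 'n lattice"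
    by (simp add: vec_eq_iff matrix_matrix_mult_def transpose_def pair_def)
  have "(\<chi> i j. pair (m i) (dual_basis m j)) = mat 1"
    by (simp add: vec_eq_iff mat_def dual_basis_pair[OF assms])
  then have 1: "det (\<chi> j. m j) * det (\<chi> j. dual_basis m j) = 1"
    using m[of m] det_mul[of "\<chi> j. m j" "transpose (\<chi> j. dual_basis m j)"] by (simp add: det_transpose)
  have "det (\<chi> i j. pair (n i) (dual_basis m j)) = det (\<chi> j. n j) * det (\<chi> j. dual_basis m j)"
    unfolding m[of n] by (simp add: det_mul det_transpose)
  then have "det (\<chi> i j. pair (n i) (dual_basis m j)) * det (\<chi> j. m j) =
      det (\<chi> j. n j) * (det (\<chi> j. m j) * det (\<chi> j. dual_basis m j))" by (simp add: mult_ac)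
  then show ?thesis using 1 by simp
qed

lemma det_lattice_basis_nonzero:
  fixes m :: "'n::finite \<Rightarrow> 'n lattice"
  assumes "lattice_basis m"
  shows "det (\<chi> j. m j) \<noteq> 0"
proof
  assume "det (\<chi> j. m j) = 0"
  then have "det ((\<chi> j. axis j 1) :: int ^ 'n ^ 'n) = 0" using det_lattice_basis[OF assms, of "\<lambda>i. axis i 1"] by simp
  moreover have "((\<chi> j. axis j 1) :: int ^ 'n ^ 'n) = mat 1" by (auto simp: vec_eq_iff mat_def axis_def)
  ultimately show False by simp
qed

lemma pdv_mon:
  fixes x :: "complex ^ 'n::finite"
  assumes x: "\<forall>j. x $ j \<noteq> 0"
  shows "pdv (\<lambda>x. mon m x k) j x = of_int (pair k (dual_basis m j)) * mon m x k / x $ j"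
proof -
  let ?p = "pair k (dual_basis m j)" and ?R = "\<Prod>i\<in>UNIV - {j}. x $ i powi pair k (dual_basis m i)"
  have eq: "mon m (x + axis j s) k = (x $ j + s) powi ?p * ?R" for s
    unfolding mon_def by (subst prod.remove[of _ j]) (auto simp: axis_def intro!: prod.cong)
  have xj: "x $ j \<noteq> 0" using x by blast
  have base: "((\<lambda>s. x $ j + s) has_field_derivative 1) (at 0)" by (auto intro!: derivative_eq_intros)
  have "((\<lambda>s. (x $ j + s) powi ?p * ?R) has_field_derivative
      of_int ?p * (x $ j + 0) powi (?p - 1) * 1 * ?R) (at 0)"
    by (rule DERIV_cmult_right[OF DERIV_power_int[OF base]]) (use xj in simp)
  moreover have "of_int ?p * (x $ j + 0) powi (?p - 1) * 1 * ?R = of_int ?p * mon m x k / x $ j"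
    using eq[of 0] xj by (simp add: power_int_diff)
  ultimately show ?thesis unfolding pdv_def eq by (simp add: DERIV_imp_deriv)
qed

context smooth_complete_fan
begin

lemma zero_in_fan: "{0} \<in> \<Sigma>"
  by (rule zero_cone_in_fan[OF fan])

lemma ray_nonzero: "\<rho> \<in> Rays \<Longrightarrow> \<rho> \<noteq> 0"
proof
  assume "\<rho> \<in> Rays" "\<rho> = 0"
  then have "primitive (0 :: 'n lattice)" by (simp add: rays_def)
  moreover have "(0 :: 'n lattice) = 0 *s 0" by simp
  ultimately have "\<bar>0 :: int\<bar> = 1" unfolding primitive_def by blast
  then show False by simp
qed

lemma gens_zero: "gens {0} = {}"
  using ray_nonzero by (auto simp: gens_def)

lemma dual_zero: "k \<in> dual_semigroup {0}"
  by (simp add: dual_semigroup_def)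

lemma pt_in_torus_iff: "(\<sigma>, m) \<in> Ch \<Longrightarrow> pt m x \<in> Torus \<longleftrightarrow> (\<forall>j. x $ j \<noteq> 0)"
  by (simp add: pt_in_U_iff gens_zero zero_in_fan)

lemma Xt_pt: "(\<sigma>, m) \<in> Ch \<Longrightarrow> \<forall>j. x $ j \<noteq> 0 \<Longrightarrow> Xt k (pt m x) = mon m x k"
  unfolding Xt_def by (rule chi_pt) (simp_all add: pt_in_torus_iff dual_zero)

lemma torus_in_dom_chart:
  assumes c: "(\<sigma>, m) \<in> Ch" and P: "P \<in> Torus"
  shows "P \<in> Dom (\<sigma>, m)"
proof -
  have "P \<in> TV" using P by (simp add: U_def)
  then obtain z where z: "z \<in> cdom" "P = cox z" using toric_variety_eq by blast
  then show ?thesis using P U_cox_iff[OF z(1)] gens_zero chart_basis(2)[OF c] by (auto simp: dom_chart_def)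
qed

lemma torus_pt:
  assumes c: "(\<sigma>, m) \<in> Ch" and P: "P \<in> Torus"
  obtains x where "P = pt m x" "\<forall>j. x $ j \<noteq> 0"
proof -
  have "P = pt m (coords (\<sigma>, m) P)" using pt_coords[OF c torus_in_dom_chart[OF c P]] by simp
  then show ?thesis using that pt_in_torus_iff[OF c] P by metis
qed

lemma ex_chart: "\<exists>\<sigma> m. (\<sigma>, m) \<in> Ch"
  using chart_above[OF zero_in_fan] by blast

lemma Xt_add: "P \<in> Torus \<Longrightarrow> Xt (k + l) P = Xt k P * Xt l P"
  by (metis ex_chart torus_pt Xt_pt mon_add)

lemma Xt_nonzero: "P \<in> Torus \<Longrightarrow> Xt k P \<noteq> 0"
  by (metis ex_chart torus_pt Xt_pt mon_nonzero)

lemma Xt_zero: "P \<in> Torus \<Longrightarrow> Xt 0 P = 1"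
  by (metis ex_chart torus_pt Xt_pt mon_zero)

lemma Xt_diff: "P \<in> Torus \<Longrightarrow> Xt (k - l) P = Xt k P / Xt l P"
  using Xt_add[of P "k - l" l] Xt_nonzero[of P l] by (simp add: field_simps)

text \<open>Points of \<Delta> have height at least -1 on the rays of the chart and
  \<open>\<Sum>j. m j\<close> has height 1 on each, so the exponent is regular there.\<close>

lemma tsec_pt:
  assumes c: "(\<sigma>, m) \<in> Ch" and "\<nu> \<in> DM"
  shows "tsec \<nu> (\<sigma>, m) (pt m x) = of_int (det (\<chi> j. m j)) * mon m x (\<nu> + (\<Sum>j\<in>UNIV. m j))"
    and "\<nu> + (\<Sum>j\<in>UNIV. m j) \<in> dual_semigroup \<sigma>"
proof -
  show d: "\<nu> + (\<Sum>j\<in>UNIV. m j) \<in> dual_semigroup \<sigma>"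
    unfolding chart_dual_iff[OF c]
  proof
    fix j
    have "-1 \<le> pair \<nu> (dual_basis m j)"
      using assms(2) chart_ray[OF c, of j] by (simp add: DeltaM_iff gens_def)
    then show "0 \<le> pair (\<nu> + (\<Sum>j\<in>UNIV. m j)) (dual_basis m j)"
      by (simp add: pair_simps dual_basis_pair[OF chart_basis(1)[OF c]])
  qed
  show "tsec \<nu> (\<sigma>, m) (pt m x) = of_int (det (\<chi> j. m j)) * mon m x (\<nu> + (\<Sum>j\<in>UNIV. m j))"
    unfolding tsec_def using chi_pt[OF c _ d] pt_in_chart[OF c, of x] by (simp add: dom_chart_def)
qed

lemma tsec_torus:
  assumes c: "(\<sigma>, m) \<in> Ch" and "\<nu> \<in> DM" "P \<in> Torus"
  shows "tsec \<nu> (\<sigma>, m) P = of_int (det (\<chi> j. m j)) * Xt (\<nu> + (\<Sum>j\<in>UNIV. m j)) P"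
proof -
  obtain x where x: "P = pt m x" "\<forall>j. x $ j \<noteq> 0" using torus_pt[OF c assms(3)] .
  then show ?thesis using tsec_pt(1)[OF c assms(2)] Xt_pt[OF c x(2)] by simp
qed

lemma pt_eventually_U:
  assumes c: "(\<sigma>, m) \<in> Ch" and x0: "pt m x0 \<in> Aff \<tau>"
  shows "\<forall>\<^sub>F x in nhds x0. pt m x \<in> Aff \<tau>"
proof -
  have "\<forall>\<^sub>F x in nhds x0. x0 $ j \<noteq> 0 \<longrightarrow> x $ j \<noteq> 0" for j
    using ratl_eventually_nonzero[OF ratl_coord, of x0 j] by (cases "x0 $ j = 0") auto
  then have "\<forall>\<^sub>F x in nhds x0. \<forall>j. x0 $ j \<noteq> 0 \<longrightarrow> x $ j \<noteq> 0" by (simp add: eventually_all_finite)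
  then show ?thesis
    by eventually_elim (use x0 in \<open>auto simp: pt_in_U_iff[OF c]\<close>)
qed

lemma ratl_chi:
  assumes c: "(\<sigma>, m) \<in> Ch" and x0: "pt m x0 \<in> Aff \<tau>" and k: "k \<in> dual_semigroup \<tau>"
  shows "ratl x0 (\<lambda>x. chi \<tau> k (pt m x))"
proof (rule ratl_cong)
  have \<tau>: "\<tau> \<in> \<Sigma>" using x0 pt_in_U_iff[OF c] by blast
  show "ratl x0 (\<lambda>x. mon m x k)"
    using x0 k gens_dual[OF \<tau>] by (intro ratl_mon) (auto simp: pt_in_U_iff[OF c])
  show "\<forall>\<^sub>F x in nhds x0. mon m x k = chi \<tau> k (pt m x)"
    using pt_eventually_U[OF c x0] by eventually_elim (simp add: chi_pt[OF c _ k])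
qed

lemma ratl_coord_ring:
  assumes c: "(\<sigma>, m) \<in> Ch" and x0: "pt m x0 \<in> Aff \<tau>" and a: "a \<in> coord_ring \<tau>"
  shows "ratl x0 (\<lambda>x. a (pt m x))"
proof -
  obtain F b where F: "finite F" "F \<subseteq> dual_semigroup \<tau>" "a = (\<lambda>P. \<Sum>k\<in>F. b k * chi \<tau> k P)"
    using a by (auto simp: coord_ring_def)
  show ?thesis unfolding F(3) using F(2)
    by (intro ratl_sum ratl_mult ratl_const ratl_chi[OF c x0]) blast
qed

lemma morphism_ratl:
  assumes g: "morphism \<Sigma> g" and c: "(\<sigma>, m) \<in> Ch" and \<tau>: "\<tau> \<in> \<Sigma>" and x0: "g (pt m x0) \<in> Aff \<tau>"
  shows "\<forall>\<^sub>F x in nhds x0. g (pt m x) \<in> Aff \<tau>"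
    and "k \<in> dual_semigroup \<tau> \<Longrightarrow> ratl x0 (\<lambda>x. chi \<tau> k (g (pt m x)))"
proof -
  let ?W = "{P \<in> TV. g P \<in> Aff \<tau>}"
  have main: "(\<forall>\<^sub>F x in nhds x0. g (pt m x) \<in> Aff \<tau>) \<and> ratl x0 (\<lambda>x. chi \<tau> k (g (pt m x)))"
    if k: "k \<in> dual_semigroup \<tau>" for k
  proof -
    have "regular_on \<Sigma> ?W (\<lambda>P. chi \<tau> k (g P))" using g \<tau> k unfolding morphism_def by blast
    moreover have "pt m x0 \<in> ?W" using x0 pt_in[OF c] by simp
    ultimately obtain \<sigma>' a b where ab: "\<sigma>' \<in> \<Sigma>" "pt m x0 \<in> Aff \<sigma>'" "a \<in> coord_ring \<sigma>'" "b \<in> coord_ring \<sigma>'"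
      "b (pt m x0) \<noteq> 0" "\<forall>Q\<in>Aff \<sigma>'. b Q \<noteq> 0 \<longrightarrow> Q \<in> ?W \<and> chi \<tau> k (g Q) = a Q / b Q"
      unfolding regular_on_def by meson
    note ra = ratl_coord_ring[OF c ab(2,3)] and rb = ratl_coord_ring[OF c ab(2,4)]
    have ev: "\<forall>\<^sub>F x in nhds x0. pt m x \<in> ?W \<and> chi \<tau> k (g (pt m x)) = a (pt m x) / b (pt m x)"
      using pt_eventually_U[OF c ab(2)] ratl_eventually_nonzero[OF rb ab(5)]
    proof eventually_elim
      case (elim x)
      then show ?case using ab(6) by blast
    qed
    then have "\<forall>\<^sub>F x in nhds x0. g (pt m x) \<in> Aff \<tau>" by eventually_elim simp
    moreover have "\<forall>\<^sub>F x in nhds x0. a (pt m x) / b (pt m x) = chi \<tau> k (g (pt m x))"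
      using ev by eventually_elim simp
    then have "ratl x0 (\<lambda>x. chi \<tau> k (g (pt m x)))"
      by (rule ratl_cong[OF ratl_divide[OF ra rb ab(5)]])
    ultimately show ?thesis by blast
  qed
  show "\<forall>\<^sub>F x in nhds x0. g (pt m x) \<in> Aff \<tau>" using main[OF dual_semigroup_zero] by blast
  show "k \<in> dual_semigroup \<tau> \<Longrightarrow> ratl x0 (\<lambda>x. chi \<tau> k (g (pt m x)))" using main by blast
qed

lemma lrep_ratl:
  assumes g: "morphism \<Sigma> g" and c: "(\<sigma>, m) \<in> Ch" and d: "d \<in> Ch" and x0: "g (pt m x0) \<in> Dom d"
  shows "ratl x0 (\<lambda>x. lrep g m d x $ i)"
proof -
  obtain \<tau> n where dd: "d = (\<tau>, n)" by (cases d)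
  show ?thesis
    using morphism_ratl(2)[OF g c chart_basis(2) _ chart_basis_in_dual, of \<tau> n x0 n i] d x0
    by (simp add: dd lrep_def coords_def dom_chart_def)
qed

lemma jac_pt:
  assumes c: "(\<sigma>, m) \<in> Ch"
  shows "Jac g (\<sigma>, m) d (pt m x) = det (\<chi> i j. pdv (\<lambda>x. lrep g m d x $ i) j x)"
  unfolding jac_def pdv_def lrep_def coords_pt[OF c] point_of_eq[OF c] ..

lemma jac_ratl:
  assumes "morphism \<Sigma> g" and c: "(\<sigma>, m) \<in> Ch" and "d \<in> Ch" and "g (pt m x0) \<in> Dom d"
  shows "ratl x0 (\<lambda>x. Jac g (\<sigma>, m) d (pt m x))"
  unfolding jac_pt[OF c] using ratl_has_derivative(2)[OF lrep_ratl[OF assms]] by (intro ratl_det) simp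

lemma lrep_pt: "(\<tau>, n) \<in> Ch \<Longrightarrow> g (pt m x) \<in> Dom (\<tau>, n) \<Longrightarrow>
    pt n (lrep g m (\<tau>, n) x) = g (pt m x)"
  unfolding lrep_def by (rule pt_coords)

lemma jac_comp:
  assumes g: "morphism \<Sigma> g" and h: "morphism \<Sigma> h" and c: "c \<in> Ch" and d: "d \<in> Ch" and e: "e \<in> Ch"
    and P: "P \<in> Dom c" "g P \<in> Dom d" "h (g P) \<in> Dom e"
  shows "Jac (h \<circ> g) c e P = Jac h d e (g P) * Jac g c d P"
proof -
  obtain \<sigma> m where cc: "c = (\<sigma>, m)" by (cases c)
  obtain \<tau> n where dd: "d = (\<tau>, n)" by (cases d)
  note c' = c[unfolded cc] and d' = d[unfolded dd]
  obtain x where x: "P = pt m x" using pt_coords[OF c'] P(1) cc by metis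
  let ?F = "lrep g m d" and ?G = "lrep h n e"
  have Fx: "pt n (?F x) = g P" using lrep_pt[OF d'] P(2) x dd by simp
  have F: "ratl x (\<lambda>x. ?F x $ i)" for i
    using lrep_ratl[OF g c' d] P(2) x by simp
  have G: "ratl (?F x) (\<lambda>y. ?G y $ i)" for i
    using lrep_ratl[OF h d' e, of "?F x"] P(3) Fx by simp
  have "\<forall>\<^sub>F y in nhds x. g (pt m y) \<in> Aff \<tau>"
    using morphism_ratl(1)[OF g c' chart_basis(2)[OF d']] P(2) x dd by (simp add: dom_chart_def)
  then have "\<forall>\<^sub>F y in nhds x. lrep (h \<circ> g) m e y = ?G (?F y)"
  proof eventually_elim
    case (elim y)
    then have "pt n (?F y) = g (pt m y)" using lrep_pt[OF d'] dd by (simp add: dom_chart_def)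
    then show ?case unfolding lrep_def[of h] lrep_def[of "h \<circ> g"] by simp
  qed
  then have "pdv (\<lambda>y. lrep (h \<circ> g) m e y $ i) j x = pdv (\<lambda>y. ?G (?F y) $ i) j x" for i j
    by (intro pdv_cong) (auto elim: eventually_mono)
  then have "pdv (\<lambda>y. lrep (h \<circ> g) m e y $ i) j x =
      (\<Sum>k\<in>UNIV. pdv (\<lambda>y. ?G y $ i) k (?F x) * pdv (\<lambda>y. ?F y $ k) j x)" for i j
    using ratl_chain[OF F G] by simp
  then have "(\<chi> i j. pdv (\<lambda>y. lrep (h \<circ> g) m e y $ i) j x) =
      (\<chi> i j. pdv (\<lambda>y. ?G y $ i) j (?F x)) ** (\<chi> i j. pdv (\<lambda>y. ?F y $ i) j x)"
    by (simp add: vec_eq_iff matrix_matrix_mult_def)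
  then have "Jac (h \<circ> g) c e P = det (\<chi> i j. pdv (\<lambda>y. ?G y $ i) j (?F x)) * det (\<chi> i j. pdv (\<lambda>y. ?F y $ i) j x)"
    unfolding x cc jac_pt[OF c'] by (simp add: det_mul)
  moreover have "Jac h d e (g P) = det (\<chi> i j. pdv (\<lambda>y. ?G y $ i) j (?F x))"
    using jac_pt[OF d', of h e "?F x"] Fx dd by simp
  moreover have "Jac g c d P = det (\<chi> i j. pdv (\<lambda>y. ?F y $ i) j x)"
    unfolding x cc jac_pt[OF c'] ..
  ultimately show ?thesis by simp
qed

lemma lrep_id: "(\<sigma>, m) \<in> Ch \<Longrightarrow> lrep id m (\<sigma>, m) x = x"
  by (simp add: lrep_def coords_pt)

lemma jac_id:
  assumes c: "c \<in> Ch" and P: "P \<in> Dom c"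
  shows "Jac id c c P = 1"
proof -
  obtain \<sigma> m where cc: "c = (\<sigma>, m)" by (cases c)
  note c' = c[unfolded cc]
  obtain x where x: "P = pt m x" using pt_coords[OF c'] P(1) cc by metis
  have "((\<lambda>x. x $ i) has_derivative (\<lambda>h. \<Sum>k\<in>UNIV. (if k = i then 1 else 0) * h $ k)) (at x)" for i
    by (simp add: if_distrib[of "\<lambda>x. x * _"] bounded_linear_vec_nth bounded_linear_imp_has_derivative cong: if_cong)
  then have "pdv (\<lambda>x. x $ i) j x = (if j = i then 1 else 0)" for i j
    by (rule has_derivative_imp_pdv)
  then have "(\<chi> i j. pdv (\<lambda>x. lrep id m (\<sigma>, m) x $ i) j x) = mat 1"
    by (simp add: lrep_id[OF c'] vec_eq_iff mat_def)
  then show ?thesis unfolding x cc jac_pt[OF c'] by simp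
qed

lemma morphism_id: "morphism \<Sigma> id"
  unfolding morphism_def regular_on_def
proof (intro conjI ballI)
  show "id ` TV \<subseteq> TV" by simp
  fix \<tau> k P assume \<tau>: "\<tau> \<in> \<Sigma>" and k: "k \<in> dual_semigroup \<tau>" and P: "P \<in> {P \<in> TV. id P \<in> Aff \<tau>}"
  have chi0: "chi \<tau> 0 Q = 1" if "Q \<in> Aff \<tau>" for Q
  proof -
    have "Q \<in> TV" using that by (simp add: U_def)
    then obtain z where z: "z \<in> cdom" "Q = cox z" using toric_variety_eq by blast
    then show ?thesis using that U_cox_iff[OF z(1)] chi_cox_ev[OF _ _ dual_semigroup_zero] by simp
  qed
  have ring: "chi \<tau> l \<in> coord_ring \<tau>" if "l \<in> dual_semigroup \<tau>" for l
    unfolding coord_ring_def using that by (intro CollectI exI[of _ "{l}"] exI[of _ "\<lambda>_. 1"]) auto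
  show "\<exists>\<sigma>\<in>\<Sigma>. P \<in> Aff \<sigma> \<and> (\<exists>a\<in>coord_ring \<sigma>. \<exists>b\<in>coord_ring \<sigma>. b P \<noteq> 0 \<and>
      (\<forall>Q\<in>Aff \<sigma>. b Q \<noteq> 0 \<longrightarrow> Q \<in> {P \<in> TV. id P \<in> Aff \<tau>} \<and> chi \<tau> k (id Q) = a Q / b Q))"
    using P chi0 by (intro bexI[OF _ \<tau>] conjI bexI[OF _ ring[OF k]] bexI[OF _ ring[OF dual_semigroup_zero]])
      (auto simp: U_def)
qed

lemma lrep_id_mon:
  assumes c: "(\<sigma>, m) \<in> Ch" and d: "(\<tau>, n) \<in> Ch" and x: "pt m x \<in> Dom (\<tau>, n)"
  shows "lrep id m (\<tau>, n) x = (\<chi> i. mon m x (n i))"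
  unfolding lrep_def coords_def using chi_pt[OF c _ chart_basis_in_dual[OF d]] x by (simp add: dom_chart_def)

text \<open>The partial derivatives of a monomial are integers times that monomial divided by
  \<open>x $ j\<close>; monomials and coordinates are pulled out of rows and columns.\<close>

lemma jac_id_torus:
  assumes c: "(\<sigma>, m) \<in> Ch" and d: "(\<tau>, n) \<in> Ch" and x: "\<forall>j. x $ j \<noteq> 0"
  shows "Jac id (\<sigma>, m) (\<tau>, n) (pt m x) =
    of_int (det (\<chi> i j. pair (n i) (dual_basis m j))) * (\<Prod>i\<in>UNIV. mon m x (n i)) / (\<Prod>j\<in>UNIV. x $ j)"
proof -
  have xU: "pt m x \<in> Torus" using pt_in_torus_iff[OF c] x by simp
  have "\<forall>\<^sub>F y in nhds x. lrep id m (\<tau>, n) y = (\<chi> i. mon m y (n i))"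
    using pt_eventually_U[OF c xU]
    by eventually_elim (rule lrep_id_mon[OF c d torus_in_dom_chart[OF d]])
  then have "pdv (\<lambda>y. lrep id m (\<tau>, n) y $ i) j x = pdv (\<lambda>y. mon m y (n i)) j x" for i j
    by (intro pdv_cong) (auto elim: eventually_mono)
  then have "Jac id (\<sigma>, m) (\<tau>, n) (pt m x) = det (\<chi> i j. of_int (pair (n i) (dual_basis m j)) * mon m x (n i) * inverse (x $ j))"
    unfolding jac_pt[OF c] pdv_mon[OF x] by (simp add: divide_inverse)
  also have "\<dots> = det (\<chi> i j. (\<chi> i j. (of_int (pair (n i) (dual_basis m j)) :: complex)) $ i $ j * mon m x (n i) * inverse (x $ j))"
    by simp
  also have "\<dots> = det (\<chi> i j. (of_int (pair (n i) (dual_basis m j)) :: complex)) * (\<Prod>i\<in>UNIV. mon m x (n i)) * (\<Prod>j\<in>UNIV. inverse (x $ j))"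
    by (rule det_scale_rows_columns)
  also have "det (\<chi> i j. (of_int (pair (n i) (dual_basis m j)) :: complex)) = of_int (det (\<chi> i j. pair (n i) (dual_basis m j)))"
    using det_of_int[of "\<chi> i j. pair (n i) (dual_basis m j)", where 'a = complex] by simp
  also have "(\<Prod>j\<in>UNIV. inverse (x $ j)) = inverse (\<Prod>j\<in>UNIV. x $ j)"
    using prod_inversef[of "\<lambda>j. x $ j" UNIV] by (simp only: o_def)
  finally show ?thesis unfolding divide_inverse .
qed

text \<open>On the torus this is the determinant computation for monomial coordinates; both sides
  are regular on the overlap, so density extends the identity.\<close>

lemma tsec_compat:
  assumes \<nu>: "\<nu> \<in> DM"
  shows "pushforward \<Sigma> id (tsec \<nu>) (tsec \<nu>)"
  unfolding pushforward_def
proof (intro ballI impI)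
  fix c d P assume cd: "c \<in> Ch" "d \<in> Ch" and P: "P \<in> Dom c" "id P \<in> Dom d"
  obtain \<sigma> m where cc: "c = (\<sigma>, m)" by (cases c)
  obtain \<tau> n where dd: "d = (\<tau>, n)" by (cases d)
  note c = cd(1)[unfolded cc] and d = cd(2)[unfolded dd]
  obtain x0 where x0: "P = pt m x0" using pt_coords[OF c] P(1) cc by metis
  let ?f = "\<lambda>x. tsec \<nu> d (pt m x) - Jac id c d (pt m x) * tsec \<nu> c (pt m x)"
  have r: "ratl x0 (\<lambda>x. tsec \<nu> (\<tau>', n') (pt m x))" if "(\<tau>', n') \<in> Ch" "P \<in> Dom (\<tau>', n')" for \<tau>' n'
    unfolding tsec_def fst_conv snd_conv
    by (intro ratl_mult ratl_const ratl_chi[OF c]) (use that x0 tsec_pt(2)[OF that(1) \<nu>] in \<open>auto simp: dom_chart_def\<close>)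
  have "ratl x0 ?f"
    using r[of \<tau> n] r[of \<sigma> m] jac_ratl[OF morphism_id c cd(2)] cd P x0
    unfolding cc dd by (intro ratl_diff ratl_mult) auto
  moreover have "?f x = 0" if x: "\<forall>j. x $ j \<noteq> 0" for x
  proof -
    have xU: "pt m x \<in> Torus" using pt_in_torus_iff[OF c] x by simp
    have "tsec \<nu> d (pt m x) = of_int (det (\<chi> j. n j)) * (mon m x \<nu> * (\<Prod>i\<in>UNIV. mon m x (n i)))"
      unfolding dd tsec_torus[OF d \<nu> xU] Xt_pt[OF c x] by (simp add: mon_add[OF x] mon_sum[OF x])
    moreover have "tsec \<nu> c (pt m x) = of_int (det (\<chi> j. m j)) * (mon m x \<nu> * (\<Prod>j\<in>UNIV. x $ j))"
      unfolding cc tsec_torus[OF c \<nu> xU] Xt_pt[OF c x]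
      by (simp add: mon_add[OF x] mon_sum[OF x] mon_basis[OF chart_basis(1)[OF c]])
    moreover have "(\<Prod>j\<in>UNIV. x $ j) \<noteq> 0" using x by simp
    moreover have "of_int (det (\<chi> j. n j)) = (of_int (det (\<chi> i j. pair (n i) (dual_basis m j))) * of_int (det (\<chi> j. m j)) :: complex)"
      using det_lattice_basis[OF chart_basis(1)[OF c], of n] by (metis of_int_mult)
    ultimately show ?thesis
      unfolding cc dd jac_id_torus[OF c d x] by (simp add: field_simps)
  qed
  then have "\<forall>\<^sub>F x in nhds x0. (\<forall>j. x $ j \<noteq> 0) \<longrightarrow> ?f x = 0" by simp
  ultimately have "?f x0 = 0" by (rule ratl_zero_by_density)
  then show "tsec \<nu> d (id P) = Jac id c d P * tsec \<nu> c P" using x0 by simp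
qed

end

text \<open>Orthogonality of characters of the cyclic group of order N. The bound on p excludes
  nonzero multiples of N.\<close>

lemma sum_root_of_unity:
  fixes N :: nat and p :: int
  assumes N: "N > 0" and p: "\<bar>p\<bar> < int N"
  defines "\<omega> \<equiv> exp (2 * of_real pi * \<i> / of_nat N)"
  shows "(\<Sum>t<N. (\<omega> ^ t) powi p) = (if p = 0 then of_nat N else 0)"
proof -
  have pow: "\<omega> powi q = exp (of_int q * (2 * of_real pi * \<i> / of_nat N))" for q
    unfolding \<omega>_def by (simp add: exp_power_int)
  have terms: "(\<omega> ^ t) powi p = (\<omega> powi p) ^ t" for t
    by (metis power_int_mult power_int_of_nat mult.commute)
  show ?thesis
  proof (cases "p = 0")
    case False
    have "\<omega> powi p \<noteq> 1"
    proof
      assume "\<omega> powi p = 1"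
      then obtain n :: int where "Im (of_int p * (2 * of_real pi * \<i> / of_nat N)) = of_int (2 * n) * pi"
        unfolding pow exp_eq_1 by blast
      then have "of_int p * (2 * pi / of_nat N) = of_int (2 * n) * pi" by (simp add: Im_divide_of_nat)
      then have "of_int p = (of_int n * of_nat N :: real)" using N by (simp add: field_simps)
      then have eq: "p = n * int N" by (metis of_int_eq_iff of_int_mult of_int_of_nat_eq)
      then have "n \<noteq> 0" using False by auto
      then have "1 * int N \<le> \<bar>n\<bar> * int N" by (intro mult_right_mono) auto
      then have "int N \<le> \<bar>p\<bar>" unfolding eq abs_mult by simp
      then show False using p by simp
    qed
    moreover have "(\<omega> powi p) ^ N = 1"
    proof -
      have "(\<omega> powi p) ^ N = exp (of_nat N * (of_int p * (2 * of_real pi * \<i> / of_nat N)))"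
        unfolding pow exp_of_nat_mult ..
      also have "of_nat N * (of_int p * (2 * of_real pi * \<i> / of_nat N)) = 2 * of_int p * of_real pi * \<i>"
        using N by simp
      also have "exp \<dots> = 1" using exp_integer_2pi[of "of_int p"] by (simp add: mult_ac)
      finally show ?thesis .
    qed
    ultimately show ?thesis using False unfolding terms by (simp add: geometric_sum)
  qed simp
qed

section \<open>Laurent polynomials and anticanonical sections\<close>

definition upd :: "complex ^ 'n::finite \<Rightarrow> 'n \<Rightarrow> complex \<Rightarrow> complex ^ 'n" where
  "upd x j s = (\<chi> i. if i = j then s else x $ i)"

lemma upd_nth [simp]: "upd x j s $ i = (if i = j then s else x $ i)"
  by (simp add: upd_def)

lemma mon_upd_scale:
  fixes x :: "complex ^ 'n::finite"
  assumes "\<forall>j. x $ j \<noteq> 0" "s \<noteq> 0"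
  shows "mon m (upd x i (s * x $ i)) k = s powi pair k (dual_basis m i) * mon m x k"
proof -
  have "mon m (upd x i (s * x $ i)) k =
      (s * x $ i) powi pair k (dual_basis m i) * (\<Prod>j\<in>UNIV - {i}. x $ j powi pair k (dual_basis m j))"
    unfolding mon_def by (subst prod.remove[of _ i]) (auto intro!: prod.cong)
  moreover have "mon m x k = x $ i powi pair k (dual_basis m i) * (\<Prod>j\<in>UNIV - {i}. x $ j powi pair k (dual_basis m j))"
    unfolding mon_def by (subst prod.remove[of _ i]) auto
  ultimately show ?thesis by (simp add: power_int_mult_distrib)
qed

text \<open>Discrete Fourier inversion: the coordinates of the points \<open>x i\<close> are roots of unity.\<close>

lemma mon_extraction:
  fixes m :: "'n::finite \<Rightarrow> 'n lattice"
  assumes m: "lattice_basis m" and F: "finite F"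
  shows "\<exists>(I :: ('n \<Rightarrow> nat) set) w x. finite I \<and> (\<forall>i\<in>I. \<forall>j. (x i :: complex ^ 'n) $ j \<noteq> 0) \<and>
    (\<forall>k\<in>F. \<forall>l\<in>F. (\<Sum>i\<in>I. w k i * mon m (x i) l) = (if k = l then 1 else 0))"
proof -
  \<comment> \<open>Exceeds all differences of exponents, so that distinct exponents remain distinct
    modulo N.\<close>
  define N where "N = Suc (nat (\<Sum>k\<in>F. \<Sum>l\<in>F. \<Sum>j\<in>UNIV. \<bar>pair (k - l) (dual_basis m j)\<bar>))"
  have N: "N > 0" by (simp add: N_def)
  have bound: "\<bar>pair (k - l) (dual_basis m j)\<bar> < int N" if kl: "k \<in> F" "l \<in> F" for k l j
  proof -
    have "\<bar>pair (k - l) (dual_basis m j)\<bar> \<le> (\<Sum>j\<in>UNIV. \<bar>pair (k - l) (dual_basis m j)\<bar>)"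
      by (rule member_le_sum) auto
    also have "\<dots> \<le> (\<Sum>l\<in>F. \<Sum>j\<in>UNIV. \<bar>pair (k - l) (dual_basis m j)\<bar>)"
      using kl(2) F by (intro member_le_sum[of l]) (auto intro: sum_nonneg)
    also have "\<dots> \<le> (\<Sum>k\<in>F. \<Sum>l\<in>F. \<Sum>j\<in>UNIV. \<bar>pair (k - l) (dual_basis m j)\<bar>)"
      using kl(1) F by (intro member_le_sum[of k]) (auto intro!: sum_nonneg)
    finally have le: "\<bar>pair (k - l) (dual_basis m j)\<bar> \<le> (\<Sum>k\<in>F. \<Sum>l\<in>F. \<Sum>j\<in>UNIV. \<bar>pair (k - l) (dual_basis m j)\<bar>)" .
    have "0 \<le> (\<Sum>k\<in>F. \<Sum>l\<in>F. \<Sum>j\<in>UNIV. \<bar>pair (k - l) (dual_basis m j)\<bar>)" by (intro sum_nonneg) auto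
    then show ?thesis using le by (simp add: N_def)
  qed
  define \<omega> where "\<omega> = exp (2 * of_real pi * \<i> / of_nat N)"
  define x :: "('n \<Rightarrow> nat) \<Rightarrow> complex ^ 'n" where "x \<kappa> = (\<chi> j. \<omega> ^ \<kappa> j)" for \<kappa>
  define I where "I = (PiE UNIV (\<lambda>_. {..<N}) :: ('n \<Rightarrow> nat) set)"
  have "\<omega> \<noteq> 0" by (simp add: \<omega>_def)
  then have nz: "\<forall>j. x \<kappa> $ j \<noteq> 0" for \<kappa> by (simp add: x_def)
  define w where "w k \<kappa> = mon m (x \<kappa>) (- k) / of_nat N ^ CARD('n)" for k \<kappa>
  have "(\<Sum>\<kappa>\<in>I. w k \<kappa> * mon m (x \<kappa>) l) = (if k = l then 1 else 0)" if kl: "k \<in> F" "l \<in> F" for k l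
  proof -
    have "(\<Sum>\<kappa>\<in>I. mon m (x \<kappa>) (l - k)) = (\<Sum>\<kappa>\<in>I. \<Prod>j\<in>UNIV. (\<omega> ^ \<kappa> j) powi pair (l - k) (dual_basis m j))"
      by (simp add: mon_def x_def)
    also have "\<dots> = (\<Prod>j\<in>UNIV. \<Sum>t<N. (\<omega> ^ t) powi pair (l - k) (dual_basis m j))"
      unfolding I_def by (subst prod_sum_PiE) auto
    also have "\<dots> = (\<Prod>j\<in>UNIV. if pair (l - k) (dual_basis m j) = 0 then of_nat N else 0)"
      using sum_root_of_unity[OF N bound[OF kl(2,1)]] unfolding \<omega>_def by simp
    also have "\<dots> = (if k = l then of_nat N ^ CARD('n) else 0)"
    proof (cases "k = l")
      case False
      then have "\<exists>j. pair (l - k) (dual_basis m j) \<noteq> 0"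
        using lattice_basis_expand[OF m, of "l - k"] by (metis (no_types, lifting) eq_iff_diff_eq_0 sum.neutral vector_smult_lzero)
      then show ?thesis using False by auto
    qed simp
    finally have *: "(\<Sum>\<kappa>\<in>I. mon m (x \<kappa>) (l - k)) = (if k = l then of_nat N ^ CARD('n) else 0)" .
    have "(\<Sum>\<kappa>\<in>I. w k \<kappa> * mon m (x \<kappa>) l) = (\<Sum>\<kappa>\<in>I. mon m (x \<kappa>) (l - k)) / of_nat N ^ CARD('n)"
      unfolding sum_divide_distrib w_def
      by (intro sum.cong refl) (use mon_add[OF nz, where m = m and k = l and l = "- k"] in \<open>simp add: mult.commute\<close>)
    then show ?thesis using * N by simp
  qed
  moreover have "finite I" by (auto simp: I_def intro!: finite_PiE)
  ultimately show ?thesis using nz by blast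
qed

lemma mon_independent:
  assumes m: "lattice_basis m" and F: "finite F"
    and 0: "\<And>x. \<forall>j. x $ j \<noteq> 0 \<Longrightarrow> (\<Sum>k\<in>F. a k * mon m x k) = 0" and k: "k \<in> F"
  shows "a k = 0"
proof -
  obtain I w x where I: "finite (I :: ('a \<Rightarrow> nat) set)" "\<forall>i\<in>I. \<forall>j. (x i :: complex ^ 'a) $ j \<noteq> 0"
    "\<forall>k\<in>F. \<forall>l\<in>F. (\<Sum>i\<in>I. w k i * mon m (x i) l) = (if k = l then 1 else 0)"
    using mon_extraction[OF m F] by blast
  have "a k = (\<Sum>l\<in>F. a l * (\<Sum>i\<in>I. w k i * mon m (x i) l))"
    using I(3) k F by (simp add: if_distrib[of "\<lambda>x. _ * x"] cong: if_cong)
  also have "\<dots> = (\<Sum>i\<in>I. w k i * (\<Sum>l\<in>F. a l * mon m (x i) l))"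
    unfolding sum_distrib_left by (subst sum.swap) (simp add: mult_ac)
  also have "\<dots> = 0" using 0 I(2) by simp
  finally show ?thesis .
qed

text \<open>Let q be the lowest negative exponent whose total coefficient \<open>G q\<close> is
  nonzero. After multiplication by the power -q of s the sum tends to \<open>G q\<close> as s tends
  to 0, but by boundedness also to 0.\<close>

lemma laurent_bounded_imp_zero:
  fixes b :: "'a \<Rightarrow> complex" and e :: "'a \<Rightarrow> int"
  assumes F: "finite F" and bd: "\<And>s. s \<noteq> 0 \<Longrightarrow> norm s \<le> 1 \<Longrightarrow> norm (\<Sum>k\<in>F. b k * s powi e k) \<le> C"
    and n: "n < 0"
  shows "(\<Sum>k\<in>{k\<in>F. e k = n}. b k) = 0"
proof (rule ccontr)
  define G where "G n = (\<Sum>k\<in>{k\<in>F. e k = n}. b k)" for n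
  assume "(\<Sum>k\<in>{k\<in>F. e k = n}. b k) \<noteq> 0"
  then have Gn: "G n \<noteq> 0" by (simp add: G_def)
  then have "n \<in> e ` F" unfolding G_def by (metis (mono_tags, lifting) empty_Collect_eq image_eqI sum.empty)
  define A where "A = {n \<in> e ` F. n < 0 \<and> G n \<noteq> 0}"
  have A: "finite A" "A \<noteq> {}" using F n Gn \<open>n \<in> e ` F\<close> by (auto simp: A_def)
  define q where "q = Min A"
  have q: "q < 0" "G q \<noteq> 0" using Min_in[OF A] by (auto simp: q_def A_def)
  have below: "G p = 0" if "p \<in> e ` F" "p < q" for p
    using that q(1) Min_le[OF A(1), of p] by (force simp: q_def A_def)
  have group: "(\<Sum>k\<in>F. b k * s powi e k) = (\<Sum>p\<in>e ` F. G p * s powi p)" for s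
  proof -
    have "(\<Sum>k\<in>F. b k * s powi e k) = (\<Sum>p\<in>e ` F. \<Sum>k\<in>{k\<in>F. e k = p}. b k * s powi e k)"
      by (rule sum.image_gen[OF F])
    also have "\<dots> = (\<Sum>p\<in>e ` F. G p * s powi p)"
      unfolding G_def sum_distrib_right by (intro sum.cong refl) auto
    finally show ?thesis .
  qed
  define f where "f s = (\<Sum>p\<in>{p\<in>e ` F. q \<le> p}. G p * s ^ nat (p - q))" for s :: complex
  have f: "f s = s ^ nat (- q) * (\<Sum>k\<in>F. b k * s powi e k)" if s: "s \<noteq> 0" for s
  proof -
    have 1: "(\<Sum>p\<in>e ` F. G p * s powi p) = (\<Sum>p\<in>{p\<in>e ` F. q \<le> p}. G p * s powi p)"
      by (rule sum.mono_neutral_right) (use F below in \<open>auto simp: not_le\<close>)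
    have 2: "s ^ nat (- q) * (G p * s powi p) = G p * s ^ nat (p - q)" if "q \<le> p" for p
    proof -
      have "s ^ nat (- q) = s powi (- q)" using q(1) by (simp add: power_int_def)
      then have "s ^ nat (- q) * s powi p = s powi (- q + p)" unfolding power_int_add[OF disjI1[OF s]] by simp
      also have "\<dots> = s ^ nat (p - q)" using that by (simp add: power_int_def)
      finally show ?thesis by (simp add: mult_ac)
    qed
    show ?thesis unfolding group f_def 1 sum_distrib_left by (intro sum.cong refl) (simp only: 2 mem_Collect_eq)
  qed
  have "(f \<longlongrightarrow> f 0) (at 0)" unfolding f_def by (intro tendsto_intros)
  moreover have "f 0 = G q"
  proof -
    have "q \<in> e ` F" using Min_in[OF A] by (simp add: q_def A_def)
    then have "f 0 = (\<Sum>p\<in>{q}. G p * 0 ^ nat (p - q))"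
      unfolding f_def by (intro sum.mono_neutral_right) (use F in auto)
    then show ?thesis by simp
  qed
  moreover have "(f \<longlongrightarrow> 0) (at 0)"
  proof (rule Lim_null_comparison)
    show "\<forall>\<^sub>F s in at 0. norm (f s) \<le> norm s ^ nat (- q) * C"
      unfolding eventually_at
    proof (intro exI[of _ 1] conjI ballI impI)
      fix s :: complex assume "s \<noteq> 0 \<and> dist s 0 < 1"
      then show "norm (f s) \<le> norm s ^ nat (- q) * C"
        using f[of s] bd[of s] by (simp add: norm_mult norm_power mult_left_mono)
    qed simp
    have "((\<lambda>s :: complex. norm s ^ nat (- q) * C) \<longlongrightarrow> norm (0::complex) ^ nat (- q) * C) (at 0)"
      by (intro tendsto_intros)
    then show "((\<lambda>s :: complex. norm s ^ nat (- q) * C) \<longlongrightarrow> 0) (at 0)" using q(1) by (simp add: zero_power)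
  qed
  ultimately have "G q = 0" using LIM_unique by metis
  then show False using q(2) by simp
qed

text \<open>Only the i-th coordinate is scaled. For each fixed point, the terms with a given
  negative exponent in that coordinate sum to 0; they form a Laurent polynomial vanishing on the
  torus, so their coefficients are 0.\<close>

lemma laurent_support:
  fixes m :: "'n::finite \<Rightarrow> 'n lattice"
  assumes m: "lattice_basis m" and F: "finite F"
    and bd: "\<And>x. \<forall>j. x $ j \<noteq> 0 \<Longrightarrow> \<exists>C. \<forall>s. s \<noteq> 0 \<and> norm s \<le> 1 \<longrightarrow>
      norm (\<Sum>k\<in>F. a k * mon m (upd x i (s * x $ i)) k) \<le> C"
    and k: "k \<in> F" "a k \<noteq> 0"
  shows "0 \<le> pair k (dual_basis m i)"
proof (rule ccontr)
  assume "\<not> 0 \<le> pair k (dual_basis m i)"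
  define n where "n = pair k (dual_basis m i)"
  let ?F = "{l \<in> F. pair l (dual_basis m i) = n}"
  have "a k = 0"
  proof (rule mon_independent[OF m, of ?F])
    fix x :: "complex ^ 'n" assume x: "\<forall>j. x $ j \<noteq> 0"
    obtain C where C: "\<forall>s. s \<noteq> 0 \<and> norm s \<le> 1 \<longrightarrow> norm (\<Sum>k\<in>F. a k * mon m (upd x i (s * x $ i)) k) \<le> C"
      using bd[OF x] by blast
    show "(\<Sum>l\<in>?F. a l * mon m x l) = 0"
    proof (rule laurent_bounded_imp_zero[OF F, of "\<lambda>l. a l * mon m x l" "\<lambda>l. pair l (dual_basis m i)" C])
      show "norm (\<Sum>l\<in>F. a l * mon m x l * s powi pair l (dual_basis m i)) \<le> C" if "s \<noteq> 0" "norm s \<le> 1" for s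
        using C[rule_format, of s] that by (simp add: mon_upd_scale[OF x that(1)] mult.assoc mult.commute[of "s powi _"])
    qed (use \<open>\<not> 0 \<le> pair k (dual_basis m i)\<close> in \<open>simp add: n_def\<close>)
  qed (use F k n_def in auto)
  then show False using k(2) by simp
qed

section \<open>Laurent polynomial functions\<close>

definition laurent :: "('n \<Rightarrow> 'n::finite lattice) \<Rightarrow> (complex ^ 'n \<Rightarrow> complex) \<Rightarrow> bool" where
  "laurent m f \<longleftrightarrow> (\<exists>F a. finite F \<and> (\<forall>x. (\<forall>j. x $ j \<noteq> 0) \<longrightarrow> f x = (\<Sum>k\<in>F. a k * mon m x k)))"

lemma laurent_mon: "laurent m (\<lambda>x. a * mon m x k)"
  unfolding laurent_def by (intro exI[of _ "{k}"] exI[of _ "\<lambda>_. a"]) auto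

lemma laurent_const: "laurent m (\<lambda>x. a)"
  using laurent_mon[of m a 0] by simp

lemma laurent_add:
  assumes "laurent m f" "laurent m g"
  shows "laurent m (\<lambda>x. f x + g x)"
proof -
  obtain F a where f: "finite F" "\<And>x. \<forall>j. x $ j \<noteq> 0 \<Longrightarrow> f x = (\<Sum>k\<in>F. a k * mon m x k)"
    using assms(1) unfolding laurent_def by blast
  obtain G b where g: "finite G" "\<And>x. \<forall>j. x $ j \<noteq> 0 \<Longrightarrow> g x = (\<Sum>k\<in>G. b k * mon m x k)"
    using assms(2) unfolding laurent_def by blast
  let ?c = "\<lambda>k. (if k \<in> F then a k else 0) + (if k \<in> G then b k else 0)"
  have "f x + g x = (\<Sum>k\<in>F \<union> G. ?c k * mon m x k)" if x: "\<forall>j. x $ j \<noteq> 0" for x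
  proof -
    have "(\<Sum>k\<in>F. a k * mon m x k) = (\<Sum>k\<in>F \<union> G. (if k \<in> F then a k else 0) * mon m x k)"
      by (rule sum.mono_neutral_cong_left) (use f g in auto)
    moreover have "(\<Sum>k\<in>G. b k * mon m x k) = (\<Sum>k\<in>F \<union> G. (if k \<in> G then b k else 0) * mon m x k)"
      by (rule sum.mono_neutral_cong_left) (use f g in auto)
    ultimately show ?thesis using f(2)[OF x] g(2)[OF x] by (simp add: distrib_right sum.distrib)
  qed
  then show ?thesis unfolding laurent_def using f(1) g(1) by (intro exI[of _ "F \<union> G"] exI[of _ ?c]) auto
qed

lemma laurent_sum: "(\<And>i. i \<in> I \<Longrightarrow> laurent m (f i)) \<Longrightarrow> laurent m (\<lambda>x. \<Sum>i\<in>I. f i x)"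
  by (induction I rule: infinite_finite_induct) (auto intro: laurent_const laurent_add)

lemma laurent_cong: "laurent m f \<Longrightarrow> (\<And>x. \<forall>j. x $ j \<noteq> 0 \<Longrightarrow> f x = g x) \<Longrightarrow> laurent m g"
  unfolding laurent_def by auto

lemma laurent_mult:
  assumes "laurent m f" "laurent m g"
  shows "laurent m (\<lambda>x. f x * g x)"
proof -
  obtain F a where f: "finite F" "\<And>x. \<forall>j. x $ j \<noteq> 0 \<Longrightarrow> f x = (\<Sum>k\<in>F. a k * mon m x k)"
    using assms(1) unfolding laurent_def by blast
  obtain G b where g: "finite G" "\<And>x. \<forall>j. x $ j \<noteq> 0 \<Longrightarrow> g x = (\<Sum>k\<in>G. b k * mon m x k)"
    using assms(2) unfolding laurent_def by blast
  have "laurent m (\<lambda>x. \<Sum>k\<in>F. \<Sum>l\<in>G. (a k * b l) * mon m x (k + l))"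
    by (intro laurent_sum laurent_mon)
  then show ?thesis
  proof (rule laurent_cong)
    fix x :: "complex ^ 'a" assume x: "\<forall>j. x $ j \<noteq> 0"
    show "(\<Sum>k\<in>F. \<Sum>l\<in>G. (a k * b l) * mon m x (k + l)) = f x * g x"
      unfolding f(2)[OF x] g(2)[OF x] sum_product
      by (intro sum.cong refl) (simp add: mon_add[OF x] mult_ac)
  qed
qed

lemma laurent_coord_power:
  assumes "lattice_basis m"
  shows "laurent m (\<lambda>x. x $ j ^ n)"
proof -
  have "mon m x (int n *s m j) = x $ j ^ n" for x
    by (simp add: mon_scale mon_basis[OF assms])
  then show ?thesis using laurent_mon[of m 1 "int n *s m j"] by simp
qed

text \<open>In one coordinate, \<open>f\<close> is recovered from its values at the N+1 roots of
  unity with polynomial weights \<open>L\<close>, the inverse discrete Fourier transform. Doing this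
  coordinate by coordinate leaves finitely many constants.\<close>

lemma separately_polynomial_laurent:
  fixes f :: "complex ^ 'n::finite \<Rightarrow> complex"
  assumes m: "lattice_basis m"
    and poly: "\<And>x j. \<forall>i. x $ i \<noteq> 0 \<Longrightarrow> \<exists>c. \<forall>s. s \<noteq> 0 \<longrightarrow> f (upd x j s) = (\<Sum>i\<le>N. c i * s ^ i)"
  shows "laurent m f"
proof -
  define M where "M = Suc N"
  define \<omega> where "\<omega> = exp (2 * of_real pi * \<i> / of_nat M)"
  have \<omega>0: "\<omega> \<noteq> 0" by (simp add: \<omega>_def)
  define L where "L t s = (\<Sum>i\<le>N. ((\<omega> ^ t) powi (- int i) / of_nat M) * s ^ i)" for t and s :: complex
  have M0: "of_nat M \<noteq> (0 :: complex)" by (simp add: M_def del: of_nat_Suc)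
  have interp: "f (upd x j s) = (\<Sum>t<M. L t s * f (upd x j (\<omega> ^ t)))" if x: "\<forall>i. x $ i \<noteq> 0" and s: "s \<noteq> 0" for x j s
  proof -
    obtain c where c: "\<And>s. s \<noteq> 0 \<Longrightarrow> f (upd x j s) = (\<Sum>i\<le>N. c i * s ^ i)" using poly[OF x] by blast
    have coeff: "(\<Sum>t<M. (\<omega> ^ t) powi (- int i) * f (upd x j (\<omega> ^ t))) = of_nat M * c i" if i: "i \<le> N" for i
    proof -
      have "(\<Sum>t<M. (\<omega> ^ t) powi (- int i) * f (upd x j (\<omega> ^ t))) =
          (\<Sum>t<M. \<Sum>l\<le>N. c l * ((\<omega> ^ t) powi (int l - int i)))"
        unfolding c[OF power_not_zero[OF \<omega>0]] sum_distrib_left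
        by (intro sum.cong refl) (use \<omega>0 in \<open>simp add: power_int_diff power_int_minus divide_inverse mult_ac\<close>)
      also have "\<dots> = (\<Sum>l\<le>N. c l * (\<Sum>t<M. (\<omega> ^ t) powi (int l - int i)))"
        unfolding sum_distrib_left by (rule sum.swap)
      also have "\<dots> = (\<Sum>l\<le>N. c l * (if l = i then of_nat M else 0))"
      proof (intro sum.cong refl arg_cong2[where f = "(*)"])
        fix l assume "l \<in> {..N}"
        then have "\<bar>int l - int i\<bar> < int M" using i by (simp add: M_def)
        from sum_root_of_unity[OF _ this] show "(\<Sum>t<M. (\<omega> ^ t) powi (int l - int i)) = (if l = i then of_nat M else 0)"
          unfolding \<omega>_def by (simp add: M_def)
      qed
      also have "\<dots> = of_nat M * c i" using i by (simp add: if_distrib[of "\<lambda>x. _ * x"] cong: if_cong)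
      finally show ?thesis .
    qed
    have "(\<Sum>t<M. L t s * f (upd x j (\<omega> ^ t))) =
        (\<Sum>i\<le>N. (\<Sum>t<M. (\<omega> ^ t) powi (- int i) * f (upd x j (\<omega> ^ t))) * s ^ i / of_nat M)"
      unfolding L_def sum_distrib_right sum_divide_distrib by (subst sum.swap) (simp add: mult_ac)
    also have "\<dots> = (\<Sum>i\<le>N. c i * s ^ i)" using M0 by (intro sum.cong refl) (simp add: coeff)
    finally show ?thesis using c[OF s] by simp
  qed
  \<comment> \<open>The induction frees the coordinates in \<open>J\<close> while the others stay
    fixed at nonzero values \<open>y\<close>.\<close>
  define merge where "merge J x y = ((\<chi> i. if i \<in> J then x $ i else y $ i) :: complex ^ 'n)" for J and x y :: "complex ^ 'n"
  have "laurent m (\<lambda>x. f (merge J x y))" if "finite J" "\<forall>i. y $ i \<noteq> 0" for J y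
    using that
  proof (induction J arbitrary: y rule: finite_induct)
    case empty
    then show ?case by (simp add: merge_def laurent_const)
  next
    case (insert j J)
    have "laurent m (\<lambda>x. \<Sum>t<M. L t (x $ j) * f (merge J x (upd y j (\<omega> ^ t))))"
      unfolding L_def
      by (intro laurent_sum laurent_mult laurent_const laurent_coord_power[OF m] insert.IH) (use insert.prems \<omega>0 in auto)
    then show ?case
    proof (rule laurent_cong)
      fix x :: "complex ^ 'n" assume x: "\<forall>i. x $ i \<noteq> 0"
      have "merge (insert j J) x y = upd (merge J x y) j (x $ j)"
        by (auto simp: merge_def vec_eq_iff)
      moreover have "merge J x (upd y j s) = upd (merge J x y) j s" for s
        using insert.hyps(2) by (auto simp: merge_def vec_eq_iff)
      ultimately show "(\<Sum>t<M. L t (x $ j) * f (merge J x (upd y j (\<omega> ^ t)))) = f (merge (insert j J) x y)"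
        using interp[of "merge J x y" "x $ j" j] x insert.prems by (simp add: merge_def)
    qed
  qed
  from this[of UNIV 1] show ?thesis by (simp add: merge_def vec_nth_inverse)
qed

lemma upd_eq_shift: "upd x j (s' + s) = upd x j s + axis j s'"
  by (simp add: vec_eq_iff axis_def)

lemma ratl_upd_holomorphic:
  assumes "\<And>x0. ratl x0 f"
  shows "(\<lambda>s. f (upd x j s)) holomorphic_on UNIV"
proof -
  have "((\<lambda>s. f (upd x j s)) has_field_derivative pdv f j (upd x j s)) (at s)" for s
  proof -
    have "((\<lambda>s'. f (upd x j s + axis j s')) has_field_derivative pdv f j (upd x j s)) (at 0)"
      by (rule has_derivative_imp_line[OF eventually_nhds_x_imp_x[OF ratl_has_derivative(1)[OF assms]]])
    then show ?thesis using DERIV_shift[of "\<lambda>s. f (upd x j s)" "pdv f j (upd x j s)" 0 s]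
      by (simp add: upd_eq_shift)
  qed
  then show ?thesis by (auto simp: holomorphic_on_open)
qed

lemma compact_unit_polydisc: "compact {x :: complex ^ 'n::finite. \<forall>j. norm (x $ j) \<le> 1}"
proof -
  have "norm x \<le> of_nat CARD('n)" if "\<forall>j. norm (x $ j) \<le> 1" for x :: "complex ^ 'n"
  proof -
    have "norm x \<le> (\<Sum>j\<in>UNIV. norm (x $ j))" unfolding norm_vec_def by (rule L2_set_le_sum) simp
    also have "\<dots> \<le> (\<Sum>j\<in>(UNIV :: 'n set). 1)" using that by (intro sum_mono) simp
    finally show ?thesis by simp
  qed
  then have "bounded {x :: complex ^ 'n. \<forall>j. norm (x $ j) \<le> 1}" unfolding bounded_iff by blast
  moreover have "closed {x :: complex ^ 'n. \<forall>j. norm (x $ j) \<le> 1}"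
    by (intro closed_Collect_all closed_Collect_le continuous_intros)
  ultimately show ?thesis by (simp add: compact_eq_bounded_closed)
qed

lemma norm_mon:
  assumes "\<forall>j. x $ j \<noteq> 0"
  shows "norm (mon m x k) = exp (\<Sum>j\<in>UNIV. of_int (pair k (dual_basis m j)) * ln (norm (x $ j)))"
proof -
  have "norm (x $ j) powi n = exp (of_int n * ln (norm (x $ j)))" for j n
    using assms exp_power_int[of "ln (norm (x $ j))" n] by simp
  then show ?thesis by (simp add: mon_def norm_power_int exp_sum flip: prod_norm)
qed

lemma norm_of_int_ge_1: "n \<noteq> 0 \<Longrightarrow> 1 \<le> norm (of_int n :: complex)"
  by (simp add: norm_of_int)

section \<open>Global sections of the anticanonical bundle\<close>

lemma pushforwardD:
  assumes "pushforward \<Sigma> g s s'" "c \<in> charts \<Sigma>" "d \<in> charts \<Sigma>" "P \<in> dom_chart \<Sigma> c" "g P \<in> dom_chart \<Sigma> d"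
  shows "s' d (g P) = jac \<Sigma> g c d P * s c P"
  using assms unfolding pushforward_def by blast

lemma pushforward_idD:
  assumes "pushforward \<Sigma> id s s'" "c \<in> charts \<Sigma>" "d \<in> charts \<Sigma>" "P \<in> dom_chart \<Sigma> c" "P \<in> dom_chart \<Sigma> d"
  shows "s' d P = jac \<Sigma> id c d P * s c P"
  using pushforwardD[OF assms(1-4)] assms(5) by (simp only: id_apply)

text \<open>A cone may carry several charts, which differ in the enumeration of its basis; one is
  fixed so that estimates are indexed by cones.\<close>

definition (in smooth_complete_fan) sel :: "(real ^ 'n) set \<Rightarrow> 'n \<Rightarrow> 'n lattice" where
  "sel \<sigma> = (SOME m. (\<sigma>, m) \<in> Ch)"

context smooth_complete_fan
begin

lemma sel_chart: "\<sigma> \<in> fst ` Ch \<Longrightarrow> (\<sigma>, sel \<sigma>) \<in> Ch"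
  unfolding sel_def by (elim imageE) (auto intro: someI[of "\<lambda>m. (\<sigma>, m) \<in> Ch"])

lemma finite_chart_cones: "finite (fst ` Ch)"
proof (rule finite_subset[OF _ finite_fan])
  show "fst ` Ch \<subseteq> \<Sigma>" by (auto simp: charts_def)
qed

text \<open>Completeness of the fan, applied to \<open>- log |P|\<close>.\<close>

lemma torus_in_unit_polydisc:
  assumes P: "P \<in> Torus"
  shows "\<exists>\<sigma>\<in>fst ` Ch. \<forall>j. norm (Xt (sel \<sigma> j) P) \<le> 1"
proof -
  obtain \<sigma>0 m0 where c0: "(\<sigma>0, m0) \<in> Ch" using ex_chart by blast
  obtain x where x: "P = pt m0 x" "\<forall>j. x $ j \<noteq> 0" using torus_pt[OF c0 P] .
  define u where "u = (\<Sum>j\<in>UNIV. (- ln (norm (x $ j))) *\<^sub>R rvec (dual_basis m0 j))"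
  have eq: "norm (Xt k P) = exp (- (rvec k \<bullet> u))" for k
    unfolding x(1) Xt_pt[OF c0 x(2)] norm_mon[OF x(2)] u_def inner_sum_right
    by (simp add: inner_rvec sum_negf mult.commute)
  obtain \<sigma> m where c: "(\<sigma>, m) \<in> Ch" "u \<in> \<sigma>" using chart_covers by blast
  then have \<sigma>: "\<sigma> \<in> fst ` Ch" by force
  then have "0 \<le> rvec (sel \<sigma> j) \<bullet> u" for j using chart_cone_iff[OF sel_chart[OF \<sigma>]] c(2) by blast
  then show ?thesis using \<sigma> eq by auto
qed

text \<open>By the covering by polydiscs, a section divided by \<open>tsec 0\<close> grows at most polynomially; so it is a
  Laurent polynomial, whose exponents lie in \<open>\<Delta>\<close> because sections are bounded near each divisor.\<close>

lemma section_expansion: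
  assumes hol: "\<And>\<sigma> m x0. (\<sigma>, m) \<in> Ch \<Longrightarrow> ratl x0 (\<lambda>x. s (\<sigma>, m) (pt m x))"
    and push: "pushforward \<Sigma> id s s"
  shows "\<exists>a. \<forall>c\<in>Ch. \<forall>P\<in>Dom c. s c P = (\<Sum>\<nu>\<in>DM. a \<nu> * tsec \<nu> c P)"
proof -
  obtain \<sigma>0 m0 where c0: "(\<sigma>0, m0) \<in> Ch" using ex_chart by blast
  \<comment> \<open>Numerator and denominator transform by the same Jacobian, so on the torus the
    quotient does not depend on the chart.\<close>
  define h where "h P = s (\<sigma>0, m0) P / tsec 0 (\<sigma>0, m0) P" for P
  define D where "D m = (of_int (det (\<chi> j. m j)) :: complex)" for m :: "'n \<Rightarrow> 'n lattice"
  define S where "S m = (\<Sum>j\<in>UNIV. m j :: 'n lattice)" for m :: "'n \<Rightarrow> 'n lattice"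
  have D: "D m \<noteq> 0" "1 \<le> norm (D m)" if "(\<sigma>, m) \<in> Ch" for \<sigma> m
    using det_lattice_basis_nonzero[OF chart_basis(1)[OF that]] norm_of_int_ge_1 by (auto simp: D_def)
  have ts: "tsec \<nu> (\<sigma>, m) P = D m * Xt (\<nu> + S m) P" if "(\<sigma>, m) \<in> Ch" "\<nu> \<in> DM" "P \<in> Torus" for \<nu> \<sigma> m P
    using tsec_torus[OF that] by (simp add: D_def S_def)
  have ts0: "tsec 0 (\<sigma>, m) P = D m * Xt (S m) P" if "(\<sigma>, m) \<in> Ch" "P \<in> Torus" for \<sigma> m P
    using ts[OF that(1) zero_in_DeltaM that(2)] by simp
  have sh: "s (\<sigma>, m) P = h P * tsec 0 (\<sigma>, m) P" if c: "(\<sigma>, m) \<in> Ch" and P: "P \<in> Torus" for \<sigma> m P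
  proof -
    note dom = torus_in_dom_chart[OF c0 P] torus_in_dom_chart[OF c P]
    have "s (\<sigma>, m) P = Jac id (\<sigma>0, m0) (\<sigma>, m) P * s (\<sigma>0, m0) P"
      by (rule pushforward_idD[OF push c0 c dom])
    moreover have "tsec 0 (\<sigma>, m) P = Jac id (\<sigma>0, m0) (\<sigma>, m) P * tsec 0 (\<sigma>0, m0) P"
      by (rule pushforward_idD[OF tsec_compat[OF zero_in_DeltaM] c0 c dom])
    moreover have "tsec 0 (\<sigma>0, m0) P \<noteq> 0" using ts0[OF c0 P] D[OF c0] Xt_nonzero[OF P] by simp
    ultimately show ?thesis by (simp add: h_def)
  qed
  define K where "K = {x :: complex ^ 'n. \<forall>j. norm (x $ j) \<le> 1}"
  have "\<exists>C. 0 \<le> C \<and> (\<forall>x\<in>K. norm (s (\<sigma>, sel \<sigma>) (pt (sel \<sigma>) x)) \<le> C)" if \<sigma>: "\<sigma> \<in> fst ` Ch" for \<sigma>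
  proof -
    have "continuous_on K (\<lambda>x. s (\<sigma>, sel \<sigma>) (pt (sel \<sigma>) x))"
      by (intro continuous_at_imp_continuous_on ballI ratl_isCont hol sel_chart \<sigma>)
    then have "bounded ((\<lambda>x. s (\<sigma>, sel \<sigma>) (pt (sel \<sigma>) x)) ` K)"
      using compact_unit_polydisc unfolding K_def by (intro compact_imp_bounded compact_continuous_image)
    then obtain C where "\<forall>x\<in>K. norm (s (\<sigma>, sel \<sigma>) (pt (sel \<sigma>) x)) \<le> C" by (auto simp: bounded_iff)
    then show ?thesis by (intro exI[of _ "\<bar>C\<bar>"]) force
  qed
  then obtain C where C: "\<And>\<sigma>. \<sigma> \<in> fst ` Ch \<Longrightarrow> 0 \<le> C \<sigma>"
    "\<And>\<sigma> x. \<sigma> \<in> fst ` Ch \<Longrightarrow> x \<in> K \<Longrightarrow> norm (s (\<sigma>, sel \<sigma>) (pt (sel \<sigma>) x)) \<le> C \<sigma>" by metis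
  \<comment> \<open>Each torus point lies in the unit polydisc of some chart. There the section is
    bounded, and division by \<open>tsec 0\<close> contributes the single character with exponent
    \<open>- S (sel \<sigma>)\<close>.\<close>
  have growth: "norm (h P) \<le> (\<Sum>\<sigma>\<in>fst ` Ch. C \<sigma> * norm (Xt (- S (sel \<sigma>)) P))" if P: "P \<in> Torus" for P
  proof -
    obtain \<sigma> where \<sigma>: "\<sigma> \<in> fst ` Ch" "\<forall>j. norm (Xt (sel \<sigma> j) P) \<le> 1"
      using torus_in_unit_polydisc[OF P] by blast
    note c = sel_chart[OF \<sigma>(1)]
    obtain x where x: "P = pt (sel \<sigma>) x" "\<forall>j. x $ j \<noteq> 0" using torus_pt[OF c P] .
    have "Xt (sel \<sigma> j) P = x $ j" for j
      unfolding x(1) Xt_pt[OF c x(2)] by (rule mon_basis[OF chart_basis(1)[OF c]])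
    then have "x \<in> K" using \<sigma>(2) by (simp add: K_def)
    then have le: "norm (s (\<sigma>, sel \<sigma>) P) \<le> C \<sigma>" using C(2)[OF \<sigma>(1)] x(1) by blast
    have Xm: "Xt (- S (sel \<sigma>)) P = 1 / Xt (S (sel \<sigma>)) P"
      using Xt_diff[OF P, of 0 "S (sel \<sigma>)"] Xt_zero[OF P] by simp
    have "h P * D (sel \<sigma>) = s (\<sigma>, sel \<sigma>) P * Xt (- S (sel \<sigma>)) P"
      unfolding sh[OF c P] ts0[OF c P] Xm using Xt_nonzero[OF P] by simp
    then have "norm (h P) * norm (D (sel \<sigma>)) = norm (s (\<sigma>, sel \<sigma>) P) * norm (Xt (- S (sel \<sigma>)) P)"
      by (metis norm_mult)
    moreover have "norm (h P) * 1 \<le> norm (h P) * norm (D (sel \<sigma>))"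
      using D(2)[OF c] by (intro mult_left_mono) auto
    moreover have "norm (s (\<sigma>, sel \<sigma>) P) * norm (Xt (- S (sel \<sigma>)) P) \<le> C \<sigma> * norm (Xt (- S (sel \<sigma>)) P)"
      using le by (intro mult_right_mono) auto
    ultimately have "norm (h P) \<le> C \<sigma> * norm (Xt (- S (sel \<sigma>)) P)" by simp
    also have "\<dots> \<le> (\<Sum>\<sigma>\<in>fst ` Ch. C \<sigma> * norm (Xt (- S (sel \<sigma>)) P))"
      using \<sigma>(1) C(1) finite_chart_cones by (intro member_le_sum) auto
    finally show ?thesis .
  qed
  define H where "H x = s (\<sigma>0, m0) (pt m0 x)" for x
  have Hr: "ratl x0 H" for x0 unfolding H_def by (rule hol[OF c0])
  note b0 = chart_basis(1)[OF c0]
  define kk where "kk \<sigma> = S m0 - S (sel \<sigma>)" for \<sigma>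
  have Hgrowth: "norm (H x) \<le> (\<Sum>\<sigma>\<in>fst ` Ch. C \<sigma> * norm (D m0) * norm (mon m0 x (kk \<sigma>)))" if x: "\<forall>j. x $ j \<noteq> 0" for x
  proof -
    have P: "pt m0 x \<in> Torus" using pt_in_torus_iff[OF c0] x by blast
    have "norm (H x) = norm (h (pt m0 x)) * (norm (D m0) * norm (Xt (S m0) (pt m0 x)))"
      unfolding H_def sh[OF c0 P] ts0[OF c0 P] by (simp add: norm_mult)
    also have "\<dots> \<le> (\<Sum>\<sigma>\<in>fst ` Ch. C \<sigma> * norm (Xt (- S (sel \<sigma>)) (pt m0 x))) *
        (norm (D m0) * norm (Xt (S m0) (pt m0 x)))"
      by (intro mult_right_mono growth P) auto
    also have "\<dots> = (\<Sum>\<sigma>\<in>fst ` Ch. C \<sigma> * norm (D m0) * norm (mon m0 x (kk \<sigma>)))"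
    proof -
      have "mon m0 x (kk \<sigma>) = Xt (- S (sel \<sigma>)) (pt m0 x) * Xt (S m0) (pt m0 x)" for \<sigma>
        unfolding kk_def Xt_pt[OF c0 x] mon_add[OF x, symmetric] by simp
      then show ?thesis
        unfolding sum_distrib_right by (intro sum.cong refl) (simp add: norm_mult mult_ac)
    qed
    finally show ?thesis .
  qed
  \<comment> \<open>Bounds the exponents in the growth estimate, and hence, by Liouville's theorem,
    the degree of \<open>H\<close> in each coordinate.\<close>
  define N where "N = nat (\<Sum>\<sigma>\<in>fst ` Ch. \<Sum>j\<in>UNIV. \<bar>pair (kk \<sigma>) (dual_basis m0 j)\<bar>)"
  have N: "pair (kk \<sigma>) (dual_basis m0 j) \<le> int N" if "\<sigma> \<in> fst ` Ch" for \<sigma> j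
  proof -
    have "\<bar>pair (kk \<sigma>) (dual_basis m0 j)\<bar> \<le> (\<Sum>j\<in>UNIV. \<bar>pair (kk \<sigma>) (dual_basis m0 j)\<bar>)"
      by (rule member_le_sum) auto
    also have "\<dots> \<le> (\<Sum>\<sigma>\<in>fst ` Ch. \<Sum>j\<in>UNIV. \<bar>pair (kk \<sigma>) (dual_basis m0 j)\<bar>)"
      using that finite_chart_cones by (intro member_le_sum[of \<sigma>]) (auto intro: sum_nonneg)
    finally show ?thesis unfolding N_def by linarith
  qed
  have "laurent m0 H"
  proof (rule separately_polynomial_laurent[OF b0, of _ N])
    fix x :: "complex ^ 'n" and j assume x: "\<forall>i. x $ i \<noteq> 0"
    define p where "p \<sigma> = pair (kk \<sigma>) (dual_basis m0 j)" for \<sigma>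
    define B where "B = (\<Sum>\<sigma>\<in>fst ` Ch. C \<sigma> * norm (D m0) * (norm (x $ j) powi (- p \<sigma>) * norm (mon m0 x (kk \<sigma>))))"
    have "norm (H (upd x j z)) \<le> B * norm z ^ N" if z: "1 \<le> norm z" for z
    proof -
      have z0: "z \<noteq> 0" "z / x $ j \<noteq> 0" using z x by auto
      have upd: "upd x j z = upd x j ((z / x $ j) * x $ j)" using x by simp
      have "norm (H (upd x j z)) \<le> (\<Sum>\<sigma>\<in>fst ` Ch. C \<sigma> * norm (D m0) * norm (mon m0 (upd x j z) (kk \<sigma>)))"
        using z0 x by (intro Hgrowth) simp
      also have "\<dots> \<le> (\<Sum>\<sigma>\<in>fst ` Ch. C \<sigma> * norm (D m0) * (norm (x $ j) powi (- p \<sigma>) * norm (mon m0 x (kk \<sigma>))) * norm z ^ N)"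
      proof (rule sum_mono)
        fix \<sigma> assume \<sigma>: "\<sigma> \<in> fst ` Ch"
        have "norm z powi p \<sigma> \<le> norm z powi int N"
          using N[OF \<sigma>, of j] z by (intro power_int_increasing) (auto simp: p_def)
        then have zp: "norm z powi p \<sigma> \<le> norm z ^ N" by simp
        have "norm (mon m0 (upd x j z) (kk \<sigma>)) = norm z powi p \<sigma> * (norm (x $ j) powi (- p \<sigma>) * norm (mon m0 x (kk \<sigma>)))"
          unfolding upd mon_upd_scale[OF x z0(2)] norm_mult norm_power_int norm_divide power_int_divide_distrib
          by (simp add: p_def power_int_minus divide_inverse)
        also have "\<dots> \<le> norm z ^ N * (norm (x $ j) powi (- p \<sigma>) * norm (mon m0 x (kk \<sigma>)))"
          using zp by (intro mult_right_mono) auto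
        finally have "C \<sigma> * norm (D m0) * norm (mon m0 (upd x j z) (kk \<sigma>)) \<le>
            C \<sigma> * norm (D m0) * (norm z ^ N * (norm (x $ j) powi (- p \<sigma>) * norm (mon m0 x (kk \<sigma>))))"
          using C(1)[OF \<sigma>] by (intro mult_left_mono) auto
        then show "C \<sigma> * norm (D m0) * norm (mon m0 (upd x j z) (kk \<sigma>)) \<le>
            C \<sigma> * norm (D m0) * (norm (x $ j) powi (- p \<sigma>) * norm (mon m0 x (kk \<sigma>))) * norm z ^ N"
          by (simp add: mult_ac)
      qed
      also have "\<dots> = B * norm z ^ N" by (simp add: B_def sum_distrib_right)
      finally show ?thesis .
    qed
    then have "H (upd x j z) = (\<Sum>i\<le>N. (deriv ^^ i) (\<lambda>z. H (upd x j z)) 0 / fact i * z ^ i)" for z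
      by (rule Liouville_polynomial[OF ratl_upd_holomorphic[OF Hr]])
    then show "\<exists>c. \<forall>z. z \<noteq> 0 \<longrightarrow> H (upd x j z) = (\<Sum>i\<le>N. c i * z ^ i)"
      by (intro exI[of _ "\<lambda>i. (deriv ^^ i) (\<lambda>z. H (upd x j z)) 0 / fact i"] allI impI)
  qed
  then obtain F a where F: "finite F" "\<And>x. \<forall>j. x $ j \<noteq> 0 \<Longrightarrow> H x = (\<Sum>k\<in>F. a k * mon m0 x k)"
    unfolding laurent_def by blast
  define F' where "F' = (\<lambda>k. k - S m0) ` F"
  define a' where "a' l = a (l + S m0) / D m0" for l
  have finF': "finite F'" using F(1) by (simp add: F'_def)
  have h: "h P = (\<Sum>l\<in>F'. a' l * Xt l P)" if P: "P \<in> Torus" for P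
  proof -
    obtain x where x: "P = pt m0 x" "\<forall>j. x $ j \<noteq> 0" using torus_pt[OF c0 P] .
    have "(\<Sum>l\<in>F'. a' l * Xt l P) = (\<Sum>k\<in>F. a k / D m0 * Xt (k - S m0) P)"
      unfolding F'_def by (subst sum.reindex) (auto simp: inj_on_def a'_def)
    also have "\<dots> = (\<Sum>k\<in>F. a k * Xt k P) / (D m0 * Xt (S m0) P)"
      by (simp add: sum_divide_distrib Xt_diff[OF P])
    also have "(\<Sum>k\<in>F. a k * Xt k P) = H x" unfolding F(2)[OF x(2)] x(1) Xt_pt[OF c0 x(2)] ..
    also have "H x = h P * (D m0 * Xt (S m0) P)" unfolding H_def x(1)[symmetric] sh[OF c0 P] ts0[OF c0 P] ..
    finally show ?thesis using D[OF c0] Xt_nonzero[OF P] by simp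
  qed
  have supp: "l \<in> DM" if l: "l \<in> F'" "a' l \<noteq> 0" for l
    unfolding DeltaM_iff
  proof
    fix \<rho> assume "\<rho> \<in> Rays"
    then obtain \<sigma> m where c: "(\<sigma>, m) \<in> Ch" "\<rho> \<in> gens \<sigma>" using ray_in_chart by blast
    then obtain i where i: "\<rho> = dual_basis m i" using chart_gens by blast
    note b = chart_basis(1)[OF c(1)]
    have expand: "(\<Sum>k\<in>(\<lambda>l. l + S m) ` F'. a' (k - S m) * mon m y k) = s (\<sigma>, m) (pt m y) / D m" if y: "\<forall>j. y $ j \<noteq> 0" for y
    proof -
      have P: "pt m y \<in> Torus" using pt_in_torus_iff[OF c(1)] y by blast
      have "(\<Sum>k\<in>(\<lambda>l. l + S m) ` F'. a' (k - S m) * mon m y k) = (\<Sum>l\<in>F'. a' l * mon m y (l + S m))"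
        by (subst sum.reindex) (auto simp: inj_on_def)
      also have "\<dots> = h (pt m y) * Xt (S m) (pt m y)"
        unfolding h[OF P] Xt_pt[OF c(1) y] by (simp add: mon_add[OF y] sum_distrib_right mult.assoc)
      finally show ?thesis unfolding sh[OF c(1) P] ts0[OF c(1) P] using D[OF c(1)] by simp
    qed
    \<comment> \<open>The section is bounded near the divisor, so its exponents are nonnegative; as
      \<open>S m\<close> has height 1 on the ray, \<open>l\<close> has height at least -1.\<close>
    have "0 \<le> pair (l + S m) (dual_basis m i)"
    proof (rule laurent_support[OF b, of "(\<lambda>l. l + S m) ` F'" "\<lambda>k. a' (k - S m)" i])
      fix x :: "complex ^ 'n" assume x: "\<forall>j. x $ j \<noteq> 0"
      let ?g = "\<lambda>z. s (\<sigma>, m) (pt m (upd x i (z * x $ i))) / D m"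
      have "continuous_on UNIV (\<lambda>z. s (\<sigma>, m) (pt m (upd x i z)))"
        by (rule holomorphic_on_imp_continuous_on[OF ratl_upd_holomorphic[OF hol[OF c(1)]]])
      then have "continuous_on (cball 0 1) (\<lambda>z. s (\<sigma>, m) (pt m (upd x i (z * x $ i))))"
        by (rule continuous_on_compose2) (auto intro!: continuous_intros)
      then have "continuous_on (cball 0 1) ?g" using D[OF c(1)] by (intro continuous_intros) auto
      then have "bounded (?g ` cball 0 1)" by (intro compact_imp_bounded compact_continuous_image) auto
      then obtain B where B: "\<forall>z\<in>cball 0 1. norm (?g z) \<le> B" by (auto simp: bounded_iff)
      show "\<exists>C. \<forall>z. z \<noteq> 0 \<and> norm z \<le> 1 \<longrightarrow>
          norm (\<Sum>k\<in>(\<lambda>l. l + S m) ` F'. a' (k - S m) * mon m (upd x i (z * x $ i)) k) \<le> C"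
      proof (intro exI[of _ B] allI impI)
        fix z :: complex assume z: "z \<noteq> 0 \<and> norm z \<le> 1"
        have "\<forall>j. upd x i (z * x $ i) $ j \<noteq> 0" using x z by simp
        from expand[OF this] show "norm (\<Sum>k\<in>(\<lambda>l. l + S m) ` F'. a' (k - S m) * mon m (upd x i (z * x $ i)) k) \<le> B"
          using B z by simp
      qed
    qed (use l finF' in auto)
    then show "-1 \<le> pair l \<rho>"
      by (simp add: i S_def pair_simps dual_basis_pair[OF b])
  qed
  define A where "A \<nu> = (if \<nu> \<in> F' then a' \<nu> else 0)" for \<nu>
  have hA: "h P = (\<Sum>\<nu>\<in>DM. A \<nu> * Xt \<nu> P)" if "P \<in> Torus" for P
  proof -
    have "(\<Sum>\<nu>\<in>DM. A \<nu> * Xt \<nu> P) = (\<Sum>\<nu>\<in>DM \<inter> F'. A \<nu> * Xt \<nu> P)"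
      by (rule sum.mono_neutral_right) (use finite_DeltaM in \<open>auto simp: A_def\<close>)
    also have "\<dots> = (\<Sum>l\<in>F'. a' l * Xt l P)"
      by (rule sum.mono_neutral_cong_left) (use finF' supp in \<open>auto simp: A_def\<close>)
    finally show ?thesis using h[OF that] by simp
  qed
  have "s c P = (\<Sum>\<nu>\<in>DM. A \<nu> * tsec \<nu> c P)" if cc: "c \<in> Ch" and P: "P \<in> Dom c" for c P
  proof -
    obtain \<sigma> m where c': "c = (\<sigma>, m)" by (cases c)
    note c = cc[unfolded c']
    obtain x0 where x0: "P = pt m x0" using pt_coords[OF c] P c' by metis
    let ?f = "\<lambda>x. s (\<sigma>, m) (pt m x) - (\<Sum>\<nu>\<in>DM. A \<nu> * tsec \<nu> (\<sigma>, m) (pt m x))"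
    have "ratl x0 (\<lambda>x. tsec \<nu> (\<sigma>, m) (pt m x))" if "\<nu> \<in> DM" for \<nu>
      unfolding tsec_def fst_conv snd_conv
      by (intro ratl_mult ratl_const ratl_chi[OF c])
        (use tsec_pt(2)[OF c that] pt_in_chart[OF c] in \<open>auto simp: dom_chart_def\<close>)
    then have "ratl x0 ?f" by (intro ratl_diff ratl_sum ratl_mult ratl_const hol[OF c])
    moreover have "?f x = 0" if x: "\<forall>j. x $ j \<noteq> 0" for x
    proof -
      have P: "pt m x \<in> Torus" using pt_in_torus_iff[OF c] x by blast
      have "s (\<sigma>, m) (pt m x) = (\<Sum>\<nu>\<in>DM. A \<nu> * Xt \<nu> (pt m x)) * (D m * Xt (S m) (pt m x))"
        unfolding sh[OF c P] ts0[OF c P] hA[OF P] ..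
      also have "\<dots> = (\<Sum>\<nu>\<in>DM. A \<nu> * tsec \<nu> (\<sigma>, m) (pt m x))"
        unfolding sum_distrib_right by (intro sum.cong refl) (simp add: ts[OF c _ P] Xt_add[OF P])
      finally show ?thesis by simp
    qed
    then have "\<forall>\<^sub>F x in nhds x0. (\<forall>j. x $ j \<noteq> 0) \<longrightarrow> ?f x = 0" by simp
    ultimately have "?f x0 = 0" by (rule ratl_zero_by_density)
    then show ?thesis by (simp add: x0 c')
  qed
  then show ?thesis by blast
qed

lemma Xt_independent:
  assumes "finite F" "\<And>P. P \<in> Torus \<Longrightarrow> (\<Sum>k\<in>F. a k * Xt k P) = 0" "k \<in> F"
  shows "a k = 0"
proof -
  obtain \<sigma> m where c: "(\<sigma>, m) \<in> Ch" using ex_chart by blast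
  show ?thesis
  proof (rule mon_independent[OF chart_basis(1)[OF c] assms(1) _ assms(3)])
    fix x :: "complex ^ 'n" assume x: "\<forall>j. x $ j \<noteq> 0"
    show "(\<Sum>k\<in>F. a k * mon m x k) = 0"
      using assms(2)[of "pt m x"] x by (simp add: pt_in_torus_iff[OF c] Xt_pt[OF c x])
  qed
qed

section \<open>The action of automorphisms on sections\<close>

lemma tsec_ratl:
  assumes "c \<in> Ch" "\<nu> \<in> DM" "(\<sigma>, m) \<in> Ch" "pt m x0 \<in> Dom c"
  shows "ratl x0 (\<lambda>x. tsec \<nu> c (pt m x))"
proof -
  obtain \<tau> n where c: "c = (\<tau>, n)" by (cases c)
  have c': "(\<tau>, n) \<in> Ch" using assms(1) c by simp
  have "pt m x0 \<in> Aff \<tau>" using assms(4) by (simp add: c dom_chart_def)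
  then show ?thesis unfolding tsec_def c fst_conv snd_conv
    by (intro ratl_mult ratl_const ratl_chi[OF assms(3)] tsec_pt(2)[OF c' assms(2)])
qed

lemma jac_inverse:
  assumes g: "g \<in> AutY" and c: "c \<in> Ch" and d: "d \<in> Ch"
    and P: "P \<in> Dom c" "g P \<in> Dom d"
  shows "Jac (inv g) d c (g P) * Jac g c d P = 1"
proof -
  have ig: "inv g (g P) = P" "inv g \<circ> g = id" using AutD(4)[OF g] by (simp_all add: bij_is_inj)
  have "Jac (inv g \<circ> g) c c P = Jac (inv g) d c (g P) * Jac g c d P"
    by (rule jac_comp[OF AutD(2,3)[OF g] c d c P]) (use ig P in simp)
  then show ?thesis using jac_id[OF c P(1)] ig by simp
qed

text \<open>The push-forward of a section at a point does not depend on the chart chosen around the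
  preimage.\<close>

lemma jac_change_source:
  assumes g: "morphism \<Sigma> g" and c: "c \<in> Ch" "c' \<in> Ch" and d: "d \<in> Ch"
    and P: "P \<in> Dom c" "P \<in> Dom c'" "g P \<in> Dom d" and \<mu>: "\<mu> \<in> DM"
  shows "Jac g c d P * tsec \<mu> c P = Jac g c' d P * tsec \<mu> c' P"
proof -
  have "Jac (g \<circ> id) c d P = Jac g c' d (id P) * Jac id c c' P"
    by (rule jac_comp[OF morphism_id g c d P(1)]) (use P in simp_all)
  then have "Jac g c d P = Jac g c' d P * Jac id c c' P" by (simp only: comp_id id_apply)
  then show ?thesis using pushforward_idD[OF tsec_compat[OF \<mu>] c P(1,2)] by simp
qed

text \<open>The push-forward is defined pointwise with an arbitrary chart \<open>ch\<close> at the
  preimage. Once it is known to be regular and compatible between charts,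
  \<open>section_expansion\<close> applies.\<close>

lemma pushforward_expansion:
  assumes g: "g \<in> AutY" and \<mu>: "\<mu> \<in> DM"
  shows "\<exists>a. pushforward \<Sigma> g (tsec \<mu>) (\<lambda>c P. \<Sum>\<nu>\<in>DM. a \<nu> * tsec \<nu> c P)"
proof -
  define f where "f = inv g"
  note G = AutD[OF g]
  have gf: "g (f Q) = Q" "f (g Q) = Q" for Q
    using G(4) by (simp_all add: f_def bij_is_inj bij_is_surj surj_f_inv_f)
  have fY: "f Q \<in> TV \<longleftrightarrow> Q \<in> TV" for Q using G(5)[of "f Q"] gf by simp
  note mor = G(2) G(3)[folded f_def]
  have ex: "\<exists>c. c \<in> Ch \<and> P \<in> Dom c" if "P \<in> TV" for P
    using in_some_chart[OF that] by blast
  define ch where "ch P = (SOME c. c \<in> Ch \<and> P \<in> Dom c)" for P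
  have ch: "ch P \<in> Ch" "P \<in> Dom (ch P)" if "P \<in> TV" for P
    using someI_ex[OF ex[OF that]] by (simp_all add: ch_def)
  define s' where "s' d Q = Jac g (ch (f Q)) d (f Q) * tsec \<mu> (ch (f Q)) (f Q)" for d Q
  have s': "s' d Q = Jac g c d (f Q) * tsec \<mu> c (f Q)"
    if "c \<in> Ch" "d \<in> Ch" "Q \<in> Dom d" "f Q \<in> Dom c" for c d Q
  proof -
    have Y: "f Q \<in> TV" using that(4) dom_chart_subset by blast
    show ?thesis unfolding s'_def
      by (rule jac_change_source[OF mor(1) ch(1)[OF Y] that(1,2) ch(2)[OF Y] that(4) _ \<mu>]) (simp add: gf that)
  qed
  have "\<exists>a. \<forall>c\<in>Ch. \<forall>P\<in>Dom c. s' c P = (\<Sum>\<nu>\<in>DM. a \<nu> * tsec \<nu> c P)"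
  proof (rule section_expansion)
    fix \<tau> n x0 assume d: "(\<tau>, n) \<in> Ch"
    have Q0: "pt n x0 \<in> Dom (\<tau>, n)" by (rule pt_in_chart[OF d])
    then have Y: "f (pt n x0) \<in> TV" using fY dom_chart_subset by blast
    obtain \<sigma> m where cc: "ch (f (pt n x0)) = (\<sigma>, m)" by (cases "ch (f (pt n x0))")
    have c: "(\<sigma>, m) \<in> Ch" "f (pt n x0) \<in> Dom (\<sigma>, m)" using ch[OF Y] cc by simp_all
    have fU: "f (pt n x0) \<in> Aff \<sigma>" using c(2) by (simp add: dom_chart_def)
    \<comment> \<open>The Jacobian of \<open>g\<close> at a preimage is the reciprocal of the
      Jacobian of the inverse map, which is rational in the coordinates of the target chart.\<close>
    have inv: "Jac g (\<sigma>, m) (\<tau>, n) (f Q) * Jac f (\<tau>, n) (\<sigma>, m) Q = 1"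
      if "Q \<in> Dom (\<tau>, n)" "f Q \<in> Dom (\<sigma>, m)" for Q
      using jac_inverse[OF g c(1) d that(2)] gf that(1) by (simp add: f_def mult.commute)
    show "ratl x0 (\<lambda>x. s' (\<tau>, n) (pt n x))"
    proof (rule ratl_cong)
      have "ratl x0 (\<lambda>x. tsec \<mu> (\<sigma>, m) (f (pt n x)))"
        unfolding tsec_def fst_conv snd_conv
        by (intro ratl_mult ratl_const morphism_ratl(2)[OF mor(2) d chart_basis(2)[OF c(1)] fU] tsec_pt(2)[OF c(1) \<mu>])
      moreover have "Jac f (\<tau>, n) (\<sigma>, m) (pt n x0) \<noteq> 0" using inv[OF Q0 c(2)] by auto
      ultimately show "ratl x0 (\<lambda>x. tsec \<mu> (\<sigma>, m) (f (pt n x)) / Jac f (\<tau>, n) (\<sigma>, m) (pt n x))"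
        by (intro ratl_divide jac_ratl[OF mor(2) d c])
      show "\<forall>\<^sub>F x in nhds x0. tsec \<mu> (\<sigma>, m) (f (pt n x)) / Jac f (\<tau>, n) (\<sigma>, m) (pt n x) = s' (\<tau>, n) (pt n x)"
        using morphism_ratl(1)[OF mor(2) d chart_basis(2)[OF c(1)] fU]
      proof eventually_elim
        case (elim x)
        then have fx: "f (pt n x) \<in> Dom (\<sigma>, m)" by (simp add: dom_chart_def)
        note i = inv[OF pt_in_chart[OF d] fx]
        then have "Jac f (\<tau>, n) (\<sigma>, m) (pt n x) \<noteq> 0" by auto
        then show ?case using s'[OF c(1) d pt_in_chart[OF d] fx] i by (simp add: field_simps)
      qed
    qed
  next
    show "pushforward \<Sigma> id s' s'"
      unfolding pushforward_def
    proof (intro ballI impI)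
      fix d e Q assume de: "d \<in> Ch" "e \<in> Ch" "Q \<in> Dom d" "id Q \<in> Dom e"
      then have Q: "Q \<in> Dom e" by simp
      have Y: "f Q \<in> TV" using fY dom_chart_subset de(3) by blast
      note c = ch[OF Y]
      have "Jac (id \<circ> g) (ch (f Q)) e (f Q) = Jac id d e (g (f Q)) * Jac g (ch (f Q)) d (f Q)"
        by (rule jac_comp[OF mor(1) morphism_id c(1) de(1,2) c(2)]) (simp_all add: gf de(3) Q)
      then have "Jac g (ch (f Q)) e (f Q) = Jac id d e Q * Jac g (ch (f Q)) d (f Q)"
        by (simp only: id_comp gf)
      then show "s' e (id Q) = Jac id d e Q * s' d Q" by (simp add: s'_def)
    qed
  qed
  then obtain a where a: "\<And>c P. c \<in> Ch \<Longrightarrow> P \<in> Dom c \<Longrightarrow> s' c P = (\<Sum>\<nu>\<in>DM. a \<nu> * tsec \<nu> c P)"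
    by blast
  have "pushforward \<Sigma> g (tsec \<mu>) (\<lambda>c P. \<Sum>\<nu>\<in>DM. a \<nu> * tsec \<nu> c P)"
    unfolding pushforward_def
  proof (intro ballI impI)
    fix c d P assume *: "c \<in> Ch" "d \<in> Ch" "P \<in> Dom c" "g P \<in> Dom d"
    have "s' d (g P) = Jac g c d P * tsec \<mu> c P" using s'[OF *(1,2,4)] *(3) gf by simp
    then show "(\<Sum>\<nu>\<in>DM. a \<nu> * tsec \<nu> d (g P)) = Jac g c d P * tsec \<mu> c P" using a[OF *(2,4)] by simp
  qed
  then show ?thesis by blast
qed

definition is_act :: "('n toric_point \<Rightarrow> 'n toric_point) \<Rightarrow> 'n mat_M \<Rightarrow> bool" where
  "is_act g A \<longleftrightarrow> (\<forall>\<nu> \<mu>. A \<nu> \<mu> \<noteq> 0 \<longrightarrow> \<nu> \<in> DM \<and> \<mu> \<in> DM) \<and>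
     (\<forall>\<mu>\<in>DM. pushforward \<Sigma> g (tsec \<mu>) (\<lambda>c P. \<Sum>\<nu>\<in>DM. A \<nu> \<mu> * tsec \<nu> c P))"

lemma is_actD:
  assumes "is_act g A" "\<mu> \<in> DM" "c \<in> Ch" "d \<in> Ch" "P \<in> Dom c" "g P \<in> Dom d"
  shows "(\<Sum>\<nu>\<in>DM. A \<nu> \<mu> * tsec \<nu> d (g P)) = Jac g c d P * tsec \<mu> c P"
proof -
  have "pushforward \<Sigma> g (tsec \<mu>) (\<lambda>c P. \<Sum>\<nu>\<in>DM. A \<nu> \<mu> * tsec \<nu> c P)"
    using assms(1,2) by (simp add: is_act_def)
  from pushforwardD[OF this assms(3-6)] show ?thesis .
qed

lemma is_act_unique:
  assumes g: "g \<in> AutY" and A: "is_act g A" and B: "is_act g B"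
  shows "A = B"
proof (intro ext)
  fix \<nu> \<mu>
  show "A \<nu> \<mu> = B \<nu> \<mu>"
  proof (cases "\<nu> \<in> DM \<and> \<mu> \<in> DM")
    case True
    obtain \<sigma> m where d: "(\<sigma>, m) \<in> Ch" using ex_chart by blast
    have "A \<nu> \<mu> - B \<nu> \<mu> = 0"
    proof (rule Xt_independent[OF finite_DeltaM, of "\<lambda>\<nu>. A \<nu> \<mu> - B \<nu> \<mu>"])
      fix Q assume Q: "Q \<in> Torus"
      let ?P = "inv g Q"
      have gP: "g ?P = Q" using AutD(4)[OF g] by (simp add: bij_is_surj surj_f_inv_f)
      have "?P \<in> TV" using AutD(5)[OF g, of ?P] gP Q by (simp add: U_def)
      then obtain \<tau> n where c: "(\<tau>, n) \<in> Ch" "?P \<in> Dom (\<tau>, n)" using in_some_chart by blast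
      have gPd: "g ?P \<in> Dom (\<sigma>, m)" unfolding gP by (rule torus_in_dom_chart[OF d Q])
      have "(\<Sum>\<nu>\<in>DM. A \<nu> \<mu> * tsec \<nu> (\<sigma>, m) (g ?P)) = Jac g (\<tau>, n) (\<sigma>, m) ?P * tsec \<mu> (\<tau>, n) ?P"
        using True by (intro is_actD[OF A _ c(1) d c(2) gPd]) simp
      moreover have "(\<Sum>\<nu>\<in>DM. B \<nu> \<mu> * tsec \<nu> (\<sigma>, m) (g ?P)) = Jac g (\<tau>, n) (\<sigma>, m) ?P * tsec \<mu> (\<tau>, n) ?P"
        using True by (intro is_actD[OF B _ c(1) d c(2) gPd]) simp
      ultimately have "(\<Sum>\<nu>\<in>DM. (A \<nu> \<mu> - B \<nu> \<mu>) * tsec \<nu> (\<sigma>, m) Q) = 0"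
        unfolding gP by (simp add: left_diff_distrib sum_subtractf)
      moreover have "(\<Sum>\<nu>\<in>DM. (A \<nu> \<mu> - B \<nu> \<mu>) * tsec \<nu> (\<sigma>, m) Q) =
          of_int (det (\<chi> j. m j)) * Xt (\<Sum>j\<in>UNIV. m j) Q * (\<Sum>\<nu>\<in>DM. (A \<nu> \<mu> - B \<nu> \<mu>) * Xt \<nu> Q)"
        unfolding sum_distrib_left
        by (intro sum.cong refl) (simp add: tsec_torus[OF d _ Q] Xt_add[OF Q])
      ultimately show "(\<Sum>\<nu>\<in>DM. (A \<nu> \<mu> - B \<nu> \<mu>) * Xt \<nu> Q) = 0"
        using Xt_nonzero[OF Q] det_lattice_basis_nonzero[OF chart_basis(1)[OF d]] by simp
    qed (use True in simp)
    then show ?thesis by simp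
  next
    case False
    then have "A \<nu> \<mu> = 0" "B \<nu> \<mu> = 0" using A B unfolding is_act_def by blast+
    then show ?thesis by simp
  qed
qed

lemma act_is_act:
  assumes g: "g \<in> AutY"
  shows "is_act g (Act g)"
proof -
  define a where "a \<mu> = (SOME a. pushforward \<Sigma> g (tsec \<mu>) (\<lambda>c P. \<Sum>\<nu>\<in>DM. a \<nu> * tsec \<nu> c P))" for \<mu>
  have a: "pushforward \<Sigma> g (tsec \<mu>) (\<lambda>c P. \<Sum>\<nu>\<in>DM. a \<mu> \<nu> * tsec \<nu> c P)" if "\<mu> \<in> DM" for \<mu>
    unfolding a_def by (rule someI_ex[OF pushforward_expansion[OF g that]])
  define A where "A \<nu> \<mu> = (if \<nu> \<in> DM \<and> \<mu> \<in> DM then a \<mu> \<nu> else 0)" for \<nu> \<mu>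
  have "(\<Sum>\<nu>\<in>DM. A \<nu> \<mu> * tsec \<nu> c P) = (\<Sum>\<nu>\<in>DM. a \<mu> \<nu> * tsec \<nu> c P)" if "\<mu> \<in> DM" for \<mu> c P
    using that by (intro sum.cong refl) (simp add: A_def)
  then have "is_act g A" using a by (auto simp: is_act_def A_def)
  moreover have "B = A" if "is_act g B" for B
    using is_act_unique[OF g that \<open>is_act g A\<close>] .
  ultimately have "(THE A. is_act g A) = A" by (rule the_equality[of "is_act g" A])
  moreover have "Act g = (THE A. is_act g A)" by (simp only: act_def is_act_def)
  ultimately show ?thesis using \<open>is_act g A\<close> by simp
qed

lemma act_eqI: "g \<in> AutY \<Longrightarrow> is_act g A \<Longrightarrow> Act g = A"
  by (rule is_act_unique[OF _ act_is_act])

lemma act_relation: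
  assumes "g \<in> AutY" "\<mu> \<in> DM" "c \<in> Ch" "d \<in> Ch" "P \<in> Dom c" "g P \<in> Dom d"
  shows "(\<Sum>\<nu>\<in>DM. Act g \<nu> \<mu> * tsec \<nu> d (g P)) = Jac g c d P * tsec \<mu> c P"
  by (rule is_actD[OF act_is_act[OF assms(1)] assms(2-6)])

lemma act_support: "g \<in> AutY \<Longrightarrow> Act g \<nu> \<mu> \<noteq> 0 \<Longrightarrow> \<nu> \<in> DM \<and> \<mu> \<in> DM"
  using act_is_act unfolding is_act_def by blast

lemma act_comp:
  assumes g: "g \<in> AutY" and h: "h \<in> AutY" and gh: "g \<circ> h \<in> AutY"
  shows "Act (g \<circ> h) \<nu> \<mu> = (\<Sum>\<kappa>\<in>DM. Act g \<nu> \<kappa> * Act h \<kappa> \<mu>)"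
proof -
  define A where "A \<nu> \<mu> = (\<Sum>\<kappa>\<in>DM. Act g \<nu> \<kappa> * Act h \<kappa> \<mu>)" for \<nu> \<mu>
  have "is_act (g \<circ> h) A"
    unfolding is_act_def
  proof (intro conjI allI impI ballI)
    fix \<nu> \<mu> assume "A \<nu> \<mu> \<noteq> 0"
    then obtain \<kappa> where "Act g \<nu> \<kappa> * Act h \<kappa> \<mu> \<noteq> 0" unfolding A_def by (metis (no_types, lifting) sum.neutral)
    then show "\<nu> \<in> DM" "\<mu> \<in> DM" using act_support[OF g] act_support[OF h] by auto
  next
    fix \<mu> assume \<mu>: "\<mu> \<in> DM"
    show "pushforward \<Sigma> (g \<circ> h) (tsec \<mu>) (\<lambda>c P. \<Sum>\<nu>\<in>DM. A \<nu> \<mu> * tsec \<nu> c P)"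
      unfolding pushforward_def
    proof (intro ballI impI)
      fix c d P assume cd: "c \<in> Ch" "d \<in> Ch" and P: "P \<in> Dom c" "(g \<circ> h) P \<in> Dom d"
      have "h P \<in> TV" using P(1) dom_chart_subset AutD(5)[OF h] by blast
      then obtain e where e: "e \<in> Ch" "h P \<in> Dom e" using in_some_chart by blast
      have P2: "g (h P) \<in> Dom d" using P(2) by simp
      have "(\<Sum>\<nu>\<in>DM. A \<nu> \<mu> * tsec \<nu> d (g (h P))) =
          (\<Sum>\<kappa>\<in>DM. Act h \<kappa> \<mu> * (\<Sum>\<nu>\<in>DM. Act g \<nu> \<kappa> * tsec \<nu> d (g (h P))))"
        unfolding A_def sum_distrib_right sum_distrib_left by (subst sum.swap) (simp add: mult_ac)
      also have "\<dots> = (\<Sum>\<kappa>\<in>DM. Act h \<kappa> \<mu> * (Jac g e d (h P) * tsec \<kappa> e (h P)))"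
        by (intro sum.cong refl) (simp add: act_relation[OF g _ e(1) cd(2) e(2) P2])
      also have "\<dots> = Jac g e d (h P) * (\<Sum>\<kappa>\<in>DM. Act h \<kappa> \<mu> * tsec \<kappa> e (h P))"
        unfolding sum_distrib_left by (simp add: mult_ac)
      also have "\<dots> = (Jac g e d (h P) * Jac h c e P) * tsec \<mu> c P"
        unfolding act_relation[OF h \<mu> cd(1) e(1) P(1) e(2)] by simp
      also have "Jac g e d (h P) * Jac h c e P = Jac (g \<circ> h) c d P"
        by (rule jac_comp[OF AutD(2)[OF h] AutD(2)[OF g] cd(1) e(1) cd(2) P(1) e(2) P2, symmetric])
      finally show "(\<Sum>\<nu>\<in>DM. A \<nu> \<mu> * tsec \<nu> d ((g \<circ> h) P)) = Jac (g \<circ> h) c d P * tsec \<mu> c P" by simp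
    qed
  qed
  then show ?thesis using act_eqI[OF gh] by (simp add: A_def)
qed

lemma id_Aut: "id \<in> AutY"
  unfolding Aut_def using morphism_id by (simp add: permutes_id inv_id)

lemma act_id: "Act id \<nu> \<mu> = (if \<nu> = \<mu> \<and> \<mu> \<in> DM then 1 else 0)"
proof -
  define A :: "'n mat_M" where "A \<nu> \<mu> = (if \<nu> = \<mu> \<and> \<mu> \<in> DM then 1 else 0)" for \<nu> \<mu>
  have "(\<Sum>\<nu>\<in>DM. A \<nu> \<mu> * tsec \<nu> c P) = tsec \<mu> c P" if "\<mu> \<in> DM" for \<mu> c P
    using that finite_DeltaM by (simp add: A_def if_distrib[of "\<lambda>x. x * _"] cong: if_cong)
  then have "is_act id A"
    using tsec_compat by (auto simp: is_act_def A_def)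
  then show ?thesis using act_eqI[OF id_Aut] by (simp add: A_def)
qed

text \<open>At the fixed point x = 0 of the chart a section \<open>tsec \<nu>\<close> is nonzero
  only if its exponent \<open>\<nu> + (\<Sum>j. m j)\<close> is 0. A section that does not vanish
  there must contain this \<nu>.\<close>

lemma bpf_vertex:
  assumes bpf: "anticanonical_bpf \<Sigma>" and c: "(\<sigma>, m) \<in> Ch"
  shows "- (\<Sum>j\<in>UNIV. m j) \<in> DM"
proof -
  note b = chart_basis(1)[OF c]
  let ?P = "pt m 0"
  have P: "?P \<in> Dom (\<sigma>, m)" "?P \<in> TV" using pt_in_chart[OF c] pt_in[OF c] by auto
  obtain s c' where s: "anticanonical_section \<Sigma> s" and c': "c' \<in> Ch" "?P \<in> Dom c'" "s c' ?P \<noteq> 0"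
    using bpf P(2) unfolding anticanonical_bpf_def by blast
  have "\<exists>a. \<forall>c\<in>Ch. \<forall>P\<in>Dom c. s c P = (\<Sum>\<nu>\<in>DM. a \<nu> * tsec \<nu> c P)"
  proof (rule section_expansion)
    show "pushforward \<Sigma> id s s" using s by (simp add: anticanonical_section_def)
    fix \<tau> n x0 assume d: "(\<tau>, n) \<in> Ch"
    then obtain f where f: "f \<in> coord_ring \<tau>" "\<forall>P\<in>Dom (\<tau>, n). s (\<tau>, n) P = f P"
      using s unfolding anticanonical_section_def by fastforce
    have "pt n x0 \<in> Aff \<tau>" using pt_in_chart[OF d] by (simp add: dom_chart_def)
    then have "ratl x0 (\<lambda>x. f (pt n x))" by (rule ratl_coord_ring[OF d _ f(1)])
    then show "ratl x0 (\<lambda>x. s (\<tau>, n) (pt n x))"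
      by (rule ratl_cong) (simp add: f(2) pt_in_chart[OF d])
  qed
  then obtain a where "s c' ?P = (\<Sum>\<nu>\<in>DM. a \<nu> * tsec \<nu> c' ?P)" using c' by blast
  then obtain \<nu> where \<nu>: "\<nu> \<in> DM" "tsec \<nu> c' ?P \<noteq> 0"
    using c'(3) by (metis (no_types, lifting) mult_zero_right sum.neutral)
  have "tsec \<nu> c' ?P = Jac id (\<sigma>, m) c' ?P * tsec \<nu> (\<sigma>, m) ?P"
    by (rule pushforward_idD[OF tsec_compat[OF \<nu>(1)] c c'(1) P(1) c'(2)])
  then have "tsec \<nu> (\<sigma>, m) ?P \<noteq> 0" using \<nu>(2) by auto
  then have "mon m 0 (\<nu> + (\<Sum>j\<in>UNIV. m j)) \<noteq> 0" using tsec_pt(1)[OF c \<nu>(1)] by auto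
  then have "pair (\<nu> + (\<Sum>j\<in>UNIV. m j)) (dual_basis m j) = 0" for j by (auto simp: mon_def)
  then have "\<nu> + (\<Sum>j\<in>UNIV. m j) = 0" using lattice_basis_expand[OF b, of "\<nu> + (\<Sum>j\<in>UNIV. m j)"] by simp
  then have "\<nu> = - (\<Sum>j\<in>UNIV. m j)" by (simp add: eq_neg_iff_add_eq_0)
  then show ?thesis using \<nu>(1) by simp
qed

text \<open>A vector \<open>v\<close> orthogonal to \<Delta> lies in some maximal cone; pairing it
  with the point of \<open>bpf_vertex\<close> shows that its nonnegative coordinates sum to 0. So
  characters in \<Delta> suffice to recover the coordinates of a chart.\<close>

lemma bpf_span:
  assumes bpf: "anticanonical_bpf \<Sigma>"
  shows "span (rvec ` DM) = UNIV"
proof (rule ccontr)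
  assume "span (rvec ` DM) \<noteq> UNIV"
  then obtain v where v: "v \<noteq> 0" "\<forall>x\<in>span (rvec ` DM). v \<bullet> x = 0"
    using span_not_UNIV_orthogonal by blast
  obtain \<sigma> m where c: "(\<sigma>, m) \<in> Ch" "v \<in> \<sigma>" using chart_covers by blast
  have nn: "0 \<le> rvec (m j) \<bullet> v" for j using chart_cone_iff[OF c(1)] c(2) by blast
  have "v \<bullet> rvec (- (\<Sum>j\<in>UNIV. m j)) = 0" using v(2) bpf_vertex[OF bpf c(1)] by (simp add: span_base)
  then have "(\<Sum>j\<in>UNIV. rvec (m j) \<bullet> v) = 0"
    by (simp add: rvec_minus rvec_sum inner_sum_right inner_commute)
  then have "rvec (m j) \<bullet> v = 0" for j using nn by (simp add: sum_nonneg_eq_0_iff)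
  then show False using v(1) real_dual_basis_expand[OF chart_basis(1)[OF c(1)], of v] by simp
qed

end

section \<open>The vector field of a one-parameter subgroup\<close>

lemma has_vector_derivative_at_0_iff:
  fixes f :: "real \<Rightarrow> 'a::real_normed_vector"
  shows "(f has_vector_derivative D) (at 0) \<longleftrightarrow> ((\<lambda>t. (1/t) *\<^sub>R (f t - f 0)) \<longlongrightarrow> D) (at 0)"
proof -
  have "norm (f (0 + h) - f 0 - h *\<^sub>R D) / norm h = norm ((1/h) *\<^sub>R (f h - f 0) - D)" if "h \<noteq> 0" for h
  proof -
    have "(1/h) *\<^sub>R (f h - f 0) - D = (1/h) *\<^sub>R (f h - f 0 - h *\<^sub>R D)"
      using that by (simp add: scaleR_diff_right)
    then show ?thesis by simp
  qed
  then have "((\<lambda>h. norm (f (0 + h) - f 0 - h *\<^sub>R D) / norm h) \<longlongrightarrow> 0) (at 0) \<longleftrightarrow>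
      ((\<lambda>h. norm ((1/h) *\<^sub>R (f h - f 0) - D)) \<longlongrightarrow> 0) (at 0)"
    by (intro filterlim_cong refl) (simp add: eventually_at_filter)
  also have "\<dots> \<longleftrightarrow> ((\<lambda>t. (1/t) *\<^sub>R (f t - f 0)) \<longlongrightarrow> D) (at 0)"
    by (simp add: tendsto_norm_zero_iff LIM_zero_iff)
  finally show ?thesis
    unfolding has_vector_derivative_def has_derivative_at using bounded_linear_scaleR_left by blast
qed

text \<open>\<open>v\<close> is \<open>M v\<close> minus \<open>(M - 1) v\<close>, and the second
  term has at most half the norm of \<open>v\<close>.\<close>

lemma near_identity_bound:
  fixes M :: "'i \<Rightarrow> 'i \<Rightarrow> complex"
  assumes I: "finite I" and M: "(\<Sum>i\<in>I. \<Sum>k\<in>I. norm (M i k - (if i = k then 1 else 0))) \<le> 1/2"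
  shows "(\<Sum>k\<in>I. norm (v k)) \<le> 2 * (\<Sum>i\<in>I. norm (\<Sum>k\<in>I. M i k * v k))"
proof -
  have 1: "norm (v i) \<le> norm (\<Sum>k\<in>I. M i k * v k) + (\<Sum>k\<in>I. norm (M i k - (if i = k then 1 else 0)) * norm (v k))"
    if i: "i \<in> I" for i
  proof -
    have "v i = (\<Sum>k\<in>I. (if i = k then 1 else 0) * v k)"
      using i I by (simp add: if_distrib[of "\<lambda>x. x * _"] cong: if_cong)
    also have "\<dots> = (\<Sum>k\<in>I. M i k * v k) - (\<Sum>k\<in>I. (M i k - (if i = k then 1 else 0)) * v k)"
      by (simp add: left_diff_distrib sum_subtractf)
    finally have "norm (v i) \<le> norm (\<Sum>k\<in>I. M i k * v k) + norm (\<Sum>k\<in>I. (M i k - (if i = k then 1 else 0)) * v k)"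
      by (metis norm_triangle_ineq4)
    also have "norm (\<Sum>k\<in>I. (M i k - (if i = k then 1 else 0)) * v k) \<le>
        (\<Sum>k\<in>I. norm (M i k - (if i = k then 1 else 0)) * norm (v k))"
      by (rule sum_norm_le) (simp add: norm_mult)
    finally show ?thesis by simp
  qed
  have "(\<Sum>i\<in>I. norm (v i)) \<le> (\<Sum>i\<in>I. norm (\<Sum>k\<in>I. M i k * v k)) +
      (\<Sum>i\<in>I. \<Sum>k\<in>I. norm (M i k - (if i = k then 1 else 0)) * norm (v k))"
    unfolding sum.distrib[symmetric] by (rule sum_mono) (rule 1)
  also have "(\<Sum>i\<in>I. \<Sum>k\<in>I. norm (M i k - (if i = k then 1 else 0)) * norm (v k)) \<le>
      (\<Sum>i\<in>I. \<Sum>k\<in>I. norm (M i k - (if i = k then 1 else 0)) * (\<Sum>l\<in>I. norm (v l)))"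
    by (intro sum_mono mult_left_mono member_le_sum) (use I in auto)
  also have "\<dots> = (\<Sum>i\<in>I. \<Sum>k\<in>I. norm (M i k - (if i = k then 1 else 0))) * (\<Sum>l\<in>I. norm (v l))"
    by (simp add: sum_distrib_right)
  also have "\<dots> \<le> 1/2 * (\<Sum>l\<in>I. norm (v l))"
    using M by (intro mult_right_mono) (auto intro: sum_nonneg)
  finally show ?thesis by simp
qed

lemma linear_system_tendsto_zero:
  fixes M :: "real \<Rightarrow> 'i \<Rightarrow> 'i \<Rightarrow> complex"
  assumes I: "finite I" and M: "\<And>i k. i \<in> I \<Longrightarrow> k \<in> I \<Longrightarrow> ((\<lambda>t. M t i k) \<longlongrightarrow> (if i = k then 1 else 0)) F"
    and r: "\<And>i. i \<in> I \<Longrightarrow> ((\<lambda>t. \<Sum>k\<in>I. M t i k * v t k) \<longlongrightarrow> 0) F" and k: "k \<in> I"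
  shows "((\<lambda>t. v t k) \<longlongrightarrow> 0) F"
proof (rule Lim_null_comparison)
  have "((\<lambda>t. \<Sum>i\<in>I. \<Sum>k\<in>I. norm (M t i k - (if i = k then 1 else 0))) \<longlongrightarrow>
      (\<Sum>i\<in>I. \<Sum>k\<in>I. norm ((if i = k then 1 else 0 :: complex) - (if i = k then 1 else 0)))) F"
    by (intro tendsto_intros M)
  then have "((\<lambda>t. \<Sum>i\<in>I. \<Sum>k\<in>I. norm (M t i k - (if i = k then 1 else 0))) \<longlongrightarrow> 0) F" by simp
  then have "\<forall>\<^sub>F t in F. (\<Sum>i\<in>I. \<Sum>k\<in>I. norm (M t i k - (if i = k then 1 else 0))) < 1/2"
    by (rule order_tendstoD) simp
  then show "\<forall>\<^sub>F t in F. norm (v t k) \<le> 2 * (\<Sum>i\<in>I. norm (\<Sum>k\<in>I. M t i k * v t k))"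
  proof eventually_elim
    case (elim t)
    have "norm (v t k) \<le> (\<Sum>k\<in>I. norm (v t k))" using I k by (intro member_le_sum) auto
    also have "\<dots> \<le> 2 * (\<Sum>i\<in>I. norm (\<Sum>k\<in>I. M t i k * v t k))"
      using elim by (intro near_identity_bound[OF I]) simp
    finally show ?case .
  qed
  have "((\<lambda>t. 2 * (\<Sum>i\<in>I. norm (\<Sum>k\<in>I. M t i k * v t k))) \<longlongrightarrow> 2 * (\<Sum>i\<in>I. norm (0::complex))) F"
    by (intro tendsto_intros r)
  then show "((\<lambda>t. 2 * (\<Sum>i\<in>I. norm (\<Sum>k\<in>I. M t i k * v t k))) \<longlongrightarrow> 0) F" by simp
qed

lemma tendsto_if_Cauchy:
  fixes f :: "'a \<Rightarrow> complex"
  assumes F: "F \<noteq> bot"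
    and cauchy: "\<And>e. e > 0 \<Longrightarrow> \<exists>P. eventually P F \<and> (\<forall>s t. P s \<and> P t \<longrightarrow> dist (f s) (f t) < e)"
  shows "\<exists>L. (f \<longlongrightarrow> L) F"
proof -
  have "cauchy_filter (filtermap f F)" using cauchy by (simp add: cauchy_filter_metric_filtermap)
  then show ?thesis
    using complete_UNIV[where 'a = complex] F unfolding complete_uniform filterlim_def by (auto simp: filtermap_bot_iff)
qed

text \<open>Multiplying by the average \<open>J\<close> of the group over a short interval, which is nearly the identity,
  makes a continuous one-parameter group of matrices differentiable.\<close>

lemma matrix_group_differentiable:
  fixes A :: "real \<Rightarrow> 'i \<Rightarrow> 'i \<Rightarrow> complex"
  assumes I: "finite I"
    and mult: "\<And>s t i k. i \<in> I \<Longrightarrow> k \<in> I \<Longrightarrow> A (s + t) i k = (\<Sum>j\<in>I. A s i j * A t j k)"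
    and one: "\<And>i k. i \<in> I \<Longrightarrow> k \<in> I \<Longrightarrow> A 0 i k = (if i = k then 1 else 0)"
    and cont: "\<And>i k. i \<in> I \<Longrightarrow> k \<in> I \<Longrightarrow> ((\<lambda>t. A t i k) \<longlongrightarrow> (if i = k then 1 else 0)) (at 0)"
    and ik: "i \<in> I" "k \<in> I"
  shows "\<exists>D. ((\<lambda>t. A t i k) has_vector_derivative D) (at 0)"
proof -
  have isC: "isCont (\<lambda>t. A t i k) t" if "i \<in> I" "k \<in> I" for t i k
  proof -
    have "((\<lambda>h. \<Sum>j\<in>I. A t i j * A h j k) \<longlongrightarrow> (\<Sum>j\<in>I. A t i j * (if j = k then 1 else 0))) (at 0)"
      by (intro tendsto_intros cont that)
    then have "((\<lambda>h. A (t + h) i k) \<longlongrightarrow> A t i k) (at 0)"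
      using that I by (simp add: mult if_distrib[of "\<lambda>x. _ * x"] cong: if_cong)
    then show ?thesis unfolding isCont_def by (rule LIM_offset_zero_cancel)
  qed
  \<comment> \<open>Primitives of the entries; the interval leaves room for \<open>t + a\<close>
    with |t| < 1 and 0 < a \<le> 1.\<close>
  have "\<exists>\<Phi>. \<forall>t\<in>{-3..3}. (\<Phi> has_vector_derivative A t i k) (at t within {-3..3})" if "i \<in> I" "k \<in> I" for i k
  proof -
    have "continuous_on {-3..3} (\<lambda>t. A t i k)"
      using isC[OF that] by (auto intro: continuous_at_imp_continuous_on)
    then obtain g where "\<And>x. x \<in> {-3..3} \<Longrightarrow> (g has_vector_derivative A x i k) (at x within {-3..3})"
      using antiderivative_continuous by blast
    then show ?thesis by blast
  qed
  then obtain \<Phi> where \<Phi>': "\<And>i k t. i \<in> I \<Longrightarrow> k \<in> I \<Longrightarrow> t \<in> {-3..3} \<Longrightarrow>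
      (\<Phi> i k has_vector_derivative A t i k) (at t within {-3..3})" by metis
  have \<Phi>: "(\<Phi> i k has_vector_derivative A t i k) (at t)" if "i \<in> I" "k \<in> I" "t \<in> {-3<..<3}" for i k t
  proof -
    have "at t within {-3..3} = at t" by (rule at_within_interior) (use that in simp)
    then show ?thesis using \<Phi>'[OF that(1,2), of t] that(3) by simp
  qed
  have "((\<lambda>a. \<Sum>k\<in>I. \<Sum>i\<in>I. norm ((1/a) *\<^sub>R (\<Phi> i k a - \<Phi> i k 0) - (if k = i then 1 else 0))) \<longlongrightarrow>
      (\<Sum>k\<in>I. \<Sum>i\<in>I. norm ((if i = k then 1 else 0 :: complex) - (if k = i then 1 else 0)))) (at 0)"
  proof (intro tendsto_intros)
    fix k i assume "k \<in> I" "i \<in> I"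
    then have "(\<Phi> i k has_vector_derivative (if i = k then 1 else 0)) (at 0)"
      using \<Phi>[of i k 0] one by simp
    then show "((\<lambda>a. (1/a) *\<^sub>R (\<Phi> i k a - \<Phi> i k 0)) \<longlongrightarrow> (if i = k then 1 else 0)) (at 0)"
      by (simp add: has_vector_derivative_at_0_iff)
  qed
  then have "((\<lambda>a. \<Sum>k\<in>I. \<Sum>i\<in>I. norm ((1/a) *\<^sub>R (\<Phi> i k a - \<Phi> i k 0) - (if k = i then 1 else 0))) \<longlongrightarrow> 0) (at 0)"
    by (simp add: eq_commute)
  then have "\<forall>\<^sub>F a in at 0. (\<Sum>k\<in>I. \<Sum>i\<in>I. norm ((1/a) *\<^sub>R (\<Phi> i k a - \<Phi> i k 0) - (if k = i then 1 else 0))) < 1/2"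
    by (rule order_tendstoD) simp
  then obtain d where d: "d > 0" "\<forall>a. a \<noteq> 0 \<and> dist a 0 < d \<longrightarrow>
      (\<Sum>k\<in>I. \<Sum>i\<in>I. norm ((1/a) *\<^sub>R (\<Phi> i k a - \<Phi> i k 0) - (if k = i then 1 else 0))) < 1/2"
    by (auto simp: eventually_at)
  define a where "a = min (d/2) 1"
  have a: "0 < a" "a \<le> 1" using d(1) by (auto simp: a_def)
  define J where "J i k = (1/a) *\<^sub>R (\<Phi> i k a - \<Phi> i k 0)" for i k
  \<comment> \<open>Indices are transposed because \<open>J\<close> multiplies \<open>A\<close> from
    the right, whereas \<open>near_identity_bound\<close> sums over the second index.\<close>
  have J: "(\<Sum>k\<in>I. \<Sum>i\<in>I. norm (J i k - (if k = i then 1 else 0))) \<le> 1/2"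
  proof -
    have "a \<noteq> 0 \<and> dist a 0 < d" using a d(1) by (auto simp: a_def)
    from d(2)[rule_format, OF this] show ?thesis unfolding J_def by (rule less_imp_le)
  qed
  \<comment> \<open>By the group law, \<open>A t\<close> times the average over [0, a] is the
    average over [t, t + a], which is differentiable in t.\<close>
  have AJ: "(\<Sum>j\<in>I. A t i j * J j k) = (1/a) *\<^sub>R (\<Phi> i k (t + a) - \<Phi> i k t)" if t: "\<bar>t\<bar> < 1" and ik: "i \<in> I" "k \<in> I" for t i k
  proof -
    have int1: "((\<lambda>u. A (t + u) i k) has_integral (\<Phi> i k (t + a) - \<Phi> i k (t + 0))) {0..a}"
    proof (rule fundamental_theorem_of_calculus)
      fix u assume u: "u \<in> {0..a}"
      have "((\<lambda>u. t + u) has_vector_derivative 1) (at u)" by (auto intro!: derivative_eq_intros)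
      moreover have "(\<Phi> i k has_vector_derivative A (t + u) i k) (at (t + u))" using u t a by (intro \<Phi> ik) auto
      ultimately have "((\<Phi> i k \<circ> (\<lambda>u. t + u)) has_vector_derivative 1 *\<^sub>R A (t + u) i k) (at u)"
        by (rule vector_diff_chain_at)
      then show "((\<lambda>u. \<Phi> i k (t + u)) has_vector_derivative A (t + u) i k) (at u within {0..a})"
        by (simp add: o_def has_vector_derivative_at_within)
    qed (use a in simp)
    have int2: "((\<lambda>u. \<Sum>j\<in>I. A t i j * A u j k) has_integral (\<Sum>j\<in>I. A t i j * (\<Phi> j k a - \<Phi> j k 0))) {0..a}"
    proof (intro has_integral_sum I has_integral_mult_right)
      fix j assume j: "j \<in> I"
      show "((\<lambda>u. A u j k) has_integral (\<Phi> j k a - \<Phi> j k 0)) {0..a}"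
      proof (rule fundamental_theorem_of_calculus)
        fix u assume "u \<in> {0..a}"
        then show "(\<Phi> j k has_vector_derivative A u j k) (at u within {0..a})"
          using a by (intro has_vector_derivative_at_within[OF \<Phi>[OF j ik(2)]]) simp
      qed (use a in simp)
    qed
    have "A (t + u) i k = (\<Sum>j\<in>I. A t i j * A u j k)" for u by (rule mult[OF ik])
    then have "((\<lambda>u. A (t + u) i k) has_integral (\<Sum>j\<in>I. A t i j * (\<Phi> j k a - \<Phi> j k 0))) {0..a}"
      using int2 by simp
    from has_integral_unique[OF int1 this]
    have "\<Phi> i k (t + a) - \<Phi> i k t = (\<Sum>j\<in>I. A t i j * (\<Phi> j k a - \<Phi> j k 0))" by (simp only: add_0_right)
    then show ?thesis by (simp add: J_def scaleR_sum_right)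
  qed
  \<comment> \<open>The difference quotients converge after multiplication by \<open>J\<close>;
    since \<open>J\<close> is nearly the identity, they are then Cauchy themselves.\<close>
  define Q where "Q t i k = (1/t) *\<^sub>R (A t i k - A 0 i k)" for t i k
  have QJ: "\<exists>L. ((\<lambda>t. \<Sum>j\<in>I. J j k * Q t i j) \<longlongrightarrow> L) (at 0)" if ik: "i \<in> I" "k \<in> I" for i k
  proof -
    have "((\<lambda>t. t + a) has_vector_derivative 1) (at 0)" by (auto intro!: derivative_eq_intros)
    moreover have "(\<Phi> i k has_vector_derivative A (0 + a) i k) (at (0 + a))" using a by (intro \<Phi> ik) auto
    ultimately have "((\<Phi> i k \<circ> (\<lambda>t. t + a)) has_vector_derivative 1 *\<^sub>R A (0 + a) i k) (at 0)"
      by (rule vector_diff_chain_at)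
    then have 1: "((\<lambda>t. \<Phi> i k (t + a)) has_vector_derivative A a i k) (at 0)" by (simp add: o_def)
    define D where "D = (1/a) *\<^sub>R (A a i k - A 0 i k)"
    have "((\<lambda>t. (1/a) *\<^sub>R (\<Phi> i k (t + a) - \<Phi> i k t)) has_vector_derivative D) (at 0)"
      unfolding D_def by (intro bounded_linear.has_vector_derivative[OF bounded_linear_scaleR_right] has_vector_derivative_diff 1 \<Phi> ik) simp
    then have lim: "((\<lambda>t. (1/t) *\<^sub>R ((1/a) *\<^sub>R (\<Phi> i k (t + a) - \<Phi> i k t) - (1/a) *\<^sub>R (\<Phi> i k (0 + a) - \<Phi> i k 0))) \<longlongrightarrow> D) (at 0)"
      by (simp add: has_vector_derivative_at_0_iff)
    have "\<forall>\<^sub>F t in at 0. (1/t) *\<^sub>R ((1/a) *\<^sub>R (\<Phi> i k (t + a) - \<Phi> i k t) - (1/a) *\<^sub>R (\<Phi> i k (0 + a) - \<Phi> i k 0)) =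
        (\<Sum>j\<in>I. J j k * Q t i j)"
      unfolding eventually_at
    proof (intro exI[of _ 1] conjI ballI impI)
      fix t :: real assume "t \<noteq> 0 \<and> dist t 0 < 1"
      then have "\<bar>t\<bar> < 1" by simp
      note AJt = AJ[OF this ik]
      have AJ0: "(\<Sum>j\<in>I. A 0 i j * J j k) = (1/a) *\<^sub>R (\<Phi> i k (0 + a) - \<Phi> i k 0)" by (rule AJ[OF _ ik]) simp
      show "(1/t) *\<^sub>R ((1/a) *\<^sub>R (\<Phi> i k (t + a) - \<Phi> i k t) - (1/a) *\<^sub>R (\<Phi> i k (0 + a) - \<Phi> i k 0)) = (\<Sum>j\<in>I. J j k * Q t i j)"
        unfolding AJt[symmetric] AJ0[symmetric] sum_subtractf[symmetric] scaleR_sum_right Q_def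
        by (intro sum.cong refl) (simp add: scaleR_conv_of_real algebra_simps)
    qed simp
    from Lim_transform_eventually[OF lim this] show ?thesis by blast
  qed
  have "\<exists>L. ((\<lambda>t. Q t i k) \<longlongrightarrow> L) (at 0)"
  proof (rule tendsto_if_Cauchy)
    fix e :: real assume e: "e > 0"
    obtain L where L: "\<And>k. k \<in> I \<Longrightarrow> ((\<lambda>t. \<Sum>j\<in>I. J j k * Q t i j) \<longlongrightarrow> L k) (at 0)"
      using QJ[OF ik(1)] by metis
    \<comment> \<open>One more than the number of summands, which makes the final estimate strict
      and keeps n positive.\<close>
    define n where "n = real (card I) + 1"
    have n: "n > 0" by (simp add: n_def)
    define P where "P t \<longleftrightarrow> (\<forall>k\<in>I. norm ((\<Sum>j\<in>I. J j k * Q t i j) - L k) < e / (4 * n))" for t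
    have "eventually P (at 0)"
      unfolding P_def using L e n by (intro eventually_ball_finite I ballI) (auto simp: tendsto_iff dist_norm)
    moreover have "dist (Q t i k) (Q s i k) < e" if P: "P t" "P s" for s t
    proof -
      have small: "norm (\<Sum>j\<in>I. J j k * (Q t i j - Q s i j)) \<le> e / (2 * n)" if "k \<in> I" for k
      proof -
        have eq: "(\<Sum>j\<in>I. J j k * (Q t i j - Q s i j)) =
            ((\<Sum>j\<in>I. J j k * Q t i j) - L k) - ((\<Sum>j\<in>I. J j k * Q s i j) - L k)"
          by (simp add: right_diff_distrib sum_subtractf)
        have "norm (\<Sum>j\<in>I. J j k * (Q t i j - Q s i j)) \<le> e / (4 * n) + e / (4 * n)"
          unfolding eq by (rule norm_triangle_le_diff, rule add_mono) (use P that in \<open>auto simp: P_def intro: less_imp_le\<close>)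
        then show ?thesis by simp
      qed
      have "norm (Q t i k - Q s i k) \<le> (\<Sum>j\<in>I. norm (Q t i j - Q s i j))"
        using ik(2) I by (intro member_le_sum) auto
      also have "\<dots> \<le> 2 * (\<Sum>k\<in>I. norm (\<Sum>j\<in>I. J j k * (Q t i j - Q s i j)))"
        by (rule near_identity_bound[OF I J])
      also have "\<dots> \<le> 2 * (\<Sum>k\<in>I. e / (2 * n))" using small by (intro mult_left_mono sum_mono) auto
      also have "\<dots> = e * (real (card I) / n)" using n by (simp add: field_simps)
      also have "\<dots> < e" using e n by (simp add: n_def field_simps)
      finally show ?thesis by (simp add: dist_norm)
    qed
    ultimately show "\<exists>P. eventually P (at 0) \<and> (\<forall>s t. P s \<and> P t \<longrightarrow> dist (Q s i k) (Q t i k) < e)" by blast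
  qed simp
  then obtain L where "((\<lambda>t. (1/t) *\<^sub>R (A t i k - A 0 i k)) \<longlongrightarrow> L) (at 0)" unfolding Q_def by blast
  then have "((\<lambda>t. A t i k) has_vector_derivative L) (at 0)" by (simp add: has_vector_derivative_at_0_iff)
  then show ?thesis by blast
qed

lemma ratl_line_differentiable:
  assumes "ratl (x + axis j s) f"
  shows "(\<lambda>s. f (x + axis j s)) field_differentiable (at s)"
proof -
  have "((\<lambda>s'. f ((x + axis j s) + axis j s')) has_field_derivative pdv f j (x + axis j s)) (at 0)"
    by (rule has_derivative_imp_line[OF eventually_nhds_x_imp_x[OF ratl_has_derivative(1)[OF assms]]])
  moreover have "(x + axis j s) + axis j s' = x + axis j (s' + s)" for s'
    by (simp add: vec_eq_iff axis_def)
  ultimately have "((\<lambda>s. f (x + axis j s)) has_field_derivative pdv f j (x + axis j s)) (at s)"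
    using DERIV_shift[of "\<lambda>s. f (x + axis j s)" "pdv f j (x + axis j s)" 0 s] by simp
  then show ?thesis by (auto simp: field_differentiable_def)
qed

lemma ratl_line_DERIV:
  assumes "ratl x f"
  shows "((\<lambda>s. f (x + axis j s)) has_field_derivative pdv f j x) (at 0)"
  by (rule has_derivative_imp_line[OF eventually_nhds_x_imp_x[OF ratl_has_derivative(1)[OF assms]]])

lemma pdv_bound:
  assumes r: "r > 0" and d: "\<And>s. norm s \<le> r \<Longrightarrow> (\<lambda>s. \<phi> (x + axis j s)) field_differentiable (at s)"
    and B: "\<And>s. norm s \<le> r \<Longrightarrow> norm (\<phi> (x + axis j s)) \<le> B"
  shows "norm (pdv \<phi> j x) \<le> B / r"
proof -
  have "norm ((deriv ^^ 1) (\<lambda>s. \<phi> (x + axis j s)) 0) \<le> fact 1 * B / r ^ 1"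
  proof (rule Cauchy_inequality)
    show "(\<lambda>s. \<phi> (x + axis j s)) holomorphic_on ball 0 r"
      unfolding holomorphic_on_def using d by (auto intro: field_differentiable_at_within)
    show "continuous_on (cball 0 r) (\<lambda>s. \<phi> (x + axis j s))"
      using d by (intro continuous_at_imp_continuous_on ballI field_differentiable_imp_continuous_at) simp
  qed (use r B in auto)
  then show ?thesis by (simp add: pdv_def)
qed

lemma pdv_diff:
  assumes "ratl x f" "ratl x g"
  shows "pdv (\<lambda>y. f y - g y) j x = pdv f j x - pdv g j x"
  using DERIV_diff[OF ratl_line_DERIV[OF assms(1)] ratl_line_DERIV[OF assms(2)], THEN DERIV_imp_deriv]
  unfolding pdv_def .

lemma pdv_sum:
  assumes "\<And>i. i \<in> I \<Longrightarrow> ratl x (f i)"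
  shows "pdv (\<lambda>y. \<Sum>i\<in>I. a i * f i y) j x = (\<Sum>i\<in>I. a i * pdv (f i) j x)"
proof -
  have "((\<lambda>s. \<Sum>i\<in>I. a i * f i (x + axis j s)) has_field_derivative (\<Sum>i\<in>I. a i * pdv (f i) j x)) (at 0)"
    by (intro DERIV_sum DERIV_cmult ratl_line_DERIV assms)
  then show ?thesis using DERIV_imp_deriv by (subst pdv_def) blast
qed

lemma pdv_coord: "pdv (\<lambda>y. y $ i) j x = (if i = j then 1 else 0)"
proof -
  have "((\<lambda>x. x $ i) has_derivative (\<lambda>h. \<Sum>k\<in>UNIV. (if k = i then 1 else 0) * h $ k)) (at x)"
    by (simp add: if_distrib[of "\<lambda>x. x * _"] bounded_linear_vec_nth bounded_linear_imp_has_derivative cong: if_cong)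
  then show ?thesis using has_derivative_imp_pdv by fastforce
qed

lemma compact_line: "compact ((\<lambda>s. x + axis j s) ` cball (0 :: complex) r :: (complex ^ 'n::finite) set)"
proof (rule compact_continuous_image)
  show "continuous_on (cball 0 r) (\<lambda>s. x + axis j s)"
    by (intro continuous_at_imp_continuous_on ballI has_derivative_continuous[OF has_derivative_line])
qed simp

lemma has_vector_derivative_cong_nhds:
  assumes "(f has_vector_derivative D) (at x)" "\<forall>\<^sub>F t in nhds x. f t = g t"
  shows "(g has_vector_derivative D) (at x)"
  unfolding has_vector_derivative_def
proof (rule has_derivative_transform_eventually[OF assms(1)[unfolded has_vector_derivative_def]])
  show "\<forall>\<^sub>F t in at x. f t = g t" using assms(2) by (auto simp: eventually_at_filter elim: eventually_mono)
  show "f x = g x" by (rule eventually_nhds_x_imp_x[OF assms(2)])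
qed simp

section \<open>Continuity and derivative of the action of a one-parameter subgroup\<close>

locale one_param = smooth_complete_fan \<Sigma> for \<Sigma> :: "(real ^ 'n::finite) set set" +
  fixes \<gamma> :: "real \<Rightarrow> 'n toric_point \<Rightarrow> 'n toric_point"
  assumes \<gamma>: "\<gamma> \<in> lie_algebra \<Sigma> (Aut0 \<Sigma>)"
begin

lemmas \<gamma>D = lie_algebraD[OF \<gamma>]

definition fl :: "'n chart \<Rightarrow> real \<Rightarrow> complex ^ 'n \<Rightarrow> complex ^ 'n" where
  "fl c t x = lrep (\<gamma> t) (snd c) c x"

lemma fl_close:
  assumes c: "(\<sigma>, m) \<in> Ch" and K: "compact K" and e: "e > 0"
  shows "\<forall>\<^sub>F t in nhds 0. \<forall>x\<in>K. \<gamma> t (pt m x) \<in> Dom (\<sigma>, m) \<and> norm (fl (\<sigma>, m) t x - x) < e"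
  using lie_algebra_uniform[OF \<gamma> c K e] by (simp add: fl_def lrep_def dist_norm)

lemma fl_ratl:
  assumes c: "(\<sigma>, m) \<in> Ch" and "\<gamma> t (pt m x) \<in> Dom (\<sigma>, m)"
  shows "ratl x (\<lambda>x. fl (\<sigma>, m) t x $ i)"
  unfolding fl_def snd_conv by (rule lrep_ratl[OF AutD(2)[OF \<gamma>D(1)] c c assms(2)])

lemma pt_fl: "(\<sigma>, m) \<in> Ch \<Longrightarrow> \<gamma> t (pt m x) \<in> Dom (\<sigma>, m) \<Longrightarrow> pt m (fl (\<sigma>, m) t x) = \<gamma> t (pt m x)"
  unfolding fl_def snd_conv by (rule lrep_pt)

lemma fl_0: "(\<sigma>, m) \<in> Ch \<Longrightarrow> fl (\<sigma>, m) 0 x = x"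
  by (simp add: fl_def \<gamma>D(2) lrep_id)

lemma dom_eventually:
  assumes c: "(\<sigma>, m) \<in> Ch"
  shows "\<forall>\<^sub>F t in nhds 0. \<gamma> t (pt m x) \<in> Dom (\<sigma>, m)"
  using fl_close[OF c, of "{x}" 1] by (auto elim: eventually_mono)

lemma fl_tendsto:
  assumes c: "(\<sigma>, m) \<in> Ch"
  shows "((\<lambda>t. fl (\<sigma>, m) t x) \<longlongrightarrow> x) (nhds 0)"
  unfolding tendsto_iff
proof (intro allI impI)
  fix e :: real assume "e > 0"
  then show "\<forall>\<^sub>F t in nhds 0. dist (fl (\<sigma>, m) t x) x < e"
    using fl_close[OF c, of "{x}" e] by (auto simp: dist_norm elim: eventually_mono)
qed

lemma jac_pt_fl: "(\<sigma>, m) \<in> Ch \<Longrightarrow>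
    Jac (\<gamma> t) (\<sigma>, m) (\<sigma>, m) (pt m x) = det (\<chi> i j. pdv (\<lambda>x. fl (\<sigma>, m) t x $ i) j x)"
  unfolding fl_def snd_conv by (rule jac_pt)

text \<open>On unit discs through x in the coordinate directions \<open>fl\<close> is uniformly
  close to the identity, so Cauchy's inequality makes its partial derivatives close to those of the
  identity.\<close>

lemma jac_tendsto:
  assumes c: "(\<sigma>, m) \<in> Ch"
  shows "((\<lambda>t. Jac (\<gamma> t) (\<sigma>, m) (\<sigma>, m) (pt m x)) \<longlongrightarrow> 1) (nhds 0)"
proof -
  have "((\<lambda>t. pdv (\<lambda>x. fl (\<sigma>, m) t x $ i) j x) \<longlongrightarrow> (if i = j then 1 else 0)) (nhds 0)" for i j
    unfolding tendsto_iff
  proof (intro allI impI)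
    fix e :: real assume e: "e > 0"
    then have "\<forall>\<^sub>F t in nhds 0. \<forall>y\<in>(\<lambda>s. x + axis j s) ` cball 0 1. \<gamma> t (pt m y) \<in> Dom (\<sigma>, m) \<and>
        norm (fl (\<sigma>, m) t y - y) < e/2"
      using fl_close[OF c compact_line[of x j 1], of "e/2"] by simp
    then show "\<forall>\<^sub>F t in nhds 0. dist (pdv (\<lambda>x. fl (\<sigma>, m) t x $ i) j x) (if i = j then 1 else 0) < e"
    proof eventually_elim
      case (elim t)
      then have *: "\<forall>s\<in>cball 0 1. \<gamma> t (pt m (x + axis j s)) \<in> Dom (\<sigma>, m) \<and>
          norm (fl (\<sigma>, m) t (x + axis j s) - (x + axis j s)) < e/2" by blast
      have r: "ratl (x + axis j s) (\<lambda>x. fl (\<sigma>, m) t x $ i - x $ i)" if "norm s \<le> 1" for s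
        using * that by (intro ratl_diff fl_ratl[OF c] ratl_coord) auto
      have "norm (pdv (\<lambda>x. fl (\<sigma>, m) t x $ i - x $ i) j x) \<le> (e/2) / 1"
      proof (rule pdv_bound)
        fix s :: complex assume s: "norm s \<le> 1"
        show "(\<lambda>s. fl (\<sigma>, m) t (x + axis j s) $ i - (x + axis j s) $ i) field_differentiable at s"
          by (rule ratl_line_differentiable[OF r[OF s]])
        have "norm ((fl (\<sigma>, m) t (x + axis j s) - (x + axis j s)) $ i) \<le> norm (fl (\<sigma>, m) t (x + axis j s) - (x + axis j s))"
          by (rule Finite_Cartesian_Product.norm_nth_le)
        then show "norm (fl (\<sigma>, m) t (x + axis j s) $ i - (x + axis j s) $ i) \<le> e/2"
          using bspec[OF *, of s] s by simp
      qed simp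
      moreover have "pdv (\<lambda>x. fl (\<sigma>, m) t x $ i - x $ i) j x = pdv (\<lambda>x. fl (\<sigma>, m) t x $ i) j x - (if i = j then 1 else 0)"
        using fl_ratl[OF c, of t x i] bspec[OF *, of 0] by (subst pdv_diff) (auto simp: ratl_coord pdv_coord)
      ultimately show ?case using e by (simp add: dist_norm)
    qed
  qed
  then have "((\<lambda>t. det (\<chi> i j. pdv (\<lambda>x. fl (\<sigma>, m) t x $ i) j x)) \<longlongrightarrow>
      (\<Sum>p | p permutes (UNIV :: 'n set). of_int (sign p) * (\<Prod>i\<in>UNIV. if i = p i then 1 else 0))) (nhds 0)"
    unfolding det_def vec_lambda_beta by (intro tendsto_sum tendsto_mult tendsto_const tendsto_prod)
  moreover have "(\<Sum>p | p permutes (UNIV :: 'n set). of_int (sign p) * (\<Prod>i\<in>UNIV. if i = p i then 1 else 0)) =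
      det (mat 1 :: complex ^ 'n ^ 'n)"
    by (simp add: det_def mat_def)
  ultimately show ?thesis by (simp add: jac_pt_fl[OF c])
qed

lemma continuous_pt_tendsto:
  assumes c: "(\<sigma>, m) \<in> Ch" and f: "ratl x (\<lambda>x. f (pt m x))"
  shows "((\<lambda>t. f (\<gamma> t (pt m x))) \<longlongrightarrow> f (pt m x)) (nhds 0)"
proof (rule Lim_transform_eventually)
  show "((\<lambda>t. f (pt m (fl (\<sigma>, m) t x))) \<longlongrightarrow> f (pt m x)) (nhds 0)"
    by (rule isCont_tendsto_compose[OF ratl_isCont[OF f] fl_tendsto[OF c]])
  show "\<forall>\<^sub>F t in nhds 0. f (pt m (fl (\<sigma>, m) t x)) = f (\<gamma> t (pt m x))"
    by (rule eventually_mono[OF dom_eventually[OF c, of x]]) (simp add: pt_fl[OF c])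
qed

text \<open>Combine the defining relations of \<open>act\<close> at finitely many points with
  weights that extract the coefficients of monomials. The deviation from the identity matrix then
  solves a linear system whose matrix tends to the identity and whose right-hand side tends to
  0.\<close>

lemma act_tendsto:
  assumes \<nu>: "\<nu> \<in> DM" and \<mu>: "\<mu> \<in> DM"
  shows "((\<lambda>t. Act (\<gamma> t) \<nu> \<mu>) \<longlongrightarrow> (if \<nu> = \<mu> then 1 else 0)) (nhds 0)"
proof -
  obtain \<sigma> m where c: "(\<sigma>, m) \<in> Ch" using ex_chart by blast
  define S where "S = (\<Sum>j\<in>UNIV. m j)"
  define D where "D = (of_int (det (\<chi> j. m j)) :: complex)"
  have D: "D \<noteq> 0" using det_lattice_basis_nonzero[OF chart_basis(1)[OF c]] by (simp add: D_def)
  obtain I w x where I: "finite (I :: ('n \<Rightarrow> nat) set)" "\<forall>i\<in>I. \<forall>j. (x i :: complex ^ 'n) $ j \<noteq> 0"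
    and w: "\<forall>k\<in>(\<lambda>\<nu>. \<nu> + S) ` DM. \<forall>l\<in>(\<lambda>\<nu>. \<nu> + S) ` DM. (\<Sum>i\<in>I. w k i * mon m (x i) l) = (if k = l then 1 else 0)"
    by (rule mon_extraction[OF chart_basis(1)[OF c] finite_imageI[OF finite_DeltaM, of "\<lambda>\<nu>. \<nu> + S"], THEN exE])
      (elim exE conjE, rule that)
  let ?p = "\<lambda>i. pt m (x i)" and ?c = "(\<sigma>, m)"
  define w' where "w' \<kappa> i = w (\<kappa> + S) i / D" for \<kappa> i
  have w': "(\<Sum>i\<in>I. w' \<kappa> i * tsec \<kappa>' ?c (?p i)) = (if \<kappa> = \<kappa>' then 1 else 0)" if "\<kappa> \<in> DM" "\<kappa>' \<in> DM" for \<kappa> \<kappa>'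
  proof -
    have "(\<Sum>i\<in>I. w' \<kappa> i * tsec \<kappa>' ?c (?p i)) = (\<Sum>i\<in>I. w (\<kappa> + S) i * mon m (x i) (\<kappa>' + S))"
      using D by (intro sum.cong refl) (simp add: tsec_pt(1)[OF c that(2)] w'_def D_def[symmetric] S_def)
    then show ?thesis using w that by auto
  qed
  have tt: "((\<lambda>t. tsec \<kappa> ?c (\<gamma> t (?p i))) \<longlongrightarrow> tsec \<kappa> ?c (?p i)) (nhds 0)" if "\<kappa> \<in> DM" for \<kappa> i
    by (rule continuous_pt_tendsto[OF c tsec_ratl[OF c that c pt_in_chart[OF c]]])
  have "((\<lambda>t. Act (\<gamma> t) \<nu> \<mu> - (if \<nu> = \<mu> then 1 else 0)) \<longlongrightarrow> 0) (nhds 0)"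
  proof (rule linear_system_tendsto_zero[OF finite_DeltaM _ _ \<nu>,
        of "\<lambda>t \<kappa> \<kappa>'. \<Sum>i\<in>I. w' \<kappa> i * tsec \<kappa>' ?c (\<gamma> t (?p i))" _ "\<lambda>t \<nu>. Act (\<gamma> t) \<nu> \<mu> - (if \<nu> = \<mu> then 1 else 0)"])
    fix \<kappa> \<kappa>' assume k: "\<kappa> \<in> DM" "\<kappa>' \<in> DM"
    have "((\<lambda>t. \<Sum>i\<in>I. w' \<kappa> i * tsec \<kappa>' ?c (\<gamma> t (?p i))) \<longlongrightarrow> (\<Sum>i\<in>I. w' \<kappa> i * tsec \<kappa>' ?c (?p i))) (nhds 0)"
      by (intro tendsto_intros tt k)
    then show "((\<lambda>t. \<Sum>i\<in>I. w' \<kappa> i * tsec \<kappa>' ?c (\<gamma> t (?p i))) \<longlongrightarrow> (if \<kappa> = \<kappa>' then 1 else 0)) (nhds 0)"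
      using w'[OF k] by simp
  next
    fix \<kappa> assume k: "\<kappa> \<in> DM"
    have "((\<lambda>t. \<Sum>i\<in>I. w' \<kappa> i * (Jac (\<gamma> t) ?c ?c (?p i) * tsec \<mu> ?c (?p i) - tsec \<mu> ?c (\<gamma> t (?p i)))) \<longlongrightarrow>
        (\<Sum>i\<in>I. w' \<kappa> i * (1 * tsec \<mu> ?c (?p i) - tsec \<mu> ?c (?p i)))) (nhds 0)"
      by (intro tendsto_intros tt \<mu> jac_tendsto[OF c])
    then have lim: "((\<lambda>t. \<Sum>i\<in>I. w' \<kappa> i * (Jac (\<gamma> t) ?c ?c (?p i) * tsec \<mu> ?c (?p i) - tsec \<mu> ?c (\<gamma> t (?p i)))) \<longlongrightarrow> 0) (nhds 0)"
      by simp
    have "\<forall>\<^sub>F t in nhds 0. \<forall>i\<in>I. \<gamma> t (?p i) \<in> Dom ?c"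
      by (intro eventually_ball_finite I(1) ballI dom_eventually[OF c])
    then have "\<forall>\<^sub>F t in nhds 0. (\<Sum>i\<in>I. w' \<kappa> i * (Jac (\<gamma> t) ?c ?c (?p i) * tsec \<mu> ?c (?p i) - tsec \<mu> ?c (\<gamma> t (?p i)))) =
        (\<Sum>\<kappa>'\<in>DM. (\<Sum>i\<in>I. w' \<kappa> i * tsec \<kappa>' ?c (\<gamma> t (?p i))) * (Act (\<gamma> t) \<kappa>' \<mu> - (if \<kappa>' = \<mu> then 1 else 0)))"
    proof eventually_elim
      case (elim t)
      have "Jac (\<gamma> t) ?c ?c (?p i) * tsec \<mu> ?c (?p i) - tsec \<mu> ?c (\<gamma> t (?p i)) =
          (\<Sum>\<kappa>'\<in>DM. (Act (\<gamma> t) \<kappa>' \<mu> - (if \<kappa>' = \<mu> then 1 else 0)) * tsec \<kappa>' ?c (\<gamma> t (?p i)))" if "i \<in> I" for i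
      proof -
        have "(\<Sum>\<kappa>'\<in>DM. (if \<kappa>' = \<mu> then 1 else 0) * tsec \<kappa>' ?c (\<gamma> t (?p i))) = tsec \<mu> ?c (\<gamma> t (?p i))"
          using \<mu> finite_DeltaM by (simp add: if_distrib[of "\<lambda>x. x * _"] cong: if_cong)
        then show ?thesis
          using act_relation[OF \<gamma>D(1) \<mu> c c pt_in_chart[OF c] bspec[OF elim that]]
          by (simp add: left_diff_distrib sum_subtractf)
      qed
      then have "(\<Sum>i\<in>I. w' \<kappa> i * (Jac (\<gamma> t) ?c ?c (?p i) * tsec \<mu> ?c (?p i) - tsec \<mu> ?c (\<gamma> t (?p i)))) =
          (\<Sum>i\<in>I. w' \<kappa> i * (\<Sum>\<kappa>'\<in>DM. (Act (\<gamma> t) \<kappa>' \<mu> - (if \<kappa>' = \<mu> then 1 else 0)) * tsec \<kappa>' ?c (\<gamma> t (?p i))))"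
        by simp
      also have "\<dots> = (\<Sum>\<kappa>'\<in>DM. (\<Sum>i\<in>I. w' \<kappa> i * tsec \<kappa>' ?c (\<gamma> t (?p i))) * (Act (\<gamma> t) \<kappa>' \<mu> - (if \<kappa>' = \<mu> then 1 else 0)))"
        unfolding sum_distrib_left sum_distrib_right by (subst sum.swap) (simp add: mult_ac)
      finally show ?case .
    qed
    from Lim_transform_eventually[OF lim this]
    show "((\<lambda>t. \<Sum>\<kappa>'\<in>DM. (\<Sum>i\<in>I. w' \<kappa> i * tsec \<kappa>' ?c (\<gamma> t (?p i))) * (Act (\<gamma> t) \<kappa>' \<mu> - (if \<kappa>' = \<mu> then 1 else 0))) \<longlongrightarrow> 0) (nhds 0)" .
  qed
  then show ?thesis by (simp add: LIM_zero_iff)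
qed

text \<open>\<open>lie_act\<close> differentiates the action of the inverse, that is of
  \<open>\<gamma> (- t)\<close>, whence the sign in the first formula.\<close>

lemma act_deriv:
  assumes "\<nu> \<in> DM" "\<mu> \<in> DM"
  shows "((\<lambda>t. Act (\<gamma> t) \<nu> \<mu>) has_vector_derivative - LieAct \<gamma> \<nu> \<mu>) (at 0)"
    and "((\<lambda>t. Act (\<gamma> (- t)) \<nu> \<mu>) has_vector_derivative LieAct \<gamma> \<nu> \<mu>) (at 0)"
proof -
  have "\<exists>D. ((\<lambda>t. Act (\<gamma> t) \<nu> \<mu>) has_vector_derivative D) (at 0)"
  proof (rule matrix_group_differentiable[OF finite_DeltaM _ _ _ assms])
    fix s t i k assume "i \<in> DM" "k \<in> DM"
    show "Act (\<gamma> (s + t)) i k = (\<Sum>j\<in>DM. Act (\<gamma> s) i j * Act (\<gamma> t) j k)"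
      unfolding \<gamma>D(4)[of s t] by (rule act_comp[OF \<gamma>D(1) \<gamma>D(1)]) (simp add: \<gamma>D(1) flip: \<gamma>D(4))
  next
    fix i k assume ik: "i \<in> DM" "k \<in> DM"
    show "Act (\<gamma> 0) i k = (if i = k then 1 else 0)" using ik by (simp add: \<gamma>D(2) act_id)
    show "((\<lambda>t. Act (\<gamma> t) i k) \<longlongrightarrow> (if i = k then 1 else 0)) (at 0)"
      by (rule filterlim_mono[OF act_tendsto[OF ik]]) (simp_all add: at_within_def)
  qed
  then obtain D where D: "((\<lambda>t. Act (\<gamma> t) \<nu> \<mu>) has_vector_derivative D) (at 0)" by blast
  have "((\<lambda>t::real. - t) has_vector_derivative - 1) (at 0)" by (auto intro!: derivative_eq_intros)
  moreover have "((\<lambda>t. Act (\<gamma> t) \<nu> \<mu>) has_vector_derivative D) (at (- 0))" using D by simp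
  ultimately have "((\<lambda>t. Act (\<gamma> t) \<nu> \<mu>) \<circ> (\<lambda>t. - t) has_vector_derivative - 1 *\<^sub>R D) (at 0)"
    by (rule vector_diff_chain_at)
  then have D': "((\<lambda>t. Act (\<gamma> (- t)) \<nu> \<mu>) has_vector_derivative - D) (at 0)" by (simp add: o_def)
  then have "LieAct \<gamma> \<nu> \<mu> = - D"
    unfolding lie_act_def \<gamma>D(3) by (rule vector_derivative_at)
  then show "((\<lambda>t. Act (\<gamma> t) \<nu> \<mu>) has_vector_derivative - LieAct \<gamma> \<nu> \<mu>) (at 0)"
    and "((\<lambda>t. Act (\<gamma> (- t)) \<nu> \<mu>) has_vector_derivative LieAct \<gamma> \<nu> \<mu>) (at 0)" using D D' by simp_all
qed

lemma torus_eventually: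
  assumes Q: "Q \<in> Torus"
  shows "\<forall>\<^sub>F t in nhds 0. \<gamma> t Q \<in> Torus"
proof -
  obtain \<sigma> m where c: "(\<sigma>, m) \<in> Ch" using ex_chart by blast
  obtain x where x: "Q = pt m x" "\<forall>j. x $ j \<noteq> 0" using torus_pt[OF c Q] .
  have "\<forall>\<^sub>F y in nhds x. pt m y \<in> Torus" by (rule pt_eventually_U[OF c]) (use Q x in simp)
  from eventually_compose_filterlim[OF this fl_tendsto[OF c]]
  show ?thesis using dom_eventually[OF c, of x]
    by eventually_elim (simp add: x(1) pt_fl[OF c])
qed

text \<open>\<open>\<gamma> (- t)\<close> takes \<open>\<gamma> t Q\<close> back to
  \<open>Q\<close>. Its Jacobian cancels when the relation for the section \<mu> is compared with
  the one for the section 0.\<close>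

lemma Xt_ratio:
  assumes Q: "Q \<in> Torus" and tQ: "\<gamma> t Q \<in> Torus" and \<mu>: "\<mu> \<in> DM"
  shows "(\<Sum>\<nu>\<in>DM. Act (\<gamma> (- t)) \<nu> \<mu> * Xt \<nu> Q) = (\<Sum>\<nu>\<in>DM. Act (\<gamma> (- t)) \<nu> 0 * Xt \<nu> Q) * Xt \<mu> (\<gamma> t Q)"
proof -
  obtain \<sigma> m where c: "(\<sigma>, m) \<in> Ch" using ex_chart by blast
  define S where "S = (\<Sum>j\<in>UNIV. m j)"
  define D where "D = (of_int (det (\<chi> j. m j)) :: complex)"
  have D: "D \<noteq> 0" using det_lattice_basis_nonzero[OF chart_basis(1)[OF c]] by (simp add: D_def)
  define J where "J = Jac (\<gamma> (- t)) (\<sigma>, m) (\<sigma>, m) (\<gamma> t Q)"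
  have ret: "\<gamma> (- t) (\<gamma> t Q) = Q"
    using \<gamma>D(4)[of "- t" t] \<gamma>D(2) by (metis add.left_inverse comp_apply id_apply)
  have ts: "tsec \<nu> (\<sigma>, m) P = D * (Xt \<nu> P * Xt S P)" if "\<nu> \<in> DM" "P \<in> Torus" for \<nu> P
    using tsec_torus[OF c that] Xt_add[OF that(2)] by (simp add: D_def S_def)
  have rel: "(\<Sum>\<nu>\<in>DM. Act (\<gamma> (- t)) \<nu> \<mu> * Xt \<nu> Q) * Xt S Q = J * (Xt \<mu> (\<gamma> t Q) * Xt S (\<gamma> t Q))"
    if \<mu>: "\<mu> \<in> DM" for \<mu>
  proof -
    have "(\<Sum>\<nu>\<in>DM. Act (\<gamma> (- t)) \<nu> \<mu> * tsec \<nu> (\<sigma>, m) Q) = J * tsec \<mu> (\<sigma>, m) (\<gamma> t Q)"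
      using act_relation[OF \<gamma>D(1)[of "- t"] \<mu> c c torus_in_dom_chart[OF c tQ]] torus_in_dom_chart[OF c Q]
      unfolding ret J_def by blast
    then have "D * ((\<Sum>\<nu>\<in>DM. Act (\<gamma> (- t)) \<nu> \<mu> * Xt \<nu> Q) * Xt S Q) = D * (J * (Xt \<mu> (\<gamma> t Q) * Xt S (\<gamma> t Q)))"
      by (simp add: ts Q tQ \<mu> sum_distrib_left sum_distrib_right mult_ac)
    then show ?thesis using D by simp
  qed
  have "(\<Sum>\<nu>\<in>DM. Act (\<gamma> (- t)) \<nu> 0 * Xt \<nu> Q) * Xt S Q = J * Xt S (\<gamma> t Q)"
    using rel[OF zero_in_DeltaM] Xt_zero[OF tQ] by simp
  then have "(\<Sum>\<nu>\<in>DM. Act (\<gamma> (- t)) \<nu> \<mu> * Xt \<nu> Q) * Xt S Q =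
      ((\<Sum>\<nu>\<in>DM. Act (\<gamma> (- t)) \<nu> 0 * Xt \<nu> Q) * Xt \<mu> (\<gamma> t Q)) * Xt S Q"
    using rel[OF \<mu>] by (simp add: mult_ac)
  then show ?thesis using Xt_nonzero[OF Q, of S] by simp
qed

lemma Xt_DeltaM_deriv:
  assumes Q: "Q \<in> Torus" and \<mu>: "\<mu> \<in> DM"
  shows "((\<lambda>t. Xt \<mu> (\<gamma> t Q)) has_vector_derivative
    (\<Sum>\<nu>\<in>DM. LieAct \<gamma> \<nu> \<mu> * Xt \<nu> Q) - Xt \<mu> Q * (\<Sum>\<nu>\<in>DM. LieAct \<gamma> \<nu> 0 * Xt \<nu> Q)) (at 0)"
proof -
  define N where "N \<mu> t = (\<Sum>\<nu>\<in>DM. Act (\<gamma> (- t)) \<nu> \<mu> * Xt \<nu> Q)" for \<mu> t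
  define N' where "N' \<mu> = (\<Sum>\<nu>\<in>DM. LieAct \<gamma> \<nu> \<mu> * Xt \<nu> Q)" for \<mu>
  have N: "(N \<mu> has_vector_derivative N' \<mu>) (at 0)" if "\<mu> \<in> DM" for \<mu>
    unfolding N_def N'_def
    by (intro has_vector_derivative_sum has_vector_derivative_mult_left act_deriv(2) that)
  have N0: "N \<mu> 0 = Xt \<mu> Q" if "\<mu> \<in> DM" for \<mu>
    using that finite_DeltaM by (simp add: N_def \<gamma>D(2) act_id if_distrib[of "\<lambda>x. x * _"] cong: if_cong)
  have N00: "N 0 0 = 1" using N0[OF zero_in_DeltaM] Xt_zero[OF Q] by simp
  have lim: "((\<lambda>t. (1/t) *\<^sub>R (N \<mu> t - N \<mu> 0)) \<longlongrightarrow> N' \<mu>) (at 0)" if "\<mu> \<in> DM" for \<mu>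
    using N[OF that] by (simp add: has_vector_derivative_at_0_iff)
  have "isCont (N 0) 0" by (rule has_vector_derivative_continuous[OF N[OF zero_in_DeltaM]])
  then have N0lim: "(N 0 \<longlongrightarrow> 1) (at 0)" using N00 by (simp add: isCont_def)
  \<comment> \<open>This is the difference quotient of \<open>N \<mu> t / N 0 t\<close>, rewritten
    in terms of the two difference quotients that are known to converge.\<close>
  have "((\<lambda>t. ((1/t) *\<^sub>R (N \<mu> t - N \<mu> 0) - Xt \<mu> Q * ((1/t) *\<^sub>R (N 0 t - N 0 0))) / N 0 t) \<longlongrightarrow> (N' \<mu> - Xt \<mu> Q * N' 0) / 1) (at 0)"
    by (intro tendsto_intros lim N0lim \<mu> zero_in_DeltaM) simp
  moreover have "\<forall>\<^sub>F t in at 0. ((1/t) *\<^sub>R (N \<mu> t - N \<mu> 0) - Xt \<mu> Q * ((1/t) *\<^sub>R (N 0 t - N 0 0))) / N 0 t =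
      (1/t) *\<^sub>R (Xt \<mu> (\<gamma> t Q) - Xt \<mu> (\<gamma> 0 Q))"
  proof -
    have "\<forall>\<^sub>F t in at 0. \<gamma> t Q \<in> Torus"
      using torus_eventually[OF Q] by (auto simp: eventually_at_filter elim: eventually_mono)
    moreover have "\<forall>\<^sub>F t in at 0. N 0 t \<noteq> 0" by (rule tendsto_imp_eventually_ne[OF N0lim]) simp
    ultimately show ?thesis
    proof eventually_elim
      case (elim t)
      have "N \<mu> t = N 0 t * Xt \<mu> (\<gamma> t Q)" unfolding N_def by (rule Xt_ratio[OF Q elim(1) \<mu>])
      then have "N \<mu> t - Xt \<mu> Q - Xt \<mu> Q * (N 0 t - 1) = N 0 t * (Xt \<mu> (\<gamma> t Q) - Xt \<mu> Q)"
        by (simp add: algebra_simps)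
      then have "(N \<mu> t - Xt \<mu> Q - Xt \<mu> Q * (N 0 t - 1)) / N 0 t = Xt \<mu> (\<gamma> t Q) - Xt \<mu> Q"
        using elim(2) by (simp add: divide_eq_eq mult.commute)
      moreover have "((1/t) *\<^sub>R (N \<mu> t - N \<mu> 0) - Xt \<mu> Q * ((1/t) *\<^sub>R (N 0 t - N 0 0))) / N 0 t =
          (1/t) *\<^sub>R ((N \<mu> t - Xt \<mu> Q - Xt \<mu> Q * (N 0 t - 1)) / N 0 t)"
        unfolding N0[OF \<mu>] N00 by (simp only: scaleR_conv_of_real mult.left_commute[of "Xt \<mu> Q"] right_diff_distrib[symmetric] times_divide_eq_right)
      ultimately show ?case by (simp add: \<gamma>D(2))
    qed
  qed
  ultimately have "((\<lambda>t. (1/t) *\<^sub>R (Xt \<mu> (\<gamma> t Q) - Xt \<mu> (\<gamma> 0 Q))) \<longlongrightarrow> (N' \<mu> - Xt \<mu> Q * N' 0) / 1) (at 0)"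
    by (rule Lim_transform_eventually)
  then show ?thesis by (simp add: has_vector_derivative_at_0_iff N'_def)
qed

end

section \<open>Logarithmic coordinates along the flow\<close>

lemma has_vector_derivative_divide:
  fixes f g :: "real \<Rightarrow> complex"
  assumes "(f has_vector_derivative f') (at x)" "(g has_vector_derivative g') (at x)" "g x \<noteq> 0"
  shows "((\<lambda>t. f t / g t) has_vector_derivative (f' * g x - f x * g') / (g x)\<^sup>2) (at x)"
proof -
  have "((inverse \<circ> g) has_vector_derivative g' * - (inverse (g x) ^ Suc (Suc 0))) (at x)"
    by (rule field_vector_diff_chain_at[OF assms(2) DERIV_inverse[OF assms(3)]])
  from has_vector_derivative_mult[OF assms(1) this]
  have "((\<lambda>t. f t / g t) has_vector_derivative f x * (g' * - (inverse (g x) ^ Suc (Suc 0))) + f' * (inverse \<circ> g) x) (at x)"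
    by (simp add: divide_inverse)
  also have "f x * (g' * - (inverse (g x) ^ Suc (Suc 0))) + f' * (inverse \<circ> g) x = (f' * g x - f x * g') / (g x)\<^sup>2"
    using assms(3) by (simp add: field_simps power2_eq_square)
  finally show ?thesis .
qed

text \<open>The numbers \<open>r\<close> express the coordinates of the chart by the \<open>t\<^sup>\<mu>\<close>: \<open>log x\<^sub>j = \<Sum>\<^sub>\<mu> r\<^sub>j\<^sub>\<mu> log t\<^sup>\<mu>\<close>.\<close>

locale flow_chart = one_param \<Sigma> \<gamma> for \<Sigma> :: "(real ^ 'n::finite) set set" and \<gamma> +
  fixes \<sigma> :: "(real ^ 'n) set" and m :: "'n \<Rightarrow> 'n lattice" and r :: "'n \<Rightarrow> 'n lattice \<Rightarrow> complex"
  assumes c: "(\<sigma>, m) \<in> charts \<Sigma>"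
    and r: "(\<Sum>\<mu>\<in>DeltaM \<Sigma>. r j \<mu> * of_int (pair \<mu> (dual_basis m k))) = (if j = k then 1 else 0)"
begin

abbreviation "phi \<equiv> fl (\<sigma>, m)"

lemmas basis = chart_basis(1)[OF c]

definition good :: "real \<Rightarrow> complex ^ 'n \<Rightarrow> bool" where
  "good t x \<longleftrightarrow> \<gamma> t (pt m x) \<in> Dom (\<sigma>, m) \<and> (\<forall>j. phi t x $ j \<noteq> 0)"

lemma good_at:
  assumes x: "\<forall>j. x $ j \<noteq> 0"
  shows "\<forall>\<^sub>F t in nhds 0. good t x"
proof -
  have "\<forall>\<^sub>F t in nhds 0. \<forall>j\<in>UNIV. phi t x $ j \<noteq> 0"
    by (intro eventually_ball_finite ballI tendsto_imp_eventually_ne[OF tendsto_vec_nth[OF fl_tendsto[OF c]]]) (use x in auto)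
  then show ?thesis using dom_eventually[OF c, of x] by eventually_elim (simp add: good_def)
qed

text \<open>For t near 0 all quotients are near 1. The bound by pi keeps the sums
  \<open>Z t \<mu>\<close> on the principal branch, so logarithms add without a jump, and
  \<open>r\<close> inverts the resulting linear relation.\<close>

lemma log_phi:
  assumes x: "\<forall>j. x $ j \<noteq> 0"
  shows "\<forall>\<^sub>F t in nhds 0. good t x \<and>
    (\<forall>j. Ln (phi t x $ j / x $ j) = (\<Sum>\<mu>\<in>DM. r j \<mu> * Ln (mon m (phi t x) \<mu> / mon m x \<mu>)))"
proof -
  define L where "L t j = Ln (phi t x $ j / x $ j)" for t j
  define Z where "Z t \<mu> = (\<Sum>k\<in>UNIV. of_int (pair \<mu> (dual_basis m k)) * L t k)" for t \<mu>
  have "((\<lambda>t. L t j) \<longlongrightarrow> Ln 1) (nhds 0)" for j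
    unfolding L_def
  proof (rule tendsto_Ln)
    have "((\<lambda>t. phi t x $ j / x $ j) \<longlongrightarrow> x $ j / x $ j) (nhds 0)"
      by (intro tendsto_intros fl_tendsto[OF c]) (use x in simp)
    then show "((\<lambda>t. phi t x $ j / x $ j) \<longlongrightarrow> 1) (nhds 0)" using x by simp
  qed simp
  then have "((\<lambda>t. norm (Z t \<mu>)) \<longlongrightarrow> norm (\<Sum>k\<in>UNIV. of_int (pair \<mu> (dual_basis m k)) * Ln (1 :: complex))) (nhds 0)" for \<mu>
    unfolding Z_def by (intro tendsto_intros)
  then have "\<forall>\<^sub>F t in nhds 0. norm (Z t \<mu>) < pi" for \<mu> by (rule order_tendstoD(2)) simp
  then have "\<forall>\<^sub>F t in nhds 0. \<forall>\<mu>\<in>DM. norm (Z t \<mu>) < pi" by (intro eventually_ball_finite finite_DeltaM ballI)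
  then show ?thesis using good_at[OF x]
  proof eventually_elim
    case (elim t)
    have p: "phi t x $ j / x $ j \<noteq> 0" for j using elim(2) x by (simp add: good_def)
    have mu: "Ln (mon m (phi t x) \<mu> / mon m x \<mu>) = Z t \<mu>" if "\<mu> \<in> DM" for \<mu>
    proof (rule Ln_unique)
      have "exp (Z t \<mu>) = (\<Prod>k\<in>UNIV. (phi t x $ k / x $ k) powi pair \<mu> (dual_basis m k))"
        using p by (simp add: Z_def exp_sum exp_power_int[symmetric] L_def)
      then show "exp (Z t \<mu>) = mon m (phi t x) \<mu> / mon m x \<mu>"
        by (simp add: mon_def power_int_divide_distrib prod_dividef)
      have "\<bar>Im (Z t \<mu>)\<bar> < pi" using elim(1) that abs_Im_le_cmod[of "Z t \<mu>"] by force
      then show "- pi < Im (Z t \<mu>)" "Im (Z t \<mu>) \<le> pi" by auto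
    qed
    have "(\<Sum>\<mu>\<in>DM. r j \<mu> * Ln (mon m (phi t x) \<mu> / mon m x \<mu>)) = L t j" for j
    proof -
      have "(\<Sum>\<mu>\<in>DM. r j \<mu> * Ln (mon m (phi t x) \<mu> / mon m x \<mu>)) =
          (\<Sum>k\<in>UNIV. (\<Sum>\<mu>\<in>DM. r j \<mu> * of_int (pair \<mu> (dual_basis m k))) * L t k)"
        by (simp add: mu Z_def sum_distrib_left sum_distrib_right mult.assoc sum.swap[of _ _ "UNIV"])
      then show ?thesis by (simp add: r if_distrib[of "\<lambda>x. x * _"] cong: if_cong)
    qed
    then show ?case using elim(2) by (simp add: L_def)
  qed
qed

text \<open>\<open>num t \<mu> / num t 0\<close> is \<open>t\<^sup>\<mu>\<close> after time t
  (\<open>num_ratio\<close>); \<open>num t 0\<close> carries the common factor in the action on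
  sections.\<close>

definition num :: "real \<Rightarrow> 'n lattice \<Rightarrow> complex ^ 'n \<Rightarrow> complex" where
  "num t \<mu> x = (\<Sum>\<nu>\<in>DM. Act (\<gamma> (- t)) \<nu> \<mu> * mon m x \<nu>)"

lemma num_ratio:
  assumes x: "\<forall>j. x $ j \<noteq> 0" and g: "good t x" and \<mu>: "\<mu> \<in> DM"
  shows "num t \<mu> x = num t 0 x * mon m (phi t x) \<mu>"
proof -
  have f: "\<gamma> t (pt m x) = pt m (phi t x)" using pt_fl[OF c] g by (simp add: good_def)
  have "\<forall>j. phi t x $ j \<noteq> 0" using g by (simp add: good_def)
  then show ?thesis
    using Xt_ratio[of "pt m x" t \<mu>] x \<mu> unfolding f by (simp add: num_def pt_in_torus_iff[OF c] Xt_pt[OF c])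
qed

lemma num_0: "\<mu> \<in> DM \<Longrightarrow> num 0 \<mu> x = mon m x \<mu>"
  using finite_DeltaM by (simp add: num_def \<gamma>D(2) act_id if_distrib[of "\<lambda>x. x * _"] cong: if_cong)

end

text \<open>The derivative of the determinant at the identity is the trace: a permutation other than
  \<open>id\<close> moves at least two indices, so a zero entry survives in each product with one
  factor removed.\<close>

lemma has_vector_derivative_det_id:
  fixes E :: "real \<Rightarrow> complex ^ 'n::finite ^ 'n"
  assumes E: "\<And>i j. ((\<lambda>t. E t $ i $ j) has_vector_derivative D i j) (at x)" and 0: "\<And>i j. E x $ i $ j = (if i = j then 1 else 0)"
  shows "((\<lambda>t. det (E t)) has_vector_derivative (\<Sum>j\<in>UNIV. D j j)) (at x)"
proof -
  have P: "((\<lambda>t. \<Prod>i\<in>UNIV. E t $ i $ p i) has_vector_derivative (\<Sum>i\<in>UNIV. D i (p i) * (\<Prod>j\<in>UNIV - {i}. if j = p j then 1 else 0))) (at x)" for p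
    unfolding has_vector_derivative_def
    by (rule has_derivative_eq_rhs[OF has_derivative_prod[OF E[unfolded has_vector_derivative_def]]])
      (simp add: 0 scaleR_sum_right)
  have z: "(\<Prod>j\<in>UNIV - {i}. if j = p j then 1 else (0::complex)) = 0" if p: "p permutes UNIV" "p \<noteq> id" for p and i :: 'n
  proof -
    obtain k where k: "p k \<noteq> k" using p(2) by (auto simp: fun_eq_iff)
    then have "p (p k) \<noteq> p k" using permutes_inj[OF p(1)] by (simp add: inj_eq)
    then have "\<exists>j\<in>UNIV - {i}. j \<noteq> p j" using k by (metis DiffI UNIV_I singletonD)
    then show ?thesis by (auto simp: prod_zero_iff)
  qed
  have "((\<lambda>t. det (E t)) has_vector_derivative
      (\<Sum>p | p permutes (UNIV :: 'n set). of_int (sign p) * (\<Sum>i\<in>UNIV. D i (p i) * (\<Prod>j\<in>UNIV - {i}. if j = p j then 1 else 0)))) (at x)"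
    unfolding det_def by (intro has_vector_derivative_sum has_vector_derivative_mult_right P)
  also have "(\<Sum>p | p permutes (UNIV :: 'n set). of_int (sign p) * (\<Sum>i\<in>UNIV. D i (p i) * (\<Prod>j\<in>UNIV - {i}. if j = p j then 1 else 0))) =
      (\<Sum>p | p permutes (UNIV :: 'n set). if p = id then (\<Sum>i\<in>UNIV. D i i) else 0)"
    by (intro sum.cong refl) (auto simp: z sign_id)
  also have "\<dots> = (\<Sum>i\<in>UNIV. D i i)" using permutes_id finite_permutations[of "UNIV :: 'n set"] by simp
  finally show ?thesis .
qed

lemma ratl_mon_torus:
  assumes "\<forall>j. x $ j \<noteq> 0"
  shows "ratl x (\<lambda>x. mon m x k)"
  unfolding mon_def by (intro ratl_prod ratl_power_int ratl_coord) (use assms in simp)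

lemma ratl_mon_comp:
  assumes "\<And>j. ratl x (\<lambda>y. F y $ j)" "\<forall>j. F x $ j \<noteq> 0"
  shows "ratl x (\<lambda>y. mon m (F y) k)"
  unfolding mon_def by (intro ratl_prod ratl_power_int assms(1)) (use assms(2) in simp)

lemma pdv_mult:
  assumes "ratl x f" "ratl x g"
  shows "pdv (\<lambda>y. f y * g y) j x = f x * pdv g j x + pdv f j x * g x"
  using DERIV_mult'[OF ratl_line_DERIV[OF assms(1)] ratl_line_DERIV[OF assms(2)], of j j, THEN DERIV_imp_deriv]
  unfolding pdv_def by simp

section \<open>Coefficients of the vector field and its divergence\<close>

context flow_chart
begin

text \<open>The coefficient of \<open>t\<^sup>\<alpha>\<close> in the logarithmic derivative of
  \<open>t\<^sup>\<mu>\<close> along \<open>\<gamma>\<close>, as the quotient rule gives it.\<close>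

definition dmat :: "'n lattice \<Rightarrow> 'n lattice \<Rightarrow> complex" where
  "dmat \<mu> \<alpha> = (if \<alpha> + \<mu> \<in> DM then LieAct \<gamma> (\<alpha> + \<mu>) \<mu> else 0) - (if \<alpha> \<in> DM then LieAct \<gamma> \<alpha> 0 else 0)"

definition supp :: "'n lattice set" where "supp = (\<lambda>(\<nu>, \<mu>). \<nu> - \<mu>) ` (DM \<times> DM)"

text \<open>The vector field generating \<open>\<gamma>\<close> is \<open>\<Sum>\<alpha>\<in>supp. t\<^sup>\<alpha> \<delta> \<alpha>\<close>, where \<open>\<delta> \<alpha>\<close> is the invariant vector
  field with \<open>t\<^sup>k \<mapsto> \<delta> \<alpha> k * t\<^sup>k\<close>.\<close>
definition \<delta> :: "'n lattice \<Rightarrow> 'n lattice \<Rightarrow> complex" where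
  "\<delta> \<alpha> k = (\<Sum>j\<in>UNIV. of_int (pair k (dual_basis m j)) * (\<Sum>\<mu>\<in>DM. r j \<mu> * dmat \<mu> \<alpha>))"

lemma \<delta>_add: "\<delta> \<alpha> (k + l) = \<delta> \<alpha> k + \<delta> \<alpha> l"
  by (simp add: \<delta>_def pair_simps distrib_right sum.distrib)

lemma finite_supp: "finite supp" using finite_DeltaM by (simp add: supp_def)

lemma shift_sum:
  assumes \<mu>: "\<mu> \<in> DM"
  shows "(\<Sum>\<alpha>\<in>supp. if \<alpha> + \<mu> \<in> DM then f \<alpha> else (0::complex)) = (\<Sum>\<nu>\<in>DM. f (\<nu> - \<mu>))"
proof -
  have "(\<Sum>\<alpha>\<in>supp. if \<alpha> + \<mu> \<in> DM then f \<alpha> else 0) = (\<Sum>\<alpha>\<in>(\<lambda>\<nu>. \<nu> - \<mu>) ` DM. f \<alpha>)"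
  proof (intro sum.mono_neutral_cong_right finite_supp ballI)
    show "(\<lambda>\<nu>. \<nu> - \<mu>) ` DM \<subseteq> supp" using \<mu> by (auto simp: supp_def)
    fix \<alpha> assume "\<alpha> \<in> supp - (\<lambda>\<nu>. \<nu> - \<mu>) ` DM"
    then have "\<alpha> \<notin> (\<lambda>\<nu>. \<nu> - \<mu>) ` DM" by blast
    then have "\<alpha> + \<mu> \<notin> DM" by (metis add_diff_cancel_right' imageI)
    then show "(if \<alpha> + \<mu> \<in> DM then f \<alpha> else 0) = 0" by simp
  qed auto
  also have "\<dots> = (\<Sum>\<nu>\<in>DM. f (\<nu> - \<mu>))" by (subst sum.reindex) (auto intro: inj_onI)
  finally show ?thesis .
qed

lemma dmat_sum:
  assumes \<mu>: "\<mu> \<in> DM" and x: "\<forall>j. x $ j \<noteq> 0"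
  shows "(\<Sum>\<alpha>\<in>supp. g \<alpha> * dmat \<mu> \<alpha> * mon m x \<alpha>) = (\<Sum>\<nu>\<in>DM. g (\<nu> - \<mu>) * LieAct \<gamma> \<nu> \<mu> * mon m x \<nu>) / mon m x \<mu> -
    (\<Sum>\<nu>\<in>DM. g \<nu> * LieAct \<gamma> \<nu> 0 * mon m x \<nu>)"
proof -
  have m: "mon m x (\<nu> - \<mu>) = mon m x \<nu> / mon m x \<mu>" for \<nu>
    using mon_add[OF x, of m "\<nu> - \<mu>" \<mu>] mon_nonzero[OF x, of m \<mu>] by (simp add: field_simps)
  have "(\<Sum>\<alpha>\<in>supp. g \<alpha> * dmat \<mu> \<alpha> * mon m x \<alpha>) =
      (\<Sum>\<alpha>\<in>supp. if \<alpha> + \<mu> \<in> DM then g \<alpha> * LieAct \<gamma> (\<alpha> + \<mu>) \<mu> * mon m x \<alpha> else 0) -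
      (\<Sum>\<alpha>\<in>supp. if \<alpha> + 0 \<in> DM then g \<alpha> * LieAct \<gamma> \<alpha> 0 * mon m x \<alpha> else 0)"
    unfolding sum_subtractf[symmetric] by (intro sum.cong refl) (simp add: dmat_def algebra_simps)
  then show ?thesis
    unfolding shift_sum[OF \<mu>] shift_sum[OF zero_in_DeltaM] by (simp add: m sum_divide_distrib)
qed

lemma mon_phi_DeltaM:
  assumes x: "\<forall>j. x $ j \<noteq> 0" and \<mu>: "\<mu> \<in> DM"
  shows "((\<lambda>t. mon m (phi t x) \<mu>) has_vector_derivative mon m x \<mu> * (\<Sum>\<alpha>\<in>supp. dmat \<mu> \<alpha> * mon m x \<alpha>)) (at 0)"
proof (rule has_vector_derivative_cong_nhds)
  let ?Q = "pt m x"
  have "mon m x \<mu> * (\<Sum>\<alpha>\<in>supp. dmat \<mu> \<alpha> * mon m x \<alpha>) =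
      (\<Sum>\<nu>\<in>DM. LieAct \<gamma> \<nu> \<mu> * Xt \<nu> ?Q) - Xt \<mu> ?Q * (\<Sum>\<nu>\<in>DM. LieAct \<gamma> \<nu> 0 * Xt \<nu> ?Q)"
    using dmat_sum[OF \<mu> x, of "\<lambda>_. 1"] mon_nonzero[OF x, of m \<mu>] by (simp add: Xt_pt[OF c x] right_diff_distrib)
  then show "((\<lambda>t. Xt \<mu> (\<gamma> t ?Q)) has_vector_derivative mon m x \<mu> * (\<Sum>\<alpha>\<in>supp. dmat \<mu> \<alpha> * mon m x \<alpha>)) (at 0)"
    using Xt_DeltaM_deriv[of ?Q \<mu>] x \<mu> by (simp add: pt_in_torus_iff[OF c])
  show "\<forall>\<^sub>F t in nhds 0. Xt \<mu> (\<gamma> t ?Q) = mon m (phi t x) \<mu>"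
    using good_at[OF x] 
  proof eventually_elim
    case (elim t)
    then have "\<gamma> t (pt m x) = pt m (phi t x)" "\<forall>j. phi t x $ j \<noteq> 0" by (auto simp: good_def pt_fl[OF c])
    then show ?case by (simp add: Xt_pt[OF c])
  qed
qed

text \<open>The derivative is known for exponents in \<Delta>; exponentiating the relations of
  \<open>log_phi\<close> extends it to every exponent k.\<close>

lemma mon_phi_deriv:
  assumes x: "\<forall>j. x $ j \<noteq> 0"
  shows "((\<lambda>t. mon m (phi t x) k) has_vector_derivative mon m x k * (\<Sum>\<alpha>\<in>supp. \<delta> \<alpha> k * mon m x \<alpha>)) (at 0)"
proof (rule has_vector_derivative_cong_nhds)
  define h where "h \<mu> = (\<Sum>\<alpha>\<in>supp. dmat \<mu> \<alpha> * mon m x \<alpha>)" for \<mu>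
  define L where "L \<mu> t = Ln (mon m (phi t x) \<mu> / mon m x \<mu>)" for \<mu> t
  let ?p = "\<lambda>j. of_int (pair k (dual_basis m j)) :: complex"
  have L0: "L \<mu> 0 = 0" for \<mu> using mon_nonzero[OF x] by (simp add: L_def fl_0[OF c])
  have L: "(L \<mu> has_vector_derivative h \<mu>) (at 0)" if \<mu>: "\<mu> \<in> DM" for \<mu>
  proof -
    have "((\<lambda>t. mon m (phi t x) \<mu> / mon m x \<mu>) has_vector_derivative h \<mu>) (at 0)"
      using has_vector_derivative_mult_left[OF mon_phi_DeltaM[OF x \<mu>], of "1 / mon m x \<mu>"] mon_nonzero[OF x, of m \<mu>]
      by (simp add: h_def)
    from field_vector_diff_chain_at[OF this, of Ln 1]
    show ?thesis using has_field_derivative_Ln[of 1] mon_nonzero[OF x] by (simp add: L_def[abs_def] o_def fl_0[OF c])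
  qed
  have "((\<lambda>t. \<Sum>j\<in>UNIV. ?p j * (\<Sum>\<mu>\<in>DM. r j \<mu> * L \<mu> t)) has_vector_derivative (\<Sum>j\<in>UNIV. ?p j * (\<Sum>\<mu>\<in>DM. r j \<mu> * h \<mu>))) (at 0)"
    by (intro has_vector_derivative_sum has_vector_derivative_mult_right L)
  from has_vector_derivative_mult_right[OF field_vector_diff_chain_at[OF this DERIV_exp], of "mon m x k"]
  have "((\<lambda>t. mon m x k * exp (\<Sum>j\<in>UNIV. ?p j * (\<Sum>\<mu>\<in>DM. r j \<mu> * L \<mu> t))) has_vector_derivative
      mon m x k * (\<Sum>j\<in>UNIV. ?p j * (\<Sum>\<mu>\<in>DM. r j \<mu> * h \<mu>))) (at 0)"
    by (simp add: o_def L0)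
  also have "(\<Sum>j\<in>UNIV. ?p j * (\<Sum>\<mu>\<in>DM. r j \<mu> * h \<mu>)) = (\<Sum>\<alpha>\<in>supp. \<delta> \<alpha> k * mon m x \<alpha>)"
    by (simp add: h_def \<delta>_def sum_distrib_left sum_distrib_right mult.assoc sum.swap[of _ _ supp])
  finally show "((\<lambda>t. mon m x k * exp (\<Sum>j\<in>UNIV. ?p j * (\<Sum>\<mu>\<in>DM. r j \<mu> * L \<mu> t))) has_vector_derivative
      mon m x k * (\<Sum>\<alpha>\<in>supp. \<delta> \<alpha> k * mon m x \<alpha>)) (at 0)" .
  have "\<forall>\<^sub>F t in nhds 0. good t x \<and>
      (\<forall>j. Ln (phi t x $ j / x $ j) = (\<Sum>\<mu>\<in>DM. r j \<mu> * Ln (mon m (phi t x) \<mu> / mon m x \<mu>)))" by (rule log_phi[OF x])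
  then show "\<forall>\<^sub>F t in nhds 0. mon m x k * exp (\<Sum>j\<in>UNIV. ?p j * (\<Sum>\<mu>\<in>DM. r j \<mu> * L \<mu> t)) = mon m (phi t x) k"
  proof eventually_elim
    case (elim t)
    have p: "phi t x $ j \<noteq> 0" for j using elim by (simp add: good_def)
    have e: "(\<Sum>\<mu>\<in>DM. r j \<mu> * L \<mu> t) = Ln (phi t x $ j / x $ j)" for j using elim by (simp add: L_def)
    have "exp (\<Sum>j\<in>UNIV. ?p j * (\<Sum>\<mu>\<in>DM. r j \<mu> * L \<mu> t)) = (\<Prod>j\<in>UNIV. (phi t x $ j / x $ j) powi pair k (dual_basis m j))"
      unfolding e using p x by (simp add: exp_sum exp_power_int[symmetric])
    also have "\<dots> = mon m (phi t x) k / mon m x k" by (simp add: mon_def power_int_divide_distrib prod_dividef)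
    finally show ?case using mon_nonzero[OF x, of m k] by simp
  qed
qed

text \<open>Compares coefficients in two formulas for one derivative. It shows that
  \<open>dmat \<mu> \<alpha>\<close> is the restriction to \<Delta> of a homomorphism in
  \<mu>.\<close>

lemma dmat_eq_\<delta>:
  assumes \<alpha>: "\<alpha> \<in> supp" and \<mu>: "\<mu> \<in> DM"
  shows "dmat \<mu> \<alpha> = \<delta> \<alpha> \<mu>"
proof -
  have "dmat \<mu> \<alpha> - \<delta> \<alpha> \<mu> = 0"
  proof (rule mon_independent[OF basis finite_supp _ \<alpha>])
    fix x :: "complex ^ 'n" assume x: "\<forall>j. x $ j \<noteq> 0"
    have "mon m x \<mu> * (\<Sum>\<alpha>\<in>supp. dmat \<mu> \<alpha> * mon m x \<alpha>) = mon m x \<mu> * (\<Sum>\<alpha>\<in>supp. \<delta> \<alpha> \<mu> * mon m x \<alpha>)"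
      by (rule vector_derivative_unique_at[OF mon_phi_DeltaM[OF x \<mu>] mon_phi_deriv[OF x]])
    then show "(\<Sum>\<alpha>\<in>supp. (dmat \<mu> \<alpha> - \<delta> \<alpha> \<mu>) * mon m x \<alpha>) = 0"
      using mon_nonzero[OF x, of m \<mu>] by (simp add: left_diff_distrib sum_subtractf)
  qed
  then show ?thesis by simp
qed

lemma good_nhds:
  assumes "good t x"
  shows "\<forall>\<^sub>F y in nhds x. good t y"
proof -
  have d: "\<gamma> t (pt m x) \<in> Dom (\<sigma>, m)" and n: "phi t x $ j \<noteq> 0" for j using assms by (auto simp: good_def)
  have "\<forall>\<^sub>F y in nhds x. \<forall>j\<in>UNIV. phi t y $ j \<noteq> 0"
    by (intro eventually_ball_finite ballI ratl_eventually_nonzero[OF fl_ratl[OF c d]] n) simp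
  moreover have "\<forall>\<^sub>F y in nhds x. \<gamma> t (pt m y) \<in> Aff \<sigma>"
    using morphism_ratl(1)[OF AutD(2)[OF \<gamma>D(1)] c chart_basis(2)[OF c]] d by (simp add: dom_chart_def)
  ultimately show ?thesis by eventually_elim (simp add: good_def dom_chart_def)
qed

definition dnum :: "'n lattice \<Rightarrow> 'n \<Rightarrow> complex ^ 'n \<Rightarrow> real \<Rightarrow> complex" where
  "dnum \<mu> j x t = (\<Sum>\<nu>\<in>DM. Act (\<gamma> (- t)) \<nu> \<mu> * (of_int (pair \<nu> (dual_basis m j)) * mon m x \<nu> / x $ j))"

text \<open>Logarithmic differentiation of \<open>t\<^sup>\<mu>(\<gamma>\<^sub>t x) = num t \<mu> x / num t 0 x\<close>.\<close>

lemma pdv_phi: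
  assumes x: "\<forall>j. x $ j \<noteq> 0" and g: "good t x" and n: "num t 0 x \<noteq> 0"
  shows "pdv (\<lambda>y. phi t y $ i) j x =
    phi t x $ i * (\<Sum>\<mu>\<in>DM. r i \<mu> * (dnum \<mu> j x t / num t \<mu> x - dnum 0 j x t / num t 0 x))"
proof -
  have d: "\<gamma> t (pt m x) \<in> Dom (\<sigma>, m)" and p: "\<forall>j. phi t x $ j \<noteq> 0" using g by (auto simp: good_def)
  have R: "ratl x (\<lambda>y. num t \<mu> y)" for \<mu> unfolding num_def by (intro ratl_sum ratl_mult ratl_const ratl_mon_torus x)
  have dn: "pdv (\<lambda>y. num t \<mu> y) j x = dnum \<mu> j x t" for \<mu>
    unfolding num_def dnum_def by (subst pdv_sum) (auto simp: ratl_mon_torus[OF x] pdv_mon[OF x])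
  let ?E = "\<lambda>k. pdv (\<lambda>y. phi t y $ k) j x"
  have q: "dnum \<mu> j x t / num t \<mu> x - dnum 0 j x t / num t 0 x =
      (\<Sum>k\<in>UNIV. of_int (pair \<mu> (dual_basis m k)) * (?E k / phi t x $ k))" if \<mu>: "\<mu> \<in> DM" for \<mu>
  proof -
    let ?M = "mon m (phi t x) \<mu>" and ?S = "\<Sum>k\<in>UNIV. of_int (pair \<mu> (dual_basis m k)) * (?E k / phi t x $ k)"
    have M: "?M \<noteq> 0" by (rule mon_nonzero[OF p])
    have "\<forall>\<^sub>F y in nhds x. \<forall>j\<in>UNIV. y $ j \<noteq> 0"
      by (intro eventually_ball_finite ballI ratl_eventually_nonzero ratl_coord) (use x in auto)
    then have ev: "\<forall>\<^sub>F y in nhds x. num t \<mu> y = num t 0 y * mon m (phi t y) \<mu>"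
      using good_nhds[OF g]
    proof eventually_elim
      case (elim y)
      then show ?case by (intro num_ratio \<mu>) auto
    qed
    have "dnum \<mu> j x t = pdv (\<lambda>y. num t 0 y * mon m (phi t y) \<mu>) j x"
      unfolding dn[symmetric] by (rule pdv_cong[OF ev])
    also have "\<dots> = num t 0 x * pdv (\<lambda>y. mon m (phi t y) \<mu>) j x + dnum 0 j x t * ?M"
      unfolding dn[symmetric]
      by (rule pdv_mult[OF R ratl_mon_comp[OF fl_ratl[OF c d] p]])
    also have "pdv (\<lambda>y. mon m (phi t y) \<mu>) j x = (\<Sum>k\<in>UNIV. (of_int (pair \<mu> (dual_basis m k)) * ?M / phi t x $ k) * ?E k)"
      by (subst ratl_chain[OF fl_ratl[OF c d] ratl_mon_torus[OF p]]) (simp add: pdv_mon[OF p])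
    also have "\<dots> = ?M * ?S" by (simp add: sum_distrib_left mult_ac)
    finally have "dnum \<mu> j x t = num t 0 x * (?M * ?S) + dnum 0 j x t * ?M" .
    moreover have "num t \<mu> x = num t 0 x * ?M" by (rule num_ratio[OF x g \<mu>])
    ultimately show ?thesis using M n by (simp add: add_divide_distrib)
  qed
  have "(\<Sum>\<mu>\<in>DM. r i \<mu> * (dnum \<mu> j x t / num t \<mu> x - dnum 0 j x t / num t 0 x)) =
      (\<Sum>k\<in>UNIV. (\<Sum>\<mu>\<in>DM. r i \<mu> * of_int (pair \<mu> (dual_basis m k))) * (?E k / phi t x $ k))"
    by (simp add: q sum_distrib_left sum_distrib_right mult.assoc sum.swap[of _ _ UNIV] del: times_divide_eq_right times_divide_eq_left)
  also have "\<dots> = ?E i / phi t x $ i"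
    by (simp add: r if_distrib[of "\<lambda>x. x * _"] cong: if_cong del: times_divide_eq_right times_divide_eq_left)
  finally show ?thesis using p by simp
qed

text \<open>Differentiates at t = 0 the transformation law of the section \<open>tsec 0\<close>: the
  Jacobian determinant times \<open>t\<^sup>S\<close> equals the sum of
  \<open>Act (\<gamma> t) \<nu> 0\<close> times \<open>t\<^sup>\<nu>\<^sup>+\<^sup>S\<close> at the
  moved point. The derivative of the determinant is a trace.\<close>

lemma divergence:
  assumes x: "\<forall>j. x $ j \<noteq> 0"
  shows "(\<Sum>\<nu>\<in>DM. LieAct \<gamma> \<nu> 0 * mon m x \<nu>) = - (\<Sum>\<alpha>\<in>supp. \<delta> \<alpha> \<alpha> * mon m x \<alpha>)"
proof -
  let ?\<delta> = "\<lambda>\<nu> j. of_int (pair \<nu> (dual_basis m j)) :: complex"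
  let ?N = "\<lambda>\<mu>. \<Sum>\<nu>\<in>DM. LieAct \<gamma> \<nu> \<mu> * mon m x \<nu>"
  define dn' where "dn' \<mu> j = (\<Sum>\<nu>\<in>DM. LieAct \<gamma> \<nu> \<mu> * (?\<delta> \<nu> j * mon m x \<nu> / x $ j))" for \<mu> j
  have N: "((\<lambda>t. num t \<mu> x) has_vector_derivative ?N \<mu>) (at 0)" if "\<mu> \<in> DM" for \<mu>
    unfolding num_def by (intro has_vector_derivative_sum has_vector_derivative_mult_left act_deriv(2) that)
  have dn: "(dnum \<mu> j x has_vector_derivative dn' \<mu> j) (at 0)" if "\<mu> \<in> DM" for \<mu> j
    unfolding dnum_def dn'_def by (intro has_vector_derivative_sum has_vector_derivative_mult_left act_deriv(2) that)
  have dn0: "dnum \<mu> j x 0 = ?\<delta> \<mu> j * mon m x \<mu> / x $ j" if "\<mu> \<in> DM" for \<mu> j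
    using that finite_DeltaM by (simp add: dnum_def \<gamma>D(2) act_id if_distrib[of "\<lambda>x. x * _"] if_distrib[of "\<lambda>x. x / _"] cong: if_cong)
  note z = zero_in_DeltaM
  \<comment> \<open>The partial derivative of \<open>phi t x $ i\<close> divided by
    \<open>phi t x $ i\<close>, in the closed form of \<open>pdv_phi\<close>. Differentiating this
    form in t avoids interchanging derivatives in t and x.\<close>
  define g where "g i j t = (\<Sum>\<mu>\<in>DM. r i \<mu> * (dnum \<mu> j x t / num t \<mu> x - dnum 0 j x t / num t 0 x))" for i j t
  define g' where "g' i j = (\<Sum>\<mu>\<in>DM. r i \<mu> *
      ((dn' \<mu> j * mon m x \<mu> - (?\<delta> \<mu> j * mon m x \<mu> / x $ j) * ?N \<mu>) / (mon m x \<mu>)\<^sup>2 - dn' 0 j))" for i j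
  have g: "(g i j has_vector_derivative g' i j) (at 0)" for i j
  proof -
    have q: "((\<lambda>t. dnum \<mu> j x t / num t \<mu> x) has_vector_derivative
        (dn' \<mu> j * mon m x \<mu> - (?\<delta> \<mu> j * mon m x \<mu> / x $ j) * ?N \<mu>) / (mon m x \<mu>)\<^sup>2) (at 0)" if "\<mu> \<in> DM" for \<mu>
      using has_vector_derivative_divide[OF dn[OF that, of j] N[OF that]] mon_nonzero[OF x]
      by (simp add: num_0[OF that] dn0[OF that])
    show ?thesis unfolding g_def g'_def
      by (intro has_vector_derivative_sum has_vector_derivative_mult_right has_vector_derivative_diff q)
        (use q[OF z] in \<open>simp add: pair_simps\<close>)+
  qed
  have g0: "g i j 0 = (if i = j then 1 / x $ j else 0)" for i j
  proof -
    have "g i j 0 = (\<Sum>\<mu>\<in>DM. r i \<mu> * ?\<delta> \<mu> j / x $ j)"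
      using mon_nonzero[OF x] by (simp add: g_def num_0 z dn0 pair_simps)
    then show ?thesis by (simp add: sum_divide_distrib[symmetric] r)
  qed
  have gj: "x $ j * g' j j = (\<Sum>\<alpha>\<in>supp. ?\<delta> \<alpha> j * (\<Sum>\<mu>\<in>DM. r j \<mu> * dmat \<mu> \<alpha>) * mon m x \<alpha>)" for j
  proof -
    have "x $ j * ((dn' \<mu> j * mon m x \<mu> - (?\<delta> \<mu> j * mon m x \<mu> / x $ j) * ?N \<mu>) / (mon m x \<mu>)\<^sup>2 - dn' 0 j) =
        (\<Sum>\<alpha>\<in>supp. ?\<delta> \<alpha> j * dmat \<mu> \<alpha> * mon m x \<alpha>)" if \<mu>: "\<mu> \<in> DM" for \<mu>
    proof -
      have "x $ j * dn' \<mu> j = (\<Sum>\<nu>\<in>DM. ?\<delta> \<nu> j * LieAct \<gamma> \<nu> \<mu> * mon m x \<nu>)" for \<mu>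
        using x by (simp add: dn'_def sum_distrib_left mult_ac)
      moreover have "(\<Sum>\<nu>\<in>DM. ?\<delta> (\<nu> - \<mu>) j * LieAct \<gamma> \<nu> \<mu> * mon m x \<nu>) =
          (\<Sum>\<nu>\<in>DM. ?\<delta> \<nu> j * LieAct \<gamma> \<nu> \<mu> * mon m x \<nu>) - ?\<delta> \<mu> j * ?N \<mu>"
        by (simp add: pair_simps sum_distrib_left sum_subtractf[symmetric] algebra_simps)
      moreover have "x $ j * ((dn' \<mu> j * mon m x \<mu> - (?\<delta> \<mu> j * mon m x \<mu> / x $ j) * ?N \<mu>) / (mon m x \<mu>)\<^sup>2 - dn' 0 j) =
          (x $ j * dn' \<mu> j - ?\<delta> \<mu> j * ?N \<mu>) / mon m x \<mu> - x $ j * dn' 0 j"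
        using x mon_nonzero[OF x, of m \<mu>] by (simp add: field_simps power2_eq_square)
      ultimately show ?thesis by (simp add: dmat_sum[OF \<mu> x])
    qed
    then have "x $ j * g' j j = (\<Sum>\<mu>\<in>DM. r j \<mu> * (\<Sum>\<alpha>\<in>supp. ?\<delta> \<alpha> j * dmat \<mu> \<alpha> * mon m x \<alpha>))"
      by (simp add: g'_def sum_distrib_left mult.left_commute[of "x $ j"])
    then show ?thesis by (simp add: sum_distrib_left sum_distrib_right mult_ac sum.swap[of _ _ supp])
  qed
  \<comment> \<open>For small t this is the Jacobian matrix of \<open>phi t\<close>; at t = 0 it is
    the identity.\<close>
  define E where "E t = (\<chi> i j. phi t x $ i * g i j t)" for t
  have ph: "((\<lambda>t. phi t x $ i) has_vector_derivative x $ i * (\<Sum>\<alpha>\<in>supp. \<delta> \<alpha> (m i) * mon m x \<alpha>)) (at 0)" for i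
    using mon_phi_deriv[OF x, of "m i"] by (simp add: mon_basis[OF basis])
  have "((\<lambda>t. det (E t)) has_vector_derivative (\<Sum>j\<in>UNIV. phi 0 x $ j * g' j j + x $ j * (\<Sum>\<alpha>\<in>supp. \<delta> \<alpha> (m j) * mon m x \<alpha>) * g j j 0)) (at 0)"
    by (rule has_vector_derivative_det_id[where D = "\<lambda>i j. phi 0 x $ i * g' i j + x $ i * (\<Sum>\<alpha>\<in>supp. \<delta> \<alpha> (m i) * mon m x \<alpha>) * g i j 0"])
      (auto simp: E_def g0 fl_0[OF c] x intro!: has_vector_derivative_eq_rhs[OF has_vector_derivative_mult[OF ph g]])
  moreover have "(\<Sum>j\<in>UNIV. phi 0 x $ j * g' j j + x $ j * (\<Sum>\<alpha>\<in>supp. \<delta> \<alpha> (m j) * mon m x \<alpha>) * g j j 0) =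
      (\<Sum>\<alpha>\<in>supp. \<delta> \<alpha> \<alpha> * mon m x \<alpha>) + (\<Sum>j\<in>UNIV. \<Sum>\<alpha>\<in>supp. \<delta> \<alpha> (m j) * mon m x \<alpha>)"
  proof -
    have "(\<Sum>j\<in>UNIV. x $ j * g' j j) = (\<Sum>\<alpha>\<in>supp. \<delta> \<alpha> \<alpha> * mon m x \<alpha>)"
      by (simp add: gj \<delta>_def sum_distrib_left sum_distrib_right mult_ac sum.swap[of _ _ supp])
    then show ?thesis using x by (simp add: g0 fl_0[OF c] sum.distrib)
  qed
  ultimately have dE: "((\<lambda>t. det (E t)) has_vector_derivative
      (\<Sum>\<alpha>\<in>supp. \<delta> \<alpha> \<alpha> * mon m x \<alpha>) + (\<Sum>j\<in>UNIV. \<Sum>\<alpha>\<in>supp. \<delta> \<alpha> (m j) * mon m x \<alpha>)) (at 0)" by simp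
  \<comment> \<open>The exponent of \<open>tsec 0\<close> in this chart.\<close>
  define S where "S = (\<Sum>j\<in>UNIV. m j)"
  have "((\<lambda>t. \<Sum>\<nu>\<in>DM. Act (\<gamma> t) \<nu> 0 * mon m (phi t x) (\<nu> + S)) has_vector_derivative
      (\<Sum>\<nu>\<in>DM. Act (\<gamma> 0) \<nu> 0 * (mon m x (\<nu> + S) * (\<Sum>\<alpha>\<in>supp. \<delta> \<alpha> (\<nu> + S) * mon m x \<alpha>)) +
        - LieAct \<gamma> \<nu> 0 * mon m (phi 0 x) (\<nu> + S))) (at 0)"
    by (intro has_vector_derivative_sum has_vector_derivative_mult act_deriv(1) z mon_phi_deriv[OF x])
  moreover have "(\<Sum>\<nu>\<in>DM. Act (\<gamma> 0) \<nu> 0 * (mon m x (\<nu> + S) * (\<Sum>\<alpha>\<in>supp. \<delta> \<alpha> (\<nu> + S) * mon m x \<alpha>)) +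
        - LieAct \<gamma> \<nu> 0 * mon m (phi 0 x) (\<nu> + S)) = mon m x S * (\<Sum>\<alpha>\<in>supp. \<delta> \<alpha> S * mon m x \<alpha>) - ?N 0 * mon m x S"
  proof -
    have "(\<Sum>\<nu>\<in>DM. Act (\<gamma> 0) \<nu> 0 * (mon m x (\<nu> + S) * (\<Sum>\<alpha>\<in>supp. \<delta> \<alpha> (\<nu> + S) * mon m x \<alpha>))) =
        mon m x S * (\<Sum>\<alpha>\<in>supp. \<delta> \<alpha> S * mon m x \<alpha>)"
      using finite_DeltaM by (simp add: zero_in_DeltaM \<gamma>D(2) act_id if_distrib[of "\<lambda>x. x * _"] cong: if_cong)
    moreover have "(\<Sum>\<nu>\<in>DM. - LieAct \<gamma> \<nu> 0 * mon m (phi 0 x) (\<nu> + S)) = - (?N 0 * mon m x S)"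
      by (simp add: fl_0[OF c] mon_add[OF x] sum_negf sum_distrib_right mult.assoc)
    ultimately show ?thesis unfolding sum.distrib by simp
  qed
  ultimately have R: "((\<lambda>t. \<Sum>\<nu>\<in>DM. Act (\<gamma> t) \<nu> 0 * mon m (phi t x) (\<nu> + S)) has_vector_derivative
      mon m x S * (\<Sum>\<alpha>\<in>supp. \<delta> \<alpha> S * mon m x \<alpha>) - ?N 0 * mon m x S) (at 0)" by simp
  have "\<forall>\<^sub>F t in nhds 0. num t 0 x \<noteq> 0"
  proof -
    have "((\<lambda>t. num t 0 x) \<longlongrightarrow> num 0 0 x) (at 0)"
      using has_vector_derivative_continuous[OF N[OF z]] by (simp add: isCont_def)
    then have "\<forall>\<^sub>F t in at 0. num t 0 x \<noteq> 0" by (rule tendsto_imp_eventually_ne) (simp add: num_0 z)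
    then show ?thesis using num_0[OF z, of x] by (auto simp: eventually_at_filter elim!: eventually_mono)
  qed
  then have "\<forall>\<^sub>F t in nhds 0. det (E t) * mon m x S = (\<Sum>\<nu>\<in>DM. Act (\<gamma> t) \<nu> 0 * mon m (phi t x) (\<nu> + S))"
    using good_at[OF x]
  proof eventually_elim
    case (elim t)
    have d: "\<gamma> t (pt m x) \<in> Dom (\<sigma>, m)" using elim(2) by (simp add: good_def)
    have "det (E t) = Jac (\<gamma> t) (\<sigma>, m) (\<sigma>, m) (pt m x)"
      unfolding jac_pt_fl[OF c] E_def g_def by (simp add: pdv_phi[OF x elim(2,1)])
    moreover have "(\<Sum>\<nu>\<in>DM. Act (\<gamma> t) \<nu> 0 * tsec \<nu> (\<sigma>, m) (\<gamma> t (pt m x))) =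
        of_int (det (\<chi> j. m j)) * (\<Sum>\<nu>\<in>DM. Act (\<gamma> t) \<nu> 0 * mon m (phi t x) (\<nu> + S))"
      unfolding pt_fl[OF c d, symmetric] by (simp add: tsec_pt(1)[OF c] S_def sum_distrib_left mult_ac)
    moreover have "tsec 0 (\<sigma>, m) (pt m x) = of_int (det (\<chi> j. m j)) * mon m x S"
      by (simp add: tsec_pt(1)[OF c z] S_def)
    ultimately show ?case
      using act_relation[OF \<gamma>D(1) z c c pt_in_chart[OF c] d] det_lattice_basis_nonzero[OF basis] by simp
  qed
  from has_vector_derivative_cong_nhds[OF has_vector_derivative_mult_left[OF dE] this]
  have "((\<Sum>\<alpha>\<in>supp. \<delta> \<alpha> \<alpha> * mon m x \<alpha>) + (\<Sum>j\<in>UNIV. \<Sum>\<alpha>\<in>supp. \<delta> \<alpha> (m j) * mon m x \<alpha>)) * mon m x S =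
      mon m x S * (\<Sum>\<alpha>\<in>supp. \<delta> \<alpha> S * mon m x \<alpha>) - ?N 0 * mon m x S"
    by (rule vector_derivative_unique_at[OF _ R])
  moreover have "\<delta> \<alpha> S = (\<Sum>j\<in>UNIV. \<delta> \<alpha> (m j))" for \<alpha>
  proof -
    have z: "\<delta> \<alpha> 0 = 0" using \<delta>_add[of \<alpha> 0 0] by simp
    have "\<delta> \<alpha> (\<Sum>j\<in>J. m j) = (\<Sum>j\<in>J. \<delta> \<alpha> (m j))" for J
      by (induction J rule: infinite_finite_induct) (simp_all add: z \<delta>_add)
    then show ?thesis by (simp add: S_def)
  qed
  then have "(\<Sum>\<alpha>\<in>supp. \<delta> \<alpha> S * mon m x \<alpha>) = (\<Sum>j\<in>UNIV. \<Sum>\<alpha>\<in>supp. \<delta> \<alpha> (m j) * mon m x \<alpha>)"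
    by (simp add: sum_distrib_right sum.swap[of _ _ supp])
  \<comment> \<open>The terms with \<open>\<delta> \<alpha> S\<close> cancel: on one side they come
    from the factors \<open>phi t x $ i\<close> of \<open>E\<close>, on the other from the exponent
    \<open>S\<close>.\<close>
  ultimately have "mon m x S * (?N 0 + (\<Sum>\<alpha>\<in>supp. \<delta> \<alpha> \<alpha> * mon m x \<alpha>)) = 0" by (simp add: algebra_simps)
  then show ?thesis using mon_nonzero[OF x, of m S] by (simp add: eq_neg_iff_add_eq_0)
qed

lemma \<delta>_diag:
  assumes \<alpha>: "\<alpha> \<in> supp"
  shows "(if \<alpha> \<in> DM then LieAct \<gamma> \<alpha> 0 else 0) = - \<delta> \<alpha> \<alpha>"
proof -
  have "(if \<alpha> \<in> DM then LieAct \<gamma> \<alpha> 0 else 0) + \<delta> \<alpha> \<alpha> = 0"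
  proof (rule mon_independent[OF basis finite_supp _ \<alpha>])
    fix x :: "complex ^ 'n" assume x: "\<forall>j. x $ j \<noteq> 0"
    have "(\<Sum>\<alpha>\<in>supp. (if \<alpha> \<in> DM then LieAct \<gamma> \<alpha> 0 else 0) * mon m x \<alpha>) = (\<Sum>\<nu>\<in>DM. LieAct \<gamma> \<nu> 0 * mon m x \<nu>)"
      using shift_sum[OF zero_in_DeltaM, of "\<lambda>\<alpha>. LieAct \<gamma> \<alpha> 0 * mon m x \<alpha>"]
      by (simp add: if_distrib[of "\<lambda>x. x * _"] cong: if_cong)
    then show "(\<Sum>\<alpha>\<in>supp. ((if \<alpha> \<in> DM then LieAct \<gamma> \<alpha> 0 else 0) + \<delta> \<alpha> \<alpha>) * mon m x \<alpha>) = 0"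
      by (simp add: divergence[OF x] distrib_right sum.distrib)
  qed
  then show ?thesis by (simp add: add_eq_0_iff2)
qed

lemma lie_act_\<delta>:
  assumes \<nu>: "\<nu> \<in> DM" and \<mu>: "\<mu> \<in> DM"
  shows "LieAct \<gamma> \<nu> \<mu> = \<delta> (\<nu> - \<mu>) \<mu> - \<delta> (\<nu> - \<mu>) (\<nu> - \<mu>)"
proof -
  have s: "\<nu> - \<mu> \<in> supp" using assms by (auto simp: supp_def)
  show ?thesis using dmat_eq_\<delta>[OF s \<mu>] \<delta>_diag[OF s] \<nu> by (simp add: dmat_def eq_diff_eq)
qed

lemma Xt_deriv:
  assumes Q: "Q \<in> Torus"
  shows "((\<lambda>t. Xt k (\<gamma> t Q)) has_vector_derivative Xt k Q * (\<Sum>\<alpha>\<in>supp. \<delta> \<alpha> k * Xt \<alpha> Q)) (at 0)"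
proof -
  obtain x where x: "Q = pt m x" "\<forall>j. x $ j \<noteq> 0" using torus_pt[OF c Q] .
  show ?thesis
  proof (rule has_vector_derivative_cong_nhds)
    show "((\<lambda>t. mon m (phi t x) k) has_vector_derivative Xt k Q * (\<Sum>\<alpha>\<in>supp. \<delta> \<alpha> k * Xt \<alpha> Q)) (at 0)"
      using mon_phi_deriv[OF x(2), of k] by (simp add: x(1) Xt_pt[OF c x(2)])
    show "\<forall>\<^sub>F t in nhds 0. mon m (phi t x) k = Xt k (\<gamma> t Q)"
      using good_at[OF x(2)]
    proof eventually_elim
      case (elim t)
      then have "\<gamma> t Q = pt m (phi t x)" "\<forall>j. phi t x $ j \<noteq> 0" by (auto simp: good_def x(1) pt_fl[OF c])
      then show ?case by (simp add: Xt_pt[OF c])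
    qed
  qed
qed

text \<open>Reads off the coefficients from a given formula for the vector field, by independence of
  characters.\<close>

lemma \<delta>_eqI:
  assumes "\<And>Q. Q \<in> Torus \<Longrightarrow> ((\<lambda>t. Xt k (\<gamma> t Q)) has_vector_derivative Xt k Q * (\<Sum>\<alpha>\<in>F. d \<alpha> * Xt \<alpha> Q)) (at 0)"
    and F: "finite F" and \<alpha>: "\<alpha> \<in> supp"
  shows "\<delta> \<alpha> k = (if \<alpha> \<in> F then d \<alpha> else 0)"
proof -
  define e where "e \<alpha> = (if \<alpha> \<in> supp then \<delta> \<alpha> k else 0) - (if \<alpha> \<in> F then d \<alpha> else 0)" for \<alpha>
  have "e \<alpha> = 0"
  proof (rule Xt_independent[of "supp \<union> F"])
    fix Q assume Q: "Q \<in> Torus"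
    have "Xt k Q * (\<Sum>\<alpha>\<in>supp. \<delta> \<alpha> k * Xt \<alpha> Q) = Xt k Q * (\<Sum>\<alpha>\<in>F. d \<alpha> * Xt \<alpha> Q)"
      by (rule vector_derivative_unique_at[OF Xt_deriv[OF Q] assms(1)[OF Q]])
    moreover have "(\<Sum>\<alpha>\<in>supp \<union> F. (if \<alpha> \<in> supp then \<delta> \<alpha> k else 0) * Xt \<alpha> Q) = (\<Sum>\<alpha>\<in>supp. \<delta> \<alpha> k * Xt \<alpha> Q)"
      using finite_supp F by (intro sum.mono_neutral_cong_right) auto
    moreover have "(\<Sum>\<alpha>\<in>supp \<union> F. (if \<alpha> \<in> F then d \<alpha> else 0) * Xt \<alpha> Q) = (\<Sum>\<alpha>\<in>F. d \<alpha> * Xt \<alpha> Q)"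
      using finite_supp F by (intro sum.mono_neutral_cong_right) auto
    ultimately show "(\<Sum>\<alpha>\<in>supp \<union> F. e \<alpha> * Xt \<alpha> Q) = 0"
      using Xt_nonzero[OF Q, of k] by (simp add: e_def left_diff_distrib sum_subtractf)
  qed (use \<alpha> F finite_supp in auto)
  then show ?thesis using \<alpha> by (simp add: e_def)
qed

lemma \<delta>_zero: "\<delta> \<alpha> 0 = 0" using \<delta>_add[of \<alpha> 0 0] by simp

lemma \<delta>_scale: "\<delta> \<alpha> (n *s k) = of_int n * \<delta> \<alpha> k"
  by (simp add: \<delta>_def pair_simps sum_distrib_left mult.assoc)

lemma \<delta>_sum: "\<delta> \<alpha> (\<Sum>i\<in>I. f i) = (\<Sum>i\<in>I. \<delta> \<alpha> (f i))"
  by (induction I rule: infinite_finite_induct) (simp_all add: \<delta>_zero \<delta>_add)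

end

section \<open>Nonzero weights of the vector field are roots\<close>

context smooth_complete_fan
begin

text \<open>For \<open>v = \<rho> + t d\<close> with \<open>\<langle>\<alpha>, v\<rangle> < 0\<close>, the height of \<open>v\<close> at the vertex of \<open>\<Delta>\<close> that belongs to the cone of
  \<open>v\<close> is known, by \<open>d\<close>, up to the height of \<open>\<rho>\<close>.  So \<open>|v| \<le> M (1 - t c)\<close>, and \<open>\<rho> = - d / c\<close> in the limit \<open>t c \<rightarrow> 1\<close>.\<close>

lemma root_direction:
  assumes bpf: "anticanonical_bpf \<Sigma>" and \<rho>: "\<rho> \<in> Rays" "pair \<alpha> \<rho> < 0"
    and d: "\<And>\<tau> n j. (\<tau>, n) \<in> Ch \<Longrightarrow> pair \<alpha> (dual_basis n j) < 0 \<Longrightarrow> rvec (- (\<Sum>j\<in>UNIV. n j)) \<bullet> d = rvec \<alpha> \<bullet> d"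
  shows "d = - (rvec \<alpha> \<bullet> d) *\<^sub>R rvec \<rho>" and "d \<noteq> 0 \<Longrightarrow> pair \<alpha> \<rho> = -1"
proof -
  define c where "c = rvec \<alpha> \<bullet> d"
  define M where "M = (\<Sum>\<rho>\<in>Rays. norm (rvec \<rho> :: real ^ 'n))"
  have M0: "0 \<le> M" by (simp add: M_def sum_nonneg)
  have bound: "norm (rvec \<rho> + t *\<^sub>R d) \<le> M * (1 - t * c) \<and> t * c \<le> 1" if t: "pair \<alpha> \<rho> + t * c < 0" for t
  proof -
    define v where "v = rvec \<rho> + t *\<^sub>R d"
    obtain \<tau> n where n: "(\<tau>, n) \<in> Ch" "v \<in> \<tau>" using chart_covers by blast
    note b = chart_basis(1)[OF n(1)]
    define x where "x j = rvec (n j) \<bullet> v" for j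
    have x: "0 \<le> x j" for j using n chart_cone_iff by (auto simp: x_def)
    have v: "v = (\<Sum>j\<in>UNIV. x j *\<^sub>R rvec (dual_basis n j))" unfolding x_def by (rule real_dual_basis_expand[OF b])
    have ray: "dual_basis n j \<in> Rays" for j using chart_ray[OF n(1)] gens_subset_rays by blast
    have "rvec \<alpha> \<bullet> v < 0" using t by (simp add: v_def inner_add_right inner_rvec c_def)
    then have "(\<Sum>j\<in>UNIV. x j * of_int (pair \<alpha> (dual_basis n j))) < 0"
      by (subst (asm) v) (simp add: inner_sum_right inner_rvec)
    then obtain j where "x j * of_int (pair \<alpha> (dual_basis n j)) < 0" by (meson not_less sum_nonneg)
    then have "pair \<alpha> (dual_basis n j) < 0" using x[of j] by (auto simp: mult_less_0_iff)
    from d[OF n(1) this] have "rvec (- (\<Sum>j\<in>UNIV. n j)) \<bullet> v = of_int (pair (- (\<Sum>j\<in>UNIV. n j)) \<rho>) + t * c"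
      by (simp add: v_def inner_add_right inner_rvec c_def)
    moreover have "-1 \<le> pair (- (\<Sum>j\<in>UNIV. n j)) \<rho>" using bpf_vertex[OF bpf n(1)] \<rho>(1) by (simp add: DeltaM_iff)
    moreover have "rvec (- (\<Sum>j\<in>UNIV. n j)) \<bullet> v = - (\<Sum>j\<in>UNIV. x j)"
      by (simp add: x_def rvec_minus rvec_sum inner_sum_left)
    ultimately have s: "(\<Sum>j\<in>UNIV. x j) \<le> 1 - t * c" by simp
    have "norm v \<le> (\<Sum>j\<in>UNIV. x j * M)"
      unfolding v
    proof (rule sum_norm_le)
      fix j
      have "norm (rvec (dual_basis n j) :: real ^ 'n) \<le> M"
        unfolding M_def using ray finite_rays by (intro member_le_sum) auto
      then show "norm (x j *\<^sub>R rvec (dual_basis n j) :: real ^ 'n) \<le> x j * M"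
        using x[of j] by (simp add: mult_left_mono)
    qed
    also have "\<dots> \<le> M * (1 - t * c)"
      using mult_left_mono[OF s M0] by (simp add: sum_distrib_left mult.commute)
    finally show ?thesis using s sum_nonneg[of UNIV x] x by (simp add: v_def)
  qed
  have "d = - c *\<^sub>R rvec \<rho> \<and> (d \<noteq> 0 \<longrightarrow> pair \<alpha> \<rho> = -1)"
  proof (cases "c = 0")
    case True
    have "\<bar>t\<bar> * norm d \<le> M + norm (rvec \<rho> :: real ^ 'n)" for t
      using bound[of t] True \<rho>(2) norm_triangle_ineq4[of "rvec \<rho> + t *\<^sub>R d" "rvec \<rho>"] by simp
    moreover have "\<exists>t. M + norm (rvec \<rho> :: real ^ 'n) < t * norm d" if "d \<noteq> 0"
      using ex_less_of_nat_mult[of "norm d"] that by (metis zero_less_norm_iff)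
    ultimately have "d = 0" by (meson abs_ge_self linorder_not_less mult_right_mono norm_ge_zero order_trans)
    then show ?thesis using True by simp
  next
    case False
    \<comment> \<open>Here \<open>t\<close> is chosen so that \<alpha> takes the value -1/2 at
      \<open>\<rho> + t d\<close>; then \<open>t c \<le> 1\<close> gives
      \<open>pair \<alpha> \<rho> \<ge> -3/2\<close>, and the pairing is a negative integer.\<close>
    have "- real_of_int (pair \<alpha> \<rho>) - 1/2 \<le> 1"
      using bound[of "(- pair \<alpha> \<rho> - 1/2) / c"] False by simp
    then have a: "pair \<alpha> \<rho> = -1" using \<rho>(2) by linarith
    define w where "w = (1/c) *\<^sub>R d"
    \<comment> \<open>\<open>bound\<close> at \<open>t c = 1 - e\<close>, where \<alpha> takes the
      admissible value -e; \<open>w\<close> is the limit of \<open>t d\<close> as e tends to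
      0.\<close>
    have le: "norm (rvec \<rho> + w) \<le> e * (M + norm w)" if e: "0 < e" for e
    proof -
      have "((1 - e) / c) *\<^sub>R d = (1 - e) *\<^sub>R w" by (simp add: w_def)
      then have "norm (rvec \<rho> + (1 - e) *\<^sub>R w) \<le> M * e"
        using bound[of "(1 - e) / c"] False a e by simp
      moreover have "rvec \<rho> + w = (rvec \<rho> + (1 - e) *\<^sub>R w) + e *\<^sub>R w" by (simp add: scaleR_left_diff_distrib)
      ultimately show ?thesis
        using norm_triangle_ineq[of "rvec \<rho> + (1 - e) *\<^sub>R w" "e *\<^sub>R w"] e by (simp add: algebra_simps)
    qed
    have "rvec \<rho> + w = 0"
    proof (rule ccontr)
      assume "rvec \<rho> + w \<noteq> 0"
      then have p: "0 < norm (rvec \<rho> + w)" by simp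
      define K where "K = M + norm w"
      have "norm (rvec \<rho> + w) \<le> K" using le[of 1] by (simp add: K_def)
      then have K: "0 < K" using p by linarith
      have "norm (rvec \<rho> + w) \<le> norm (rvec \<rho> + w) / (2 * K) * K"
        unfolding K_def by (rule le) (use p K in \<open>simp add: K_def\<close>)
      also have "\<dots> = norm (rvec \<rho> + w) / 2" using K by simp
      finally show False using p by simp
    qed
    then have "c *\<^sub>R w = - c *\<^sub>R rvec \<rho>" by (simp add: eq_neg_iff_add_eq_0 add.commute[of w] flip: scaleR_right_distrib)
    then have "d = - c *\<^sub>R rvec \<rho>" using False by (simp add: w_def)
    then show ?thesis using a by simp
  qed
  then show "d = - (rvec \<alpha> \<bullet> d) *\<^sub>R rvec \<rho>" "d \<noteq> 0 \<Longrightarrow> pair \<alpha> \<rho> = -1" unfolding c_def by blast+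
qed

end

lemma root_rayI:
  assumes "is_root_ray \<Sigma> \<alpha> \<rho>"
  shows "\<alpha> \<in> roots \<Sigma>" "root_ray \<Sigma> \<alpha> = \<rho>"
proof -
  have u: "\<rho>' = \<rho>" if "is_root_ray \<Sigma> \<alpha> \<rho>'" for \<rho>' using assms that unfolding is_root_ray_def by force
  then show "\<alpha> \<in> roots \<Sigma>" "root_ray \<Sigma> \<alpha> = \<rho>"
    using assms unfolding roots_def root_ray_def by (blast intro: the_equality)+
qed

context one_param
begin

text \<open>By \<open>bpf_span\<close> each \<open>m j\<close> is a real combination of points of
  \<Delta>; its coefficients serve as \<open>r\<close>.\<close>

lemma flow_chart_exists:
  assumes bpf: "anticanonical_bpf \<Sigma>" and c: "(\<sigma>, m) \<in> Ch"
  shows "\<exists>r. flow_chart \<Sigma> \<gamma> \<sigma> m r"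
proof -
  have "\<exists>f :: 'n lattice \<Rightarrow> real. \<forall>k. (\<Sum>\<mu>\<in>DM. f \<mu> * of_int (pair \<mu> (dual_basis m k))) = (if j = k then 1 else 0)" for j
  proof -
    have "rvec (m j) \<in> span (rvec ` DM)" using bpf_span[OF bpf] by simp
    then obtain f where f: "rvec (m j) = (\<Sum>u\<in>rvec ` DM. f u *\<^sub>R u)"
      using span_finite[of "rvec ` DM"] finite_DeltaM by auto
    have inj: "inj_on (rvec :: 'n lattice \<Rightarrow> real ^ 'n) DM" by (auto simp: inj_on_def rvec_def vec_eq_iff)
    have "(\<Sum>\<mu>\<in>DM. f (rvec \<mu>) * of_int (pair \<mu> (dual_basis m k))) = rvec (m j) \<bullet> rvec (dual_basis m k)" for k
      unfolding f by (simp add: sum.reindex[OF inj] inner_sum_left inner_rvec)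
    then show ?thesis
      by (intro exI[of _ "\<lambda>\<mu>. f (rvec \<mu>)"]) (simp add: inner_rvec dual_basis_pair[OF chart_basis(1)[OF c]])
  qed
  then obtain f where f: "\<And>j k. (\<Sum>\<mu>\<in>DM. (f j :: 'n lattice \<Rightarrow> real) \<mu> * of_int (pair \<mu> (dual_basis m k))) = (if j = k then 1 else 0)"
    by metis
  have "(\<Sum>\<mu>\<in>DM. complex_of_real (f j \<mu>) * of_int (pair \<mu> (dual_basis m k))) = (if j = k then 1 else 0)" for j k
    using arg_cong[OF f[of j k], of complex_of_real] by simp
  then show ?thesis
    by (intro exI[of _ "\<lambda>j \<mu>. complex_of_real (f j \<mu>)"]) (unfold_locales, use c in auto)
qed

end

context flow_chart
begin

text \<open>\<open>root_direction\<close> applies to the real and the imaginary part of the complex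
  functional \<open>\<delta> \<alpha>\<close>; a nonzero part forces the height -1.\<close>

lemma \<delta>_root:
  assumes bpf: "anticanonical_bpf \<Sigma>" and \<alpha>: "\<alpha> \<in> supp" "\<alpha> \<noteq> 0" and k: "\<delta> \<alpha> k \<noteq> 0"
  shows "\<exists>\<rho>. isRoot \<alpha> \<rho> \<and> (\<forall>k. \<delta> \<alpha> k = - \<delta> \<alpha> \<alpha> * of_int (pair k \<rho>))"
proof -
  have expand: "\<delta> \<alpha> k = (\<Sum>i\<in>UNIV. of_int (k $ i) * \<delta> \<alpha> (axis i 1))" for k
  proof -
    have "k = (\<Sum>i\<in>UNIV. (k $ i) *s axis i 1)"
      by (simp add: vec_eq_iff axis_def if_distrib[of "\<lambda>x. _ * x"] sum.delta cong: if_cong)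
    then have "\<delta> \<alpha> k = \<delta> \<alpha> (\<Sum>i\<in>UNIV. (k $ i) *s axis i 1)" by simp
    then show ?thesis by (simp add: \<delta>_sum \<delta>_scale)
  qed
  \<comment> \<open>At this vertex each ray of the cone has height -1, so the shift by \<alpha>
    leaves \<Delta>. The first term of \<open>dmat\<close> is then 0, and
    \<open>\<delta>_diag\<close> evaluates the second.\<close>
  have key: "\<delta> \<alpha> (- (\<Sum>j\<in>UNIV. n j)) = \<delta> \<alpha> \<alpha>" if n: "(\<tau>, n) \<in> Ch" "pair \<alpha> (dual_basis n j) < 0" for \<tau> n j
  proof -
    have "- (\<Sum>j\<in>UNIV. n j) \<in> DM" by (rule bpf_vertex[OF bpf n(1)])
    moreover have "\<alpha> + - (\<Sum>j\<in>UNIV. n j) \<notin> DM"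
    proof -
      have "pair (\<alpha> + - (\<Sum>j\<in>UNIV. n j)) (dual_basis n j) < -1"
        using n(2) by (simp add: pair_simps dual_basis_pair[OF chart_basis(1)[OF n(1)]])
      moreover have "dual_basis n j \<in> Rays" using chart_ray[OF n(1)] gens_subset_rays by blast
      ultimately show ?thesis unfolding DeltaM_iff by force
    qed
    ultimately show ?thesis
      using dmat_eq_\<delta>[OF \<alpha>(1), of "- (\<Sum>j\<in>UNIV. n j)"] \<delta>_diag[OF \<alpha>(1)] unfolding dmat_def by simp
  qed
  define re where "re = (\<chi> i. Re (\<delta> \<alpha> (axis i 1)))"
  define im where "im = (\<chi> i. Im (\<delta> \<alpha> (axis i 1)))"
  have ri: "rvec k \<bullet> re = Re (\<delta> \<alpha> k)" "rvec k \<bullet> im = Im (\<delta> \<alpha> k)" for k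
    unfolding expand[of k] by (simp_all add: re_def im_def inner_vec_def rvec_def)
  have dir: "re = - Re (\<delta> \<alpha> \<alpha>) *\<^sub>R rvec \<rho>" "im = - Im (\<delta> \<alpha> \<alpha>) *\<^sub>R rvec \<rho>" "pair \<alpha> \<rho> = -1"
    if \<rho>: "\<rho> \<in> Rays" "pair \<alpha> \<rho> < 0" for \<rho>
  proof -
    have H: "rvec (- (\<Sum>j\<in>UNIV. n j)) \<bullet> re = rvec \<alpha> \<bullet> re" "rvec (- (\<Sum>j\<in>UNIV. n j)) \<bullet> im = rvec \<alpha> \<bullet> im"
      if "(\<tau>, n) \<in> Ch" "pair \<alpha> (dual_basis n j) < 0" for \<tau> n j
      unfolding ri key[OF that] by (rule refl)+
    show "re = - Re (\<delta> \<alpha> \<alpha>) *\<^sub>R rvec \<rho>" "im = - Im (\<delta> \<alpha> \<alpha>) *\<^sub>R rvec \<rho>"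
      unfolding ri[symmetric] by (rule root_direction(1)[OF bpf \<rho> H(1)] root_direction(1)[OF bpf \<rho> H(2)]; assumption)+
    have "re \<noteq> 0 \<or> im \<noteq> 0" using k ri[of k] by (auto simp: complex_eq_iff)
    then show "pair \<alpha> \<rho> = -1"
      by (elim disjE) (rule root_direction(2)[OF bpf \<rho> H(1)] root_direction(2)[OF bpf \<rho> H(2)]; assumption)+
  qed
  have e: "\<delta> \<alpha> k = - \<delta> \<alpha> \<alpha> * of_int (pair k \<rho>)" if \<rho>: "\<rho> \<in> Rays" "pair \<alpha> \<rho> < 0" for \<rho> k
    using ri[of k] unfolding dir(1,2)[OF \<rho>] by (simp add: complex_eq_iff inner_rvec mult.commute)
  have "\<exists>\<rho>\<in>Rays. pair \<alpha> \<rho> < 0" using pair_rays_nonneg_imp_zero[of \<alpha>] \<alpha>(2) by force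
  then obtain \<rho> where \<rho>: "\<rho> \<in> Rays" "pair \<alpha> \<rho> < 0" by blast
  \<comment> \<open>\<open>\<delta> \<alpha> \<alpha>\<close> is nonzero, so the functional
    \<open>\<delta> \<alpha>\<close> determines the ray.\<close>
  have uniq: "\<rho>' = \<rho>" if \<rho>': "\<rho>' \<in> Rays" "pair \<alpha> \<rho>' < 0" for \<rho>'
  proof -
    have "\<delta> \<alpha> \<alpha> \<noteq> 0" using e[OF \<rho>, of k] k by auto
    then have "pair k \<rho>' = pair k \<rho>" for k using e[OF \<rho>, of k] e[OF \<rho>', of k] by simp
    from this[of "axis _ 1"] show ?thesis
      by (simp add: vec_eq_iff pair_def axis_def if_distrib[of "\<lambda>x. x * _"] cong: if_cong)
  qed
  have "isRoot \<alpha> \<rho>"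
    unfolding is_root_ray_def
  proof (intro conjI ballI impI \<rho>(1) dir(3)[OF \<rho>])
    show "0 \<le> pair \<alpha> \<rho>'" if "\<rho>' \<in> Rays" "\<rho>' \<noteq> \<rho>" for \<rho>' using uniq that by (meson not_less)
  qed
  then show ?thesis using e[OF \<rho>] by blast
qed

end

context one_param
begin

text \<open>Splits the field by weight: weight 0 is the torus part, with coefficients
  \<open>a\<close> in the standard basis, and \<open>\<delta>_root\<close> describes every other
  weight by a single scalar \<open>b\<close>.\<close>

lemma lie_act_structure:
  assumes bpf: "anticanonical_bpf \<Sigma>"
  shows "\<exists>a b. \<forall>\<nu>\<in>DM. \<forall>\<mu>\<in>DM. LieAct \<gamma> \<nu> \<mu> =
    (if \<nu> = \<mu> then \<Sum>j\<in>UNIV. a j * of_int (\<mu> $ j) else 0) +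
    (if \<nu> - \<mu> \<in> Roots then b (\<nu> - \<mu>) * of_int (pair (\<mu> - (\<nu> - \<mu>)) (root_ray \<Sigma> (\<nu> - \<mu>))) else 0)"
proof -
  obtain \<sigma> m where c: "(\<sigma>, m) \<in> Ch" using ex_chart by blast
  obtain r where r: "flow_chart \<Sigma> \<gamma> \<sigma> m r" using flow_chart_exists[OF bpf c] by blast
  interpret flow_chart \<Sigma> \<gamma> \<sigma> m r by (rule r)
  define b where "b \<alpha> = (if \<alpha> \<in> supp \<and> \<alpha> \<noteq> 0 \<and> (\<exists>k. \<delta> \<alpha> k \<noteq> 0) then
      (SOME b. \<forall>k. \<delta> \<alpha> k = b * of_int (pair k (root_ray \<Sigma> \<alpha>))) else 0)" for \<alpha>
  have b: "\<delta> \<alpha> k = (if \<alpha> \<in> Roots then b \<alpha> * of_int (pair k (root_ray \<Sigma> \<alpha>)) else 0)" if \<alpha>: "\<alpha> \<in> supp" "\<alpha> \<noteq> 0" for \<alpha> k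
  proof (cases "\<exists>k. \<delta> \<alpha> k \<noteq> 0")
    case True
    then obtain \<rho> where e: "isRoot \<alpha> \<rho>" "\<forall>k. \<delta> \<alpha> k = - \<delta> \<alpha> \<alpha> * of_int (pair k \<rho>)" using \<delta>_root[OF bpf \<alpha>] by blast
    have "b \<alpha> = (SOME b. \<forall>k. \<delta> \<alpha> k = b * of_int (pair k (root_ray \<Sigma> \<alpha>)))"
      unfolding b_def using \<alpha> True by simp
    moreover have "\<forall>k. \<delta> \<alpha> k = - \<delta> \<alpha> \<alpha> * of_int (pair k (root_ray \<Sigma> \<alpha>))"
      using e(2) unfolding root_rayI(2)[OF e(1)] .
    then have "\<forall>k. \<delta> \<alpha> k = (SOME b. \<forall>k. \<delta> \<alpha> k = b * of_int (pair k (root_ray \<Sigma> \<alpha>))) * of_int (pair k (root_ray \<Sigma> \<alpha>))"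
      by (rule someI[of "\<lambda>b. \<forall>k. \<delta> \<alpha> k = b * of_int (pair k (root_ray \<Sigma> \<alpha>))"])
    ultimately have "\<forall>k. \<delta> \<alpha> k = b \<alpha> * of_int (pair k (root_ray \<Sigma> \<alpha>))" by metis
    then show ?thesis using root_rayI(1)[OF e(1)] by simp
  qed (auto simp: b_def)
  have 0: "0 \<notin> Roots" by (auto simp: roots_def is_root_ray_def pair_simps)
  show ?thesis
  proof (intro exI[of _ "\<lambda>j. \<delta> 0 (axis j 1)"] exI[of _ b] ballI)
    fix \<nu> \<mu> assume \<nu>: "\<nu> \<in> DM" and \<mu>: "\<mu> \<in> DM"
    then have s: "\<nu> - \<mu> \<in> supp" by (auto simp: supp_def)
    have ax: "\<delta> 0 \<mu> = (\<Sum>j\<in>UNIV. \<delta> 0 (axis j 1) * of_int (\<mu> $ j))"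
    proof -
      have "\<mu> = (\<Sum>j\<in>UNIV. (\<mu> $ j) *s axis j 1)"
        by (simp add: vec_eq_iff axis_def if_distrib[of "\<lambda>x. _ * x"] sum.delta cong: if_cong)
      then have "\<delta> 0 \<mu> = \<delta> 0 (\<Sum>j\<in>UNIV. (\<mu> $ j) *s axis j 1)" by simp
      then show ?thesis by (simp add: \<delta>_sum \<delta>_scale mult.commute)
    qed
    show "LieAct \<gamma> \<nu> \<mu> = (if \<nu> = \<mu> then \<Sum>j\<in>UNIV. \<delta> 0 (axis j 1) * of_int (\<mu> $ j) else 0) +
        (if \<nu> - \<mu> \<in> Roots then b (\<nu> - \<mu>) * of_int (pair (\<mu> - (\<nu> - \<mu>)) (root_ray \<Sigma> (\<nu> - \<mu>))) else 0)"
    proof (cases "\<nu> = \<mu>")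
      case True
      then show ?thesis using lie_act_\<delta>[OF \<nu> \<mu>] ax 0 by (simp add: \<delta>_zero)
    next
      case False
      then have nz: "\<nu> - \<mu> \<noteq> 0" by simp
      have pd: "pair (\<mu> - (\<nu> - \<mu>)) \<rho> = pair \<mu> \<rho> - pair (\<nu> - \<mu>) \<rho>" for \<rho> by (simp only: pair_simps)
      from False show ?thesis unfolding lie_act_\<delta>[OF \<nu> \<mu>] b[OF s nz] pd by (simp add: right_diff_distrib)
    qed
  qed
qed

text \<open>For an explicit subgroup it suffices to compute the derivatives of the characters on the
  torus; its Jacobian has been dealt with once and for all.\<close>

lemma lie_act_monomial_field:
  assumes bpf: "anticanonical_bpf \<Sigma>"
    and d: "\<And>Q k. Q \<in> Torus \<Longrightarrow> ((\<lambda>t. Xt k (\<gamma> t Q)) has_vector_derivative Xt k Q * (of_int (pair k \<rho>) * Xt \<alpha> Q)) (at 0)"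
    and "\<nu> \<in> DM" "\<mu> \<in> DM"
  shows "LieAct \<gamma> \<nu> \<mu> = (if \<nu> - \<mu> = \<alpha> then of_int (pair (\<mu> - \<alpha>) \<rho>) else 0)"
proof -
  obtain \<sigma> m where c: "(\<sigma>, m) \<in> Ch" using ex_chart by blast
  obtain r where r: "flow_chart \<Sigma> \<gamma> \<sigma> m r" using flow_chart_exists[OF bpf c] by blast
  interpret flow_chart \<Sigma> \<gamma> \<sigma> m r by (rule r)
  have s: "\<nu> - \<mu> \<in> supp" using assms by (auto simp: supp_def)
  have "\<delta> (\<nu> - \<mu>) k = (if \<nu> - \<mu> = \<alpha> then of_int (pair k \<rho>) else 0)" for k
    using \<delta>_eqI[where k = k and F = "{\<alpha>}" and d = "\<lambda>_. of_int (pair k \<rho>)" and \<alpha> = "\<nu> - \<mu>"] d s by simp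
  then show ?thesis using lie_act_\<delta>[OF assms(3,4)] by (auto simp: pair_simps)
qed

end

section \<open>Torus and root subgroups\<close>

lemma isCont_power_int:
  fixes f :: "'a::t2_space \<Rightarrow> complex"
  assumes "isCont f x" "f x \<noteq> 0 \<or> 0 \<le> n"
  shows "isCont (\<lambda>x. f x powi n) x"
  using assms(2)
proof
  assume "f x \<noteq> 0"
  then show ?thesis using assms(1) by (auto simp: isCont_def intro: tendsto_power_int)
next
  assume "0 \<le> n"
  then have "(\<lambda>x. f x powi n) = (\<lambda>x. f x ^ nat n)" by (simp add: power_int_def)
  then show ?thesis using assms(1) by simp
qed

text \<open>The pairs \<open>(a, b) = (exp t, 0)\<close> and \<open>(1, t)\<close> give the torus and the root subgroups.\<close>

locale cox_flow = smooth_complete_fan \<Sigma> for \<Sigma> :: "(real ^ 'n::finite) set set" +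
  fixes \<rho>0 \<alpha> :: "'n lattice" and a b :: "real \<Rightarrow> complex"
  assumes \<rho>0: "\<rho>0 \<in> rays \<Sigma>" and root: "(\<forall>t. b t = 0) \<or> is_root_ray \<Sigma> \<alpha> \<rho>0"
    and a: "a t \<noteq> 0" "a 0 = 1" "a (s + t) = a s * a t" and b: "b 0 = 0" "b (s + t) = a s * b t + b s"
    and cont: "continuous_on UNIV a" "continuous_on UNIV b"
begin

definition R :: "('n lattice \<Rightarrow> complex) \<Rightarrow> 'n lattice \<Rightarrow> complex" where
  "R z k = (\<Prod>\<rho>\<in>Rays - {\<rho>0}. z \<rho> powi pair k \<rho>)"

definition \<Phi> :: "real \<Rightarrow> ('n lattice \<Rightarrow> complex) \<Rightarrow> 'n lattice \<Rightarrow> complex" where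
  "\<Phi> t z = z(\<rho>0 := a t * z \<rho>0 + b t * R z \<alpha>)"

lemma ev_R: "ev z k = z \<rho>0 powi pair k \<rho>0 * R z k"
  unfolding ev_def R_def by (rule prod.remove[OF finite_rays \<rho>0])

lemma R_upd [simp]: "R (z(\<rho>0 := u)) k = R z k"
  unfolding R_def by (rule prod.cong) auto

text \<open>\<open>R\<close> ignores the coordinate at \<open>\<rho>0\<close>, so
  \<open>\<Phi> t\<close> is affine in that coordinate; the conditions on \<open>a\<close> and
  \<open>b\<close> are the composition law of affine maps.\<close>

lemma \<Phi>_\<Phi>: "\<Phi> s (\<Phi> t z) = \<Phi> (s + t) z"
  by (simp add: \<Phi>_def a(3) b(2) algebra_simps)

lemma \<Phi>_0: "\<Phi> 0 z = z" by (simp add: \<Phi>_def a(2) b(1))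

lemma Zs_upd: "Zs (z(\<rho>0 := u)) = (if u = 0 then insert \<rho>0 (Zs z) else Zs z - {\<rho>0})"
  using \<rho>0 by (auto simp: Zs_def)

lemma R_nonzero:
  assumes "R z \<alpha> \<noteq> 0" "\<rho> \<in> Zs z" "\<rho> \<noteq> \<rho>0"
  shows "pair \<alpha> \<rho> = 0"
proof -
  have "z \<rho> powi pair \<alpha> \<rho> \<noteq> 0"
    using assms prod_zero_iff[of "Rays - {\<rho>0}" "\<lambda>\<rho>. z \<rho> powi pair \<alpha> \<rho>"] finite_rays
    by (auto simp: R_def Zs_def)
  then show ?thesis using assms(2) by (simp add: Zs_def)
qed

text \<open>As \<open>pair \<alpha> \<rho>0 = -1\<close>, \<open>R z \<alpha>\<close> is
  \<open>z \<rho>0 * ev z \<alpha>\<close> where \<open>z \<rho>0\<close> is nonzero. Off the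
  divisor of \<open>\<rho>0\<close> the flow is thus a rescaling by an invariant function.\<close>

lemma \<Phi>_nonzero: "z \<rho>0 \<noteq> 0 \<Longrightarrow> \<Phi> t z = z(\<rho>0 := (a t + b t * ev z \<alpha>) * z \<rho>0)"
  using root by (auto simp: \<Phi>_def ev_R is_root_ray_def power_int_minus distrib_right)

text \<open>Only \<open>\<rho>0\<close> can become a new zero. This needs
  \<open>R z \<alpha>\<close> to be nonzero, so \<alpha> vanishes on the other zeros, and
  \<open>root_cone\<close> supplies a cone containing them together with
  \<open>\<rho>0\<close>.\<close>

lemma \<Phi>_cdom:
  assumes "z \<in> cdom"
  shows "\<Phi> t z \<in> cdom"
proof -
  obtain \<tau> where \<tau>: "\<tau> \<in> \<Sigma>" "Zs z \<subseteq> gens \<tau>" using assms by (auto simp: cdom_def)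
  show ?thesis
  proof (cases "b t * R z \<alpha> = 0")
    case True
    then have "Zs (\<Phi> t z) = Zs z" unfolding \<Phi>_def using \<rho>0 a(1) by (auto simp: Zs_def)
    then show ?thesis using \<tau> by (auto simp: cdom_def)
  next
    case False
    then have "isRoot \<alpha> \<rho>0" "\<forall>\<rho>\<in>Zs z - {\<rho>0}. pair \<alpha> \<rho> = 0" using root R_nonzero by auto
    then obtain \<sigma> where "\<sigma> \<in> \<Sigma>" "Zs z - {\<rho>0} \<subseteq> gens \<sigma>" "\<rho>0 \<in> gens \<sigma>"
      using root_cone[of \<alpha> \<rho>0 \<tau> "Zs z - {\<rho>0}"] \<tau> by blast
    then have "Zs (\<Phi> t z) \<subseteq> gens \<sigma>" "\<sigma> \<in> \<Sigma>" unfolding \<Phi>_def Zs_upd by (auto split: if_splits)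
    then show ?thesis unfolding cdom_def by blast
  qed
qed

text \<open>Off the divisor of \<open>\<rho>0\<close> both representatives are rescaled by the same
  factor. On it the new coordinate is \<open>b t * R z \<alpha>\<close>, and monomials after the
  flow are expressed by invariant monomials before it.\<close>

lemma \<Phi>_descends:
  assumes z: "z \<in> cdom" and w: "cox z = cox w"
  shows "cox (\<Phi> t z) = cox (\<Phi> t w)"
proof -
  have Z: "Zs w = Zs z" and E: "ev w k = ev z k" if "\<forall>\<rho>\<in>Zs z. 0 \<le> pair k \<rho>" for k
    using w that unfolding cox_eq_iff[OF z] by auto
  have Z: "Zs w = Zs z" using Z[of 0] by (simp add: pair_simps)
  have z0: "w \<rho>0 = 0 \<longleftrightarrow> z \<rho>0 = 0" using Z \<rho>0 by (auto simp: Zs_def)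
  have R0: "R w \<alpha> = 0 \<longleftrightarrow> R z \<alpha> = 0"
  proof -
    have "w \<rho> = 0 \<longleftrightarrow> z \<rho> = 0" if "\<rho> \<in> Rays" for \<rho> using Z that by (auto simp: Zs_def)
    then show ?thesis using finite_rays by (simp add: R_def prod_zero_iff)
  qed
  have "Zs (\<Phi> t z) = Zs (\<Phi> t w) \<and> (\<forall>k. (\<forall>\<rho>\<in>Zs (\<Phi> t z). 0 \<le> pair k \<rho>) \<longrightarrow> ev (\<Phi> t z) k = ev (\<Phi> t w) k)"
  proof (cases "z \<rho>0 = 0")
    case False
    define c where "c = a t + b t * ev z \<alpha>"
    have c: "c = a t + b t * ev w \<alpha>"
    proof (cases "\<forall>t. b t = 0")
      case True
      then show ?thesis by (simp add: c_def)
    next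
      case nb: False
      then have "\<forall>\<rho>\<in>Zs z. 0 \<le> pair \<alpha> \<rho>" using root False by (auto simp: is_root_ray_def Zs_def)
      then show ?thesis using E by (simp add: c_def)
    qed
    have e: "\<Phi> t z = z(\<rho>0 := c * z \<rho>0)" "\<Phi> t w = w(\<rho>0 := c * w \<rho>0)"
    proof -
      show "\<Phi> t z = z(\<rho>0 := c * z \<rho>0)" unfolding c_def by (rule \<Phi>_nonzero) (rule False)
      show "\<Phi> t w = w(\<rho>0 := c * w \<rho>0)" unfolding c by (rule \<Phi>_nonzero) (use False z0 in simp)
    qed
    have "ev (\<Phi> t z) k = ev (\<Phi> t w) k" if "\<forall>\<rho>\<in>Zs (\<Phi> t z). 0 \<le> pair k \<rho>" for k
    proof -
      have "\<forall>\<rho>\<in>Zs z. 0 \<le> pair k \<rho>" using that False by (auto simp: e Zs_def split: if_splits)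
      from E[OF this] show ?thesis by (simp add: e ev_R power_int_mult_distrib mult.assoc)
    qed
    then show ?thesis using False z0 Z by (auto simp: e Zs_upd)
  next
    case z00: True
    show ?thesis
    proof (cases "b t * R z \<alpha> = 0")
      case True
      then have "\<Phi> t z = z" "\<Phi> t w = w" using z00 z0 R0 by (auto simp: \<Phi>_def)
      then show ?thesis using E Z by simp
    next
      case False
      then have r: "isRoot \<alpha> \<rho>0" using root by auto
      have n: "b t \<noteq> 0" "R z \<alpha> \<noteq> 0" "R w \<alpha> \<noteq> 0" using False R0 by auto
      have e: "\<Phi> t z = z(\<rho>0 := b t * R z \<alpha>)" "\<Phi> t w = w(\<rho>0 := b t * R w \<alpha>)" using z00 z0 by (auto simp: \<Phi>_def)
      have Z\<Phi>: "Zs (\<Phi> t z) = Zs z - {\<rho>0}" "Zs (\<Phi> t w) = Zs z - {\<rho>0}" unfolding e Zs_upd using n Z by auto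
      \<comment> \<open>The exponent is shifted by the multiple of \<alpha> that makes its pairing
        with \<open>\<rho>0\<close> zero; the monomial on the right is therefore defined on the
        divisor.\<close>
      have key: "ev (y(\<rho>0 := b t * R y \<alpha>)) k = b t powi pair k \<rho>0 * ev y (k + pair k \<rho>0 *s \<alpha>)"
        if y: "Zs y = Zs z" "R y \<alpha> \<noteq> 0" and k: "\<forall>\<rho>\<in>Zs z - {\<rho>0}. 0 \<le> pair k \<rho>" for y k
      proof -
        have "R y k * R y \<alpha> powi pair k \<rho>0 = R y (k + pair k \<rho>0 *s \<alpha>)"
          unfolding R_def prod_power_int_distrib prod.distrib[symmetric]
        proof (rule prod.cong[OF refl])
          fix \<rho> assume \<rho>: "\<rho> \<in> Rays - {\<rho>0}"
          have "y \<rho> powi (pair k \<rho> + pair \<alpha> \<rho> * pair k \<rho>0) = y \<rho> powi pair k \<rho> * y \<rho> powi (pair \<alpha> \<rho> * pair k \<rho>0)"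
          proof (rule power_int_add_nonneg)
            assume "y \<rho> = 0"
            then have "\<rho> \<in> Zs y" using \<rho> by (simp add: Zs_def)
            then show "0 \<le> pair k \<rho> \<and> 0 \<le> pair \<alpha> \<rho> * pair k \<rho>0" using R_nonzero[OF y(2)] k y(1) \<rho> by auto
          qed
          then show "y \<rho> powi pair k \<rho> * (y \<rho> powi pair \<alpha> \<rho>) powi pair k \<rho>0 = y \<rho> powi pair (k + pair k \<rho>0 *s \<alpha>) \<rho>"
            by (simp add: pair_simps power_int_mult mult.commute)
        qed
        then show ?thesis using r by (simp add: ev_R power_int_mult_distrib pair_simps is_root_ray_def mult_ac)
      qed
      have "ev (\<Phi> t z) k = ev (\<Phi> t w) k" if k: "\<forall>\<rho>\<in>Zs z - {\<rho>0}. 0 \<le> pair k \<rho>" for k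
      proof -
        have "0 \<le> pair (k + pair k \<rho>0 *s \<alpha>) \<rho>" if "\<rho> \<in> Zs z" for \<rho>
          using that k r R_nonzero[OF n(2) that] by (cases "\<rho> = \<rho>0") (auto simp: pair_simps is_root_ray_def)
        then have "ev w (k + pair k \<rho>0 *s \<alpha>) = ev z (k + pair k \<rho>0 *s \<alpha>)" by (intro E) blast
        then show ?thesis unfolding e key[OF refl n(2) k] key[OF Z n(3) k] by simp
      qed
      then show ?thesis unfolding Z\<Phi> by simp
    qed
  qed
  then show ?thesis using cox_eq_iff[OF \<Phi>_cdom[OF z]] by blast
qed

definition flow :: "real \<Rightarrow> 'n toric_point \<Rightarrow> 'n toric_point" where
  "flow t P = (if P \<in> TV then cox (\<Phi> t (SOME z. z \<in> cdom \<and> cox z = P)) else P)"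

lemma flow_cox:
  assumes "z \<in> cdom"
  shows "flow t (cox z) = cox (\<Phi> t z)"
proof -
  define w where "w = (SOME w. w \<in> cdom \<and> cox w = cox z)"
  have "w \<in> cdom \<and> cox w = cox z" unfolding w_def by (rule someI[of _ z]) (simp add: assms)
  then have "cox (\<Phi> t z) = cox (\<Phi> t w)" using \<Phi>_descends[OF assms, of w t] by simp
  then show ?thesis using cox_in[OF assms] by (simp add: flow_def w_def)
qed

lemma flow_add: "flow (s + t) = flow s \<circ> flow t"
proof
  fix P
  show "flow (s + t) P = (flow s \<circ> flow t) P"
  proof (cases "P \<in> TV")
    case True
    then obtain z where "z \<in> cdom" "P = cox z" by (auto simp: toric_variety_eq)
    then show ?thesis by (simp add: flow_cox \<Phi>_cdom \<Phi>_\<Phi>)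
  qed (simp add: flow_def)
qed

lemma flow_0: "flow 0 = id"
proof
  fix P
  show "flow 0 P = id P"
  proof (cases "P \<in> TV")
    case True
    then obtain z where "z \<in> cdom" "P = cox z" by (auto simp: toric_variety_eq)
    then show ?thesis by (simp add: flow_cox \<Phi>_0)
  qed (simp add: flow_def)
qed

lemma flow_inverse: "flow t \<circ> flow (- t) = id" "flow (- t) \<circ> flow t = id"
  using flow_add[of t "- t"] flow_add[of "- t" t] flow_0 by simp_all

lemma flow_permutes: "flow t permutes TV"
  using o_bij[OF flow_inverse(2,1)[of t]] by (auto simp: permutes_def bij_iff flow_def)

lemma inv_flow: "inv (flow t) = flow (- t)"
  by (rule inv_unique_comp[OF flow_inverse])

end

section \<open>Polynomial functions on charts\<close>

context smooth_complete_fan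
begin

definition polyfun :: "'n chart \<Rightarrow> (complex ^ 'n \<Rightarrow> complex) \<Rightarrow> bool" where
  "polyfun c f \<longleftrightarrow> (\<exists>F a. finite F \<and> F \<subseteq> dual_semigroup (fst c) \<and> (\<forall>x. f x = (\<Sum>k\<in>F. a k * mon (snd c) x k)))"

lemma polyfun_coord_ring:
  assumes c: "(\<sigma>, m) \<in> Ch" and f: "polyfun (\<sigma>, m) f"
  obtains g where "g \<in> coord_ring \<sigma>" "\<And>x. f x = g (pt m x)"
proof -
  obtain F a where F: "finite F" "F \<subseteq> dual_semigroup \<sigma>" "\<forall>x. f x = (\<Sum>k\<in>F. a k * mon m x k)"
    using f by (auto simp: polyfun_def)
  have "f x = (\<Sum>k\<in>F. a k * chi \<sigma> k (pt m x))" for x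
    unfolding F(3)[rule_format] using F(2) pt_in_chart[OF c]
    by (intro sum.cong refl) (simp add: dom_chart_def chi_pt[OF c] subset_iff)
  moreover have "(\<lambda>P. \<Sum>k\<in>F. a k * chi \<sigma> k P) \<in> coord_ring \<sigma>" using F(1,2) by (auto simp: coord_ring_def)
  ultimately show ?thesis using that by blast
qed

lemma polyfun_mon: "k \<in> dual_semigroup \<sigma> \<Longrightarrow> polyfun (\<sigma>, m) (\<lambda>x. a * mon m x k)"
  unfolding polyfun_def by (intro exI[of _ "{k}"] exI[of _ "\<lambda>_. a"]) auto

lemma polyfun_add:
  assumes "polyfun c f" "polyfun c g"
  shows "polyfun c (\<lambda>x. f x + g x)"
proof -
  obtain F a where F: "finite F" "F \<subseteq> dual_semigroup (fst c)" "\<forall>x. f x = (\<Sum>k\<in>F. a k * mon (snd c) x k)"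
    using assms(1) by (auto simp: polyfun_def)
  obtain G b where G: "finite G" "G \<subseteq> dual_semigroup (fst c)" "\<forall>x. g x = (\<Sum>k\<in>G. b k * mon (snd c) x k)"
    using assms(2) by (auto simp: polyfun_def)
  have "f x + g x = (\<Sum>k\<in>F \<union> G. ((if k \<in> F then a k else 0) + (if k \<in> G then b k else 0)) * mon (snd c) x k)" for x
  proof -
    have "(\<Sum>k\<in>F \<union> G. (if k \<in> F then a k else 0) * mon (snd c) x k) = (\<Sum>k\<in>F. a k * mon (snd c) x k)"
      "(\<Sum>k\<in>F \<union> G. (if k \<in> G then b k else 0) * mon (snd c) x k) = (\<Sum>k\<in>G. b k * mon (snd c) x k)"
      using F(1) G(1) by (auto intro!: sum.mono_neutral_cong_right)
    then show ?thesis using F(3) G(3) by (simp add: distrib_right sum.distrib)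
  qed
  then show ?thesis unfolding polyfun_def using F(1,2) G(1,2)
    by (intro exI[of _ "F \<union> G"] exI[of _ "\<lambda>k. (if k \<in> F then a k else 0) + (if k \<in> G then b k else 0)"]) auto
qed

lemma polyfun_const: "polyfun c (\<lambda>x. a)"
  using polyfun_mon[OF dual_semigroup_zero, of "fst c" "snd c" a] by simp

lemma polyfun_sum: "(\<And>i. i \<in> I \<Longrightarrow> polyfun c (f i)) \<Longrightarrow> polyfun c (\<lambda>x. \<Sum>i\<in>I. f i x)"
  by (induction I rule: infinite_finite_induct) (auto intro: polyfun_const polyfun_add)

lemma polyfun_mult:
  assumes c: "c \<in> Ch" and "polyfun c f" "polyfun c g"
  shows "polyfun c (\<lambda>x. f x * g x)"
proof -
  obtain \<sigma> m where cc: "c = (\<sigma>, m)" by (cases c)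
  obtain F a where F: "finite F" "F \<subseteq> dual_semigroup \<sigma>" "\<forall>x. f x = (\<Sum>k\<in>F. a k * mon m x k)"
    using assms(2) by (auto simp: polyfun_def cc)
  obtain G b where G: "finite G" "G \<subseteq> dual_semigroup \<sigma>" "\<forall>x. g x = (\<Sum>k\<in>G. b k * mon m x k)"
    using assms(3) by (auto simp: polyfun_def cc)
  have add: "mon m x k * mon m x l = mon m x (k + l)" if "k \<in> dual_semigroup \<sigma>" "l \<in> dual_semigroup \<sigma>" for x k l
    using that c unfolding cc chart_dual_iff[OF c[unfolded cc]] mon_def prod.distrib[symmetric] pair_add_left
    by (intro prod.cong refl) (simp add: power_int_add_nonneg)
  have "f x * g x = (\<Sum>k\<in>F. \<Sum>l\<in>G. (a k * b l) * mon m x (k + l))" for x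
    unfolding F(3)[rule_format] G(3)[rule_format] sum_product
    using F(2) G(2) by (intro sum.cong refl) (simp add: subset_iff flip: add)
  then show ?thesis unfolding cc
    using F(2) G(2) by (auto intro!: polyfun_sum polyfun_mon dual_semigroup_add)
qed

lemma polyfun_prod: "c \<in> Ch \<Longrightarrow> (\<And>i. i \<in> I \<Longrightarrow> polyfun c (f i)) \<Longrightarrow> polyfun c (\<lambda>x. \<Prod>i\<in>I. f i x)"
  by (induction I rule: infinite_finite_induct) (auto intro: polyfun_const polyfun_mult)

lemma polyfun_power_int:
  assumes "c \<in> Ch" "polyfun c f" "0 \<le> n"
  shows "polyfun c (\<lambda>x. f x powi n)"
proof -
  have "polyfun c (\<lambda>x. f x ^ k)" for k
    by (induction k) (auto intro: polyfun_const polyfun_mult assms)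
  then show ?thesis using assms(3) by (simp add: power_int_def)
qed

lemma polyfun_zc:
  assumes c: "(\<sigma>, m) \<in> Ch"
  shows "polyfun (\<sigma>, m) (\<lambda>x. zc m x \<rho>)"
proof (cases "\<rho> \<in> range (dual_basis m)")
  case True
  then obtain j where "\<rho> = dual_basis m j" by blast
  then show ?thesis
    using polyfun_mon[OF chart_basis_in_dual[OF c, of j], of m 1]
    by (simp add: zc_dual[OF chart_basis(1)[OF c]] mon_basis[OF chart_basis(1)[OF c]])
qed (simp add: zc_def polyfun_const)

end

section \<open>The Cox flow is an algebraic one-parameter subgroup\<close>

context cox_flow
begin

lemma flow_pt: "(\<sigma>, m) \<in> Ch \<Longrightarrow> flow t (pt m x) = cox (\<Phi> t (zc m x))"
  unfolding pt_def by (rule flow_cox[OF zc_cdom])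

lemma flow_in_U_iff:
  assumes "(\<sigma>, m) \<in> Ch"
  shows "flow t (pt m x) \<in> Aff \<tau> \<longleftrightarrow> \<tau> \<in> \<Sigma> \<and> (\<forall>\<rho>\<in>Rays - gens \<tau>. \<Phi> t (zc m x) \<rho> \<noteq> 0)"
  unfolding flow_pt[OF assms] U_cox_iff[OF \<Phi>_cdom[OF zc_cdom[OF assms]]] by (auto simp: Zs_def)

lemma chi_flow:
  assumes c: "(\<sigma>, m) \<in> Ch" and "flow t (pt m x) \<in> Aff \<tau>" "k \<in> dual_semigroup \<tau>"
  shows "chi \<tau> k (flow t (pt m x)) = ev (\<Phi> t (zc m x)) k"
  using assms(2,3) unfolding flow_pt[OF c] U_cox_iff[OF \<Phi>_cdom[OF zc_cdom[OF c]]] by (auto intro: chi_cox_ev)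

lemma polyfun_\<Phi>:
  assumes c: "(\<sigma>, m) \<in> Ch"
  shows "polyfun (\<sigma>, m) (\<lambda>x. \<Phi> t (zc m x) \<rho>)"
proof (cases "\<rho> = \<rho>0")
  case True
  have "polyfun (\<sigma>, m) (\<lambda>x. b t * R (zc m x) \<alpha>)"
  proof (cases "\<forall>t. b t = 0")
    case False
    then have "isRoot \<alpha> \<rho>0" using root by blast
    then have "polyfun (\<sigma>, m) (\<lambda>x. R (zc m x) \<alpha>)"
      unfolding R_def by (intro polyfun_prod polyfun_power_int polyfun_zc c) (auto simp: is_root_ray_def)
    then show ?thesis by (intro polyfun_mult polyfun_const c)
  qed (simp add: polyfun_const)
  from polyfun_add[OF polyfun_mult[OF c polyfun_const[of _ "a t"] polyfun_zc[OF c, of \<rho>0]] this]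
  show ?thesis by (simp add: \<Phi>_def True)
qed (simp add: \<Phi>_def polyfun_zc[OF c])

lemma flow_morphism: "morphism \<Sigma> (flow t)"
  unfolding morphism_def
proof (intro conjI ballI)
  show "flow t ` TV \<subseteq> TV"
    using permutes_image[OF flow_permutes] by blast
  fix \<tau> k assume \<tau>: "\<tau> \<in> \<Sigma>" and k: "k \<in> dual_semigroup \<tau>"
  show "regular_on \<Sigma> {P \<in> TV. flow t P \<in> Aff \<tau>} (\<lambda>P. chi \<tau> k (flow t P))"
    unfolding regular_on_def
  proof
    fix P assume P: "P \<in> {P \<in> TV. flow t P \<in> Aff \<tau>}"
    then obtain \<sigma> m where c: "(\<sigma>, m) \<in> Ch" and "P \<in> Dom (\<sigma>, m)" using in_some_chart by blast
    then obtain x0 where x0: "P = pt m x0" using dom_chart_eq[OF c] by auto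
    define Y where "Y x \<rho> = \<Phi> t (zc m x) \<rho>" for x \<rho>
    \<comment> \<open>The character is \<open>A / B\<close>, where \<open>B\<close> clears the
      denominators at rays outside \<open>\<tau>\<close>. The extra 1 in the exponents makes
      \<open>B\<close> vanish whenever such a coordinate does, even if
      \<open>pair k \<rho> = 0\<close>.\<close>
    define A where "A x = (\<Prod>\<rho>\<in>gens \<tau>. Y x \<rho> powi pair k \<rho>) * (\<Prod>\<rho>\<in>Rays - gens \<tau>. Y x \<rho> powi (\<bar>pair k \<rho>\<bar> + 1 + pair k \<rho>))" for x
    define B where "B x = (\<Prod>\<rho>\<in>Rays - gens \<tau>. Y x \<rho> powi (\<bar>pair k \<rho>\<bar> + 1))" for x
    have "polyfun (\<sigma>, m) A" "polyfun (\<sigma>, m) B"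
      unfolding A_def B_def Y_def using k gens_dual[OF \<tau>]
      by (auto intro!: polyfun_mult polyfun_prod polyfun_power_int polyfun_\<Phi> c)
    then obtain A' B' where A': "A' \<in> coord_ring \<sigma>" "\<And>x. A x = A' (pt m x)"
      and B': "B' \<in> coord_ring \<sigma>" "\<And>x. B x = B' (pt m x)"
      using polyfun_coord_ring[OF c] by metis
    have B: "B x \<noteq> 0 \<longleftrightarrow> flow t (pt m x) \<in> Aff \<tau>" for x
    proof -
      have "y powi (\<bar>n\<bar> + 1) = 0 \<longleftrightarrow> y = 0" for y :: complex and n
        using abs_ge_zero[of n] by (auto simp: add_nonneg_eq_0_iff)
      then show ?thesis using finite_rays \<tau> by (simp add: B_def Y_def flow_in_U_iff[OF c] prod_zero_iff)
    qed
    have AB: "chi \<tau> k (flow t (pt m x)) = A x / B x" if "flow t (pt m x) \<in> Aff \<tau>" for x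
    proof -
      have "Y x \<rho> \<noteq> 0" if "\<rho> \<in> Rays - gens \<tau>" for \<rho>
        using that \<open>flow t (pt m x) \<in> Aff \<tau>\<close> by (simp add: flow_in_U_iff[OF c] Y_def)
      then have "(\<Prod>\<rho>\<in>Rays - gens \<tau>. Y x \<rho> powi (\<bar>pair k \<rho>\<bar> + 1 + pair k \<rho>)) = B x * (\<Prod>\<rho>\<in>Rays - gens \<tau>. Y x \<rho> powi pair k \<rho>)"
        unfolding B_def prod.distrib[symmetric] by (intro prod.cong refl power_int_add) auto
      moreover have "ev (Y x) k = (\<Prod>\<rho>\<in>Rays - gens \<tau>. Y x \<rho> powi pair k \<rho>) * (\<Prod>\<rho>\<in>gens \<tau>. Y x \<rho> powi pair k \<rho>)"
        unfolding ev_def by (rule prod.subset_diff[OF gens_subset_rays finite_rays])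
      moreover have "chi \<tau> k (flow t (pt m x)) = ev (Y x) k"
        using chi_flow[OF c that k] by (simp add: Y_def[abs_def])
      ultimately show ?thesis using B[of x] that by (simp add: A_def)
    qed
    have "B' P \<noteq> 0" using P B B'(2) x0 by simp
    moreover have "Q \<in> {P \<in> TV. flow t P \<in> Aff \<tau>} \<and> chi \<tau> k (flow t Q) = A' Q / B' Q"
      if Q: "Q \<in> Aff \<sigma>" "B' Q \<noteq> 0" for Q
    proof -
      obtain x where x: "Q = pt m x" using dom_chart_eq[OF c] Q(1) by (auto simp: dom_chart_def)
      have *: "flow t (pt m x) \<in> Aff \<tau>" using Q(2) B B'(2) x by simp
      then show ?thesis using x pt_in[OF c] AB[OF *] A'(2) B'(2) by simp
    qed
    moreover have "P \<in> Aff \<sigma>" using pt_in_chart[OF c] by (simp add: x0 dom_chart_def)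
    ultimately show "\<exists>\<sigma>\<in>\<Sigma>. P \<in> Aff \<sigma> \<and> (\<exists>a\<in>coord_ring \<sigma>. \<exists>b\<in>coord_ring \<sigma>. b P \<noteq> 0 \<and>
        (\<forall>Q\<in>Aff \<sigma>. b Q \<noteq> 0 \<longrightarrow> Q \<in> {P \<in> TV. flow t P \<in> Aff \<tau>} \<and> chi \<tau> k (flow t Q) = a Q / b Q))"
      using A'(1) B'(1) chart_basis(2)[OF c] by blast
  qed
qed

lemma isCont_\<Phi>: "isCont (\<lambda>(t, x). \<Phi> t (zc m x) \<rho>) p"
proof -
  have Z: "isCont (\<lambda>q. zc m (snd q) \<rho>) p" for \<rho>
    by (cases "\<rho> \<in> range (dual_basis m)") (simp_all add: zc_def)
  have ab: "isCont (\<lambda>q. a (fst q)) p" "isCont (\<lambda>q. b (fst q)) p"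
    using cont by (auto intro!: isCont_o2[OF isCont_fst] simp: continuous_on_eq_continuous_at)
  have "isCont (\<lambda>q. b (fst q) * R (zc m (snd q)) \<alpha>) p"
  proof (cases "\<forall>t. b t = 0")
    case False
    then have "isRoot \<alpha> \<rho>0" using root by blast
    then have "isCont (\<lambda>q. R (zc m (snd q)) \<alpha>) p"
      unfolding R_def by (intro continuous_prod isCont_power_int Z) (auto simp: is_root_ray_def)
    then show ?thesis using ab by (intro continuous_intros)
  qed simp
  then have "isCont (\<lambda>q. \<Phi> (fst q) (zc m (snd q)) \<rho>) p"
    using Z ab by (cases "\<rho> = \<rho>0") (auto simp: \<Phi>_def intro!: continuous_intros)
  then show ?thesis by (simp add: case_prod_beta')
qed

text \<open>\<open>lie_algebraI\<close> asks for joint continuity; near a given point the flow is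
  \<open>pt n\<close> applied to the map \<open>G\<close>, the explicit monomials in a chart around
  the image.\<close>

lemma flow_lie_algebra: "flow \<in> LieAut"
proof (rule lie_algebraI)
  show "flow t \<in> AutY" for t
    unfolding Aut_def using flow_permutes flow_morphism by (simp add: inv_flow)
  show "flow (s + t) = flow s \<circ> flow t" for s t by (rule flow_add)
  fix \<sigma> m W assume c: "(\<sigma>, m) \<in> Ch" and W: "openin TopY W"
  let ?S = "{(t :: real, x). flow t (pt m x) \<in> W}"
  have "\<forall>\<^sub>F q in nhds p. q \<in> ?S" if p: "p \<in> ?S" for p
  proof -
    obtain t0 x0 where tx: "p = (t0, x0)" by (cases p)
    have "flow t0 (pt m x0) \<in> W" using p tx by simp
    moreover have "flow t0 (pt m x0) \<in> TV" using flow_permutes pt_in[OF c] by (simp add: permutes_in_image)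
    ultimately obtain \<tau> n where d: "(\<tau>, n) \<in> Ch" and D: "flow t0 (pt m x0) \<in> Dom (\<tau>, n)"
      using in_some_chart by blast
    define G where "G = (\<lambda>(t, x). (\<chi> j. ev (\<Phi> t (zc m x)) (n j)) :: complex ^ 'n)"
    have U: "\<forall>\<rho>\<in>Rays - gens \<tau>. \<Phi> t0 (zc m x0) \<rho> \<noteq> 0"
      using D by (simp add: dom_chart_def flow_in_U_iff[OF c])
    have G: "pt n (G (t, x)) = flow t (pt m x)" if "\<forall>\<rho>\<in>Rays - gens \<tau>. \<Phi> t (zc m x) \<rho> \<noteq> 0" for t x
    proof -
      have i: "flow t (pt m x) \<in> Aff \<tau>" using that chart_basis(2)[OF d] by (simp add: flow_in_U_iff[OF c])
      have "coords (\<tau>, n) (flow t (pt m x)) = G (t, x)"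
        unfolding coords_def G_def using chi_flow[OF c i chart_basis_in_dual[OF d]] by simp
      then show ?thesis using pt_coords[OF d, of "flow t (pt m x)"] i by (simp add: dom_chart_def)
    qed
    have "isCont G p"
    proof -
      have "isCont (\<lambda>q. (\<lambda>(t, x). ev (\<Phi> t (zc m x)) (n j)) q) p" for j
      proof -
        have "isCont (\<lambda>q. \<Prod>\<rho>\<in>Rays. (case q of (t, x) \<Rightarrow> \<Phi> t (zc m x) \<rho>) powi pair (n j) \<rho>) p"
        proof (intro continuous_prod isCont_power_int isCont_\<Phi>)
          fix \<rho> assume "\<rho> \<in> Rays"
          show "(case p of (t, x) \<Rightarrow> \<Phi> t (zc m x) \<rho>) \<noteq> 0 \<or> 0 \<le> pair (n j) \<rho>"
            using U \<open>\<rho> \<in> Rays\<close> chart_basis_in_dual[OF d, of j] unfolding gens_dual[OF chart_basis(2)[OF d]] tx by auto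
        qed
        then show ?thesis by (simp add: ev_def case_prod_beta')
      qed
      then show ?thesis unfolding G_def isCont_def by (intro vec_tendstoI) (simp add: case_prod_beta')
    qed
    moreover have "open {y. pt n y \<in> W}" by (rule open_pt_vimage[OF d W])
    moreover have "G p \<in> {y. pt n y \<in> W}" using G[OF U] p tx by simp
    ultimately have "\<forall>\<^sub>F q in nhds p. G q \<in> {y. pt n y \<in> W}"
      unfolding isCont_def tendsto_at_iff_tendsto_nhds by (rule topological_tendstoD)
    moreover have "\<forall>\<^sub>F q in nhds p. \<forall>\<rho>\<in>Rays - gens \<tau>. (case q of (t, x) \<Rightarrow> \<Phi> t (zc m x) \<rho>) \<noteq> 0"
      using U finite_rays tx by (intro eventually_ball_finite ballI eventually_nhds_continuous_nonzero isCont_\<Phi>) auto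
    ultimately show ?thesis
      by eventually_elim (use G in auto)
  qed
  then have "\<exists>T. open T \<and> p \<in> T \<and> (\<forall>q\<in>T. q \<in> ?S)" if "p \<in> ?S" for p
    using that unfolding eventually_nhds by (rule meta_mp)
  then show "open ?S" unfolding subset_eq[symmetric] by (subst open_subopen) (rule ballI)
qed

text \<open>On the torus the flow multiplies \<open>t\<^sup>k\<close> by the power
  \<open>pair k \<rho>0\<close> of \<open>a t + b t * t\<^sup>\<alpha>\<close>. The torus subgroups
  have \<alpha> = 0, for which only w = 1 occurs.\<close>

lemma Xt_flow_deriv:
  assumes d: "\<And>w. (w = 1 \<or> isRoot \<alpha> \<rho>0) \<Longrightarrow> ((\<lambda>t. a t + b t * w) has_vector_derivative w) (at 0)"
    and \<alpha>: "\<alpha> = 0 \<or> isRoot \<alpha> \<rho>0" and Q: "Q \<in> Torus"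
  shows "((\<lambda>t. Xt k (flow t Q)) has_vector_derivative Xt k Q * (of_int (pair k \<rho>0) * Xt \<alpha> Q)) (at 0)"
proof -
  obtain \<sigma> m where c: "(\<sigma>, m) \<in> Ch" using ex_chart by blast
  obtain x where x: "Q = pt m x" "\<forall>j. x $ j \<noteq> 0" using torus_pt[OF c Q] .
  define z where "z = zc m x"
  have z: "Zs z = {}" using x(2) by (simp add: z_def Zs_zc[OF c])
  have z0: "z \<rho>0 \<noteq> 0" using z \<rho>0 by (auto simp: Zs_def)
  have X: "Xt l Q = ev z l" for l using Xt_pt[OF c x(2)] ev_zc[OF c] by (simp add: x(1) z_def)
  define f where "f t = a t + b t * Xt \<alpha> Q" for t
  have f0: "f 0 = 1" by (simp add: f_def a(2) b(1))
  have "Xt \<alpha> Q = 1 \<or> isRoot \<alpha> \<rho>0" using \<alpha> Xt_zero[OF Q] by auto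
  then have f: "(f has_vector_derivative Xt \<alpha> Q) (at 0)" unfolding f_def by (rule d)
  have "((\<lambda>y. y powi pair k \<rho>0) has_field_derivative of_int (pair k \<rho>0)) (at (f 0))"
    using f0 by (auto intro!: derivative_eq_intros)
  from has_vector_derivative_mult_right[OF field_vector_diff_chain_at[OF f this], of "Xt k Q"]
  have D: "((\<lambda>t. Xt k Q * f t powi pair k \<rho>0) has_vector_derivative Xt k Q * (of_int (pair k \<rho>0) * Xt \<alpha> Q)) (at 0)"
    by (simp add: o_def mult_ac)
  show ?thesis
  proof (rule has_vector_derivative_cong_nhds[OF D])
    have "isCont f 0" by (rule has_vector_derivative_continuous[OF f])
    then have "\<forall>\<^sub>F t in nhds 0. f t \<noteq> 0" by (rule eventually_nhds_continuous_nonzero) (simp add: f0)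
    then show "\<forall>\<^sub>F t in nhds 0. Xt k Q * f t powi pair k \<rho>0 = Xt k (flow t Q)"
    proof eventually_elim
      case (elim t)
      have e: "\<Phi> t z = z(\<rho>0 := f t * z \<rho>0)" unfolding f_def X by (rule \<Phi>_nonzero) (rule z0)
      have "Zs (\<Phi> t z) = {}" unfolding e Zs_upd using elim z z0 by simp
      then have i: "flow t (pt m x) \<in> Torus"
        using zero_in_fan by (auto simp: flow_in_U_iff[OF c] Zs_def simp flip: z_def)
      have "Xt k (flow t Q) = ev (\<Phi> t z) k"
        unfolding x(1) Xt_def z_def by (rule chi_flow[OF c i dual_zero])
      then show ?case by (simp add: X e ev_R power_int_mult_distrib mult_ac)
    qed
  qed
qed

end

section \<open>The subgroups that realise the generators\<close>

context smooth_complete_fan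
begin

lemma torus_one_parameter:
  assumes bpf: "anticanonical_bpf \<Sigma>" and \<rho>: "\<rho> \<in> Rays"
  shows "\<exists>\<gamma>\<in>LieAut. \<forall>\<nu>\<in>DM. \<forall>\<mu>\<in>DM.
    LieAct \<gamma> \<nu> \<mu> = (if \<nu> = \<mu> then of_int (pair \<mu> \<rho>) else 0)"
proof -
  interpret f: cox_flow \<Sigma> \<rho> 0 "\<lambda>t. exp (of_real t)" "\<lambda>t. 0"
    by unfold_locales (auto simp: \<rho> exp_add intro!: continuous_intros)
  interpret g: one_param \<Sigma> f.flow by unfold_locales (rule f.flow_lie_algebra)
  have "((\<lambda>t. exp (complex_of_real t) + 0 * w) has_vector_derivative w) (at 0)" if "w = 1 \<or> isRoot 0 \<rho>" for w
  proof -
    have "w = 1" using that by (auto simp: is_root_ray_def pair_simps)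
    moreover have "((\<lambda>t. complex_of_real t) has_vector_derivative 1) (at 0)"
      by (auto intro!: has_vector_derivative_eq_rhs[OF has_vector_derivative_of_real])
    from field_vector_diff_chain_at[OF this DERIV_exp]
    have "((\<lambda>t. exp (complex_of_real t)) has_vector_derivative 1) (at 0)" by (simp add: o_def)
    ultimately show ?thesis by simp
  qed
  then have "LieAct f.flow \<nu> \<mu> = (if \<nu> = \<mu> then of_int (pair \<mu> \<rho>) else 0)" if "\<nu> \<in> DM" "\<mu> \<in> DM" for \<nu> \<mu>
    using g.lie_act_monomial_field[OF bpf f.Xt_flow_deriv that] by simp
  then show ?thesis using f.flow_lie_algebra by blast
qed

lemma root_one_parameter:
  assumes bpf: "anticanonical_bpf \<Sigma>" and \<alpha>: "isRoot \<alpha> \<rho>"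
  shows "\<exists>\<gamma>\<in>LieAut. \<forall>\<nu>\<in>DM. \<forall>\<mu>\<in>DM.
    LieAct \<gamma> \<nu> \<mu> = (if \<nu> - \<mu> = \<alpha> then of_int (pair (\<mu> - \<alpha>) \<rho>) else 0)"
proof -
  interpret f: cox_flow \<Sigma> \<rho> \<alpha> "\<lambda>t. 1" "\<lambda>t. of_real t"
    by unfold_locales (use \<alpha> in \<open>auto simp: is_root_ray_def intro!: continuous_intros\<close>)
  interpret g: one_param \<Sigma> f.flow by unfold_locales (rule f.flow_lie_algebra)
  have "((\<lambda>t. 1 + complex_of_real t * w) has_vector_derivative w) (at 0)" for w
  proof -
    have "((\<lambda>t. complex_of_real t) has_vector_derivative 1) (at 0)"
      by (auto intro!: has_vector_derivative_eq_rhs[OF has_vector_derivative_of_real])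
    from has_vector_derivative_add[OF has_vector_derivative_const has_vector_derivative_mult_left[OF this], of 1 w]
    show ?thesis by simp
  qed
  then have "LieAct f.flow \<nu> \<mu> = (if \<nu> - \<mu> = \<alpha> then of_int (pair (\<mu> - \<alpha>) \<rho>) else 0)" if "\<nu> \<in> DM" "\<mu> \<in> DM" for \<nu> \<mu>
    using g.lie_act_monomial_field[OF bpf f.Xt_flow_deriv that] \<alpha> by simp
  then show ?thesis using f.flow_lie_algebra by blast
qed

text \<open>The trivial subgroup paired with the scalar 1 yields the Euler operator plus 1.\<close>

lemma id_one_parameter:
  assumes "anticanonical_bpf \<Sigma>"
  shows "(\<lambda>t. id) \<in> LieAut" and "LieAct (\<lambda>t. id) \<nu> \<mu> = 0"
proof -
  show "(\<lambda>t. id) \<in> LieAut"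
  proof (rule lie_algebraI)
    fix \<sigma> m W assume "(\<sigma>, m) \<in> Ch" "openin TopY W"
    then have "open (UNIV \<times> {x. pt m x \<in> W} :: (real \<times> (complex ^ 'n)) set)" by (intro open_Times open_pt_vimage) auto
    moreover have "{(t :: real, x). id (pt m x) \<in> W} = UNIV \<times> {x. pt m x \<in> W}" by auto
    ultimately show "open {(t :: real, x). id (pt m x) \<in> W}" by simp
  qed (auto simp: id_Aut)
  show "LieAct (\<lambda>t. id) \<nu> \<mu> = 0"
    unfolding lie_act_def by (simp add: vector_derivative_const_at)
qed

end

section \<open>Differential operators and the toric ideal\<close>

abbreviation "lookup \<equiv> Poly_Mapping.lookup"
abbreviation "keys \<equiv> Poly_Mapping.keys"

lemma Const_0 [simp]: "Const 0 = 0" and Const_1 [simp]: "Const 1 = 1"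
  by (simp_all add: Const_def)

lemma Const_add: "Const (a + b) = Const a + Const b"
  by (simp add: Const_def single_add)

lemma Const_uminus: "Const (- a) = - Const a"
  by (simp add: Const_def single_uminus)

lemma Const_mult: "Const (a * b) = Const a * Const b"
  by (simp add: Const_def mult_single)

lemma Const_sum: "Const (\<Sum>i\<in>I. f i) = (\<Sum>i\<in>I. Const (f i))"
  by (induction I rule: infinite_finite_induct) (simp_all add: Const_add)

lemma lookup_pd:
  "lookup (pd v q) f = of_nat (lookup f v + 1) * lookup q (f + Poly_Mapping.single v 1)"
proof -
  let ?s = "Poly_Mapping.single v (1::nat)"
  have "lookup (pd v q) f = (\<Sum>e\<in>keys q.
      (of_nat (lookup e v) * lookup q e) when e - ?s = f)"
    by (simp add: pd_def lookup_sum lookup_single)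
  also have "\<dots> = (\<Sum>e\<in>keys q. if e = f + ?s then of_nat (lookup f v + 1) * lookup q (f + ?s) else 0)"
  proof (rule sum.cong[OF refl])
    fix e :: "'a \<Rightarrow>\<^sub>0 nat"
    show "((of_nat (lookup e v) * lookup q e) when e - ?s = f) =
        (if e = f + ?s then of_nat (lookup f v + 1) * lookup q (f + ?s) else 0)"
    proof (cases "e = f + ?s")
      case False
      \<comment> \<open>Subtraction of exponents is truncated at 0; where this loses information,
        \<open>lookup e v = 0\<close> and the coefficient vanishes anyway.\<close>
      have "e = f + ?s" if "e - ?s = f" "lookup e v \<noteq> 0"
        using that by (intro poly_mapping_eqI) (auto simp: lookup_add lookup_minus lookup_single when_def)
      then show ?thesis using False by (cases "lookup e v = 0") (auto simp: when_def)
    qed (simp add: lookup_add)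
  qed
  also have "\<dots> = of_nat (lookup f v + 1) * lookup q (f + ?s)"
    by (simp add: in_keys_iff)
  finally show ?thesis .
qed

lemma pd_diff: "pd v (p - q) = pd v p - pd v q"
  by (rule poly_mapping_eqI) (simp add: lookup_pd lookup_minus algebra_simps)

lemma pd_commute: "pd v (pd w q) = pd w (pd v q)"
  by (rule poly_mapping_eqI, cases "v = w") (simp_all add: lookup_pd lookup_add lookup_single add_ac)

lemma funpow_commute_apply:
  assumes "\<And>x. f (g x) = g (f x)"
  shows "(f ^^ i) ((g ^^ j) x) = (g ^^ j) ((f ^^ i) x)"
proof -
  have "f ((g ^^ j) y) = (g ^^ j) (f y)" for y by (induction j) (simp_all add: assms)
  then show ?thesis by (induction i) simp_all
qed

lemma pd_funpow_commute: "(pd v ^^ i) ((pd w ^^ j) q) = (pd w ^^ j) ((pd v ^^ i) q)"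
  by (rule funpow_commute_apply) (rule pd_commute)

text \<open>A form of \<open>pd_monom\<close> with exponents and index set kept apart, so that two
  monomials can be compared over a common index set.\<close>

definition pdm :: "('v \<Rightarrow> nat) \<Rightarrow> 'v set \<Rightarrow> 'v mpoly \<Rightarrow> 'v mpoly" where
  "pdm n K = Finite_Set.fold (\<lambda>v T. (pd v ^^ n v) \<circ> T) id K"

lemma pdm_empty [simp]: "pdm n {} = id" by (simp add: pdm_def)

lemma pdm_insert:
  assumes "finite K" "v \<notin> K"
  shows "pdm n (insert v K) q = (pd v ^^ n v) (pdm n K q)"
proof -
  interpret comp_fun_commute "\<lambda>v T. (pd v ^^ n v) \<circ> T"
  proof
    fix v w
    show "((\<lambda>T. (pd w ^^ n w) \<circ> T) \<circ> (\<lambda>T. (pd v ^^ n v) \<circ> T)) = ((\<lambda>T. (pd v ^^ n v) \<circ> T) \<circ> (\<lambda>T. (pd w ^^ n w) \<circ> T))"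
      by (rule ext)+ (simp, rule pd_funpow_commute)
  qed
  show ?thesis unfolding pdm_def using assms by simp
qed

lemma pd_pdm: "finite K \<Longrightarrow> (pd w ^^ i) (pdm n K q) = pdm n K ((pd w ^^ i) q)"
proof (induction K rule: finite_induct)
  case (insert v K)
  then show ?case using pd_funpow_commute[of i w "n v" v "pdm n K q"] by (simp add: pdm_insert)
qed simp

lemma pdm_add: "finite K \<Longrightarrow> pdm (\<lambda>v. n v + n' v) K q = pdm n K (pdm n' K q)"
proof (induction K rule: finite_induct)
  case (insert v K)
  then show ?case using pd_pdm[OF insert(1), of "n' v" v n "pdm n' K q"] by (simp add: pdm_insert funpow_add)
qed simp

lemma pdm_diff: "finite K \<Longrightarrow> pdm n K (p - q) = pdm n K p - pdm n K q"
proof (induction K rule: finite_induct)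
  case (insert v K)
  have "(pd v ^^ i) (p - q) = (pd v ^^ i) p - (pd v ^^ i) q" for i p q
    by (induction i) (simp_all add: pd_diff)
  then show ?case using insert by (simp add: pdm_insert)
qed simp

lemma pd_monom_pdm:
  assumes K: "finite K" "keys e \<subseteq> K"
  shows "pd_monom e = pdm (lookup e) K"
proof -
  have "pdm (lookup e) (keys e \<union> D) = pdm (lookup e) (keys e)"
    if "finite D" "D \<inter> keys e = {}" for D
    using that
  proof (induction D rule: finite_induct)
    case (insert v D)
    then have "lookup e v = 0" "v \<notin> keys e \<union> D" by (auto simp: in_keys_iff)
    then show ?case using insert by (simp add: fun_eq_iff pdm_insert)
  qed simp
  from this[of "K - keys e"] have "pdm (lookup e) K = pdm (lookup e) (keys e)"
    using K by (simp add: Un_absorb1 Diff_Int_distrib2)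
  then show ?thesis by (simp add: pd_monom_def pdm_def)
qed

lemma pd_monom_add: "pd_monom (e + f) q = pd_monom e (pd_monom f q)"
proof -
  let ?K = "keys e \<union> keys f"
  have "pd_monom (e + f) = pdm (lookup (e + f)) ?K" by (rule pd_monom_pdm) (auto dest: subsetD[OF keys_add])
  also have "lookup (e + f) = (\<lambda>v. lookup e v + lookup f v)"
    by (simp add: fun_eq_iff lookup_add)
  finally show ?thesis by (simp add: pdm_add pd_monom_pdm[of ?K])
qed

lemma pd_monom_diff: "pd_monom e (p - q) = pd_monom e p - pd_monom e q"
  by (simp add: pd_monom_pdm[OF finite_keys order_refl] pdm_diff)

lemma weyl_id: "id \<in> weyl A"
proof -
  have "(id :: 'a mpoly \<Rightarrow> 'a mpoly) = (\<lambda>q. Const 1 * q)" by (simp add: fun_eq_iff)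
  then show ?thesis using weyl_const[of 1 A] by metis
qed

lemma pd_monom_weyl:
  assumes "keys e \<subseteq> A"
  shows "pd_monom e \<in> weyl A"
proof -
  have pow: "pd v ^^ i \<in> weyl A" if "v \<in> A" for v i
    using that by (induction i) (simp_all only: funpow.simps weyl_id weyl_mult weyl_pd)
  have "pdm n K \<in> weyl A" if "finite K" "K \<subseteq> A" for n K
    using that
  proof (induction K rule: finite_induct)
    case (insert v K)
    then have "pdm n (insert v K) = (pd v ^^ n v) \<circ> pdm n K" by (simp add: fun_eq_iff pdm_insert)
    then show ?case using insert weyl_mult[OF pow, of v "pdm n K" "n v"] by (simp only: insert_subset)
  qed (simp add: weyl_id)
  then show ?thesis using assms by (simp add: pd_monom_pdm[OF finite_keys order_refl])
qed

lemma left_ideal_subsetI: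
  assumes "X \<subseteq> left_ideal A Y"
  shows "left_ideal A X \<subseteq> left_ideal A Y"
proof
  fix T assume "T \<in> left_ideal A X"
  then show "T \<in> left_ideal A Y"
    by induction (use assms in \<open>blast intro: left_ideal.intros\<close>)+
qed

lemma li_Const: "T \<in> left_ideal A X \<Longrightarrow> (\<lambda>q. Const a * T q) \<in> left_ideal A X"
  using li_mult[OF weyl_const[of a A], of T X] by (simp add: o_def)

lemma li_sum: "(\<And>i. i \<in> I \<Longrightarrow> T i \<in> left_ideal A X) \<Longrightarrow> (\<lambda>q. \<Sum>i\<in>I. T i q) \<in> left_ideal A X"
proof (induction I rule: infinite_finite_induct)
  case (insert i I)
  then show ?case using li_add[of "T i" A X "\<lambda>q. \<Sum>i\<in>I. T i q"] by simp
qed (simp_all add: li_zero)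

lemma li_cong: "T \<in> left_ideal A X \<Longrightarrow> (\<And>q. S q = T q) \<Longrightarrow> S \<in> left_ideal A X"
  by (metis ext)

lemma peval_superset:
  assumes "finite K" "keys p \<subseteq> K"
  shows "peval p z = (\<Sum>e\<in>K. lookup p e * (\<Prod>v\<in>keys e. z v ^ lookup e v))"
  unfolding peval_def by (rule sum.mono_neutral_left) (use assms in \<open>auto simp: in_keys_iff\<close>)

lemma pd_poly_superset:
  assumes "finite K" "keys p \<subseteq> K"
  shows "pd_poly p q = (\<Sum>e\<in>K. Const (lookup p e) * pd_monom e q)"
  unfolding pd_poly_def by (rule sum.mono_neutral_left) (use assms in \<open>auto simp: in_keys_iff\<close>)

section \<open>Degree, weight and binomial operators\<close>

definition mdeg :: "('v \<Rightarrow>\<^sub>0 nat) \<Rightarrow> nat" where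
  "mdeg e = (\<Sum>v\<in>keys e. lookup e v)"

definition wt :: "('n::finite lattice \<Rightarrow>\<^sub>0 nat) \<Rightarrow> 'n lattice" where
  "wt e = (\<Sum>v\<in>keys e. int (lookup e v) *s v)"

definition gkz_boxes :: "'n::finite lattice set \<Rightarrow> ('n lattice mpoly \<Rightarrow> 'n lattice mpoly) set" where
  "gkz_boxes A = {gkz_box l | l. keys l \<subseteq> A \<and> (\<Sum>\<mu>\<in>keys l. lookup l \<mu>) = 0 \<and>
     (\<Sum>\<mu>\<in>keys l. lookup l \<mu> *s \<mu>) = 0}"

lemma sum_keys_superset:
  fixes e :: "'v \<Rightarrow>\<^sub>0 'a::zero"
  assumes "finite K" "keys e \<subseteq> K" "\<And>v. g v 0 = 0"
  shows "(\<Sum>v\<in>keys e. g v (lookup e v)) = (\<Sum>v\<in>K. g v (lookup e v))"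
  by (rule sum.mono_neutral_left) (use assms in \<open>auto simp: in_keys_iff\<close>)

lemma mdeg_superset: "finite K \<Longrightarrow> keys e \<subseteq> K \<Longrightarrow> mdeg e = (\<Sum>v\<in>K. lookup e v)"
  unfolding mdeg_def by (rule sum_keys_superset[of K e "\<lambda>v x. x"]) auto

lemma wt_superset: "finite K \<Longrightarrow> keys e \<subseteq> K \<Longrightarrow> wt e = (\<Sum>v\<in>K. int (lookup e v) *s v)"
  unfolding wt_def by (rule sum_keys_superset[of K e "\<lambda>v x. int x *s v"]) auto

lemma lookup_map_0: "f 0 = 0 \<Longrightarrow> lookup (Poly_Mapping.map f e) v = f (lookup e v)"
  by (simp add: map.rep_eq when_def)

text \<open>With \<open>l = e - f\<close>, the common factor \<open>g\<close> is the pointwise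
  minimum of \<open>e\<close> and \<open>f\<close>, and the difference is \<open>pd_monom g\<close>
  applied to the box operator of \<open>l\<close>.\<close>

lemma monom_diff_in_boxes:
  assumes A: "finite A" and e: "keys e \<subseteq> A" "keys f \<subseteq> A" "mdeg e = mdeg f" "wt e = wt f"
  shows "(\<lambda>q. pd_monom e q - pd_monom f q) \<in> left_ideal A (gkz_boxes A)"
proof -
  define l where "l = Poly_Mapping.map int e - Poly_Mapping.map int f"
  have l: "lookup l v = int (lookup e v) - int (lookup f v)" for v
    by (simp add: l_def lookup_minus lookup_map_0)
  have keys: "keys l \<subseteq> A" using e(1,2) by (auto simp: in_keys_iff l subset_iff) (metis gr0I)
  have "(\<Sum>\<mu>\<in>keys l. lookup l \<mu>) = (\<Sum>\<mu>\<in>A. lookup l \<mu>)"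
    by (rule sum_keys_superset[OF A keys, of "\<lambda>v x. x"]) simp
  also have "\<dots> = int (mdeg e) - int (mdeg f)"
    by (simp add: l sum_subtractf mdeg_superset[OF A e(1)] mdeg_superset[OF A e(2)])
  finally have 1: "(\<Sum>\<mu>\<in>keys l. lookup l \<mu>) = 0" using e(3) by simp
  have "(\<Sum>\<mu>\<in>keys l. lookup l \<mu> *s \<mu>) = (\<Sum>\<mu>\<in>A. lookup l \<mu> *s \<mu>)"
    by (rule sum_keys_superset[OF A keys, of "\<lambda>v x. x *s v"]) simp
  also have "\<dots> = wt e - wt f"
    by (simp add: l sum_subtractf wt_superset[OF A e(1)] wt_superset[OF A e(2)] vector_sub_rdistrib)
  finally have 2: "(\<Sum>\<mu>\<in>keys l. lookup l \<mu> *s \<mu>) = 0" using e(4) by simp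
  have box: "gkz_box l \<in> left_ideal A (gkz_boxes A)"
    using keys 1 2 by (intro li_gen) (auto simp: gkz_boxes_def)
  define g where "g = e - Poly_Mapping.map nat l"
  have g: "e = g + Poly_Mapping.map nat l" "f = g + Poly_Mapping.map nat (- l)"
    by (rule poly_mapping_eqI, simp add: g_def lookup_add lookup_minus lookup_map_0 l lookup_uminus)+
  have "keys g \<subseteq> A" using e(1) by (auto simp: in_keys_iff g_def lookup_minus)
  from li_mult[OF pd_monom_weyl[OF this] box]
  show ?thesis
    by (rule li_cong) (simp add: gkz_box_def pd_monom_diff g(1)[THEN arg_cong[of _ _ pd_monom]] g(2)[THEN arg_cong[of _ _ pd_monom]] pd_monom_add)
qed

lemma prod_mon_dual:
  assumes "\<And>v j. v \<in> K \<Longrightarrow> 0 \<le> pair (w v) (dual_basis m j)"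
  shows "(\<Prod>v\<in>K. mon m x (w v) ^ n v) = mon m x (\<Sum>v\<in>K. int (n v) *s w v)"
proof -
  have "(\<Prod>v\<in>K. (x $ j powi pair (w v) (dual_basis m j)) ^ n v) = x $ j powi pair (\<Sum>v\<in>K. int (n v) *s w v) (dual_basis m j) \<and>
      0 \<le> pair (\<Sum>v\<in>K. int (n v) *s w v) (dual_basis m j)" for j
    using assms
  proof (induction K rule: infinite_finite_induct)
    case (insert v K)
    then have "0 \<le> int (n v) * pair (w v) (dual_basis m j)" by simp
    then show ?case using insert
      by (simp add: pair_simps power_int_add_nonneg power_int_mult mult.commute[of "int (n v)"])
  qed (simp_all add: pair_simps)
  then show ?thesis by (simp add: mon_def prod_power_distrib prod.swap[of _ _ K])
qed

context smooth_complete_fan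
begin

text \<open>On a chart of the cone a monomial depends only on its degree and weight: every factor
  \<open>tsec v\<close> contributes the same constant and the same shift by
  \<open>\<Sum>j. m j\<close> to the exponent.\<close>

lemma cone_monomial:
  assumes c: "(\<sigma>, m) \<in> Ch" and e: "keys e \<subseteq> DM"
  shows "(\<Prod>v\<in>keys e. (if v \<in> DM then k * tsec v (\<sigma>, m) (pt m x) else 0) ^ lookup e v) =
    (k * of_int (det (\<chi> j. m j))) ^ mdeg e * mon m x (wt e + int (mdeg e) *s (\<Sum>j\<in>UNIV. m j))"
proof -
  define S where "S = (\<Sum>j\<in>UNIV. m j)"
  define D where "D = (of_int (det (\<chi> j. m j)) :: complex)"
  have "(\<Prod>v\<in>keys e. (if v \<in> DM then k * tsec v (\<sigma>, m) (pt m x) else 0) ^ lookup e v) =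
      (\<Prod>v\<in>keys e. (k * D) ^ lookup e v * mon m x (v + S) ^ lookup e v)"
    using e by (intro prod.cong refl) (auto simp: tsec_pt(1)[OF c] D_def S_def power_mult_distrib mult_ac)
  also have "\<dots> = (k * D) ^ mdeg e * (\<Prod>v\<in>keys e. mon m x (v + S) ^ lookup e v)"
    by (simp add: prod.distrib mdeg_def power_sum)
  also have "(\<Prod>v\<in>keys e. mon m x (v + S) ^ lookup e v) =
      mon m x (\<Sum>v\<in>keys e. int (lookup e v) *s (v + S))"
    using e tsec_pt(2)[OF c] by (intro prod_mon_dual) (auto simp: S_def chart_dual_iff[OF c])
  also have "(\<Sum>v\<in>keys e. int (lookup e v) *s (v + S)) = wt e + int (mdeg e) *s S"
    by (simp add: wt_def mdeg_def vector_add_ldistrib sum.distrib vec_eq_iff sum_distrib_right)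
  finally show ?thesis by (simp add: D_def S_def)
qed

text \<open>The two monomials of a box have equal degree and weight, so they agree on the cone by
  \<open>cone_monomial\<close>.\<close>

lemma boxes_in_pd_ideal: "gkz_boxes DM \<subseteq> pd_poly ` ideal_cone_Y \<Sigma>"
proof
  fix T assume "T \<in> gkz_boxes DM"
  then obtain l where T: "T = gkz_box l" and l: "keys l \<subseteq> DM"
    "(\<Sum>\<mu>\<in>keys l. lookup l \<mu>) = 0" "(\<Sum>\<mu>\<in>keys l. lookup l \<mu> *s \<mu>) = 0"
    by (auto simp: gkz_boxes_def)
  define e where "e = Poly_Mapping.map nat l"
  define f where "f = Poly_Mapping.map nat (- l)"
  let ?K = "keys l"
  have ef: "lookup e v = nat (lookup l v)" "lookup f v = nat (- lookup l v)" for v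
    by (simp_all add: e_def f_def lookup_map_0 lookup_uminus)
  have k: "keys e \<subseteq> ?K" "keys f \<subseteq> ?K" by (auto simp: in_keys_iff ef)
  have i: "int (nat x) - int (nat (- x)) = x" for x by simp
  have "int (mdeg e) - int (mdeg f) = 0"
    unfolding mdeg_superset[OF finite_keys k(1)] mdeg_superset[OF finite_keys k(2)] of_nat_sum sum_subtractf[symmetric] ef i
    by (rule l(2))
  then have d: "mdeg e = mdeg f" by simp
  have "wt e - wt f = 0"
    unfolding wt_superset[OF finite_keys k(1)] wt_superset[OF finite_keys k(2)] sum_subtractf[symmetric] vector_sub_rdistrib[symmetric] ef i
    by (rule l(3))
  then have w: "wt e = wt f" by simp
  define p where "p = Poly_Mapping.single e (1::complex) - Poly_Mapping.single f 1"
  have p: "keys p \<subseteq> {e, f}" using keys_diff[of "Poly_Mapping.single e (1::complex)" "Poly_Mapping.single f 1"] by (auto simp: p_def)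
  have lp: "lookup p g = (if g = e then 1 else 0) - (if g = f then 1 else 0)" for g
    by (simp add: p_def lookup_minus lookup_single when_def)
  have "pd_poly p = T"
  proof
    fix q
    show "pd_poly p q = T q"
      unfolding pd_poly_superset[OF _ p, simplified] T gkz_box_def e_def[symmetric] f_def[symmetric]
      by (cases "e = f") (auto simp: lp Const_uminus)
  qed
  moreover have "p \<in> ideal_cone_Y \<Sigma>"
    unfolding ideal_cone_Y_def
  proof (intro CollectI conjI ballI)
    show "keys g \<subseteq> DM" if "g \<in> keys p" for g using that p k l(1) by blast
    fix u assume "u \<in> cone_Y \<Sigma>"
    then obtain h c P where u: "u = (\<lambda>\<mu>. if \<mu> \<in> DM then h * tsec \<mu> c P else 0)" "c \<in> Ch" "P \<in> Dom c"
      by (auto simp: cone_Y_def)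
    obtain \<sigma> m where c: "c = (\<sigma>, m)" by (cases c)
    obtain x where x: "P = pt m x" using u dom_chart_eq c by blast
    have "(\<Prod>v\<in>keys g. u v ^ lookup g v) =
        (h * of_int (det (\<chi> j. m j))) ^ mdeg e * mon m x (wt e + int (mdeg e) *s (\<Sum>j\<in>UNIV. m j))" if "g = e \<or> g = f" for g
      unfolding u(1) c x using that k l(1) d w cone_monomial[OF u(2)[unfolded c], of g h x] by auto
    then show "peval p u = 0"
      unfolding peval_superset[OF _ p, simplified] by (cases "e = f") (auto simp: lp)
  qed
  ultimately show "T \<in> pd_poly ` ideal_cone_Y \<Sigma>" by blast
qed

text \<open>Scaling in the cone separates degrees and the torus separates weights, so the
  coefficients of \<open>p\<close> sum to 0 within each class of equal degree and weight.\<close>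

lemma pd_ideal_in_boxes:
  assumes p: "p \<in> ideal_cone_Y \<Sigma>"
  shows "pd_poly p \<in> left_ideal DM (gkz_boxes DM)"
proof -
  define E where "E = keys p"
  define cl where "cl e = (mdeg e, wt e)" for e :: "'n lattice \<Rightarrow>\<^sub>0 nat"
  have E: "finite E" by (simp add: E_def)
  have kE: "keys e \<subseteq> DM" if "e \<in> E" for e using p that by (simp add: E_def ideal_cone_Y_def)
  obtain \<sigma> m where c: "(\<sigma>, m) \<in> Ch" using ex_chart by blast
  define S where "S = (\<Sum>j\<in>UNIV. m j)"
  define D where "D = (of_int (det (\<chi> j. m j)) :: complex)"
  have D: "D \<noteq> 0" using det_lattice_basis_nonzero[OF chart_basis(1)[OF c]] by (simp add: D_def)
  have zero: "(\<Sum>e\<in>{e \<in> E. cl e = C}. lookup p e) = 0" if C: "C \<in> cl ` E" for C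
  proof -
    obtain d w where dw: "C = (d, w)" by (cases C)
    have deg: "(\<Sum>e\<in>{e\<in>E. mdeg e = d}. lookup p e * mon m x (wt e)) = 0" if x: "\<forall>j. x $ j \<noteq> 0" for x
    proof -
      define G where "G i = (\<Sum>e\<in>{e\<in>E. mdeg e = i}. lookup p e * (D ^ mdeg e * mon m x (wt e + int (mdeg e) *s S)))" for i
      \<comment> \<open>A common bound for the degrees in \<open>p\<close>; adding \<open>d\<close>
        places \<open>d\<close> itself in the range of coefficients to be compared.\<close>
      define N where "N = d + Max (insert 0 (mdeg ` E))"
      have N: "mdeg e \<le> N" if "e \<in> E" for e
        using that E Max_ge[of "insert 0 (mdeg ` E)" "mdeg e"] by (simp add: N_def trans_le_add2)
      have "(\<Sum>i\<le>N. G i * h ^ i) = 0" for h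
      proof -
        have "(\<lambda>\<mu>. if \<mu> \<in> DM then h * tsec \<mu> (\<sigma>, m) (pt m x) else 0) \<in> cone_Y \<Sigma>"
          unfolding cone_Y_def using c pt_in_chart[OF c] by blast
        then have "peval p (\<lambda>\<mu>. if \<mu> \<in> DM then h * tsec \<mu> (\<sigma>, m) (pt m x) else 0) = 0"
          using p by (simp add: ideal_cone_Y_def)
        then have "(\<Sum>e\<in>E. lookup p e * ((h * D) ^ mdeg e * mon m x (wt e + int (mdeg e) *s S))) = 0"
          unfolding peval_def E_def[symmetric] using kE by (simp add: cone_monomial[OF c] D_def S_def cong: sum.cong)
        then have "(\<Sum>i\<in>{..N}. \<Sum>e\<in>{e\<in>E. mdeg e = i}. lookup p e * ((h * D) ^ mdeg e * mon m x (wt e + int (mdeg e) *s S))) = 0"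
          by (subst sum.group[OF E]) (use N in auto)
        also have "(\<Sum>i\<in>{..N}. \<Sum>e\<in>{e\<in>E. mdeg e = i}. lookup p e * ((h * D) ^ mdeg e * mon m x (wt e + int (mdeg e) *s S))) =
            (\<Sum>i\<le>N. G i * h ^ i)"
          unfolding G_def sum_distrib_right by (intro sum.cong refl) (auto simp: power_mult_distrib)
        finally show ?thesis .
      qed
      then have "\<forall>i\<le>N. G i = 0" using polyfun_eq_0[of G N] by blast
      then have "G d = 0" by (simp add: N_def)
      moreover have "G d = (D ^ d * mon m x (int d *s S)) * (\<Sum>e\<in>{e\<in>E. mdeg e = d}. lookup p e * mon m x (wt e))"
        unfolding G_def sum_distrib_left by (intro sum.cong refl) (auto simp: mon_add[OF x])
      ultimately show ?thesis using D mon_nonzero[OF x] by simp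
    qed
    have "(\<Sum>e\<in>{e \<in> {e\<in>E. mdeg e = d}. wt e = w}. lookup p e) = 0"
    proof (rule mon_independent[OF chart_basis(1)[OF c], of "wt ` {e\<in>E. mdeg e = d}" "\<lambda>w. \<Sum>e\<in>{e \<in> {e\<in>E. mdeg e = d}. wt e = w}. lookup p e"])
      fix x :: "complex ^ 'n" assume x: "\<forall>j. x $ j \<noteq> 0"
      have "(\<Sum>k\<in>wt ` {e\<in>E. mdeg e = d}. (\<Sum>e\<in>{e \<in> {e\<in>E. mdeg e = d}. wt e = k}. lookup p e) * mon m x k) =
          (\<Sum>k\<in>wt ` {e\<in>E. mdeg e = d}. \<Sum>e\<in>{e \<in> {e\<in>E. mdeg e = d}. wt e = k}. lookup p e * mon m x (wt e))"
        by (intro sum.cong refl) (auto simp: sum_distrib_right intro!: sum.cong)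
      also have "\<dots> = (\<Sum>e\<in>{e\<in>E. mdeg e = d}. lookup p e * mon m x (wt e))"
        by (rule sum.image_gen[symmetric]) (use E in simp)
      finally show "(\<Sum>k\<in>wt ` {e\<in>E. mdeg e = d}. (\<Sum>e\<in>{e \<in> {e\<in>E. mdeg e = d}. wt e = k}. lookup p e) * mon m x k) = 0"
        using deg[OF x] by simp
    qed (use E C dw in \<open>auto simp: cl_def\<close>)
    then show ?thesis by (simp add: dw cl_def conj_assoc)
  qed
  \<comment> \<open>Replacing each monomial by the representative of its class changes the operator
    by box operators, and leaves 0 because the coefficients cancel in each class.\<close>
  define rep where "rep C = (SOME e. e \<in> E \<and> cl e = C)" for C
  have rep: "rep (cl e) \<in> E \<and> cl (rep (cl e)) = cl e" if "e \<in> E" for e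
    unfolding rep_def by (rule someI[of _ e]) (simp add: that)
  have "(\<lambda>q. \<Sum>e\<in>E. Const (lookup p e) * (pd_monom e q - pd_monom (rep (cl e)) q)) \<in> left_ideal DM (gkz_boxes DM)"
    using rep kE by (intro li_sum li_Const monom_diff_in_boxes[OF finite_DeltaM]) (auto simp: cl_def)
  then show ?thesis
  proof (rule li_cong)
    fix q
    have "(\<Sum>e\<in>E. Const (lookup p e) * pd_monom (rep (cl e)) q) =
        (\<Sum>C\<in>cl ` E. \<Sum>e\<in>{e\<in>E. cl e = C}. Const (lookup p e) * pd_monom (rep (cl e)) q)"
      by (rule sum.image_gen[OF E])
    also have "\<dots> = (\<Sum>C\<in>cl ` E. Const (\<Sum>e\<in>{e\<in>E. cl e = C}. lookup p e) * pd_monom (rep C) q)"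
      by (intro sum.cong refl) (auto simp: Const_sum sum_distrib_right intro!: sum.cong)
    also have "\<dots> = 0" by (simp add: zero)
    finally show "pd_poly p q = (\<Sum>e\<in>E. Const (lookup p e) * (pd_monom e q - pd_monom (rep (cl e)) q))"
      by (simp add: pd_poly_def E_def right_diff_distrib sum_subtractf)
  qed
qed

lemma Zhat_monomial:
  assumes "\<And>\<nu> \<mu>. \<nu> \<in> DM \<Longrightarrow> \<mu> \<in> DM \<Longrightarrow> LieAct \<gamma> \<nu> \<mu> = (if \<nu> - \<mu> = \<alpha> then f \<mu> else 0)"
  shows "Zhat \<Sigma> (\<gamma>, 0) q = (\<Sum>\<mu> | \<mu> \<in> DM \<and> \<mu> + \<alpha> \<in> DM. Const (f \<mu>) * (var \<mu> * pd (\<mu> + \<alpha>) q))"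
proof -
  have "(\<Sum>\<nu>\<in>DM. Const (LieAct \<gamma> \<nu> \<mu>) * (var \<mu> * pd \<nu> q)) =
      (if \<mu> + \<alpha> \<in> DM then Const (f \<mu>) * (var \<mu> * pd (\<mu> + \<alpha>) q) else 0)" if "\<mu> \<in> DM" for \<mu>
  proof -
    have "(\<Sum>\<nu>\<in>DM. Const (LieAct \<gamma> \<nu> \<mu>) * (var \<mu> * pd \<nu> q)) =
        (\<Sum>\<nu>\<in>DM. if \<nu> = \<mu> + \<alpha> then Const (f \<mu>) * (var \<mu> * pd (\<mu> + \<alpha>) q) else 0)"
      using assms that by (intro sum.cong refl) (auto simp: algebra_simps)
    then show ?thesis using finite_DeltaM by simp
  qed
  then have "Zhat \<Sigma> (\<gamma>, 0) q = (\<Sum>\<mu>\<in>DM. if \<mu> + \<alpha> \<in> DM then Const (f \<mu>) * (var \<mu> * pd (\<mu> + \<alpha>) q) else 0)"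
    unfolding Zhat_def by (subst sum.swap) simp
  also have "\<dots> = (\<Sum>\<mu> | \<mu> \<in> DM \<and> \<mu> + \<alpha> \<in> DM. Const (f \<mu>) * (var \<mu> * pd (\<mu> + \<alpha>) q))"
    using finite_DeltaM by (simp add: sum.inter_filter)
  finally show ?thesis .
qed

text \<open>Collects matrix entries by the difference \<open>\<nu> - \<mu>\<close>. Only roots that
  are differences of points of \<Delta> can occur, which keeps the sum finite.\<close>

lemma Zhat_expand:
  assumes "\<And>\<nu> \<mu>. \<nu> \<in> DM \<Longrightarrow> \<mu> \<in> DM \<Longrightarrow> LieAct \<gamma> \<nu> \<mu> =
    (if \<nu> = \<mu> then \<Sum>j\<in>UNIV. a j * of_int (\<mu> $ j) else 0) +
    (if \<nu> - \<mu> \<in> Roots then b (\<nu> - \<mu>) * of_int (pair (\<mu> - (\<nu> - \<mu>)) (root_ray \<Sigma> (\<nu> - \<mu>))) else 0)"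
  shows "Zhat \<Sigma> (\<gamma>, s) q =
    (\<Sum>j\<in>UNIV. Const (a j) * (\<Sum>\<mu>\<in>DM. Const (of_int (pair \<mu> (axis j 1))) * (var \<mu> * pd \<mu> q))) +
    (\<Sum>\<alpha>\<in>Roots \<inter> (\<lambda>(\<nu>, \<mu>). \<nu> - \<mu>) ` (DM \<times> DM). Const (b \<alpha>) * gkz_root \<Sigma> \<alpha> q) +
    Const s * (\<Sum>\<mu>\<in>DM. var \<mu> * pd \<mu> q)"
proof -
  let ?A = "DM" and ?R = "Roots \<inter> (\<lambda>(\<nu>, \<mu>). \<nu> - \<mu>) ` (DM \<times> DM)"
  note fin = finite_DeltaM
  have finR: "finite ?R" using fin by simp
  define G where "G \<alpha> \<mu> = Const (b \<alpha>) * (Const (of_int (pair (\<mu> - \<alpha>) (root_ray \<Sigma> \<alpha>))) * (var \<mu> * pd (\<mu> + \<alpha>) q))" for \<alpha> \<mu>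
  have "(\<Sum>\<nu>\<in>?A. \<Sum>\<mu>\<in>?A. Const (LieAct \<gamma> \<nu> \<mu>) * (var \<mu> * pd \<nu> q)) =
      (\<Sum>\<nu>\<in>?A. \<Sum>\<mu>\<in>?A. if \<nu> = \<mu> then Const (\<Sum>j\<in>UNIV. a j * of_int (\<mu> $ j)) * (var \<mu> * pd \<mu> q) else 0) +
      (\<Sum>\<nu>\<in>?A. \<Sum>\<mu>\<in>?A. if \<nu> - \<mu> \<in> Roots then G (\<nu> - \<mu>) \<mu> else 0)"
    unfolding sum.distrib[symmetric]
    by (intro sum.cong refl) (auto simp: assms G_def Const_add Const_mult distrib_right mult.assoc)
  also have "(\<Sum>\<nu>\<in>?A. \<Sum>\<mu>\<in>?A. if \<nu> = \<mu> then Const (\<Sum>j\<in>UNIV. a j * of_int (\<mu> $ j)) * (var \<mu> * pd \<mu> q) else 0) =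
      (\<Sum>j\<in>UNIV. Const (a j) * (\<Sum>\<mu>\<in>?A. Const (of_int (pair \<mu> (axis j 1))) * (var \<mu> * pd \<mu> q)))"
    using fin by (simp add: pair_axis Const_sum Const_mult sum_distrib_left sum_distrib_right mult.assoc sum.swap[of _ _ UNIV])
  also have "(\<Sum>\<nu>\<in>?A. \<Sum>\<mu>\<in>?A. if \<nu> - \<mu> \<in> Roots then G (\<nu> - \<mu>) \<mu> else 0) = (\<Sum>\<alpha>\<in>?R. Const (b \<alpha>) * gkz_root \<Sigma> \<alpha> q)"
  proof -
    have "(\<Sum>\<nu>\<in>?A. if \<nu> - \<mu> \<in> Roots then G (\<nu> - \<mu>) \<mu> else 0) = (\<Sum>\<alpha>\<in>?R. if \<mu> + \<alpha> \<in> ?A then G \<alpha> \<mu> else 0)"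
      if \<mu>: "\<mu> \<in> ?A" for \<mu>
    proof -
      have "(\<Sum>\<nu>\<in>{\<nu> \<in> ?A. \<nu> - \<mu> \<in> Roots}. G (\<nu> - \<mu>) \<mu>) = (\<Sum>\<alpha>\<in>{\<alpha> \<in> ?R. \<mu> + \<alpha> \<in> ?A}. G \<alpha> \<mu>)"
        by (rule sum.reindex_bij_witness[of _ "\<lambda>\<alpha>. \<mu> + \<alpha>" "\<lambda>\<nu>. \<nu> - \<mu>"]) (use \<mu> in auto)
      then show ?thesis unfolding sum.inter_filter[OF fin] sum.inter_filter[OF finR] .
    qed
    then have "(\<Sum>\<nu>\<in>?A. \<Sum>\<mu>\<in>?A. if \<nu> - \<mu> \<in> Roots then G (\<nu> - \<mu>) \<mu> else 0) =
        (\<Sum>\<alpha>\<in>?R. \<Sum>\<mu>\<in>?A. if \<mu> + \<alpha> \<in> ?A then G \<alpha> \<mu> else 0)"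
      by (subst sum.swap) (simp add: sum.swap[of _ ?R])
    also have "\<dots> = (\<Sum>\<alpha>\<in>?R. Const (b \<alpha>) * gkz_root \<Sigma> \<alpha> q)"
      unfolding gkz_root_def sum_distrib_left G_def[symmetric] using fin by (simp add: sum.inter_filter)
    finally show ?thesis .
  qed
  finally show ?thesis by (simp add: Zhat_def sum_distrib_left)
qed

end

section \<open>Comparison of the two left ideals\<close>

theorem proposition3p1:
  fixes \<Sigma> :: "(real ^ 'n::finite) set set"
  assumes "fan \<Sigma>"
    and "smooth_variety \<Sigma>" and "projective_variety \<Sigma>"
    and "anticanonical_bpf \<Sigma>"
  shows "tautological_ideal \<Sigma> (Aut0 \<Sigma>) (\<lambda>(x, c). c) = extended_gkz_ideal \<Sigma>"
proof -
  interpret smooth_complete_fan \<Sigma>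
    by unfold_locales (use assms projective_imp_complete in blast)+
  note bpf = assms(4)
  let ?A = "DeltaM \<Sigma>"
  define T where "T j q = (\<Sum>\<mu>\<in>?A. Const (of_int (pair \<mu> (axis j 1))) * (var \<mu> * pd \<mu> q))" for j and q :: "'n lattice mpoly"
  define E where "E q = (\<Sum>\<mu>\<in>?A. var \<mu> * pd \<mu> q) + q" for q :: "'n lattice mpoly"
  define Z where "Z \<gamma> s q = Zhat \<Sigma> (\<gamma>, s) q + Const s * q" for \<gamma> s q
  define X where "X = pd_poly ` ideal_cone_Y \<Sigma> \<union> {Z \<gamma> s | \<gamma> s. \<gamma> \<in> lie_algebra \<Sigma> (Aut0 \<Sigma>)}"
  define Y where "Y = gkz_boxes ?A \<union> range T \<union> {E} \<union> gkz_root \<Sigma> ` roots \<Sigma>"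
  have taut: "tautological_ideal \<Sigma> (Aut0 \<Sigma>) (\<lambda>(x, c). c) = left_ideal ?A X"
    unfolding tautological_ideal_def X_def Z_def[abs_def] by (rule arg_cong[of _ _ "left_ideal ?A"]) auto
  have gkz: "extended_gkz_ideal \<Sigma> = left_ideal ?A Y"
    unfolding extended_gkz_ideal_def Y_def gkz_boxes_def T_def[abs_def] E_def[abs_def]
    by (rule arg_cong[of _ _ "left_ideal ?A"]) auto
  have Y: "pd_poly p \<in> left_ideal ?A Y" if "p \<in> ideal_cone_Y \<Sigma>" for p
    using pd_ideal_in_boxes[OF that] left_ideal_subsetI[of "gkz_boxes ?A" ?A Y] by (auto simp: Y_def intro: li_gen)
  have "Z \<gamma> s \<in> left_ideal ?A Y" if \<gamma>: "\<gamma> \<in> lie_algebra \<Sigma> (Aut0 \<Sigma>)" for \<gamma> s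
  proof -
    interpret one_param \<Sigma> \<gamma> by unfold_locales (rule \<gamma>)
    obtain a b where ab: "\<And>\<nu> \<mu>. \<nu> \<in> ?A \<Longrightarrow> \<mu> \<in> ?A \<Longrightarrow> lie_act \<Sigma> \<gamma> \<nu> \<mu> =
      (if \<nu> = \<mu> then \<Sum>j\<in>UNIV. a j * of_int (\<mu> $ j) else 0) +
      (if \<nu> - \<mu> \<in> roots \<Sigma> then b (\<nu> - \<mu>) * of_int (pair (\<mu> - (\<nu> - \<mu>)) (root_ray \<Sigma> (\<nu> - \<mu>))) else 0)"
      using lie_act_structure[OF bpf] by blast
    let ?R = "roots \<Sigma> \<inter> (\<lambda>(\<nu>, \<mu>). \<nu> - \<mu>) ` (?A \<times> ?A)"
    \<comment> \<open>The scalar s multiplies the Euler operator together with its constant term 1,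
      since \<beta> is the identity on the second factor.\<close>
    have "(\<lambda>q. ((\<Sum>j\<in>UNIV. Const (a j) * T j q) + (\<Sum>\<alpha>\<in>?R. Const (b \<alpha>) * gkz_root \<Sigma> \<alpha> q)) + Const s * E q) \<in> left_ideal ?A Y"
      by (intro li_add li_sum li_Const li_gen) (auto simp: Y_def)
    then show ?thesis
      by (rule li_cong) (simp add: Z_def Zhat_expand[OF ab] T_def E_def distrib_left)
  qed
  then have "X \<subseteq> left_ideal ?A Y" using Y by (auto simp: X_def)
  moreover have "Y \<subseteq> left_ideal ?A X"
  proof -
    have Zg: "Z \<gamma> s \<in> left_ideal ?A X" if "\<gamma> \<in> lie_algebra \<Sigma> (Aut0 \<Sigma>)" for \<gamma> s
      using that by (intro li_gen) (auto simp: X_def)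
    have "T j \<in> left_ideal ?A X" for j
    proof -
      \<comment> \<open>Torus subgroups were constructed along rays. The rays of one chart form a
        basis of N, in which the j-th standard vector has the coefficients
        \<open>m i $ j\<close>.\<close>
      obtain \<sigma> m where c: "(\<sigma>, m) \<in> charts \<Sigma>" using ex_chart by blast
      have "\<exists>\<gamma>\<in>lie_algebra \<Sigma> (Aut0 \<Sigma>). \<forall>\<nu>\<in>?A. \<forall>\<mu>\<in>?A. lie_act \<Sigma> \<gamma> \<nu> \<mu> = (if \<nu> = \<mu> then of_int (pair \<mu> (dual_basis m i)) else 0)" for i
        using torus_one_parameter[OF bpf] chart_ray[OF c] gens_subset_rays by blast
      then obtain \<gamma> where \<gamma>: "\<And>i. \<gamma> i \<in> lie_algebra \<Sigma> (Aut0 \<Sigma>)"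
        "\<And>i \<nu> \<mu>. \<nu> \<in> ?A \<Longrightarrow> \<mu> \<in> ?A \<Longrightarrow> lie_act \<Sigma> (\<gamma> i) \<nu> \<mu> = (if \<nu> = \<mu> then of_int (pair \<mu> (dual_basis m i)) else 0)"
        by metis
      have Zi: "Z (\<gamma> i) 0 q = (\<Sum>\<mu>\<in>?A. Const (of_int (pair \<mu> (dual_basis m i))) * (var \<mu> * pd \<mu> q))" for i q
        using Zhat_monomial[of "\<gamma> i" 0 "\<lambda>\<mu>. of_int (pair \<mu> (dual_basis m i))" q] \<gamma>(2) by (simp add: Z_def)
      have "(\<lambda>q. \<Sum>i\<in>UNIV. Const (of_int (m i $ j)) * Z (\<gamma> i) 0 q) \<in> left_ideal ?A X"
        by (intro li_sum li_Const Zg \<gamma>)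
      then show ?thesis
      proof (rule li_cong)
        fix q
        have K: "Const (of_int (pair \<mu> (axis j 1))) = (\<Sum>i\<in>UNIV. Const (of_int (m i $ j)) * Const (of_int (pair \<mu> (dual_basis m i))))" for \<mu>
          using pair_dual_basis[OF chart_basis(1)[OF c], of \<mu> "axis j 1"]
          by (simp add: pair_axis Const_sum Const_mult mult.commute)
        show "T j q = (\<Sum>i\<in>UNIV. Const (of_int (m i $ j)) * Z (\<gamma> i) 0 q)"
          by (simp add: K T_def Zi sum_distrib_left sum_distrib_right mult.assoc sum.swap[of _ _ UNIV])
      qed
    qed
    moreover have "E \<in> left_ideal ?A X"
      using Zg[OF id_one_parameter(1)[OF bpf], of 1]
      by (rule li_cong) (simp add: E_def Z_def Zhat_def id_one_parameter(2)[OF bpf])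
    moreover have "gkz_root \<Sigma> \<alpha> \<in> left_ideal ?A X" if \<alpha>: "\<alpha> \<in> roots \<Sigma>" for \<alpha>
    proof -
      obtain \<rho> where \<rho>: "is_root_ray \<Sigma> \<alpha> \<rho>" using \<alpha> by (auto simp: roots_def)
      obtain \<gamma> where \<gamma>: "\<gamma> \<in> lie_algebra \<Sigma> (Aut0 \<Sigma>)"
        "\<forall>\<nu>\<in>?A. \<forall>\<mu>\<in>?A. lie_act \<Sigma> \<gamma> \<nu> \<mu> = (if \<nu> - \<mu> = \<alpha> then of_int (pair (\<mu> - \<alpha>) \<rho>) else 0)"
        using root_one_parameter[OF bpf \<rho>] by blast
      from Zg[OF \<gamma>(1), of 0] show ?thesis
        by (rule li_cong) (simp add: Z_def gkz_root_def root_rayI(2)[OF \<rho>] Zhat_monomial[of \<gamma> \<alpha> "\<lambda>\<mu>. of_int (pair (\<mu> - \<alpha>) \<rho>)"] \<gamma>(2))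
    qed
    moreover have "gkz_boxes ?A \<subseteq> left_ideal ?A X"
      using boxes_in_pd_ideal by (auto simp: X_def intro: li_gen)
    ultimately show ?thesis by (auto simp: Y_def)
  qed
  ultimately show ?thesis unfolding taut gkz using left_ideal_subsetI by blast
qed

end
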